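(* Let $\Omega\subset\mathbb{R}^n$ be an open set and let $D\subset\mathbb{R}^n$ be a bounded connected open set with Lipschitz boundary. For $\varepsilon>0$ and $u\in L^1(\Omega)$ let $$H_\varepsilon(u,\Omega)=\varepsilon^{n-1}\sup_{\mathcal H_\varepsilon}\sum_{D'\in\mathcal H_\varepsilon}⨍_{D'}\Big|u(x)-⨍_{D'}u\Big|\,dx ,$$ where $⨍$ denotes the integral average and the supremum is over all families $\mathcal H_\varepsilon$ of pairwise disjoint translates $D'=x_0+\varepsilon D$ of $\varepsilon D$ contained in $\Omega$. Then, as $\varepsilon\to0$, the family of functionals $H_\varepsilon(\cdot,\Omega)$ $\Gamma$-converges in $L^1(\Omega)$ to the functional $H(\cdot,\Omega)$ defined for $u\in L^1(\Omega)$ by $$H(u,\Omega)=\begin{cases}\Psi(Du)(\Omega)&\text{if }u\in BV(\Omega),\\ +\infty&\text{otherwise,}\end{cases}$$ where $$\Psi(Du)(\Omega)=\inf\Big\{\liminf_{h\to\infty}\int_\Omega\psi(\nabla u_h)\,dx\;:\;u_h\in C^\infty(\Omega),\ u_h\to u\text{ in }L^1(\Omega)\Big\}$$ and $\psi:\mathbb{R}^n\to[0,+\infty)$ is the $1$-homogeneous function associated with $D$ that is defined in the context.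
   Context: Definition of $\psi$: let $Q=(-\tfrac12,\tfrac12)^n$ be the unit cube. For $\nu\in\mathbb S^{n-1}$ set $\psi(\nu)=\lim_{\varepsilon\to0}H_\varepsilon(x\cdot\nu,Q)$, where $H_\varepsilon(x\cdot \nu,Q)$ is the functional above applied to the linear function $x\mapsto x\cdot\nu$ on the open set $Q$ in place of $\Omega$ (it is a known fact that this limit exists). Extend $\psi$ to $\mathbb{R}^n$ by $\psi(0)=0$ and $\psi(\tau)=|\tau|\,\psi(\tau/|\tau|)$ for $\tau\ne0$. It is a known fact that $\psi$ is Lipschitz, convex, and satisfies $\psi(\tau)\ge c|\tau|$ for some $c>0$. Definition of $\Gamma$-convergence: a family of functionals $\mathcal F_\varepsilon:L^1(\Omega)\to[0,+\infty]$ $\Gamma$-converges in $L^1(\Omega)$ to $\mathcal F:L^1(\Omega)\to[0,+\infty]$ as $\varepsilon\to0$ if (i) for every $u\in L^1(\Omega)$ and every family $u_\varepsilon\to u$ in $L^1(\Omega)$ one has $\liminf_{\varepsilon\to0}\mathcal F_\varepsilon(u_\varepsilon)\ge\mathcal F(u)$; and (ii) for every $u\in L^1(\Omega)$ there is a family $\tilde u_\varepsilon\to u$ in $L^1(\Omega)$ with $\limsup_{\varepsilon\to0}\mathcal F_\varepsilon(\tilde u_\varepsilon)\le\mathcal F(u)$. $BV(\Omega)$ is the space of $u\in L^1(\Omega)$ with finite total variation $|Du|(\Omega)$. The supremum over families is $0$ if no translate of $\varepsilon D$ is contained in the set. *)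

theory Defs
  imports "HOL-Analysis.Analysis"
begin

section \<open>Function spaces on subsets of \<open>\<real>\<^sup>n\<close>\<close>

text \<open>Elements of \<open>L\<^sup>1(\<Omega>)\<close> are represented by functions on the whole space, of which only the
  values on \<open>\<Omega>\<close> matter; functions that agree almost everywhere on \<open>\<Omega>\<close> are not identified.\<close>

definition L1 :: "(real ^ 'n) set \<Rightarrow> (real ^ 'n \<Rightarrow> real) set" where
  "L1 \<Omega> = {u. set_integrable lebesgue \<Omega> u}"

definition tendsto_L1 ::
  "(real ^ 'n) set \<Rightarrow> ('i \<Rightarrow> real ^ 'n \<Rightarrow> real) \<Rightarrow> (real ^ 'n \<Rightarrow> real) \<Rightarrow> 'i filter \<Rightarrow> bool" where
  "tendsto_L1 \<Omega> v u F \<longleftrightarrow> ((\<lambda>i. LINT x:\<Omega>|lebesgue. \<bar>v i x - u x\<bar>) \<longlongrightarrow> 0) F"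

definition partial_deriv :: "'n \<Rightarrow> (real ^ 'n \<Rightarrow> real) \<Rightarrow> real ^ 'n \<Rightarrow> real" where
  "partial_deriv i f x = frechet_derivative f (at x) (axis i 1)"

definition grad :: "(real ^ 'n \<Rightarrow> real) \<Rightarrow> real ^ 'n \<Rightarrow> real ^ 'n" where
  "grad f x = (\<chi> i. partial_deriv i f x)"

text \<open>Only meant for open sets \<open>A\<close>, where \<open>at x\<close> and \<open>at x within A\<close> coincide.\<close>

primrec Ck_on :: "nat \<Rightarrow> (real ^ 'n) set \<Rightarrow> (real ^ 'n \<Rightarrow> real) \<Rightarrow> bool" where
  "Ck_on 0 A f \<longleftrightarrow> continuous_on A f"
| "Ck_on (Suc k) A f \<longleftrightarrow>
     (\<forall>x\<in>A. f differentiable (at x)) \<and> (\<forall>i. Ck_on k A (partial_deriv i f))"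

definition smooth_on :: "(real ^ 'n) set \<Rightarrow> (real ^ 'n \<Rightarrow> real) \<Rightarrow> bool" where
  "smooth_on A f \<longleftrightarrow> (\<forall>k. Ck_on k A f)"

definition divergence :: "(real ^ 'n \<Rightarrow> real ^ 'n) \<Rightarrow> real ^ 'n \<Rightarrow> real" where
  "divergence \<phi> x = (\<Sum>i\<in>UNIV. partial_deriv i (\<lambda>y. \<phi> y $ i) x)"

text \<open>The fields in \<open>C\<^sub>c\<^sup>1(\<Omega>; \<real>\<^sup>n)\<close> with \<open>|\<phi>| \<le> 1\<close>, extended by zero to the whole space.\<close>

definition test_fields :: "(real ^ 'n) set \<Rightarrow> (real ^ 'n \<Rightarrow> real ^ 'n) set" where
  "test_fields \<Omega> = {\<phi>. (\<forall>i. Ck_on 1 UNIV (\<lambda>x. \<phi> x $ i)) \<and>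
     compact (closure {x. \<phi> x \<noteq> 0}) \<and> closure {x. \<phi> x \<noteq> 0} \<subseteq> \<Omega> \<and> (\<forall>x. norm (\<phi> x) \<le> 1)}"

definition total_variation :: "(real ^ 'n) set \<Rightarrow> (real ^ 'n \<Rightarrow> real) \<Rightarrow> ereal" where
  "total_variation \<Omega> u = (SUP \<phi>\<in>test_fields \<Omega>. ereal (LINT x:\<Omega>|lebesgue. u x * divergence \<phi> x))"

definition BV :: "(real ^ 'n) set \<Rightarrow> (real ^ 'n \<Rightarrow> real) set" where
  "BV \<Omega> = {u \<in> L1 \<Omega>. total_variation \<Omega> u < \<infinity>}"


section \<open>Sets with Lipschitz boundary\<close>

text \<open>Near each boundary point, and in a suitable orthogonal coordinate system with last axis \<open>e\<close>,
  the set is the strict subgraph of a Lipschitz function of the remaining coordinates, which are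
  given by the projection of the point to the hyperplane orthogonal to \<open>e\<close>.\<close>

definition lipschitz_boundary :: "(real ^ 'n) set \<Rightarrow> bool" where
  "lipschitz_boundary D \<longleftrightarrow>
     (\<forall>p\<in>frontier D. \<exists>r>0. \<exists>e. norm e = 1 \<and> (\<exists>g :: real ^ 'n \<Rightarrow> real. \<exists>L.
        L-lipschitz_on {y. y \<bullet> e = 0} g \<and>
        D \<inter> ball p r = {x \<in> ball p r. x \<bullet> e < g (x - (x \<bullet> e) *\<^sub>R e)}))"


section \<open>The functionals\<close>

definition avg :: "(real ^ 'n) set \<Rightarrow> (real ^ 'n \<Rightarrow> real) \<Rightarrow> real" where
  "avg A u = (LINT x:A|lebesgue. u x) / measure lebesgue A"

definition translate_families ::
  "real \<Rightarrow> (real ^ 'n) set \<Rightarrow> (real ^ 'n) set \<Rightarrow> (real ^ 'n) set set set" where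
  "translate_families \<epsilon> D \<Omega> = {\<H>. pairwise disjnt \<H> \<and>
     (\<forall>D'\<in>\<H>. D' \<subseteq> \<Omega> \<and> (\<exists>x0. D' = (\<lambda>y. x0 + \<epsilon> *\<^sub>R y) ` D))}"

text \<open>Families may be infinite, so the sum is taken in \<open>[0,\<infinity>]\<close>. The empty family is always
  admissible, hence the supremum is 0 if no translate fits into \<open>\<Omega>\<close>.\<close>

definition H_eps ::
  "(real ^ 'n) set \<Rightarrow> (real ^ 'n) set \<Rightarrow> real \<Rightarrow> (real ^ 'n \<Rightarrow> real) \<Rightarrow> ennreal" where
  "H_eps D \<Omega> \<epsilon> u = ennreal (\<epsilon> ^ (CARD('n) - 1)) *
     (SUP \<H>\<in>translate_families \<epsilon> D \<Omega>.
        \<Sum>\<^sub>\<infinity>D'\<in>\<H>. ennreal (avg D' (\<lambda>x. \<bar>u x - avg D' u\<bar>)))"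

definition unit_cube :: "(real ^ 'n) set" where
  "unit_cube = box (\<chi> i. - 1/2) (\<chi> i. 1/2)"

text \<open>For unit vectors \<open>\<nu>\<close>; the limit exists and is finite for bounded connected open nonempty
  sets \<open>D\<close> with Lipschitz boundary.\<close>

definition psi_sphere :: "(real ^ 'n) set \<Rightarrow> real ^ 'n \<Rightarrow> real" where
  "psi_sphere D \<nu> = enn2real (Lim (at_right 0) (\<lambda>\<epsilon>. H_eps D unit_cube \<epsilon> (\<lambda>x. x \<bullet> \<nu>)))"

definition psi :: "(real ^ 'n) set \<Rightarrow> real ^ 'n \<Rightarrow> real" where
  "psi D \<tau> = (if \<tau> = 0 then 0 else norm \<tau> * psi_sphere D (\<tau> /\<^sub>R norm \<tau>))"

definition anisotropic_variation ::
  "(real ^ 'n \<Rightarrow> real) \<Rightarrow> (real ^ 'n) set \<Rightarrow> (real ^ 'n \<Rightarrow> real) \<Rightarrow> ennreal" where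
  "anisotropic_variation \<psi> \<Omega> u =
     (INF v\<in>{v :: nat \<Rightarrow> real ^ 'n \<Rightarrow> real.
               (\<forall>h. smooth_on \<Omega> (v h) \<and> v h \<in> L1 \<Omega>) \<and> tendsto_L1 \<Omega> v u sequentially}.
        liminf (\<lambda>h. \<integral>\<^sup>+x\<in>\<Omega>. ennreal (\<psi> (grad (v h) x)) \<partial>lebesgue))"

definition H_limit :: "(real ^ 'n) set \<Rightarrow> (real ^ 'n) set \<Rightarrow> (real ^ 'n \<Rightarrow> real) \<Rightarrow> ennreal" where
  "H_limit D \<Omega> u = (if u \<in> BV \<Omega> then anisotropic_variation (psi D) \<Omega> u else \<infinity>)"


section \<open>Gamma-convergence in \<open>L\<^sup>1\<close>\<close>

definition Gamma_converges_L1 ::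
  "(real ^ 'n) set \<Rightarrow> (real \<Rightarrow> (real ^ 'n \<Rightarrow> real) \<Rightarrow> ennreal) \<Rightarrow>
   ((real ^ 'n \<Rightarrow> real) \<Rightarrow> ennreal) \<Rightarrow> bool" where
  "Gamma_converges_L1 \<Omega> F F0 \<longleftrightarrow>
     (\<forall>u\<in>L1 \<Omega>. \<forall>v :: real \<Rightarrow> real ^ 'n \<Rightarrow> real.
        (\<forall>\<epsilon>>0. v \<epsilon> \<in> L1 \<Omega>) \<longrightarrow> tendsto_L1 \<Omega> v u (at_right 0) \<longrightarrow>
        F0 u \<le> Liminf (at_right 0) (\<lambda>\<epsilon>. F \<epsilon> (v \<epsilon>))) \<and>
     (\<forall>u\<in>L1 \<Omega>. \<exists>v :: real \<Rightarrow> real ^ 'n \<Rightarrow> real.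
        (\<forall>\<epsilon>>0. v \<epsilon> \<in> L1 \<Omega>) \<and> tendsto_L1 \<Omega> v u (at_right 0) \<and>
        Limsup (at_right 0) (\<lambda>\<epsilon>. F \<epsilon> (v \<epsilon>)) \<le> F0 u)"

end

theory Submission
  imports Defs
begin

text \<open>A linear function has the same oscillation on all translates of \<open>\<epsilon> D\<close>. Hence
  \<open>psi D \<tau> = \<kappa> * linear_osc \<tau>\<close>, where \<open>linear_osc \<tau>\<close> is the mean oscillation of \<open>x \<bullet> \<tau>\<close> on \<open>D\<close> and
  \<open>\<kappa>\<close> is the limit of \<open>\<epsilon>\<^sup>n\<close> times the maximal number of disjoint translates of \<open>\<epsilon> D\<close> in the unit cube; it
  exists by superadditivity. On small cubes a \<open>C\<^sup>1\<close> function is nearly affine, which gives the asymptotics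
  of the functionals from below. From above, the Poincare inequality on the Lipschitz domain \<open>D\<close> controls the
  translates that lie in no such cube, in particular those close to the boundary of \<open>\<Omega>\<close>; this is the limsup
  inequality. For the liminf inequality, mollification does not increase the functionals (they are convex and
  translation invariant) and turns \<open>L\<^sup>1\<close> convergence into uniform convergence of gradients, so the
  mollifications of the limit \<open>u\<close> have bounded anisotropic energy; a Meyers-Serrin gluing of them yields smooth
  functions on \<open>\<Omega>\<close> that converge to \<open>u\<close>.\<close>

section \<open>Calculus of smooth functions\<close>

text \<open>Convergence in the mean says nothing about gradients, so the mollification radius is
  fixed before \<open>\<epsilon>\<close> tends to 0. The price is a distance to the boundary of
  \<open>\<Omega>\<close>: only bounds on interior sets \<open>G\<close> come out, but with one
  constant \<open>M\<close> for all \<open>G\<close> and all radii, and this uniformity is what the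
  gluing consumes. The glued functions also give membership in \<open>BV\<close>, because
  \<open>psi D \<tau>\<close> is at least \<open>c * norm \<tau>\<close>.

  In the limsup inequality the number of translates outside the good cubes is not under control.
  With the weight \<open>\<epsilon> ^ (CARD('n) - 1)\<close> the Poincare inequality is scale
  invariant, so disjoint translates contribute at most a constant times the energy of the region
  that contains them, however many they are; this region is chosen with small energy.

  The functionals use \<open>lebesgue\<close>, whereas Fubini and affine substitution are applied to
  \<open>lborel\<close>; hence the passage to Borel representatives that vanish outside
  \<open>\<Omega>\<close>.\<close>

lemma partial_deriv_eqI: "(f has_derivative f') (at x) \<Longrightarrow> partial_deriv i f x = f' (axis i 1)"
  unfolding partial_deriv_def using frechet_derivative_at by metis

lemma grad_eqI: "(f has_derivative (\<lambda>h. g \<bullet> h)) (at x) \<Longrightarrow> grad f x = g"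
  unfolding grad_def by (auto simp: vec_eq_iff partial_deriv_eqI inner_axis)

lemma grad_nth: "grad f x $ i = partial_deriv i f x"
  by (simp add: grad_def)

lemma has_derivative_grad:
  assumes "f differentiable (at x)"
  shows "(f has_derivative (\<lambda>h. grad f x \<bullet> h)) (at x)"
proof -
  obtain f' where f': "(f has_derivative f') (at x)" using assms differentiable_def by blast
  then interpret bounded_linear f' by (rule has_derivative_bounded_linear)
  have "f' h = grad f x \<bullet> h" for h
  proof -
    have "f' h = f' (\<Sum>i\<in>UNIV. (h $ i) *\<^sub>R axis i 1)"
      using basis_expansion[of h] by (simp add: scalar_mult_eq_scaleR)
    also have "\<dots> = (\<Sum>i\<in>UNIV. (h $ i) * f' (axis i 1))"
      by (simp add: sum scaleR)
    also have "\<dots> = grad f x \<bullet> h"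
      by (simp add: inner_vec_def grad_def partial_deriv_eqI[OF f'] mult.commute)
    finally show ?thesis .
  qed
  then have "f' = (\<lambda>h. grad f x \<bullet> h)" by (rule ext)
  then show ?thesis using f' by simp
qed

lemma partial_deriv_cong:
  assumes "open A" "x \<in> A" "\<And>y. y \<in> A \<Longrightarrow> f y = g y"
  shows "partial_deriv i f x = partial_deriv i g x"
proof -
  have "(f has_derivative D) (at x) \<longleftrightarrow> (g has_derivative D) (at x)" for D
    using has_derivative_transform_within_open[OF _ assms(1,2)] assms(3) by metis
  then show ?thesis by (simp add: partial_deriv_def frechet_derivative_def)
qed

lemma differentiable_cong_open:
  assumes "open A" "x \<in> A" "\<And>y. y \<in> A \<Longrightarrow> f y = g y"
  shows "f differentiable (at x) \<longleftrightarrow> g differentiable (at x)"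
  using has_derivative_transform_within_open[OF _ assms(1,2)] assms(3) unfolding differentiable_def by metis

lemma Ck_on_cong:
  assumes "open A" "\<And>y. y \<in> A \<Longrightarrow> f y = g y"
  shows "Ck_on k A f \<longleftrightarrow> Ck_on k A g"
  using assms(2)
proof (induction k arbitrary: f g)
  case 0 then show ?case by (auto intro: continuous_on_eq)
next
  case (Suc k)
  have "Ck_on k A (partial_deriv i f) \<longleftrightarrow> Ck_on k A (partial_deriv i g)" for i
    by (rule Suc.IH) (auto intro!: partial_deriv_cong[OF assms(1)] Suc.prems)
  then show ?case using differentiable_cong_open[OF assms(1) _ Suc.prems] by auto
qed

lemma Ck_on_subset: "Ck_on k A f \<Longrightarrow> B \<subseteq> A \<Longrightarrow> Ck_on k B f"
  by (induction k arbitrary: f) (auto intro: continuous_on_subset)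

lemma Ck_on_Suc_imp: "Ck_on (Suc k) A f \<Longrightarrow> Ck_on k A f"
proof (induction k arbitrary: f)
  case 0 then show ?case
    by (auto intro!: differentiable_imp_continuous_on simp: differentiable_on_def differentiable_at_withinI)
qed auto

lemma Ck_on_le: "Ck_on k A f \<Longrightarrow> j \<le> k \<Longrightarrow> Ck_on j A f"
  by (induction k) (auto simp: le_Suc_eq dest: Ck_on_Suc_imp simp del: Ck_on.simps)

text \<open>The glued function of \<open>meyers_serrin\<close> is a finite sum only near each point,
  so its smoothness has to be checked on neighbourhoods.\<close>

lemma Ck_on_locally:
  assumes "\<And>x. x \<in> A \<Longrightarrow> \<exists>U. open U \<and> x \<in> U \<and> Ck_on k U f"
  shows "Ck_on k A f"
  using assms
proof (induction k arbitrary: f)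
  case 0
  have "continuous (at x) f" if x: "x \<in> A" for x
  proof -
    obtain U where "open U" "x \<in> U" "continuous_on U f" using 0[OF x] by auto
    then show ?thesis by (simp add: continuous_on_eq_continuous_at)
  qed
  then show ?case by (simp add: continuous_at_imp_continuous_on)
next
  case (Suc k)
  show ?case unfolding Ck_on.simps
  proof (intro conjI ballI allI)
    show "f differentiable at x" if "x \<in> A" for x using Suc.prems[OF that] by auto
    show "Ck_on k A (partial_deriv i f)" for i
      by (rule Suc.IH) (use Suc.prems in fastforce)
  qed
qed

lemma partial_deriv_const [simp]: "partial_deriv i (\<lambda>x. c) = (\<lambda>x. 0)"
  by (rule ext) (rule partial_deriv_eqI[of _ "\<lambda>_. 0"], auto)

lemma Ck_on_const: "Ck_on k A (\<lambda>x. c)"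
  by (induction k arbitrary: c) auto

lemma partial_deriv_add:
  assumes "f differentiable (at x)" "g differentiable (at x)"
  shows "partial_deriv i (\<lambda>x. f x + g x) x = partial_deriv i f x + partial_deriv i g x"
  using has_derivative_add[OF has_derivative_grad[OF assms(1)] has_derivative_grad[OF assms(2)]]
  by (auto dest: partial_deriv_eqI simp: inner_axis grad_nth)

lemma partial_deriv_mult:
  assumes "f differentiable (at x)" "g differentiable (at x)"
  shows "partial_deriv i (\<lambda>x. f x * g x) x = f x * partial_deriv i g x + partial_deriv i f x * g x"
  using has_derivative_mult[OF has_derivative_grad[OF assms(1)] has_derivative_grad[OF assms(2)]]
  by (auto dest: partial_deriv_eqI simp: inner_axis grad_nth)

lemma grad_add:
  assumes "f differentiable (at x)" "g differentiable (at x)"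
  shows "grad (\<lambda>x. f x + g x) x = grad f x + grad g x"
  by (simp add: vec_eq_iff grad_def partial_deriv_add[OF assms])

lemma grad_mult:
  assumes "f differentiable (at x)" "g differentiable (at x)"
  shows "grad (\<lambda>x. f x * g x) x = f x *\<^sub>R grad g x + g x *\<^sub>R grad f x"
  by (simp add: vec_eq_iff grad_def partial_deriv_mult[OF assms])

lemma Ck_on_add:
  assumes "open A" "Ck_on k A f" "Ck_on k A g"
  shows "Ck_on k A (\<lambda>x. f x + g x)"
  using assms(2,3)
proof (induction k arbitrary: f g)
  case (Suc k)
  have "Ck_on k A (partial_deriv i (\<lambda>x. f x + g x)) \<longleftrightarrow>
      Ck_on k A (\<lambda>x. partial_deriv i f x + partial_deriv i g x)" for i
    by (rule Ck_on_cong[OF assms(1)]) (auto intro!: partial_deriv_add simp: Suc.prems[unfolded Ck_on.simps])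
  then show ?case using Suc by auto
qed (auto intro: continuous_intros)

lemma Ck_on_mult:
  assumes "open A" "Ck_on k A f" "Ck_on k A g"
  shows "Ck_on k A (\<lambda>x. f x * g x)"
  using assms(2,3)
proof (induction k arbitrary: f g)
  case (Suc k)
  have "Ck_on k A (partial_deriv i (\<lambda>x. f x * g x)) \<longleftrightarrow>
      Ck_on k A (\<lambda>x. f x * partial_deriv i g x + partial_deriv i f x * g x)" for i
    by (rule Ck_on_cong[OF assms(1)]) (auto intro!: partial_deriv_mult simp: Suc.prems[unfolded Ck_on.simps])
  moreover have "Ck_on k A f" "Ck_on k A g" using Suc.prems Ck_on_Suc_imp by auto
  ultimately show ?case using Suc.prems by (auto intro!: Suc.IH Ck_on_add[OF assms(1)])
qed (auto intro: continuous_intros)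

text \<open>Passing the whole sequence of derivatives \<open>h n\<close> keeps the induction within
  one statement: a partial derivative of \<open>h n (f x)\<close> is a product with
  \<open>h (Suc n) (f x)\<close>, which is again of this form.\<close>

lemma Ck_on_compose_real:
  assumes "open A" and h: "\<And>n t. (h n has_real_derivative h (Suc n) t) (at t)"
    and "Ck_on k A f"
  shows "Ck_on k A (\<lambda>x. h (n::nat) (f x))"
  using assms(3)
proof (induction k arbitrary: f n)
  case 0
  have "continuous_on UNIV (h n)"
    using h by (meson DERIV_isCont continuous_at_imp_continuous_on)
  then show ?case using 0 by (auto intro: continuous_on_compose2)
next
  case (Suc k)
  have D: "((\<lambda>x. h n (f x)) has_derivative (\<lambda>v. (grad f x \<bullet> v) * h (Suc n) (f x))) (at x)" if "x \<in> A" for x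
    using has_derivative_compose[OF has_derivative_grad[of f x] h[of n, unfolded has_field_derivative_def]] Suc.prems that
    by (simp add: mult.commute)
  have "Ck_on k A (partial_deriv i (\<lambda>x. h n (f x))) \<longleftrightarrow>
      Ck_on k A (\<lambda>x. partial_deriv i f x * h (Suc n) (f x))" for i
    by (rule Ck_on_cong[OF assms(1)]) (simp add: partial_deriv_eqI[OF D] inner_axis grad_nth)
  moreover have "Ck_on k A f" using Suc.prems Ck_on_Suc_imp by auto
  moreover have "Ck_on k A (partial_deriv i f)" for i using Suc.prems by auto
  ultimately have "Ck_on k A (partial_deriv i (\<lambda>x. h n (f x)))" for i
    using Suc.IH by (auto intro!: Ck_on_mult[OF assms(1)])
  moreover have "(\<lambda>x. h n (f x)) differentiable (at x)" if "x \<in> A" for x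
    using D[OF that] unfolding differentiable_def by blast
  ultimately show ?case by simp
qed

lemma Ck_on_sum:
  assumes "open A" "finite I" "\<And>i. i \<in> I \<Longrightarrow> Ck_on k A (f i)"
  shows "Ck_on k A (\<lambda>x. \<Sum>i\<in>I. f i x)"
  using assms(2,3) by (induction I) (auto simp: Ck_on_const intro!: Ck_on_add[OF assms(1)])

lemma Ck_on_nth: "Ck_on k A (\<lambda>x::real^'n. x $ j)"
proof (cases k)
  case (Suc m)
  have D: "((\<lambda>x::real^'n. x $ j) has_derivative (\<lambda>h. h $ j)) (at x)" for x
    by (intro derivative_eq_intros bounded_linear.has_derivative[OF bounded_linear_vec_nth]) auto
  have "partial_deriv i (\<lambda>x::real^'n. x $ j) = (\<lambda>x. axis i 1 $ j)" for i
    by (rule ext, rule partial_deriv_eqI, rule D)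
  then show ?thesis using D unfolding Suc by (auto simp: Ck_on_const differentiable_def)
qed (auto intro: continuous_intros)

lemma Ck_on_grad_continuous:
  assumes "Ck_on (Suc k) A f" shows "continuous_on A (grad f)"
proof -
  have "continuous_on A (partial_deriv i f)" for i
    using assms Ck_on_le[of k A _ 0] by auto
  then show ?thesis unfolding grad_def by (rule continuous_on_vec_lambda)
qed

text \<open>\<open>flat n\<close> is the \<open>n\<close>-th derivative of \<open>exp (- 1 / t)\<close>, extended by \<open>0\<close> to \<open>t \<le> 0\<close>.\<close>

fun flat_poly :: "nat \<Rightarrow> real poly" where
  "flat_poly 0 = 1"
| "flat_poly (Suc n) = monom 1 2 * (flat_poly n - pderiv (flat_poly n))"

definition flat :: "nat \<Rightarrow> real \<Rightarrow> real" where
  "flat n t = (if t > 0 then poly (flat_poly n) (1 / t) * exp (- (1 / t)) else 0)"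

lemma poly_times_exp_minus_tendsto: "((\<lambda>s. poly p s * exp (- s)) \<longlongrightarrow> 0) (at_top :: real filter)"
proof -
  have "((\<lambda>s. \<Sum>i\<le>degree p. coeff p i * (s ^ i / exp s)) \<longlongrightarrow> (\<Sum>i\<le>degree p. coeff p i * 0)) at_top"
    by (intro tendsto_intros tendsto_power_div_exp_0)
  moreover have "(\<Sum>i\<le>degree p. coeff p i * (s ^ i / exp s)) = poly p s * exp (- s)" for s
    by (simp add: poly_altdef sum_distrib_right exp_minus divide_inverse mult.assoc)
  ultimately show ?thesis by simp
qed

text \<open>With \<open>s = 1 / t\<close>, differentiating \<open>p(s) exp(-s)\<close> in
  \<open>t\<close> gives \<open>s^2 (p(s) - p'(s)) exp(-s)\<close>, the recursion of
  \<open>flat_poly\<close>. At 0 the right difference quotient is \<open>s p(s) exp(-s)\<close> with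
  \<open>s\<close> tending to infinity, and the left one is 0.\<close>

lemma flat_DERIV: "(flat n has_real_derivative flat (Suc n) t) (at t)"
proof -
  consider "t > 0" | "t < 0" | "t = 0" by linarith
  then show ?thesis
  proof cases
    case 1
    have "((\<lambda>t. poly (flat_poly n) (1 / t) * exp (- (1 / t))) has_real_derivative flat (Suc n) t) (at t)"
      using 1 by (auto intro!: derivative_eq_intros poly_DERIV[THEN DERIV_chain2] simp: flat_def field_simps power2_eq_square poly_monom)
    then show ?thesis
      by (rule has_field_derivative_transform_within_open[where S="{0<..}"]) (use 1 in \<open>auto simp: flat_def\<close>)
  next
    case 2
    have "((\<lambda>t. 0) has_real_derivative flat (Suc n) t) (at t)" using 2 by (simp add: flat_def)
    then show ?thesis
      by (rule has_field_derivative_transform_within_open[where S="{..<0}"]) (use 2 in \<open>auto simp: flat_def\<close>)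
  next
    case 3
    have r: "((\<lambda>h. flat n h / h) \<longlongrightarrow> 0) (at_right 0)"
    proof -
      have "((\<lambda>h. poly (monom 1 1 * flat_poly n) (inverse h) * exp (- inverse h)) \<longlongrightarrow> 0) (at_right (0::real))"
        by (rule filterlim_compose[OF poly_times_exp_minus_tendsto filterlim_inverse_at_top_right])
      then show ?thesis
        by (rule Lim_transform_eventually)
           (auto simp: flat_def poly_monom eventually_at_right_less inverse_eq_divide intro: eventually_mono[OF eventually_at_right_less])
    qed
    have l: "((\<lambda>h. flat n h / h) \<longlongrightarrow> 0) (at_left 0)"
      by (rule Lim_transform_eventually[of "\<lambda>_. 0"])
         (auto simp: flat_def eventually_at_left_field intro!: exI[of _ "-1"])
    have "((\<lambda>h. flat n h / h) \<longlongrightarrow> 0) (at 0)" using l r by (simp add: filterlim_split_at)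
    then show ?thesis unfolding 3 DERIV_def by (simp add: flat_def)
  qed
qed

text \<open>The squared norm is written as a polynomial in the coordinates, so that smoothness
  follows from the rules for sums, products and composition with \<open>flat\<close>.\<close>

definition flat_bump :: "real \<Rightarrow> real ^ 'n \<Rightarrow> real" where
  "flat_bump \<delta> x = flat 0 (\<delta>\<^sup>2 - (\<Sum>j\<in>UNIV. x $ j * x $ j))"

lemma flat_bump_smooth: "smooth_on UNIV (flat_bump \<delta> :: real ^ 'n \<Rightarrow> real)"
proof -
  have "Ck_on k UNIV (\<lambda>x::real^'n. \<delta>\<^sup>2 + (\<Sum>j\<in>UNIV. (-1) * (x $ j * x $ j)))" for k
    by (intro Ck_on_add Ck_on_const Ck_on_sum Ck_on_mult Ck_on_nth) auto
  then have "Ck_on k UNIV (\<lambda>x::real^'n. \<delta>\<^sup>2 - (\<Sum>j\<in>UNIV. x $ j * x $ j))" for k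
    by (simp add: sum_negf)
  then have "Ck_on k UNIV (\<lambda>x::real^'n. flat 0 (\<delta>\<^sup>2 - (\<Sum>j\<in>UNIV. x $ j * x $ j)))" for k
    by (intro Ck_on_compose_real[where h=flat, OF _ flat_DERIV]) auto
  then show ?thesis unfolding smooth_on_def by (simp add: flat_bump_def [abs_def])
qed

lemma flat_bump_pos_iff: assumes "\<delta> > 0" shows "flat_bump \<delta> x > 0 \<longleftrightarrow> norm x < \<delta>"
  and flat_bump_nonneg: "flat_bump \<delta> x \<ge> 0"
proof -
  have "(\<Sum>j\<in>UNIV. x $ j * x $ j) = (norm x)\<^sup>2"
    by (simp add: power2_norm_eq_inner inner_vec_def)
  moreover have "(norm x)\<^sup>2 < \<delta>\<^sup>2 \<longleftrightarrow> norm x < \<delta>"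
    using assms power_less_imp_less_base[of "norm x" 2 \<delta>] power_strict_mono[of "norm x" \<delta> 2] by auto
  ultimately show "flat_bump \<delta> x > 0 \<longleftrightarrow> norm x < \<delta>" "flat_bump \<delta> x \<ge> 0"
    by (auto simp: flat_bump_def flat_def)
qed

section \<open>Affine changes of variables\<close>

lemma nn_integral_lborel_affine:
  fixes t :: "real ^ 'n"
  assumes [measurable]: "f \<in> borel_measurable borel" and c: "c \<noteq> 0"
  shows "(\<integral>\<^sup>+x. f x \<partial>lborel) = ennreal (\<bar>c\<bar> ^ CARD('n)) * (\<integral>\<^sup>+x. f (t + c *\<^sub>R x) \<partial>lborel)"
  by (subst lborel_affine[OF c, of t])
     (simp add: nn_integral_density nn_integral_distr nn_integral_cmult)

lemma nn_integral_lborel_shift: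
  fixes t :: "real ^ 'n"
  assumes "f \<in> borel_measurable borel"
  shows "(\<integral>\<^sup>+x. f (x - t) \<partial>lborel) = (\<integral>\<^sup>+x. f x \<partial>lborel)"
    and "(\<integral>\<^sup>+x. f (x + t) \<partial>lborel) = (\<integral>\<^sup>+x. f x \<partial>lborel)"
    and "(\<integral>\<^sup>+x. f (t - x) \<partial>lborel) = (\<integral>\<^sup>+x. f x \<partial>lborel)"
  using nn_integral_lborel_affine[OF assms, of 1 t] nn_integral_lborel_affine[OF assms, of 1 "-t"]
    nn_integral_lborel_affine[OF assms, of "-1" t]
  by (simp_all add: algebra_simps)

lemma integrable_lborel_affine:
  fixes t :: "real ^ 'n" and f :: "real ^ 'n \<Rightarrow> 'b::{banach, second_countable_topology}"
  assumes f: "integrable lborel f" and "c \<noteq> 0"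
  shows "integrable lborel (\<lambda>x. f (t + c *\<^sub>R x))"
proof -
  have [measurable]: "f \<in> borel_measurable borel" using f by auto
  have "(\<integral>\<^sup>+x. ennreal (norm (f x)) \<partial>lborel) < \<infinity>" using f integrable_iff_bounded by blast
  then show ?thesis
    unfolding integrable_iff_bounded
    by (subst (asm) nn_integral_lborel_affine[OF _ assms(2), of _ t]) (auto simp: ennreal_mult_less_top assms(2))
qed

lemma integral_lborel_affine:
  fixes t :: "real ^ 'n" and f :: "real ^ 'n \<Rightarrow> 'b::{banach, second_countable_topology}"
  assumes [measurable]: "f \<in> borel_measurable borel" and c: "c \<noteq> 0"
  shows "(LINT x|lborel. f x) = \<bar>c\<bar> ^ CARD('n) *\<^sub>R (LINT x|lborel. f (t + c *\<^sub>R x))"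
  by (subst lborel_affine[OF c, of t])
     (simp add: integral_density integral_distr)

lemma integrable_lborel_reflect:
  fixes t :: "real ^ 'n" and f :: "real ^ 'n \<Rightarrow> 'b::{banach, second_countable_topology}"
  shows "integrable lborel f \<Longrightarrow> integrable lborel (\<lambda>x. f (t - x))"
  using integrable_lborel_affine[of f "-1" t] by simp

lemma integral_lborel_reflect:
  fixes t :: "real ^ 'n" and f :: "real ^ 'n \<Rightarrow> 'b::{banach, second_countable_topology}"
  shows "f \<in> borel_measurable borel \<Longrightarrow> (LINT x|lborel. f (t - x)) = (LINT x|lborel. f x)"
  using integral_lborel_affine[of f "-1" t] by simp

section \<open>Continuity of translations in the mean\<close>

definition translation_continuous :: "(real ^ 'n \<Rightarrow> real) \<Rightarrow> bool" where
  "translation_continuous u \<longleftrightarrow>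
     (\<forall>e>0. \<exists>d>0. \<forall>h. norm h < d \<longrightarrow> (\<integral>\<^sup>+x. ennreal \<bar>u (x - h) - u x\<bar> \<partial>lborel) \<le> ennreal e)"

text \<open>The property passes to limits in the mean: a shift moves \<open>u - w\<close> without
  changing its norm, so the error splits into three thirds, two of them bounded independently of
  \<open>h\<close>.\<close>

lemma translation_continuous_approx:
  fixes u :: "real ^ 'n \<Rightarrow> real"
  assumes [measurable]: "u \<in> borel_measurable borel"
    and ap: "\<And>e. e > 0 \<Longrightarrow> \<exists>w\<in>borel_measurable borel. translation_continuous w \<and>
      (\<integral>\<^sup>+x. ennreal \<bar>u x - w x\<bar> \<partial>lborel) \<le> ennreal e"
  shows "translation_continuous u"
  unfolding translation_continuous_def
proof (intro allI impI)
  fix e :: real assume e: "e > 0"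
  obtain w where [measurable]: "w \<in> borel_measurable borel" and w: "translation_continuous w"
    and uw: "(\<integral>\<^sup>+x. ennreal \<bar>u x - w x\<bar> \<partial>lborel) \<le> ennreal (e/3)"
    using ap[of "e/3"] e by auto
  obtain d where d: "d > 0" "\<And>h. norm h < d \<Longrightarrow> (\<integral>\<^sup>+x. ennreal \<bar>w (x - h) - w x\<bar> \<partial>lborel) \<le> ennreal (e/3)"
    using w e unfolding translation_continuous_def by (meson divide_pos_pos zero_less_numeral)
  have "(\<integral>\<^sup>+x. ennreal \<bar>u (x - h) - u x\<bar> \<partial>lborel) \<le> ennreal e" if h: "norm h < d" for h
  proof -
    have "(\<integral>\<^sup>+x. ennreal \<bar>u (x - h) - u x\<bar> \<partial>lborel) \<le>
      (\<integral>\<^sup>+x. ennreal \<bar>u (x - h) - w (x - h)\<bar> + ennreal \<bar>w (x - h) - w x\<bar> + ennreal \<bar>u x - w x\<bar> \<partial>lborel)"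
      by (intro nn_integral_mono) (simp flip: ennreal_plus add: ennreal_leI)
    also have "\<dots> = (\<integral>\<^sup>+x. ennreal \<bar>u (x - h) - w (x - h)\<bar> \<partial>lborel) +
        (\<integral>\<^sup>+x. ennreal \<bar>w (x - h) - w x\<bar> \<partial>lborel) + (\<integral>\<^sup>+x. ennreal \<bar>u x - w x\<bar> \<partial>lborel)"
      by (simp add: nn_integral_add)
    also have "(\<integral>\<^sup>+x. ennreal \<bar>u (x - h) - w (x - h)\<bar> \<partial>lborel) = (\<integral>\<^sup>+x. ennreal \<bar>u x - w x\<bar> \<partial>lborel)"
      by (rule nn_integral_lborel_shift(1)[where f="\<lambda>x. ennreal \<bar>u x - w x\<bar>"]) simp
    also have "(\<integral>\<^sup>+x. ennreal \<bar>u x - w x\<bar> \<partial>lborel) + (\<integral>\<^sup>+x. ennreal \<bar>w (x - h) - w x\<bar> \<partial>lborel)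
       + (\<integral>\<^sup>+x. ennreal \<bar>u x - w x\<bar> \<partial>lborel) \<le> ennreal (e/3) + ennreal (e/3) + ennreal (e/3)"
      by (intro add_mono uw d h)
    also have "\<dots> = ennreal e" using e by (simp flip: ennreal_plus)
    finally show ?thesis .
  qed
  then show "\<exists>d>0. \<forall>h. norm h < d \<longrightarrow> (\<integral>\<^sup>+x. ennreal \<bar>u (x - h) - u x\<bar> \<partial>lborel) \<le> ennreal e"
    using d by blast
qed

text \<open>A point of an open set stays in it under small shifts, so the part of \<open>T\<close>
  that leaves under the shift by \<open>h\<close> has measure tending to 0 by dominated convergence.
  The other half of the symmetric difference is the same quantity for \<open>- h\<close>.\<close>

lemma translation_continuous_open:
  fixes T :: "(real ^ 'n) set"
  assumes T: "open T" and fin: "emeasure lborel T < \<infinity>"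
  shows "translation_continuous (\<lambda>x. c * indicator T x)"
proof -
  have [measurable]: "T \<in> sets borel" using T by simp
  have *: "(\<lambda>n. \<integral>\<^sup>+x. ennreal (indicator T x * (1 - indicator T (x - h n))) \<partial>lborel) \<longlonglongrightarrow> 0"
    if h: "h \<longlonglongrightarrow> 0" for h :: "nat \<Rightarrow> real ^ 'n"
  proof -
    have "(\<lambda>n. \<integral>\<^sup>+x. ennreal (indicator T x * (1 - indicator T (x - h n))) \<partial>lborel) \<longlonglongrightarrow> (\<integral>\<^sup>+(x::real^'n). 0 \<partial>lborel)"
    proof (rule nn_integral_dominated_convergence[where w="\<lambda>x. indicator T x" and u'="\<lambda>x. 0" and
        u="\<lambda>n x. ennreal (indicator T x * (1 - indicator T (x - h n)))"])
      show "AE x in lborel. ennreal (indicator T x * (1 - indicator T (x - h n))) \<le> indicator T x" for n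
        by (rule AE_I2) (auto simp: indicator_def)
      show "(\<integral>\<^sup>+x. indicator T x \<partial>lborel) < \<infinity>" using fin by simp
      show "AE x in lborel. (\<lambda>n. ennreal (indicator T x * (1 - indicator T (x - h n)))) \<longlonglongrightarrow> 0"
      proof (rule AE_I2)
        fix x
        show "(\<lambda>n. ennreal (indicator T x * (1 - indicator T (x - h n)))) \<longlonglongrightarrow> 0"
        proof (cases "x \<in> T")
          case True
          have "(\<lambda>n. x - h n) \<longlonglongrightarrow> x" using tendsto_diff[OF tendsto_const h, of x] by simp
          then have "\<forall>\<^sub>F n in sequentially. x - h n \<in> T" using T True by (simp add: tendsto_def)
          then have "\<forall>\<^sub>F n in sequentially. ennreal (indicator T x * (1 - indicator T (x - h n))) = 0"
            by (rule eventually_mono) simp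
          then show ?thesis by (rule tendsto_eventually)
        qed simp
      qed
    qed simp_all
    then show ?thesis by simp
  qed
  have lim: "((\<lambda>h. \<integral>\<^sup>+x. ennreal \<bar>c * indicator T (x - h) - c * indicator T x\<bar> \<partial>lborel) \<longlongrightarrow> 0) (at 0)"
    unfolding tendsto_at_iff_sequentially comp_def
  proof (intro allI impI)
    fix h :: "nat \<Rightarrow> real ^ 'n" assume h: "h \<longlonglongrightarrow> 0"
    have eq: "(\<integral>\<^sup>+x. ennreal \<bar>c * indicator T (x - h n) - c * indicator T x\<bar> \<partial>lborel) =
      ennreal \<bar>c\<bar> * ((\<integral>\<^sup>+x. ennreal (indicator T x * (1 - indicator T (x - h n))) \<partial>lborel) +
      (\<integral>\<^sup>+x. ennreal (indicator T x * (1 - indicator T (x - (- h n)))) \<partial>lborel))" for n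
    proof -
      have "(\<integral>\<^sup>+x. ennreal \<bar>c * indicator T (x - h n) - c * indicator T x\<bar> \<partial>lborel) =
        (\<integral>\<^sup>+x. ennreal \<bar>c\<bar> * (ennreal (indicator T x * (1 - indicator T (x - h n)))
          + ennreal (indicator T (x - h n) * (1 - indicator T x))) \<partial>lborel)"
        by (intro nn_integral_cong) (auto simp: indicator_def)
      also have "\<dots> = ennreal \<bar>c\<bar> * ((\<integral>\<^sup>+x. ennreal (indicator T x * (1 - indicator T (x - h n))) \<partial>lborel) +
        (\<integral>\<^sup>+x. ennreal (indicator T (x - h n) * (1 - indicator T x)) \<partial>lborel))"
        by (simp add: nn_integral_cmult nn_integral_add)
      also have "(\<integral>\<^sup>+x. ennreal (indicator T (x - h n) * (1 - indicator T x)) \<partial>lborel) =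
         (\<integral>\<^sup>+x. ennreal (indicator T x * (1 - indicator T (x - (- h n)))) \<partial>lborel)"
        using nn_integral_lborel_shift(1)[where t="h n" and f="\<lambda>x. ennreal (indicator T x * (1 - indicator T (x + h n)))"]
        by simp
      finally show ?thesis .
    qed
    have "(\<lambda>n. ennreal \<bar>c\<bar> * ((\<integral>\<^sup>+x. ennreal (indicator T x * (1 - indicator T (x - h n))) \<partial>lborel) +
      (\<integral>\<^sup>+x. ennreal (indicator T x * (1 - indicator T (x - (- h n)))) \<partial>lborel))) \<longlonglongrightarrow> ennreal \<bar>c\<bar> * (0 + 0)"
      by (intro ennreal_tendsto_cmult tendsto_add * h) (use tendsto_minus[OF h] in auto)
    then show "(\<lambda>n. \<integral>\<^sup>+x. ennreal \<bar>c * indicator T (x - h n) - c * indicator T x\<bar> \<partial>lborel) \<longlonglongrightarrow> 0"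
      unfolding eq by simp
  qed
  show ?thesis unfolding translation_continuous_def
  proof (intro allI impI)
    fix e :: real assume "e > 0"
    then have "\<forall>\<^sub>F h in at 0. (\<integral>\<^sup>+x. ennreal \<bar>c * indicator T (x - h) - c * indicator T x\<bar> \<partial>lborel) < ennreal e"
      using order_tendstoD(2)[OF lim] by simp
    then obtain d where d: "d > 0" "\<And>h. h \<noteq> 0 \<Longrightarrow> norm h < d \<Longrightarrow>
        (\<integral>\<^sup>+x. ennreal \<bar>c * indicator T (x - h) - c * indicator T x\<bar> \<partial>lborel) < ennreal e"
      unfolding eventually_at by auto
    show "\<exists>d>0. \<forall>h. norm h < d \<longrightarrow> (\<integral>\<^sup>+x. ennreal \<bar>c * indicator T (x - h) - c * indicator T x\<bar> \<partial>lborel) \<le> ennreal e"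
    proof (intro exI[of _ d] conjI allI impI d(1))
      fix h :: "real ^ 'n" assume "norm h < d"
      then show "(\<integral>\<^sup>+x. ennreal \<bar>c * indicator T (x - h) - c * indicator T x\<bar> \<partial>lborel) \<le> ennreal e"
        using d(2)[of h] by (cases "h = 0") (auto simp: less_imp_le)
    qed
  qed
qed

text \<open>\<open>integrable_induct\<close> reduces the claim to indicators of Borel sets, which
  outer regularity replaces by open sets.\<close>

lemma translation_continuous_integrable:
  fixes u :: "real ^ 'n \<Rightarrow> real"
  assumes "integrable lborel u"
  shows "translation_continuous u"
  using assms
proof (induction rule: integrable_induct)
  case (base A c)
  then have [measurable]: "A \<in> sets borel" by simp
  show ?case
  proof (rule translation_continuous_approx)
    fix e :: real assume e: "e > 0"
    \<comment> \<open>The summand 1 covers the case \<open>c = 0\<close>.\<close>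
    define e' where "e' = e / (\<bar>c\<bar> + 1)"
    have e': "e' > 0" "\<bar>c\<bar> * e' \<le> e" using e by (auto simp: e'_def field_simps)
    have "A \<in> sets lebesgue" using base by simp
    then obtain T where T: "open T" "A \<subseteq> T" "emeasure lebesgue (T - A) < ennreal e'"
      using sets_lebesgue_outer_open e'(1) by metis
    then have [measurable]: "T \<in> sets borel" by simp
    have TA: "emeasure lborel (T - A) < ennreal e'" using T by simp
    have "emeasure lborel T = emeasure lborel A + emeasure lborel (T - A)"
      using T(2) by (subst plus_emeasure) (auto intro!: arg_cong[where f="emeasure lborel"])
    then have fin: "emeasure lborel T < \<infinity>" using base TA by (auto simp: less_top[symmetric])
    show "\<exists>w\<in>borel_measurable borel. translation_continuous w \<and>
      (\<integral>\<^sup>+x. ennreal \<bar>indicator A x *\<^sub>R c - w x\<bar> \<partial>lborel) \<le> ennreal e"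
    proof (intro bexI[of _ "\<lambda>x. c * indicator T x"] conjI translation_continuous_open T fin)
      have "(\<integral>\<^sup>+x. ennreal \<bar>indicator A x *\<^sub>R c - c * indicator T x\<bar> \<partial>lborel) =
        (\<integral>\<^sup>+x. ennreal \<bar>c\<bar> * indicator (T - A) x \<partial>lborel)"
        using T(2) by (intro nn_integral_cong) (auto simp: indicator_def)
      also have "\<dots> = ennreal \<bar>c\<bar> * emeasure lborel (T - A)" by (simp add: nn_integral_cmult)
      also have "\<dots> \<le> ennreal \<bar>c\<bar> * ennreal e'" using TA by (intro mult_left_mono) auto
      also have "\<dots> \<le> ennreal e" using e' by (simp flip: ennreal_mult' add: ennreal_leI)
      finally show "(\<integral>\<^sup>+x. ennreal \<bar>indicator A x *\<^sub>R c - c * indicator T x\<bar> \<partial>lborel) \<le> ennreal e" .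
    qed simp
  qed simp
next
  case (add f g)
  have [measurable]: "f \<in> borel_measurable borel" "g \<in> borel_measurable borel" using add by auto
  show ?case unfolding translation_continuous_def
  proof (intro allI impI)
    fix e :: real assume e: "e > 0"
    obtain d1 where d1: "d1 > 0" "\<And>h. norm h < d1 \<Longrightarrow> (\<integral>\<^sup>+x. ennreal \<bar>f (x - h) - f x\<bar> \<partial>lborel) \<le> ennreal (e/2)"
      using add(3) e unfolding translation_continuous_def by (meson half_gt_zero)
    obtain d2 where d2: "d2 > 0" "\<And>h. norm h < d2 \<Longrightarrow> (\<integral>\<^sup>+x. ennreal \<bar>g (x - h) - g x\<bar> \<partial>lborel) \<le> ennreal (e/2)"
      using add(4) e unfolding translation_continuous_def by (meson half_gt_zero)
    have "(\<integral>\<^sup>+x. ennreal \<bar>f (x - h) + g (x - h) - (f x + g x)\<bar> \<partial>lborel) \<le> ennreal e" if "norm h < min d1 d2" for h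
    proof -
      have "(\<integral>\<^sup>+x. ennreal \<bar>f (x - h) + g (x - h) - (f x + g x)\<bar> \<partial>lborel) \<le>
        (\<integral>\<^sup>+x. ennreal \<bar>f (x - h) - f x\<bar> + ennreal \<bar>g (x - h) - g x\<bar> \<partial>lborel)"
        by (intro nn_integral_mono) (simp flip: ennreal_plus add: ennreal_leI)
      also have "\<dots> = (\<integral>\<^sup>+x. ennreal \<bar>f (x - h) - f x\<bar> \<partial>lborel) + (\<integral>\<^sup>+x. ennreal \<bar>g (x - h) - g x\<bar> \<partial>lborel)"
        by (simp add: nn_integral_add)
      also have "\<dots> \<le> ennreal (e/2) + ennreal (e/2)" using that by (intro add_mono d1 d2) auto
      also have "\<dots> = ennreal e" using e by (simp flip: ennreal_plus)
      finally show ?thesis .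
    qed
    then show "\<exists>d>0. \<forall>h. norm h < d \<longrightarrow> (\<integral>\<^sup>+x. ennreal \<bar>f (x - h) + g (x - h) - (f x + g x)\<bar> \<partial>lborel) \<le> ennreal e"
      using d1(1) d2(1) by (intro exI[of _ "min d1 d2"]) auto
  qed
next
  case (lim f s)
  have [measurable]: "f \<in> borel_measurable borel" "s i \<in> borel_measurable borel" for i using lim by auto
  show ?case
  proof (rule translation_continuous_approx)
    fix e :: real assume e: "e > 0"
    have "(\<lambda>i. \<integral>\<^sup>+x. ennreal (norm (f x - s i x)) \<partial>lborel) \<longlonglongrightarrow> 0"
    proof (rule nn_integral_dominated_convergence_norm[where w="\<lambda>x. 2 * norm (f x)"])
      have "integrable lborel (\<lambda>x. 2 * norm (f x))" using lim by simp
      then show "(\<integral>\<^sup>+x. ennreal (2 * norm (f x)) \<partial>lborel) < \<infinity>"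
        unfolding integrable_iff_bounded by simp
    qed (use lim in auto)
    then have "\<forall>\<^sub>F i in sequentially. (\<integral>\<^sup>+x. ennreal (norm (f x - s i x)) \<partial>lborel) < ennreal e"
      using e by (intro order_tendstoD) auto
    then obtain i where "(\<integral>\<^sup>+x. ennreal (norm (f x - s i x)) \<partial>lborel) < ennreal e"
      by (meson eventually_happens sequentially_bot)
    then show "\<exists>w\<in>borel_measurable borel. translation_continuous w \<and>
      (\<integral>\<^sup>+x. ennreal \<bar>f x - w x\<bar> \<partial>lborel) \<le> ennreal e"
      using lim by (intro bexI[of _ "s i"]) (auto simp: less_imp_le)
  qed simp
qed

section \<open>Mollification\<close>

lemma smooth_onD: "smooth_on A f \<Longrightarrow> Ck_on k A f"
  by (simp add: smooth_on_def)

lemma smooth_on_partial_deriv: "smooth_on A f \<Longrightarrow> smooth_on A (partial_deriv i f)"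
  unfolding smooth_on_def by (metis Ck_on.simps(2))

lemma smooth_on_differentiable: "smooth_on A f \<Longrightarrow> x \<in> A \<Longrightarrow> f differentiable (at x)"
  using smooth_onD[of A f "Suc 0"] by simp

lemma smooth_on_continuous: "smooth_on A f \<Longrightarrow> continuous_on A f"
  using smooth_onD[of A f 0] by simp

lemma smooth_on_grad_continuous: "smooth_on A f \<Longrightarrow> continuous_on A (grad f)"
  using Ck_on_grad_continuous[of 0 A f] smooth_onD by blast

lemma grad_zero_outside:
  assumes "\<And>y. R < norm y \<Longrightarrow> f y = 0" "R < norm x"
  shows "grad f x = 0"
proof -
  have "open {y::real^'n. R < norm y}" by (intro open_Collect_less continuous_intros)
  then have "partial_deriv i f x = partial_deriv i (\<lambda>_. 0) x" for i
    by (rule partial_deriv_cong) (use assms in auto)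
  then show ?thesis by (simp add: grad_def vec_eq_iff)
qed

lemma bounded_of_compact_support:
  fixes f :: "real ^ 'n \<Rightarrow> 'b::real_normed_vector"
  assumes "continuous_on UNIV f" "\<And>y. R < norm y \<Longrightarrow> f y = 0"
  obtains B where "B \<ge> 0" "\<And>x. norm (f x) \<le> B"
proof -
  have "compact (f ` cball 0 R)"
    using assms(1) by (intro compact_continuous_image compact_cball) (auto intro: continuous_on_subset)
  then obtain B where B: "\<And>x. x \<in> cball 0 R \<Longrightarrow> norm (f x) \<le> B"
    using compact_imp_bounded by (metis bounded_iff imageI)
  show thesis
  proof (rule that[of "max B 0"])
    show "norm (f x) \<le> max B 0" for x
      using assms(2)[of x] B[of x] by (cases "R < norm x") (auto simp: le_max_iff_disj)
  qed simp
qed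

lemma lipschitz_of_grad_bound:
  fixes f :: "real ^ 'n \<Rightarrow> real"
  assumes "convex S" "\<And>x. x \<in> S \<Longrightarrow> f differentiable (at x)" "\<And>x. x \<in> S \<Longrightarrow> norm (grad f x) \<le> B"
    and "x \<in> S" "y \<in> S"
  shows "\<bar>f x - f y\<bar> \<le> B * norm (x - y)"
proof -
  have "norm (f x - f y) \<le> B * norm (x - y)"
  proof (rule differentiable_bound[OF assms(1) _ _ assms(4,5)])
    show "(f has_derivative (\<lambda>h. grad f x \<bullet> h)) (at x within S)" if "x \<in> S" for x
      using has_derivative_grad[OF assms(2)[OF that]] has_derivative_at_withinI by blast
    show "onorm (\<lambda>h. grad f x \<bullet> h) \<le> B" if "x \<in> S" for x
    proof (rule onorm_le)
      fix h
      have "norm (grad f x \<bullet> h) \<le> norm (grad f x) * norm h" by (simp add: Cauchy_Schwarz_ineq2)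
      also have "\<dots> \<le> B * norm h" by (intro mult_right_mono assms(3) that) simp
      finally show "norm (grad f x \<bullet> h) \<le> B * norm h" .
    qed
  qed
  then show ?thesis by simp
qed

definition conv :: "(real ^ 'n \<Rightarrow> real) \<Rightarrow> (real ^ 'n \<Rightarrow> real) \<Rightarrow> real ^ 'n \<Rightarrow> real" where
  "conv \<rho> u x = (LINT z|lborel. u z * \<rho> (x - z))"

lemma integrable_mult_bounded:
  fixes g :: "'a \<Rightarrow> 'b::{second_countable_topology, banach}"
  assumes u: "integrable M u" and [measurable]: "g \<in> borel_measurable M" and "\<And>z. norm (g z) \<le> B"
  shows "integrable M (\<lambda>z. u z *\<^sub>R g z)"
proof (rule Bochner_Integration.integrable_bound)
  show "integrable M (\<lambda>z. B * \<bar>u z\<bar>)" using u by simp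
  have "norm (u z *\<^sub>R g z) \<le> norm (B * \<bar>u z\<bar>)" for z
    using assms(3)[of z] mult_right_mono[of "norm (g z)" "\<bar>B\<bar>" "\<bar>u z\<bar>"] by (simp add: abs_mult mult.commute)
  then show "AE z in M. norm (u z *\<^sub>R g z) \<le> norm (B * \<bar>u z\<bar>)" by simp
  show "(\<lambda>z. u z *\<^sub>R g z) \<in> borel_measurable M" using u by measurable
qed

lemma conv_integrable:
  fixes u :: "real ^ 'n \<Rightarrow> real"
  assumes "integrable lborel u" "continuous_on UNIV \<rho>" "\<And>x. \<bar>\<rho> x\<bar> \<le> B"
  shows "integrable lborel (\<lambda>z. u z * \<rho> (x - z))"
proof -
  have [measurable]: "\<rho> \<in> borel_measurable borel" using assms(2) by (rule borel_measurable_continuous_onI)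
  show ?thesis
    using integrable_mult_bounded[of lborel u "\<lambda>z. \<rho> (x - z)" B] assms by simp
qed

lemma continuous_on_conv:
  fixes u :: "real ^ 'n \<Rightarrow> real"
  assumes u: "integrable lborel u" and \<rho>: "continuous_on UNIV \<rho>" and B: "\<And>x. \<bar>\<rho> x\<bar> \<le> B"
  shows "continuous_on UNIV (conv \<rho> u)"
proof -
  have [measurable]: "\<rho> \<in> borel_measurable borel" "u \<in> borel_measurable borel"
    using \<rho> u by (auto intro: borel_measurable_continuous_onI)
  show ?thesis unfolding continuous_on_sequentially comp_def
  proof (intro allI ballI impI; elim conjE)
    fix X and a :: "real ^ 'n" assume X: "X \<longlonglongrightarrow> a"
    show "(\<lambda>n. conv \<rho> u (X n)) \<longlonglongrightarrow> conv \<rho> u a" unfolding conv_def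
    proof (rule integral_dominated_convergence[where w="\<lambda>z. B * \<bar>u z\<bar>"])
      show "AE z in lborel. (\<lambda>n. u z * \<rho> (X n - z)) \<longlonglongrightarrow> u z * \<rho> (a - z)"
      proof (rule AE_I2, intro tendsto_intros)
        fix z
        have "(\<lambda>n. X n - z) \<longlonglongrightarrow> a - z" by (intro tendsto_intros X)
        then show "(\<lambda>n. \<rho> (X n - z)) \<longlonglongrightarrow> \<rho> (a - z)"
          using \<rho> by (simp add: continuous_on_eq_continuous_at isCont_tendsto_compose[of _ \<rho>])
      qed
      show "AE z in lborel. norm (u z * \<rho> (X n - z)) \<le> B * \<bar>u z\<bar>" for n
        by (rule AE_I2) (simp add: abs_mult mult.commute[of "\<bar>u _\<bar>"] mult_right_mono B)
    qed (use u in auto)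
  qed
qed

text \<open>The remainder quotients \<open>r y z\<close> tend to 0 pointwise and are bounded by
  \<open>2 * B\<close>, one \<open>B\<close> from the mean value inequality and one from the linear
  part; dominated convergence with majorant \<open>2 * B * \<bar>u z\<bar>\<close>
  concludes.\<close>

lemma conv_has_derivative:
  fixes u :: "real ^ 'n \<Rightarrow> real"
  assumes u: "integrable lborel u" and d: "\<And>x. \<rho> differentiable (at x)"
    and g: "continuous_on UNIV (grad \<rho>)" and B: "\<And>x. norm (grad \<rho> x) \<le> B" and B0: "\<And>x. \<bar>\<rho> x\<bar> \<le> B0"
  shows "(conv \<rho> u has_derivative (\<lambda>h. (LINT z|lborel. u z *\<^sub>R grad \<rho> (x - z)) \<bullet> h)) (at x)"
proof -
  have c: "continuous_on UNIV \<rho>"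
    using d by (simp add: continuous_on_eq_continuous_at differentiable_imp_continuous_within)
  have [measurable]: "\<rho> \<in> borel_measurable borel" "u \<in> borel_measurable borel" "grad \<rho> \<in> borel_measurable borel"
    using c g u by (auto intro: borel_measurable_continuous_onI)
  have iG: "integrable lborel (\<lambda>z. u z *\<^sub>R grad \<rho> (x - z))"
    by (rule integrable_mult_bounded[OF u _ B]) simp
  have iC: "integrable lborel (\<lambda>z. u z * \<rho> (y - z))" for y by (rule conv_integrable[OF u c B0])
  \<comment> \<open>At \<open>y = x\<close> the quotient is 0, the value of a division by 0, so the
    bound holds there as well.\<close>
  define r where "r y z = (\<rho> (y - z) - \<rho> (x - z) - grad \<rho> (x - z) \<bullet> (y - x)) / norm (y - x)" for y z
  have lip: "\<bar>\<rho> a - \<rho> b\<bar> \<le> B * norm (a - b)" for a b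
    by (rule lipschitz_of_grad_bound[where S=UNIV]) (use d B in auto)
  have B_nonneg: "B \<ge> 0" using B[of 0] norm_ge_zero[of "grad \<rho> 0"] by linarith
  have rb: "\<bar>r y z\<bar> \<le> 2 * B" for y z
  proof (cases "y = x")
    case False
    have "\<bar>grad \<rho> (x - z) \<bullet> (y - x)\<bar> \<le> B * norm (y - x)"
      by (rule order_trans[OF Cauchy_Schwarz_ineq2]) (intro mult_right_mono B norm_ge_zero)
    then have "\<bar>\<rho> (y - z) - \<rho> (x - z) - grad \<rho> (x - z) \<bullet> (y - x)\<bar> \<le> 2 * B * norm (y - x)"
      using lip[of "y - z" "x - z"] by simp
    then show ?thesis using False by (simp add: r_def divide_le_eq)
  qed (simp add: r_def B_nonneg)
  have r0: "((\<lambda>y. r y z) \<longlongrightarrow> 0) (at x)" for z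
  proof -
    have "((\<lambda>y. \<rho> (y - z)) has_derivative (\<lambda>h. grad \<rho> (x - z) \<bullet> h)) (at x)"
    proof (rule has_derivative_compose[of "\<lambda>y. y - z" "\<lambda>h. h" x UNIV \<rho>, OF _ has_derivative_grad[OF d]])
      show "((\<lambda>y. y - z) has_derivative (\<lambda>h. h)) (at x)" by (auto intro!: derivative_eq_intros)
    qed
    then have "((\<lambda>y. norm (\<rho> (y - z) - \<rho> (x - z) - grad \<rho> (x - z) \<bullet> (y - x)) / norm (y - x)) \<longlongrightarrow> 0) (at x)"
      unfolding has_derivative_iff_norm by simp
    then show ?thesis by (intro tendsto_norm_zero_cancel[of "\<lambda>y. r y z"]) (simp add: r_def)
  qed
  show ?thesis unfolding has_derivative_iff_norm
  proof
    show "bounded_linear (\<lambda>h. (LINT z|lborel. u z *\<^sub>R grad \<rho> (x - z)) \<bullet> h)"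
      by (rule bounded_linear_inner_right)
    have eq: "(conv \<rho> u y - conv \<rho> u x - (LINT z|lborel. u z *\<^sub>R grad \<rho> (x - z)) \<bullet> (y - x)) / norm (y - x)
        = (LINT z|lborel. u z * r y z)" for y
    proof -
      have e: "conv \<rho> u y - conv \<rho> u x - (LINT z|lborel. u z *\<^sub>R grad \<rho> (x - z)) \<bullet> (y - x) =
        (LINT z|lborel. u z * \<rho> (y - z) - u z * \<rho> (x - z) - (u z *\<^sub>R grad \<rho> (x - z)) \<bullet> (y - x))"
        using iG iC by (simp add: conv_def del: inner_scaleR_left)
      have "(conv \<rho> u y - conv \<rho> u x - (LINT z|lborel. u z *\<^sub>R grad \<rho> (x - z)) \<bullet> (y - x)) / norm (y - x) =
        (LINT z|lborel. (u z * \<rho> (y - z) - u z * \<rho> (x - z) - (u z *\<^sub>R grad \<rho> (x - z)) \<bullet> (y - x)) / norm (y - x))"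
        unfolding e by simp
      also have "\<dots> = (LINT z|lborel. u z * r y z)"
      proof (rule Bochner_Integration.integral_cong[OF refl])
        fix z
        have "u z * \<rho> (y - z) - u z * \<rho> (x - z) - (u z *\<^sub>R grad \<rho> (x - z)) \<bullet> (y - x) =
          u z * (\<rho> (y - z) - \<rho> (x - z) - grad \<rho> (x - z) \<bullet> (y - x))"
          by (simp add: right_diff_distrib)
        then show "(u z * \<rho> (y - z) - u z * \<rho> (x - z) - (u z *\<^sub>R grad \<rho> (x - z)) \<bullet> (y - x)) / norm (y - x) = u z * r y z"
          unfolding r_def by simp
      qed
      finally show ?thesis .
    qed
    have "((\<lambda>y. LINT z|lborel. u z * r y z) \<longlongrightarrow> 0) (at x)"
      unfolding tendsto_at_iff_sequentially comp_def
    proof (intro allI impI)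
      fix X assume X: "\<forall>i. X i \<in> UNIV - {x}" "X \<longlonglongrightarrow> x"
      have "(\<lambda>n. LINT z|lborel. u z * r (X n) z) \<longlonglongrightarrow> (LINT z|lborel. u z * 0)"
      proof (rule integral_dominated_convergence[where w="\<lambda>z. 2 * B * \<bar>u z\<bar>"])
        show "AE z in lborel. (\<lambda>n. u z * r (X n) z) \<longlonglongrightarrow> u z * 0"
          using r0 X unfolding tendsto_at_iff_sequentially comp_def
          by (intro AE_I2 tendsto_intros) blast
        show "AE z in lborel. norm (u z * r (X n) z) \<le> 2 * B * \<bar>u z\<bar>" for n
          using mult_left_mono[OF rb[of "X n"], of "\<bar>u _\<bar>"] by (intro AE_I2) (simp add: abs_mult mult.commute)
        show "(\<lambda>z. u z * r (X n) z) \<in> borel_measurable lborel" for n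
          unfolding r_def by measurable
      qed (use u in auto)
      then show "(\<lambda>n. LINT z|lborel. u z * r (X n) z) \<longlonglongrightarrow> 0" by simp
    qed
    then show "((\<lambda>y. norm (conv \<rho> u y - conv \<rho> u x - (LINT z|lborel. u z *\<^sub>R grad \<rho> (x - z)) \<bullet> (y - x)) / norm (y - x)) \<longlongrightarrow> 0) (at x)"
      unfolding eq[symmetric] by (auto dest: tendsto_norm)
  qed
qed

lemma grad_conv:
  fixes u :: "real ^ 'n \<Rightarrow> real"
  assumes u: "integrable lborel u" and d: "smooth_on UNIV \<rho>" and R: "\<And>x. R < norm x \<Longrightarrow> \<rho> x = 0"
  shows "conv \<rho> u differentiable (at x)"
    and "grad (conv \<rho> u) x = (LINT z|lborel. u z *\<^sub>R grad \<rho> (x - z))"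
    and "partial_deriv i (conv \<rho> u) x = conv (partial_deriv i \<rho>) u x"
proof -
  have g: "continuous_on UNIV (grad \<rho>)" using d by (rule smooth_on_grad_continuous)
  then have [measurable]: "grad \<rho> \<in> borel_measurable borel" by (rule borel_measurable_continuous_onI)
  obtain B where B: "\<And>x. norm (grad \<rho> x) \<le> B"
    using bounded_of_compact_support[OF g, of R] grad_zero_outside[of R \<rho>, OF R] by metis
  obtain B0 where B0: "\<And>x. norm (\<rho> x) \<le> B0"
    using bounded_of_compact_support[OF smooth_on_continuous[OF d] R] by metis
  have D: "(conv \<rho> u has_derivative (\<lambda>h. (LINT z|lborel. u z *\<^sub>R grad \<rho> (x - z)) \<bullet> h)) (at x)"
    by (rule conv_has_derivative[OF u smooth_on_differentiable[OF d] g B]) (use B0 in auto)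
  then show "conv \<rho> u differentiable (at x)" by (auto simp: differentiable_def)
  show G: "grad (conv \<rho> u) x = (LINT z|lborel. u z *\<^sub>R grad \<rho> (x - z))" by (rule grad_eqI[OF D])
  have "integrable lborel (\<lambda>z. u z *\<^sub>R grad \<rho> (x - z))"
    by (rule integrable_mult_bounded[OF u _ B]) simp
  then show "partial_deriv i (conv \<rho> u) x = conv (partial_deriv i \<rho>) u x"
    using integral_inner_left[of "axis i (1::real)" lborel "\<lambda>z. u z *\<^sub>R grad \<rho> (x - z)"]
    by (simp add: partial_deriv_eqI[OF D] conv_def inner_axis grad_nth)
qed

text \<open>The partial derivatives of \<open>\<rho>\<close> are again smooth and vanish outside the
  same ball, so the induction applies to them in place of \<open>\<rho>\<close>.\<close>

lemma conv_smooth: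
  fixes u :: "real ^ 'n \<Rightarrow> real"
  assumes u: "integrable lborel u" and d: "smooth_on UNIV \<rho>" and R: "\<And>x. R < norm x \<Longrightarrow> \<rho> x = 0"
  shows "smooth_on UNIV (conv \<rho> u)"
proof -
  have "Ck_on k UNIV (conv \<rho> u)" for k
    using d R
  proof (induction k arbitrary: \<rho>)
    case 0
    obtain B0 where B0: "\<And>x. norm (\<rho> x) \<le> B0"
      using bounded_of_compact_support[OF smooth_on_continuous[OF 0(1)] 0(2)] by metis
    show ?case using continuous_on_conv[OF u smooth_on_continuous[OF 0(1)]] B0 by auto
  next
    case (Suc k)
    have "partial_deriv i (conv \<rho> u) = conv (partial_deriv i \<rho>) u" for i
      by (rule ext) (rule grad_conv(3)[OF u Suc.prems])
    moreover have "Ck_on k UNIV (conv (partial_deriv i \<rho>) u)" for i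
      by (rule Suc.IH[OF smooth_on_partial_deriv[OF Suc.prems(1)]])
        (metis Suc.prems(2) grad_nth grad_zero_outside zero_index)
    ultimately show ?case using grad_conv(1)[OF u Suc.prems] by simp
  qed
  then show ?thesis by (simp add: smooth_on_def)
qed

lemma integrable_indicator_bounded:
  fixes A :: "(real ^ 'n) set"
  assumes "A \<in> sets borel" "bounded A"
  shows "integrable lborel (indicator A :: real ^ 'n \<Rightarrow> real)"
  using assms emeasure_bounded_finite[OF assms(2)] by (intro integrable_real_indicator) auto

section \<open>Mollifiers and smooth cutoff functions\<close>

definition mollifier :: "real \<Rightarrow> (real ^ 'n \<Rightarrow> real) \<Rightarrow> bool" where
  "mollifier \<delta> \<rho> \<longleftrightarrow> smooth_on UNIV \<rho> \<and> (\<forall>x. 0 \<le> \<rho> x) \<and> (\<forall>x. \<delta> < norm x \<longrightarrow> \<rho> x = 0) \<and>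
     integrable lborel \<rho> \<and> (LINT x|lborel. \<rho> x) = 1"

text \<open>The flat bump divided by its integral, which is positive because the bump is positive on
  a ball.\<close>

lemma mollifier_exists:
  assumes "\<delta> > 0" obtains \<rho> :: "real ^ 'n \<Rightarrow> real" where "mollifier \<delta> \<rho>"
proof -
  let ?b = "flat_bump \<delta> :: real ^ 'n \<Rightarrow> real"
  have c: "continuous_on UNIV ?b" by (rule smooth_on_continuous[OF flat_bump_smooth])
  have [measurable]: "?b \<in> borel_measurable borel" by (rule borel_measurable_continuous_onI[OF c])
  have z: "?b x = 0" if "\<delta> < norm x" for x
    using flat_bump_pos_iff[OF assms, of x] flat_bump_nonneg[OF assms, of x] that by linarith
  obtain B where B: "B \<ge> 0" "\<And>x. norm (?b x) \<le> B" using bounded_of_compact_support[OF c z] by metis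
  have i: "integrable lborel ?b"
  proof (rule Bochner_Integration.integrable_bound)
    show "integrable lborel (\<lambda>x. B * indicator (cball (0::real^'n) \<delta>) x)"
      by (intro integrable_mult_right integrable_indicator_bounded) auto
    show "AE x in lborel. norm (?b x) \<le> norm (B * indicator (cball (0::real^'n) \<delta>) x)"
    proof (rule AE_I2)
      fix x show "norm (?b x) \<le> norm (B * indicator (cball (0::real^'n) \<delta>) x)"
        using z[of x] B(2)[of x] B(1) by (cases "norm x \<le> \<delta>") (auto simp: indicator_def)
    qed
  qed simp
  have pos: "(LINT x|lborel. ?b x) > 0"
  proof -
    have "(LINT x|lborel. ?b x) \<noteq> 0"
    proof
      assume "(LINT x|lborel. ?b x) = 0"
      then have "AE x in lborel. ?b x = 0"
        using integral_nonneg_eq_0_iff_AE[OF i AE_I2[OF flat_bump_nonneg[OF assms]]] by simp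
      then have "AE x in lborel. x \<notin> ball (0::real^'n) \<delta>"
        by (rule AE_mp) (use flat_bump_pos_iff[OF assms] in \<open>auto intro!: AE_I2 simp: less_le\<close>)
      then have "emeasure lborel (ball (0::real^'n) \<delta>) = 0"
        by (subst (asm) AE_iff_measurable[where N="ball (0::real^'n) \<delta>"]) auto
      then have "negligible (ball (0::real^'n) \<delta>)"
        by (simp add: negligible_iff_null_sets null_sets_def)
      then show False using open_not_negligible[of "ball (0::real^'n) \<delta>"] assms by simp
    qed
    then show ?thesis using Bochner_Integration.integral_nonneg[of lborel ?b] flat_bump_nonneg[OF assms] by (metis less_le)
  qed
  define I where "I = (LINT x|lborel. ?b x)"
  have sm: "Ck_on k UNIV (\<lambda>x. (1 / I) * ?b x)" for k
    using flat_bump_smooth by (intro Ck_on_mult Ck_on_const) (auto simp: smooth_on_def)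
  have "mollifier \<delta> (\<lambda>x. (1 / I) * ?b x)"
    unfolding mollifier_def
    using pos i z sm flat_bump_nonneg[OF assms]
    by (auto simp: smooth_on_def I_def[symmetric] intro!: divide_nonneg_pos)
  then show thesis by (rule that)
qed

lemma mollifierD:
  assumes "mollifier \<delta> \<rho>"
  shows "smooth_on UNIV \<rho>" "0 \<le> \<rho> x" "\<delta> < norm x \<Longrightarrow> \<rho> x = 0" "integrable lborel \<rho>" "(LINT x|lborel. \<rho> x) = 1"
    "continuous_on UNIV \<rho>" "\<rho> \<in> borel_measurable borel" "(\<integral>\<^sup>+x. ennreal (\<rho> x) \<partial>lborel) = 1"
proof -
  show *: "smooth_on UNIV \<rho>" "0 \<le> \<rho> x" "\<delta> < norm x \<Longrightarrow> \<rho> x = 0" "integrable lborel \<rho>" "(LINT x|lborel. \<rho> x) = 1" for x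
    using assms unfolding mollifier_def by auto
  show "continuous_on UNIV \<rho>" using *(1) by (rule smooth_on_continuous)
  then show "\<rho> \<in> borel_measurable borel" by (rule borel_measurable_continuous_onI)
  show "(\<integral>\<^sup>+x. ennreal (\<rho> x) \<partial>lborel) = 1"
    by (subst nn_integral_eq_integral[OF *(4)]) (use * in auto)
qed

lemma mollifier_bounded:
  assumes "mollifier \<delta> \<rho>" obtains B where "B \<ge> 0" "\<And>x. \<bar>\<rho> x\<bar> \<le> B"
  using bounded_of_compact_support[OF mollifierD(6)[OF assms] mollifierD(3)[OF assms]] by (metis real_norm_def)

text \<open>In this form \<open>conv \<rho> u\<close> is an average of translates of
  \<open>u\<close>, as estimates by convexity need it; the definition keeps \<open>x\<close> inside
  \<open>\<rho>\<close>, where the derivatives fall.\<close>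

lemma conv_eq_swap:
  fixes u :: "real ^ 'n \<Rightarrow> real"
  assumes [measurable]: "u \<in> borel_measurable borel" "\<rho> \<in> borel_measurable borel"
  shows "conv \<rho> u x = (LINT y|lborel. \<rho> y * u (x - y))"
  unfolding conv_def
  by (subst integral_lborel_reflect[of "\<lambda>z. u z * \<rho> (x - z)" x, symmetric]) (simp_all add: mult.commute)

lemma integrable_conv_swap:
  fixes u :: "real ^ 'n \<Rightarrow> real"
  assumes "integrable lborel u" "mollifier \<delta> \<rho>"
  shows "integrable lborel (\<lambda>y. \<rho> y * u (x - y))"
proof -
  obtain B where "\<And>x. \<bar>\<rho> x\<bar> \<le> B" using mollifier_bounded[OF assms(2)] by auto
  then have "integrable lborel (\<lambda>z. u z * \<rho> (x - z))"
    by (rule conv_integrable[OF assms(1) mollifierD(6)[OF assms(2)]])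
  from integrable_lborel_reflect[OF this, of x] show ?thesis by (simp add: mult.commute)
qed

text \<open>Since \<open>\<rho>\<close> has integral 1, \<open>conv \<rho> u x - u x\<close>
  averages \<open>u (x - y) - u x\<close>; exchanging the integrals leaves an average over small
  \<open>y\<close> of norms controlled by \<open>translation_continuous\<close>. One
  \<open>d\<close> serves all mollifiers of smaller radius.\<close>

lemma conv_mollifier_L1:
  fixes u :: "real ^ 'n \<Rightarrow> real"
  assumes u: "integrable lborel u" and e: "e > 0"
  obtains d where "d > 0" "\<And>\<delta> \<rho>. mollifier \<delta> \<rho> \<Longrightarrow> \<delta> < d \<Longrightarrow>
     (\<integral>\<^sup>+x. ennreal \<bar>conv \<rho> u x - u x\<bar> \<partial>lborel) \<le> ennreal e"
proof -
  have [measurable]: "u \<in> borel_measurable borel" using u by auto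
  obtain d where d: "d > 0" "\<And>h. norm h < d \<Longrightarrow> (\<integral>\<^sup>+x. ennreal \<bar>u (x - h) - u x\<bar> \<partial>lborel) \<le> ennreal e"
    using translation_continuous_integrable[OF u] e unfolding translation_continuous_def by meson
  show thesis
  proof (rule that[OF d(1)])
    fix \<delta> and \<rho> :: "real ^ 'n \<Rightarrow> real" assume m: "mollifier \<delta> \<rho>" and "\<delta> < d"
    note [measurable] = mollifierD(7)[OF m]
    have pt: "ennreal \<bar>conv \<rho> u x - u x\<bar> \<le> (\<integral>\<^sup>+y. ennreal (\<rho> y) * ennreal \<bar>u (x - y) - u x\<bar> \<partial>lborel)" for x
    proof -
      have i1: "integrable lborel (\<lambda>y. \<rho> y * u (x - y))" by (rule integrable_conv_swap[OF u m])
      have i2: "integrable lborel (\<lambda>y. \<rho> y * u x)" using mollifierD(4)[OF m] by simp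
      have "conv \<rho> u x - u x = (LINT y|lborel. \<rho> y * u (x - y)) - (LINT y|lborel. \<rho> y * u x)"
        using mollifierD(5)[OF m] by (simp add: conv_eq_swap)
      also have "\<dots> = (LINT y|lborel. \<rho> y * (u (x - y) - u x))"
        using i1 i2 by (simp add: right_diff_distrib)
      also have "ennreal (norm \<dots>) \<le> (\<integral>\<^sup>+y. ennreal (norm (\<rho> y * (u (x - y) - u x))) \<partial>lborel)"
        using i1 i2 by (intro integral_norm_bound_ennreal) (simp add: right_diff_distrib)
      also have "\<dots> = (\<integral>\<^sup>+y. ennreal (\<rho> y) * ennreal \<bar>u (x - y) - u x\<bar> \<partial>lborel)"
        using mollifierD(2)[OF m] by (intro nn_integral_cong) (simp add: abs_mult flip: ennreal_mult)
      finally show ?thesis by simp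
    qed
    have "(\<integral>\<^sup>+x. ennreal \<bar>conv \<rho> u x - u x\<bar> \<partial>lborel) \<le>
      (\<integral>\<^sup>+x. \<integral>\<^sup>+y. ennreal (\<rho> y) * ennreal \<bar>u (x - y) - u x\<bar> \<partial>lborel \<partial>lborel)"
      by (intro nn_integral_mono pt)
    also have "\<dots> = (\<integral>\<^sup>+y. \<integral>\<^sup>+x. ennreal (\<rho> y) * ennreal \<bar>u (x - y) - u x\<bar> \<partial>lborel \<partial>lborel)"
      by (rule lborel_pair.Fubini') simp
    also have "\<dots> = (\<integral>\<^sup>+y. ennreal (\<rho> y) * (\<integral>\<^sup>+x. ennreal \<bar>u (x - y) - u x\<bar> \<partial>lborel) \<partial>lborel)"
      by (simp add: nn_integral_cmult)
    also have "\<dots> \<le> (\<integral>\<^sup>+y. ennreal (\<rho> y) * ennreal e \<partial>lborel)"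
    proof (intro nn_integral_mono)
      fix y show "ennreal (\<rho> y) * (\<integral>\<^sup>+x. ennreal \<bar>u (x - y) - u x\<bar> \<partial>lborel) \<le> ennreal (\<rho> y) * ennreal e"
      proof (cases "norm y < d")
        case True then show ?thesis by (intro mult_left_mono d(2)) auto
      next
        case False
        then have "\<rho> y = 0" using \<open>\<delta> < d\<close> by (intro mollifierD(3)[OF m]) auto
        then show ?thesis by simp
      qed
    qed
    also have "\<dots> = ennreal e" by (simp add: nn_integral_multc mollifierD(8)[OF m])
    finally show "(\<integral>\<^sup>+x. ennreal \<bar>conv \<rho> u x - u x\<bar> \<partial>lborel) \<le> ennreal e" .
  qed
qed

text \<open>The indicator of the closed \<open>d/3\<close>-neighbourhood \<open>A\<close> of
  \<open>K\<close> is mollified at radius \<open>d/3\<close>. The result is 1 at points whose closed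
  ball of that radius lies in \<open>A\<close>, and it vanishes off the
  \<open>2*d/3\<close>-neighbourhood \<open>S\<close>, which still lies in \<open>U\<close>.\<close>

lemma smooth_cutoff:
  fixes K U :: "(real ^ 'n) set"
  assumes K: "compact K" and U: "open U" "K \<subseteq> U"
  obtains \<zeta> S where "smooth_on UNIV \<zeta>" "\<And>x. 0 \<le> \<zeta> x" "\<And>x. \<zeta> x \<le> 1" "\<And>x. x \<in> K \<Longrightarrow> \<zeta> x = 1"
    "compact S" "S \<subseteq> U" "\<And>x. x \<notin> S \<Longrightarrow> \<zeta> x = 0"
proof -
  obtain d where d: "d > 0" "(\<Union>x\<in>K. ball x d) \<subseteq> U"
    using compact_subset_open_imp_ball_epsilon_subset[OF K U] by metis
  obtain \<rho> :: "real ^ 'n \<Rightarrow> real" where m: "mollifier (d/3) \<rho>" using mollifier_exists[of "d/3"] d by auto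
  note [measurable] = mollifierD(7)[OF m]
  have cmp: "compact {x + y |x y. x \<in> K \<and> y \<in> cball 0 r}" for r
    by (intro compact_sums K compact_cball)
  define A where "A = {x + y |x y. x \<in> K \<and> y \<in> cball 0 (d/3)}"
  define S where "S = {x + y |x y. x \<in> K \<and> y \<in> cball 0 (2*d/3)}"
  have cA: "compact A" unfolding A_def by (rule cmp)
  then have [measurable]: "A \<in> sets borel" by (simp add: borel_compact)
  have iA: "integrable lborel (indicator A :: real ^ 'n \<Rightarrow> real)"
    using cA by (intro integrable_indicator_bounded compact_imp_bounded) auto
  have sw: "conv \<rho> (indicator A) x = (LINT y|lborel. \<rho> y * indicator A (x - y))" for x
    by (rule conv_eq_swap) auto
  have ii: "integrable lborel (\<lambda>y. \<rho> y * indicator A (x - y))" for x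
    by (rule integrable_conv_swap[OF iA m])
  show thesis
  proof (rule that[of "conv \<rho> (indicator A)" S])
    show "smooth_on UNIV (conv \<rho> (indicator A))"
      by (rule conv_smooth[OF iA mollifierD(1)[OF m] mollifierD(3)[OF m]])
    show "0 \<le> conv \<rho> (indicator A) x" for x
      unfolding sw by (intro Bochner_Integration.integral_nonneg) (simp add: mollifierD(2)[OF m])
    have "conv \<rho> (indicator A) x \<le> (LINT y|lborel. \<rho> y)" for x
      unfolding sw using mollifierD(2)[OF m]
      by (intro integral_mono ii mollifierD(4)[OF m]) (auto simp: indicator_def)
    then show "conv \<rho> (indicator A) x \<le> 1" for x using mollifierD(5)[OF m] by simp
    show "conv \<rho> (indicator A) x = 1" if x: "x \<in> K" for x
    proof -
      have "\<rho> y * indicator A (x - y) = \<rho> y" for y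
      proof (cases "norm y \<le> d/3")
        case True
        have "x - y \<in> A" unfolding A_def using x True by (intro CollectI exI[of _ x] exI[of _ "-y"]) auto
        then show ?thesis by simp
      qed (simp add: mollifierD(3)[OF m])
      then show ?thesis unfolding sw using mollifierD(5)[OF m] by (simp only:)
    qed
    show "compact S" unfolding S_def by (rule cmp)
    show "S \<subseteq> U" using d unfolding S_def by (force simp: dist_norm)
    show "conv \<rho> (indicator A) x = 0" if x: "x \<notin> S" for x
    proof -
      have "\<rho> y * indicator A (x - y) = 0" for y
      proof (cases "norm y \<le> d/3")
        case True
        have "x - y \<notin> A"
        proof
          assume "x - y \<in> A"
          then obtain a b where ab: "x - y = a + b" "a \<in> K" "norm b \<le> d/3" by (auto simp: A_def)
          have "x = a + (b + y)" using ab(1) by (simp add: algebra_simps)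
          moreover have "norm (b + y) \<le> 2*d/3" using norm_triangle_ineq[of b y] ab True by simp
          ultimately show False using x ab(2) unfolding S_def by auto
        qed
        then show ?thesis by simp
      qed (simp add: mollifierD(3)[OF m])
      then show ?thesis unfolding sw by (simp only: Bochner_Integration.integral_zero)
    qed
  qed
qed

section \<open>Mean oscillation and packings\<close>

definition osc :: "(real ^ 'n) set \<Rightarrow> (real ^ 'n \<Rightarrow> real) \<Rightarrow> real" where
  "osc A u = avg A (\<lambda>x. \<bar>u x - avg A u\<bar>)"

lemma avg_cong: "(\<And>x. x \<in> A \<Longrightarrow> u x = v x) \<Longrightarrow> avg A u = avg A v"
  unfolding avg_def set_lebesgue_integral_def
  by (intro arg_cong2[where f="(/)"] Bochner_Integration.integral_cong) (auto simp: indicator_def)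

lemma avg_nonneg: "(\<And>x. x \<in> A \<Longrightarrow> 0 \<le> u x) \<Longrightarrow> 0 \<le> avg A u"
  unfolding avg_def set_lebesgue_integral_def
  by (intro divide_nonneg_nonneg Bochner_Integration.integral_nonneg) (auto simp: indicator_def)

lemma osc_nonneg: "0 \<le> osc A u"
  unfolding osc_def by (rule avg_nonneg) simp

lemma avg_const: "measure lebesgue A > 0 \<Longrightarrow> avg A (\<lambda>x. c) = c"
  by (simp add: avg_def set_lebesgue_integral_def)

context
  fixes A :: "(real ^ 'n) set"
  assumes pos: "measure lebesgue A > 0"
begin

lemma pos_measure_sets: "A \<in> sets lebesgue"
  using pos measure_notin_sets by fastforce

lemma set_integrable_const_pos: "set_integrable lebesgue A (\<lambda>x. c :: real)"
proof -
  have "emeasure lebesgue A < \<infinity>"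
    using pos unfolding measure_def by (metis enn2real_top infinity_ennreal_def less_irrefl top.not_eq_extremum)
  then show ?thesis
    using pos_measure_sets unfolding set_integrable_def by (intro integrable_scaleR_left integrable_real_indicator) auto
qed

lemma avg_add:
  assumes "set_integrable lebesgue A u" "set_integrable lebesgue A v"
  shows "avg A (\<lambda>x. u x + v x) = avg A u + avg A v"
  using assms by (simp add: avg_def add_divide_distrib)

lemma avg_mono:
  assumes "set_integrable lebesgue A u" "set_integrable lebesgue A v" "\<And>x. x \<in> A \<Longrightarrow> u x \<le> v x"
  shows "avg A u \<le> avg A v"
  unfolding avg_def using set_integral_mono[OF assms] by (simp add: divide_right_mono)

lemma set_integrable_abs_diff_const:
  fixes u :: "real ^ 'n \<Rightarrow> real"
  assumes "set_integrable lebesgue A u"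
  shows "set_integrable lebesgue A (\<lambda>x. \<bar>u x - c\<bar>)"
  by (rule set_integrable_abs[OF set_integral_diff(1)[OF assms set_integrable_const_pos]])

lemma osc_add_le:
  assumes u: "set_integrable lebesgue A u" and v: "set_integrable lebesgue A v"
  shows "osc A (\<lambda>x. u x + v x) \<le> osc A u + osc A v"
proof -
  have "osc A (\<lambda>x. u x + v x) = avg A (\<lambda>x. \<bar>u x + v x - (avg A u + avg A v)\<bar>)"
    by (simp add: osc_def avg_add[OF u v])
  also have "\<dots> \<le> avg A (\<lambda>x. \<bar>u x - avg A u\<bar> + \<bar>v x - avg A v\<bar>)"
    using u v by (intro avg_mono set_integrable_abs_diff_const set_integral_add) auto
  also have "\<dots> = osc A u + osc A v"
    unfolding osc_def by (intro avg_add set_integrable_abs_diff_const u v)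
  finally show ?thesis .
qed

lemma osc_le_bound:
  assumes u: "set_integrable lebesgue A u" and d: "\<And>x y. x \<in> A \<Longrightarrow> y \<in> A \<Longrightarrow> \<bar>u x - u y\<bar> \<le> d"
  shows "osc A u \<le> d"
proof -
  have "\<bar>u x - avg A u\<bar> \<le> d" if x: "x \<in> A" for x
  proof -
    have "avg A u \<le> avg A (\<lambda>y. u x + d)" "avg A (\<lambda>y. u x - d) \<le> avg A u"
      using d[OF x] d[OF _ x] by (intro avg_mono u set_integrable_const_pos; force simp: abs_le_iff)+
    then show ?thesis by (simp add: avg_const pos abs_le_iff)
  qed
  then have "osc A u \<le> avg A (\<lambda>x. d)"
    unfolding osc_def by (intro avg_mono set_integrable_abs_diff_const u set_integrable_const_pos)
  then show ?thesis by (simp add: avg_const pos)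
qed

end

lemma osc_cmult: "osc A (\<lambda>x. c * u x) = \<bar>c\<bar> * osc A u"
proof -
  have "avg A (\<lambda>x. c * u x) = c * avg A u" for c u by (simp add: avg_def)
  then show ?thesis unfolding osc_def by (simp add: abs_mult flip: right_diff_distrib)
qed

text \<open>Completion does not change the integral of a Borel function, so averages can be computed
  with \<open>lborel\<close>, where substitution and Fubini are available.\<close>

lemma avg_borel:
  assumes "(\<lambda>x. indicator A x * u x) \<in> borel_measurable borel" "A \<in> sets borel"
  shows "avg A u = (LINT x|lborel. indicator A x * u x) / measure lborel A"
  unfolding avg_def set_lebesgue_integral_def using assms by (simp add: integral_completion)

section \<open>Averages and oscillation under similarities\<close>

lemma indicator_affine_image:
  fixes x0 :: "real ^ 'n"
  assumes "s \<noteq> 0"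
  shows "indicator ((\<lambda>y. x0 + s *\<^sub>R y) ` A) (x0 + s *\<^sub>R y) = indicator A y"
  using assms by (auto simp: indicator_def)

lemma open_affine_image:
  fixes x0 :: "real ^ 'n"
  assumes "open A" "s \<noteq> 0" shows "open ((\<lambda>y. x0 + s *\<^sub>R y) ` A)"
  using open_affinity[OF assms, of x0] by simp

lemma measure_affine_image:
  fixes x0 :: "real ^ 'n"
  assumes "open A" "s > 0"
  shows "measure lebesgue ((\<lambda>y. x0 + s *\<^sub>R y) ` A) = s ^ CARD('n) * measure lebesgue A"
proof -
  have [measurable]: "A \<in> sets borel" "((\<lambda>y. x0 + s *\<^sub>R y) ` A) \<in> sets borel"
    using assms open_affine_image[of A s x0] by auto
  have "emeasure lborel ((\<lambda>y. x0 + s *\<^sub>R y) ` A) = ennreal (s ^ CARD('n)) * emeasure lborel A"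
    using nn_integral_lborel_affine[of "indicator ((\<lambda>y. x0 + s *\<^sub>R y) ` A)" s x0] assms
    by (simp add: indicator_affine_image)
  then show ?thesis using assms by (simp add: measure_def enn2real_mult)
qed

lemma avg_affine:
  fixes x0 :: "real ^ 'n"
  assumes A: "open A" and s: "s > 0"
    and [measurable]: "(\<lambda>x. indicator ((\<lambda>y. x0 + s *\<^sub>R y) ` A) x * u x) \<in> borel_measurable borel"
  shows "avg ((\<lambda>y. x0 + s *\<^sub>R y) ` A) u = avg A (\<lambda>y. u (x0 + s *\<^sub>R y))"
proof -
  let ?B = "(\<lambda>y. x0 + s *\<^sub>R y) ` A"
  have [measurable]: "A \<in> sets borel" "?B \<in> sets borel"
    using A s open_affine_image[of A s x0] by auto
  have eq: "(\<lambda>y. indicator A y * u (x0 + s *\<^sub>R y)) = (\<lambda>y. (\<lambda>x. indicator ?B x * u x) (x0 + s *\<^sub>R y))"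
    using s by (simp add: indicator_affine_image)
  have [measurable]: "(\<lambda>y. indicator A y * u (x0 + s *\<^sub>R y)) \<in> borel_measurable borel"
    unfolding eq by measurable
  have "(LINT x|lborel. indicator ?B x * u x) = s ^ CARD('n) * (LINT y|lborel. indicator A y * u (x0 + s *\<^sub>R y))"
    using s by (subst integral_lborel_affine[of _ s x0]) (simp_all add: indicator_affine_image)
  moreover have "measure lborel ?B = s ^ CARD('n) * measure lborel A"
    using measure_affine_image[OF A s, of x0] by simp
  ultimately show ?thesis using s by (simp add: avg_borel)
qed

lemma osc_affine:
  fixes x0 :: "real ^ 'n"
  assumes A: "open A" and s: "s > 0"
    and m[measurable]: "(\<lambda>x. indicator ((\<lambda>y. x0 + s *\<^sub>R y) ` A) x * u x) \<in> borel_measurable borel"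
  shows "osc ((\<lambda>y. x0 + s *\<^sub>R y) ` A) u = osc A (\<lambda>y. u (x0 + s *\<^sub>R y))"
proof -
  let ?B = "(\<lambda>y. x0 + s *\<^sub>R y) ` A"
  have [measurable]: "?B \<in> sets borel" using A s open_affine_image[of A s x0] by auto
  have "(\<lambda>x. indicator ?B x * \<bar>u x - c\<bar>) = (\<lambda>x. indicator ?B x * \<bar>indicator ?B x * u x - c\<bar>)" for c
    by (auto simp: indicator_def)
  then have "(\<lambda>x. indicator ?B x * \<bar>u x - c\<bar>) \<in> borel_measurable borel" for c by simp
  then show ?thesis unfolding osc_def avg_affine[OF A s m] by (rule avg_affine[OF A s])
qed

lemma power_card_minus_one_mult: "(x :: real) ^ (CARD('n :: finite) - 1) * x = x ^ CARD('n)"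
  by (metis One_nat_def Suc_pred power_Suc2 zero_less_card_finite)

section \<open>Families of translates\<close>

lemma translate_familiesD:
  assumes "H \<in> translate_families \<epsilon> D G" "D' \<in> H"
  shows "D' \<subseteq> G" "\<exists>x0. D' = (\<lambda>y. x0 + \<epsilon> *\<^sub>R y) ` D"
  using assms by (auto simp: translate_families_def)

lemma translate_families_subset: "H \<in> translate_families \<epsilon> D G \<Longrightarrow> H' \<subseteq> H \<Longrightarrow> H' \<in> translate_families \<epsilon> D G"
  by (auto simp: translate_families_def intro: pairwise_subset)

lemma empty_translate_families: "{} \<in> translate_families \<epsilon> D G"
  by (auto simp: translate_families_def)

definition finite_families :: "real \<Rightarrow> (real ^ 'n) set \<Rightarrow> (real ^ 'n) set \<Rightarrow> (real ^ 'n) set set set" where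
  "finite_families \<epsilon> D G = {H \<in> translate_families \<epsilon> D G. finite H}"

text \<open>A sum of nonnegative terms is the supremum of its finite partial sums, and subfamilies
  of admissible families are admissible. The power of \<open>\<epsilon>\<close> moves inside the
  sum, next to the oscillation of the single translate that it scales.\<close>

lemma H_eps_finite_families:
  fixes D :: "(real ^ 'n) set"
  assumes "\<epsilon> > 0"
  shows "H_eps D G \<epsilon> u = (SUP H\<in>finite_families \<epsilon> D G. \<Sum>D'\<in>H. ennreal (\<epsilon> ^ (CARD('n) - 1) * osc D' u))"
proof -
  have "(SUP H\<in>translate_families \<epsilon> D G. \<Sum>\<^sub>\<infinity>D'\<in>H. ennreal (osc D' u)) =
    (SUP H\<in>finite_families \<epsilon> D G. \<Sum>D'\<in>H. ennreal (osc D' u))"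
  proof (rule antisym)
    show "(SUP H\<in>translate_families \<epsilon> D G. \<Sum>\<^sub>\<infinity>D'\<in>H. ennreal (osc D' u)) \<le>
      (SUP H\<in>finite_families \<epsilon> D G. \<Sum>D'\<in>H. ennreal (osc D' u))"
      by (intro SUP_least, subst nonneg_infsum_complete, simp, intro SUP_least SUP_upper)
         (auto simp: finite_families_def intro: translate_families_subset)
    show "(SUP H\<in>finite_families \<epsilon> D G. \<Sum>D'\<in>H. ennreal (osc D' u)) \<le>
      (SUP H\<in>translate_families \<epsilon> D G. \<Sum>\<^sub>\<infinity>D'\<in>H. ennreal (osc D' u))"
      by (intro SUP_least SUP_upper2) (auto simp: finite_families_def)
  qed
  moreover have "ennreal (\<epsilon> ^ (CARD('n) - 1)) * (\<Sum>D'\<in>H. ennreal (osc D' u)) =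
      (\<Sum>D'\<in>H. ennreal (\<epsilon> ^ (CARD('n) - 1) * osc D' u))" for H
    using assms by (simp add: sum_distrib_left ennreal_mult' osc_nonneg del: sum_ennreal)
  ultimately show ?thesis
    unfolding H_eps_def osc_def[symmetric] by (simp only: SUP_mult_left_ennreal)
qed

lemma H_eps_ge:
  fixes D :: "(real ^ 'n) set"
  assumes "\<epsilon> > 0" "H \<in> finite_families \<epsilon> D G"
  shows "(\<Sum>D'\<in>H. ennreal (\<epsilon> ^ (CARD('n) - 1) * osc D' u)) \<le> H_eps D G \<epsilon> u"
  unfolding H_eps_finite_families[OF assms(1)] by (rule SUP_upper[OF assms(2)])

lemma set_integrable_continuous_bounded:
  fixes A :: "(real ^ 'n) set" and u :: "real ^ 'n \<Rightarrow> real"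
  assumes A: "open A" "bounded A" and u: "continuous_on A u" "\<And>x. x \<in> A \<Longrightarrow> \<bar>u x\<bar> \<le> B"
  shows "set_integrable lebesgue A u"
proof -
  have [measurable]: "A \<in> sets borel" using A by simp
  have m: "(\<lambda>x. indicator A x *\<^sub>R u x) \<in> borel_measurable borel"
    by (rule borel_measurable_continuous_on_indicator[OF _ u(1)]) simp
  have "integrable lborel (\<lambda>x. indicator A x *\<^sub>R u x)"
  proof (rule Bochner_Integration.integrable_bound)
    show "integrable lborel (\<lambda>x. B * indicator A x)"
      using A by (intro integrable_mult_right integrable_indicator_bounded) auto
    show "AE x in lborel. norm (indicator A x *\<^sub>R u x) \<le> norm (B * indicator A x)"
      using u(2) by (intro AE_I2) (fastforce simp: indicator_def)
  qed (use m in simp)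
  then show ?thesis using m unfolding set_integrable_def by (simp add: integrable_completion)
qed

section \<open>Translates of a bounded open set and the oscillation of linear functions\<close>

locale profile =
  fixes D :: "(real ^ 'n) set"
  assumes open_D: "open D" and D_ne: "D \<noteq> {}" and bounded_D: "bounded D"
begin

definition radius :: real where "radius = (SOME r. r > 0 \<and> (\<forall>x\<in>D. norm x \<le> r))"

lemma radius: "radius > 0" "x \<in> D \<Longrightarrow> norm x \<le> radius"
proof -
  have "\<exists>r. r > 0 \<and> (\<forall>x\<in>D. norm x \<le> r)"
    using bounded_D by (meson bounded_pos)
  then have "radius > 0 \<and> (\<forall>x\<in>D. norm x \<le> radius)" unfolding radius_def by (rule someI_ex)
  then show "radius > 0" "x \<in> D \<Longrightarrow> norm x \<le> radius" by auto
qed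

abbreviation translate :: "real ^ 'n \<Rightarrow> real \<Rightarrow> (real ^ 'n) set" where
  "translate x0 \<epsilon> \<equiv> (\<lambda>y. x0 + \<epsilon> *\<^sub>R y) ` D"

lemma open_pos_measure:
  fixes A :: "(real ^ 'n) set"
  assumes "open A" "A \<noteq> {}" "bounded A"
  shows "measure lebesgue A > 0"
proof -
  have "\<not> negligible A" using open_not_negligible assms by blast
  moreover have "A \<in> lmeasurable" using assms by (simp add: lmeasurable_open)
  ultimately show ?thesis
    using negligible_iff_measure zero_less_measure_iff by blast
qed

lemma measure_D_pos: "measure lebesgue D > 0"
  using open_pos_measure open_D D_ne bounded_D by blast

lemma translate_facts:
  assumes "\<epsilon> > 0"
  shows "open (translate x0 \<epsilon>)" "translate x0 \<epsilon> \<noteq> {}" "bounded (translate x0 \<epsilon>)"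
    "measure lebesgue (translate x0 \<epsilon>) = \<epsilon> ^ CARD('n) * measure lebesgue D"
    "measure lebesgue (translate x0 \<epsilon>) > 0"
    "\<And>x y. x \<in> translate x0 \<epsilon> \<Longrightarrow> y \<in> translate x0 \<epsilon> \<Longrightarrow> norm (x - y) \<le> \<epsilon> * (2 * radius)"
proof -
  show o: "open (translate x0 \<epsilon>)" using open_affine_image[OF open_D, of \<epsilon> x0] assms by simp
  show ne: "translate x0 \<epsilon> \<noteq> {}" using D_ne by simp
  show b: "bounded (translate x0 \<epsilon>)" using bounded_D
    by (metis (no_types) bounded_scaling bounded_translation image_image)
  show "measure lebesgue (translate x0 \<epsilon>) = \<epsilon> ^ CARD('n) * measure lebesgue D"
    by (rule measure_affine_image[OF open_D assms])
  show "measure lebesgue (translate x0 \<epsilon>) > 0" by (rule open_pos_measure[OF o ne b])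
  show "norm (x - y) \<le> \<epsilon> * (2 * radius)" if xy: "x \<in> translate x0 \<epsilon>" "y \<in> translate x0 \<epsilon>" for x y
  proof -
    obtain a b where ab: "x = x0 + \<epsilon> *\<^sub>R a" "y = x0 + \<epsilon> *\<^sub>R b" "a \<in> D" "b \<in> D" using xy by auto
    then have "x - y = \<epsilon> *\<^sub>R (a - b)" by (simp add: algebra_simps)
    moreover have "norm (a - b) \<le> 2 * radius" using norm_triangle_ineq4[of a b] radius(2)[OF ab(3)] radius(2)[OF ab(4)] by linarith
    ultimately show ?thesis using assms by simp
  qed
qed

definition linear_osc :: "real ^ 'n \<Rightarrow> real" where "linear_osc \<tau> = osc D (\<lambda>x. x \<bullet> \<tau>)"

lemma linear_integrable_D: "set_integrable lebesgue D (\<lambda>x. x \<bullet> \<tau>)"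
proof (rule set_integrable_continuous_bounded[OF open_D bounded_D, where B="radius * norm \<tau>"])
  show "\<bar>x \<bullet> \<tau>\<bar> \<le> radius * norm \<tau>" if "x \<in> D" for x
    using Cauchy_Schwarz_ineq2[of x \<tau>] mult_right_mono[OF radius(2)[OF that], of "norm \<tau>"] by simp
qed (intro continuous_intros)

lemma linear_osc_nonneg: "linear_osc \<tau> \<ge> 0" by (simp add: linear_osc_def osc_nonneg)

lemma linear_osc_add_le: "linear_osc (\<tau> + \<sigma>) \<le> linear_osc \<tau> + linear_osc \<sigma>"
  using osc_add_le[OF measure_D_pos linear_integrable_D linear_integrable_D] by (simp add: linear_osc_def inner_add_right)

lemma linear_osc_scale: "linear_osc (c *\<^sub>R \<tau>) = \<bar>c\<bar> * linear_osc \<tau>"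
  using osc_cmult[of D c] by (simp add: linear_osc_def)

lemma linear_osc_le: "linear_osc \<tau> \<le> 2 * radius * norm \<tau>"
  unfolding linear_osc_def
proof (rule osc_le_bound[OF measure_D_pos linear_integrable_D])
  fix x y assume xy: "x \<in> D" "y \<in> D"
  have "norm (x - y) \<le> 2 * radius" using norm_triangle_ineq4[of x y] radius(2)[OF xy(1)] radius(2)[OF xy(2)] by linarith
  then show "\<bar>x \<bullet> \<tau> - y \<bullet> \<tau>\<bar> \<le> 2 * radius * norm \<tau>"
    using Cauchy_Schwarz_ineq2[of "x - y" \<tau>] mult_right_mono[of "norm (x - y)" "2 * radius" "norm \<tau>"]
    by (simp add: inner_diff_left)
qed

lemma linear_osc_diff: "\<bar>linear_osc \<tau> - linear_osc \<sigma>\<bar> \<le> 2 * radius * norm (\<tau> - \<sigma>)"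
  using linear_osc_add_le[of "\<tau> - \<sigma>" \<sigma>] linear_osc_add_le[of "\<sigma> - \<tau>" \<tau>] linear_osc_le[of "\<tau> - \<sigma>"] linear_osc_le[of "\<sigma> - \<tau>"]
  by (simp add: norm_minus_commute abs_le_iff)

lemma continuous_on_linear_osc: "continuous_on UNIV linear_osc"
proof (rule lipschitz_on_continuous_on)
  show "(2 * radius)-lipschitz_on UNIV linear_osc"
    using linear_osc_diff radius(1) by (intro lipschitz_onI) (auto simp: dist_norm)
qed

text \<open>Were it 0, then \<open>x \<bullet> \<tau>\<close> would equal its average
  \<open>m\<close> almost everywhere on \<open>D\<close>; the exceptional set is open and null,
  hence empty, but moving inside \<open>D\<close> in the direction \<open>\<tau>\<close> changes the
  value.\<close>

lemma linear_osc_pos: assumes "\<tau> \<noteq> 0" shows "linear_osc \<tau> > 0"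
proof (rule ccontr)
  assume "\<not> linear_osc \<tau> > 0"
  then have "linear_osc \<tau> = 0" using linear_osc_nonneg[of \<tau>] by simp
  define m where "m = avg D (\<lambda>x. x \<bullet> \<tau>)"
  have [measurable]: "D \<in> sets borel" using open_D by simp
  have i: "integrable lebesgue (\<lambda>x. indicator D x * \<bar>x \<bullet> \<tau> - m\<bar>)"
    using set_integrable_abs_diff_const[OF measure_D_pos linear_integrable_D, of \<tau> m] by (simp add: set_integrable_def)
  have "(LINT x|lebesgue. indicator D x * \<bar>x \<bullet> \<tau> - m\<bar>) = 0"
    using \<open>linear_osc \<tau> = 0\<close> measure_D_pos unfolding linear_osc_def osc_def m_def[symmetric] by (simp add: avg_def set_lebesgue_integral_def)
  then have "AE x in lebesgue. indicator D x * \<bar>x \<bullet> \<tau> - m\<bar> = 0"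
    using integral_nonneg_eq_0_iff_AE[OF i] by simp
  then have ae: "AE x in lebesgue. x \<notin> D \<inter> {x. x \<bullet> \<tau> \<noteq> m}"
    by (rule AE_mp) (auto intro!: AE_I2 simp: indicator_def)
  have o: "open (D \<inter> {x. x \<bullet> \<tau> \<noteq> m})"
    by (intro open_Int open_D open_Collect_neq continuous_intros)
  then have "D \<inter> {x. x \<bullet> \<tau> \<noteq> m} \<in> sets lebesgue" by simp
  then have "D \<inter> {x. x \<bullet> \<tau> \<noteq> m} \<in> null_sets lebesgue"
    using ae by (subst AE_iff_null_sets) auto
  then have "D \<inter> {x. x \<bullet> \<tau> \<noteq> m} = {}"
    using o open_not_negligible negligible_iff_null_sets by blast
  then have eq: "x \<bullet> \<tau> = m" if "x \<in> D" for x using that by auto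
  obtain x where x: "x \<in> D" using D_ne by auto
  then obtain e where e: "e > 0" "ball x e \<subseteq> D" using open_D open_contains_ball by meson
  define y where "y = x + (e / (2 * norm \<tau>)) *\<^sub>R \<tau>"
  have "y \<in> ball x e" using e assms by (simp add: y_def dist_norm)
  then have "y \<bullet> \<tau> = x \<bullet> \<tau>" using eq x e by (metis subsetD)
  then have "(e / (2 * norm \<tau>)) * (\<tau> \<bullet> \<tau>) = 0" by (simp add: y_def inner_add_left)
  then show False using e assms by simp
qed

text \<open>The minimum over the compact unit sphere, extended by homogeneity.\<close>

lemma linear_osc_lower: obtains c where "c > 0" "\<And>\<tau>. linear_osc \<tau> \<ge> c * norm \<tau>"
proof -
  have "compact (sphere (0::real^'n) 1)" by simp
  moreover have "sphere (0::real^'n) 1 \<noteq> {}" by simp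
  moreover have "continuous_on (sphere 0 1) linear_osc" using continuous_on_linear_osc continuous_on_subset by blast
  ultimately obtain v where v: "v \<in> sphere 0 1" "\<And>w. w \<in> sphere 0 1 \<Longrightarrow> linear_osc v \<le> linear_osc w"
    using continuous_attains_inf by metis
  show thesis
  proof (rule that[of "linear_osc v"])
    show "linear_osc v > 0" using v(1) by (intro linear_osc_pos) auto
    show "linear_osc \<tau> \<ge> linear_osc v * norm \<tau>" for \<tau>
    proof (cases "\<tau> = 0")
      case False
      have "linear_osc v \<le> linear_osc ((1 / norm \<tau>) *\<^sub>R \<tau>)" using False by (intro v(2)) simp
      then show ?thesis using False by (simp add: linear_osc_scale field_simps)
    qed (simp add: linear_osc_nonneg)
  qed
qed

text \<open>Independence of \<open>x0\<close> is what reduces \<open>H_eps\<close> on linear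
  functions to counting translates.\<close>

lemma osc_translate_linear:
  assumes "\<epsilon> > 0" shows "osc (translate x0 \<epsilon>) (\<lambda>x. x \<bullet> \<tau>) = \<epsilon> * linear_osc \<tau>"
proof -
  have [measurable]: "translate x0 \<epsilon> \<in> sets borel" using translate_facts(1)[OF assms] by simp
  have "osc (translate x0 \<epsilon>) (\<lambda>x. x \<bullet> \<tau>) = osc D (\<lambda>y. (x0 + \<epsilon> *\<^sub>R y) \<bullet> \<tau>)"
    by (rule osc_affine[OF open_D assms]) simp
  also have "\<dots> = avg D (\<lambda>x. \<bar>\<epsilon> * (x \<bullet> \<tau> - avg D (\<lambda>x. x \<bullet> \<tau>))\<bar>)"
  proof -
    have "avg D (\<lambda>x. (x0 + \<epsilon> *\<^sub>R x) \<bullet> \<tau>) = avg D (\<lambda>x. x0 \<bullet> \<tau> + \<epsilon> * (x \<bullet> \<tau>))"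
      by (simp add: inner_add_left)
    also have "\<dots> = avg D (\<lambda>x. x0 \<bullet> \<tau>) + avg D (\<lambda>x. \<epsilon> * (x \<bullet> \<tau>))"
      by (intro avg_add[OF measure_D_pos] set_integrable_const_pos[OF measure_D_pos] set_integrable_mult_right linear_integrable_D)
    also have "\<dots> = x0 \<bullet> \<tau> + \<epsilon> * avg D (\<lambda>x. x \<bullet> \<tau>)"
      by (simp add: avg_const measure_D_pos) (simp add: avg_def)
    finally show ?thesis unfolding osc_def by (simp add: inner_add_left right_diff_distrib)
  qed
  also have "\<dots> = \<epsilon> * linear_osc \<tau>"
    using assms unfolding linear_osc_def osc_def by (simp add: abs_mult) (simp add: avg_def)
  finally show ?thesis .
qed

end

section \<open>Packing numbers and the packing constant\<close>

context profile
begin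

definition packing_number :: "real \<Rightarrow> (real ^ 'n) set \<Rightarrow> nat" where
  "packing_number \<epsilon> G = Max (card ` finite_families \<epsilon> D G)"

definition packing_density :: "real \<Rightarrow> (real ^ 'n) set \<Rightarrow> real" where
  "packing_density \<epsilon> G = \<epsilon> ^ CARD('n) * real (packing_number \<epsilon> G)"

lemma finite_families_memD:
  assumes "H \<in> finite_families \<epsilon> D G" "D' \<in> H"
  shows "D' \<subseteq> G" "\<exists>x0. D' = translate x0 \<epsilon>"
  using translate_familiesD[OF _ assms(2)] assms(1) by (auto simp: finite_families_def)

text \<open>A volume bound: disjoint translates of equal volume inside a set of finite measure. It
  makes the maximum in \<open>packing_number\<close> one over a finite set of cardinalities.\<close>

lemma finite_families_sum_measure_le:
  assumes "\<epsilon> > 0" "H \<in> finite_families \<epsilon> D G" "G \<subseteq> A" "A \<in> lmeasurable"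
  shows "real (card H) * (\<epsilon> ^ CARD('n) * measure lebesgue D) \<le> measure lebesgue A"
proof -
  have m: "D' \<in> lmeasurable" "measure lebesgue D' = \<epsilon> ^ CARD('n) * measure lebesgue D" if D': "D' \<in> H" for D'
  proof -
    obtain x0 where x0: "D' = translate x0 \<epsilon>" using finite_families_memD(2)[OF assms(2) D'] by auto
    show "D' \<in> lmeasurable" unfolding x0 using translate_facts[OF assms(1)] by (simp add: lmeasurable_open)
    show "measure lebesgue D' = \<epsilon> ^ CARD('n) * measure lebesgue D" unfolding x0 by (rule translate_facts(4)[OF assms(1)])
  qed
  have f: "finite H" "pairwise disjnt H" using assms(2) by (auto simp: finite_families_def translate_families_def)
  have "real (card H) * (\<epsilon> ^ CARD('n) * measure lebesgue D) = (\<Sum>D'\<in>H. measure lebesgue D')"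
    using m(2) by simp
  also have "\<dots> = measure lebesgue (\<Union>H)"
    using f m by (intro measure_Union'[symmetric]) auto
  also have "\<dots> \<le> measure lebesgue A"
    using finite_families_memD(1)[OF assms(2)] assms(3,4) f m
    by (intro measure_mono_fmeasurable) (auto intro!: fmeasurableD)
  finally show ?thesis .
qed

lemma finite_card_families:
  assumes "\<epsilon> > 0" "bounded G"
  shows "finite (card ` finite_families \<epsilon> D G)"
proof -
  obtain a b where ab: "G \<subseteq> cbox a b" using bounded_subset_cbox_symmetric assms by metis
  let ?c = "\<epsilon> ^ CARD('n) * measure lebesgue D"
  have c: "?c > 0" using assms measure_D_pos by simp
  have "card H \<le> nat \<lceil>measure lebesgue (cbox a b) / ?c\<rceil>" if "H \<in> finite_families \<epsilon> D G" for H
  proof -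
    have "real (card H) \<le> measure lebesgue (cbox a b) / ?c"
      using finite_families_sum_measure_le[OF assms(1) that ab] c by (simp add: pos_le_divide_eq)
    then show ?thesis by linarith
  qed
  then have "card ` finite_families \<epsilon> D G \<subseteq> {..nat \<lceil>measure lebesgue (cbox a b) / ?c\<rceil>}" by blast
  then show ?thesis by (rule finite_subset) simp
qed

lemma packing_number_ge:
  assumes "\<epsilon> > 0" "bounded G" "H \<in> finite_families \<epsilon> D G"
  shows "card H \<le> packing_number \<epsilon> G"
  unfolding packing_number_def using finite_card_families[OF assms(1,2)] assms(3) by (intro Max_ge) auto

lemma packing_number_attained:
  assumes "\<epsilon> > 0" "bounded G"
  obtains H where "H \<in> finite_families \<epsilon> D G" "card H = packing_number \<epsilon> G"
proof -
  have "{} \<in> finite_families \<epsilon> D G" by (simp add: finite_families_def empty_translate_families)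
  then have "packing_number \<epsilon> G \<in> card ` finite_families \<epsilon> D G"
    unfolding packing_number_def using finite_card_families[OF assms] by (intro Max_in) auto
  then show thesis using that by auto
qed

lemma packing_density_nonneg: "\<epsilon> > 0 \<Longrightarrow> packing_density \<epsilon> G \<ge> 0"
  by (simp add: packing_density_def)

lemma packing_number_affine_ge:
  fixes x0 :: "real ^ 'n"
  assumes "\<epsilon> > 0" "s > 0" "bounded G"
  shows "packing_number \<epsilon> G \<le> packing_number (s * \<epsilon>) ((\<lambda>y. x0 + s *\<^sub>R y) ` G)"
proof -
  let ?T = "\<lambda>y. x0 + s *\<^sub>R y"
  have inj: "inj ?T" using assms(2) by (auto intro: injI)
  obtain H where H: "H \<in> finite_families \<epsilon> D G" "card H = packing_number \<epsilon> G" using packing_number_attained assms by metis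
  have "(`) ?T ` H \<in> finite_families (s * \<epsilon>) D (?T ` G)"
    unfolding finite_families_def translate_families_def
  proof (intro CollectI conjI ballI)
    show "finite ((`) ?T ` H)" using H(1) by (simp add: finite_families_def)
    have "pairwise disjnt H" using H(1) by (simp add: finite_families_def translate_families_def)
    then show "pairwise disjnt ((`) ?T ` H)"
      unfolding pairwise_image
      by (rule pairwise_mono) (use inj in \<open>auto simp: disjnt_def image_Int[symmetric]\<close>)
    fix D' assume "D' \<in> (`) ?T ` H"
    then obtain E where E: "E \<in> H" "D' = ?T ` E" by auto
    obtain x1 where x1: "E = translate x1 \<epsilon>" using finite_families_memD(2)[OF H(1) E(1)] by auto
    show "D' \<subseteq> ?T ` G" using E(2) finite_families_memD(1)[OF H(1) E(1)] by auto
    show "\<exists>x0. D' = (\<lambda>y. x0 + (s * \<epsilon>) *\<^sub>R y) ` D"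
      by (rule exI[of _ "x0 + s *\<^sub>R x1"]) (simp add: E x1 image_image scaleR_right_distrib add.assoc)
  qed
  moreover have "card ((`) ?T ` H) = card H"
    using inj by (intro card_image) (auto intro!: inj_onI simp: inj_image_eq_iff)
  moreover have "bounded (?T ` G)"
    using assms(3) by (metis (no_types) bounded_scaling bounded_translation image_image)
  ultimately show ?thesis using packing_number_ge[of "s * \<epsilon>" "?T ` G"] assms H(2) by fastforce
qed

text \<open>The inequality still missing is \<open>packing_number_affine_ge\<close> for the inverse
  similarity \<open>?S\<close>.\<close>

lemma packing_number_affine:
  fixes x0 :: "real ^ 'n"
  assumes "\<epsilon> > 0" "s > 0" "bounded G"
  shows "packing_number (s * \<epsilon>) ((\<lambda>y. x0 + s *\<^sub>R y) ` G) = packing_number \<epsilon> G"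
proof (rule antisym)
  let ?T = "\<lambda>y. x0 + s *\<^sub>R y" and ?S = "\<lambda>y. (- (1/s)) *\<^sub>R x0 + (1/s) *\<^sub>R y"
  have b: "bounded (?T ` G)"
    using assms(3) by (metis (no_types) bounded_scaling bounded_translation image_image)
  have "?S ` ?T ` G = G" using assms(2) by (simp add: image_image scaleR_right_distrib)
  then show "packing_number (s * \<epsilon>) (?T ` G) \<le> packing_number \<epsilon> G"
    using packing_number_affine_ge[of "s * \<epsilon>" "1/s" "?T ` G" "(- (1/s)) *\<^sub>R x0"] assms b by simp
qed (rule packing_number_affine_ge[OF assms])

text \<open>The second claim holds because no translate of \<open>D\<close> is empty; it lets sums
  over the union split into sums over the \<open>H i\<close>.\<close>

lemma disjoint_family_union_families:
  assumes "finite I" "disjoint_family_on G I" "\<And>i. i \<in> I \<Longrightarrow> H i \<in> finite_families \<epsilon> D (G i)"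
    and "\<And>i. i \<in> I \<Longrightarrow> G i \<subseteq> A" and "\<epsilon> > 0"
  shows "(\<Union>i\<in>I. H i) \<in> finite_families \<epsilon> D A" "disjoint_family_on H I"
proof -
  have m: "E \<subseteq> G i" "\<exists>x0. E = translate x0 \<epsilon>" "E \<noteq> {}" if "i \<in> I" "E \<in> H i" for i E
    using finite_families_memD[OF assms(3)[OF that(1)] that(2)] D_ne by auto
  show "disjoint_family_on H I"
  proof (unfold disjoint_family_on_def, intro ballI impI)
    fix i j assume ij: "i \<in> I" "j \<in> I" "i \<noteq> j"
    then have "G i \<inter> G j = {}" using assms(2) by (auto simp: disjoint_family_on_def)
    then have "E \<noteq> F" if "E \<in> H i" "F \<in> H j" for E F
      using m(1,3)[OF ij(1) that(1)] m(1)[OF ij(2) that(2)] by auto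
    then show "H i \<inter> H j = {}" by auto
  qed
  have "disjnt E F" if "i \<in> I" "j \<in> I" "E \<in> H i" "F \<in> H j" "E \<noteq> F" for i j E F
  proof (cases "i = j")
    case True
    then show ?thesis using assms(3)[OF that(1)] that
      by (auto simp: finite_families_def translate_families_def pairwise_def)
  next
    case False
    then have "G i \<inter> G j = {}" using that assms(2) by (auto simp: disjoint_family_on_def)
    then show ?thesis using m(1)[OF that(1,3)] m(1)[OF that(2,4)] by (auto simp: disjnt_def)
  qed
  moreover have "finite (\<Union>i\<in>I. H i)"
    using assms(1,3) by (auto simp: finite_families_def)
  moreover have "E \<subseteq> A" if "i \<in> I" "E \<in> H i" for i E using m[OF that] assms(4)[OF that(1)] by auto
  ultimately show "(\<Union>i\<in>I. H i) \<in> finite_families \<epsilon> D A"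
    using m(2) unfolding finite_families_def translate_families_def pairwise_def by auto
qed

lemma packing_number_superadditive:
  assumes "finite I" "disjoint_family_on G I" "\<And>i. i \<in> I \<Longrightarrow> G i \<subseteq> A" "bounded A" "\<epsilon> > 0"
  shows "(\<Sum>i\<in>I. packing_number \<epsilon> (G i)) \<le> packing_number \<epsilon> A"
proof -
  have "\<forall>i\<in>I. \<exists>H. H \<in> finite_families \<epsilon> D (G i) \<and> card H = packing_number \<epsilon> (G i)"
    using packing_number_attained assms bounded_subset by metis
  then obtain H where H: "\<And>i. i \<in> I \<Longrightarrow> H i \<in> finite_families \<epsilon> D (G i)" "\<And>i. i \<in> I \<Longrightarrow> card (H i) = packing_number \<epsilon> (G i)"
    by metis
  note U = disjoint_family_union_families[OF assms(1,2) H(1) assms(3,5)]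
  have "(\<Sum>i\<in>I. packing_number \<epsilon> (G i)) = (\<Sum>i\<in>I. card (H i))" using H by simp
  also have "\<dots> = card (\<Union>i\<in>I. H i)"
    using assms(1) H(1) U(2) by (intro card_UN_disjoint[symmetric]) (auto simp: finite_families_def disjoint_family_on_def)
  also have "\<dots> \<le> packing_number \<epsilon> A" by (rule packing_number_ge[OF assms(5,4)]) (use U in auto)
  finally show ?thesis .
qed

lemma mem_unit_cube: "x \<in> (unit_cube :: (real ^ 'n) set) \<longleftrightarrow> (\<forall>i. - 1/2 < x $ i \<and> x $ i < 1/2)"
  by (simp add: unit_cube_def mem_box_cart)

lemma bounded_unit_cube: "bounded (unit_cube :: (real ^ 'n) set)"
  by (simp add: unit_cube_def bounded_box)

text \<open>The cube of side \<open>1\<close> contains \<open>m ^ CARD('n)\<close> disjoint cubes of side \<open>\<epsilon> / \<epsilon>0\<close>.\<close>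

lemma packing_number_unit_cube_subdivide:
  assumes "\<epsilon> > 0" "\<epsilon>0 > 0" "real m * \<epsilon> \<le> \<epsilon>0"
  shows "m ^ CARD('n) * packing_number \<epsilon>0 unit_cube \<le> packing_number \<epsilon> unit_cube"
proof -
  define s where "s = \<epsilon> / \<epsilon>0"
  have s: "s > 0" "s * \<epsilon>0 = \<epsilon>" "s * real m \<le> 1" using assms by (auto simp: s_def field_simps)
  define I where "I = (UNIV :: 'n set) \<rightarrow>\<^sub>E {..<m}"
  \<comment> \<open>The centre of the cell with index \<open>f\<close>: in coordinate
    \<open>i\<close> this cell reaches from \<open>- 1/2 + s * f i\<close> to
    \<open>- 1/2 + s * (f i + 1)\<close>, counted from the lower corner of the cube.\<close>
  define c :: "('n \<Rightarrow> nat) \<Rightarrow> real ^ 'n" where "c f = (\<chi> i. - 1/2 + s * (real (f i) + 1/2))" for f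
  define G where "G f = (\<lambda>y. c f + s *\<^sub>R y) ` unit_cube" for f
  have mem: "- 1/2 + s * real (f i) < x $ i" "x $ i < - 1/2 + s * (real (f i) + 1)" if "x \<in> G f" for f x i
  proof -
    obtain y where y: "x = c f + s *\<^sub>R y" "y \<in> unit_cube" using \<open>x \<in> G f\<close> by (auto simp: G_def)
    have "- 1/2 < y $ i" "y $ i < 1/2" using y(2) by (auto simp: mem_unit_cube)
    then have "s * (- 1/2) < s * y $ i" "s * y $ i < s * (1/2)" using s(1) by (simp_all only: mult_less_cancel_left_pos)
    then show "- 1/2 + s * real (f i) < x $ i" "x $ i < - 1/2 + s * (real (f i) + 1)"
      unfolding y(1) by (simp_all add: c_def algebra_simps)
  qed
  have "(\<Sum>f\<in>I. packing_number \<epsilon> (G f)) \<le> packing_number \<epsilon> unit_cube"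
  proof (rule packing_number_superadditive[OF _ _ _ bounded_unit_cube assms(1)])
    show "finite I" by (simp add: I_def finite_PiE)
    show "disjoint_family_on G I"
    proof (unfold disjoint_family_on_def, intro ballI impI)
      have lem: "G f \<inter> G g = {}" if "f i < g i" for f g i
      proof (rule ccontr)
        assume "G f \<inter> G g \<noteq> {}"
        then obtain x where "x \<in> G f" "x \<in> G g" by auto
        then have "s * real (g i) < s * (real (f i) + 1)" using mem[of x f i] mem[of x g i] by simp
        then show False using that s(1) by simp
      qed
      fix f g :: "'n \<Rightarrow> nat" assume "f \<noteq> g"
      then obtain i where "f i < g i \<or> g i < f i" by (meson ext linorder_neqE_nat)
      then show "G f \<inter> G g = {}" using lem[of f i g] lem[of g i f] by auto
    qed
    show "G f \<subseteq> unit_cube" if "f \<in> I" for f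
    proof
      fix x assume x: "x \<in> G f"
      show "x \<in> unit_cube" unfolding mem_unit_cube
      proof (intro allI conjI)
        fix i
        have "0 \<le> s * real (f i)" using s by simp
        then show "- 1/2 < x $ i" using mem(1)[OF x, of i] by linarith
        have "f i < m" using that by (auto simp: I_def PiE_def Pi_def)
        then have "s * (real (f i) + 1) \<le> s * real m" using s(1) by (intro mult_left_mono) auto
        then show "x $ i < 1/2" using mem(2)[OF x, of i] s(3) by linarith
      qed
    qed
  qed
  moreover have "packing_number \<epsilon> (G f) = packing_number \<epsilon>0 unit_cube" for f
    using packing_number_affine[OF assms(2) s(1) bounded_unit_cube, of "c f"] s(2) by (simp add: G_def)
  moreover have "card I = m ^ CARD('n)" by (simp add: I_def card_PiE)
  ultimately show ?thesis by simp
qed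

text \<open>As a supremum it bounds every packing density of the unit cube at once;
  \<open>tendsto_packing_density_unit_cube\<close> shows that it is the limit too.\<close>

definition \<kappa> :: real where "\<kappa> = (SUP \<epsilon>\<in>{0<..}. packing_density \<epsilon> unit_cube)"

lemma packing_density_bdd_above: "bdd_above ((\<lambda>\<epsilon>. packing_density \<epsilon> (unit_cube :: (real ^ 'n) set)) ` {0<..})"
proof (rule bdd_aboveI2)
  fix \<epsilon> :: real assume "\<epsilon> \<in> {0<..}"
  then have e: "\<epsilon> > 0" by simp
  obtain H where H: "H \<in> finite_families \<epsilon> D unit_cube" "card H = packing_number \<epsilon> unit_cube"
    using packing_number_attained[OF e bounded_unit_cube] by metis
  have "(unit_cube :: (real ^ 'n) set) \<in> lmeasurable" by (simp add: unit_cube_def)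
  from finite_families_sum_measure_le[OF e H(1) order_refl this] H(2)
  show "packing_density \<epsilon> (unit_cube :: (real ^ 'n) set) \<le> measure lebesgue (unit_cube :: (real ^ 'n) set) / measure lebesgue D"
    using measure_D_pos by (simp add: packing_density_def pos_le_divide_eq mult_ac)
qed

lemma packing_density_le_\<kappa>: "\<epsilon> > 0 \<Longrightarrow> packing_density \<epsilon> unit_cube \<le> \<kappa>"
  unfolding \<kappa>_def by (rule cSUP_upper[OF _ packing_density_bdd_above]) simp

text \<open>The argument of Fekete's lemma. Take \<open>\<epsilon>0\<close> with almost optimal
  density; for small \<open>\<epsilon>\<close> copy its packing, scaled, into
  \<open>m ^ CARD('n)\<close> cells. Since \<open>\<epsilon> * m\<close> is at least
  \<open>\<epsilon>0 - \<epsilon>\<close>, the loss disappears in the limit.\<close>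

lemma tendsto_packing_density_unit_cube: "((\<lambda>\<epsilon>. packing_density \<epsilon> unit_cube) \<longlongrightarrow> \<kappa>) (at_right 0)"
proof (rule order_tendstoI)
  fix b assume "\<kappa> < b"
  then show "\<forall>\<^sub>F \<epsilon> in at_right 0. packing_density \<epsilon> unit_cube < b"
    using packing_density_le_\<kappa> by (intro eventually_mono[OF eventually_at_right_less[of 0]]) fastforce
next
  fix b assume "b < \<kappa>"
  then obtain \<epsilon>0 where \<epsilon>0: "\<epsilon>0 > 0" "b < packing_density \<epsilon>0 unit_cube"
    unfolding \<kappa>_def using less_cSUP_iff[OF _ packing_density_bdd_above, of b] by auto
  let ?N = "real (packing_number \<epsilon>0 unit_cube)"
  have "((\<lambda>\<epsilon>. (\<epsilon>0 - \<epsilon>) ^ CARD('n) * ?N) \<longlongrightarrow> (\<epsilon>0 - 0) ^ CARD('n) * ?N) (at_right 0)"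
    by (intro tendsto_intros)
  then have "\<forall>\<^sub>F \<epsilon> in at_right 0. b < (\<epsilon>0 - \<epsilon>) ^ CARD('n) * ?N"
    using \<epsilon>0(2) by (intro order_tendstoD(1)) (auto simp: packing_density_def)
  moreover have "\<forall>\<^sub>F \<epsilon> in at_right 0. 0 < \<epsilon> \<and> \<epsilon> < \<epsilon>0"
    using \<epsilon>0(1) eventually_at_right_real[of 0 \<epsilon>0] by (simp add: greaterThanLessThan_iff)
  ultimately show "\<forall>\<^sub>F \<epsilon> in at_right 0. b < packing_density \<epsilon> unit_cube"
  proof eventually_elim
    case (elim \<epsilon>)
    define m where "m = nat \<lfloor>\<epsilon>0 / \<epsilon>\<rfloor>"
    have q: "0 < \<epsilon>0 / \<epsilon>" using elim \<epsilon>0 by simp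
    have "real m \<le> \<epsilon>0 / \<epsilon>" "\<epsilon>0 / \<epsilon> < real m + 1" using q unfolding m_def by linarith+
    then have m: "real m * \<epsilon> \<le> \<epsilon>0" "\<epsilon>0 - \<epsilon> \<le> \<epsilon> * real m" using elim by (auto simp: field_simps)
    have "b < (\<epsilon>0 - \<epsilon>) ^ CARD('n) * ?N" using elim by simp
    also have "\<dots> \<le> (\<epsilon> * real m) ^ CARD('n) * ?N" using m elim by (intro mult_right_mono power_mono) auto
    also have "\<dots> = \<epsilon> ^ CARD('n) * real (m ^ CARD('n) * packing_number \<epsilon>0 unit_cube)"
      by (simp add: power_mult_distrib)
    also have "\<dots> \<le> packing_density \<epsilon> unit_cube"
      unfolding packing_density_def using packing_number_unit_cube_subdivide[OF _ \<epsilon>0(1) m(1)] elim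
      by (intro mult_left_mono) (auto simp only: of_nat_le_iff intro: zero_le_power)
    finally show ?case .
  qed
qed

lemma \<kappa>_pos: "\<kappa> > 0"
proof -
  \<comment> \<open>At this scale all points of the translate have norm at most 1/4, so it fits into
    the cube.\<close>
  let ?e = "1 / (4 * radius)"
  have e: "?e > 0" using radius(1) by simp
  have "translate 0 ?e \<subseteq> unit_cube"
  proof
    fix x assume "x \<in> translate 0 ?e"
    then obtain y where y: "y \<in> D" "x = ?e *\<^sub>R y" by auto
    have "norm x \<le> 1/4" using radius y by (simp add: field_simps)
    then have "\<bar>x $ i\<bar> \<le> 1/4" for i using component_le_norm_cart order_trans by blast
    then have "\<bar>x $ i\<bar> < 1/2" for i using le_less_trans[of "\<bar>x $ i\<bar>" "1/4" "1/2"] by simp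
    then have "- 1/2 < x $ i \<and> x $ i < 1/2" for i by (metis abs_less_iff minus_divide_left minus_less_iff)
    then show "x \<in> unit_cube" unfolding mem_unit_cube by blast
  qed
  then have "{translate 0 ?e} \<in> finite_families ?e D unit_cube"
    by (auto simp: finite_families_def translate_families_def intro!: exI[of _ 0])
  then have "1 \<le> packing_number ?e unit_cube" using packing_number_ge[OF e bounded_unit_cube] by fastforce
  then have "0 < packing_density ?e unit_cube" using e by (simp add: packing_density_def)
  then show ?thesis using packing_density_le_\<kappa>[OF e] by linarith
qed

lemma box_eq_affine_unit_cube:
  fixes u v :: "real ^ 'n"
  assumes s: "s > 0" and uv: "\<And>i. v $ i - u $ i = s"
  shows "box u v = (\<lambda>y. (1/2) *\<^sub>R (u + v) + s *\<^sub>R y) ` unit_cube"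
proof (intro set_eqI iffI)
  fix x assume x: "x \<in> box u v"
  let ?y = "(1/s) *\<^sub>R (x - (1/2) *\<^sub>R (u + v))"
  have "?y \<in> unit_cube" unfolding mem_unit_cube
  proof
    fix i
    have "u $ i < x $ i" "x $ i < v $ i" using x by (auto simp: mem_box_cart)
    then show "- 1/2 < ?y $ i \<and> ?y $ i < 1/2" using s uv[of i] by (auto simp: field_simps)
  qed
  moreover have "x = (1/2) *\<^sub>R (u + v) + s *\<^sub>R ?y" using s by simp
  ultimately show "x \<in> (\<lambda>y. (1/2) *\<^sub>R (u + v) + s *\<^sub>R y) ` unit_cube" by blast
next
  fix x assume "x \<in> (\<lambda>y. (1/2) *\<^sub>R (u + v) + s *\<^sub>R y) ` unit_cube"
  then obtain y where y: "y \<in> unit_cube" "x = (1/2) *\<^sub>R (u + v) + s *\<^sub>R y" by auto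
  show "x \<in> box u v" unfolding mem_box_cart
  proof
    fix i
    have "- 1/2 < y $ i" "y $ i < 1/2" using y(1) by (auto simp: mem_unit_cube)
    then have "s * (- 1/2) < s * y $ i" "s * y $ i < s * (1/2)" using s(1) by (simp_all only: mult_less_cancel_left_pos)
    then have "- (s / 2) < s * y $ i" "s * y $ i < s / 2" by simp_all
    moreover have "x $ i = u $ i / 2 + v $ i / 2 + s * y $ i" by (simp add: y(2) add_divide_distrib)
    moreover have "v $ i = u $ i + s" using uv[of i] by simp
    ultimately show "u $ i < x $ i \<and> x $ i < v $ i" by (simp add: add_divide_distrib)
  qed
qed

text \<open>By similarity, the density of a cube of side \<open>s\<close> at scale
  \<open>\<epsilon>\<close> is \<open>s ^ CARD('n)\<close> times that of the unit cube at scale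
  \<open>\<epsilon> / s\<close>.\<close>

lemma tendsto_packing_density_cube:
  fixes u v :: "real ^ 'n"
  assumes s: "s > 0" and uv: "\<And>i. v $ i - u $ i = s"
  shows "((\<lambda>\<epsilon>. packing_density \<epsilon> (box u v)) \<longlongrightarrow> \<kappa> * measure lebesgue (box u v)) (at_right 0)"
proof -
  let ?T = "\<lambda>y. (1/2) *\<^sub>R (u + v) + s *\<^sub>R y"
  have box: "box u v = ?T ` unit_cube" by (rule box_eq_affine_unit_cube[OF s uv])
  have m1: "measure lebesgue (unit_cube :: (real ^ 'n) set) = 1"
  proof -
    have "emeasure lborel (unit_cube :: (real ^ 'n) set) = 1"
      by (simp add: unit_cube_def emeasure_lborel_box_eq Basis_vec_def inner_axis prod.neutral UNION_singleton_eq_range)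
    then show ?thesis by (simp add: measure_def unit_cube_def)
  qed
  have "open (unit_cube :: (real ^ 'n) set)" by (simp add: unit_cube_def open_box)
  then have m: "measure lebesgue (box u v) = s ^ CARD('n)"
    unfolding box by (subst measure_affine_image[OF _ s]) (simp_all add: m1)
  have "((\<lambda>\<epsilon>. s ^ CARD('n) * packing_density (\<epsilon> / s) unit_cube) \<longlongrightarrow> s ^ CARD('n) * \<kappa>) (at_right 0)"
  proof (intro tendsto_intros filterlim_compose[OF tendsto_packing_density_unit_cube])
    have "((\<lambda>\<epsilon>. \<epsilon> / s) \<longlongrightarrow> 0 / s) (at_right 0)" by (intro tendsto_intros) (use s in auto)
    then show "filterlim (\<lambda>\<epsilon>. \<epsilon> / s) (at_right 0) (at_right 0)"
      using s by (auto simp: filterlim_at intro: eventually_mono[OF eventually_at_right_less[of 0]])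
  qed
  moreover have "\<forall>\<^sub>F \<epsilon> in at_right 0. s ^ CARD('n) * packing_density (\<epsilon> / s) unit_cube = packing_density \<epsilon> (box u v)"
    using eventually_at_right_less[of "0::real"]
  proof eventually_elim
    case (elim \<epsilon>)
    have "packing_number (s * (\<epsilon> / s)) (?T ` unit_cube) = packing_number (\<epsilon> / s) unit_cube"
      using elim s by (intro packing_number_affine bounded_unit_cube) auto
    then have "packing_number \<epsilon> (box u v) = packing_number (\<epsilon> / s) unit_cube" using s by (simp add: box)
    then show ?case using s by (simp add: packing_density_def power_divide)
  qed
  ultimately show ?thesis unfolding m by (simp add: mult.commute tendsto_cong)
qed

end

section \<open>Lower bound for functions of class \<open>C\<^sup>1\<close>\<close>

context profile
begin

lemma sum_osc_family:
  assumes "\<epsilon> > 0" "H \<in> finite_families \<epsilon> D G" "\<And>x0. translate x0 \<epsilon> \<in> H \<Longrightarrow> osc (translate x0 \<epsilon>) w = \<epsilon> * b" "b \<ge> 0"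
  shows "(\<Sum>D'\<in>H. ennreal (\<epsilon> ^ (CARD('n) - 1) * osc D' w)) = ennreal (\<epsilon> ^ CARD('n) * real (card H) * b)"
proof -
  have p: "\<epsilon> ^ (CARD('n) - 1) * \<epsilon> = \<epsilon> ^ CARD('n)"
    by (rule power_card_minus_one_mult)
  have "osc D' w = \<epsilon> * b" if "D' \<in> H" for D'
    using finite_families_memD(2)[OF assms(2) that] assms(3) that by auto
  then have "(\<Sum>D'\<in>H. ennreal (\<epsilon> ^ (CARD('n) - 1) * osc D' w)) = (\<Sum>D'\<in>H. ennreal (\<epsilon> ^ (CARD('n) - 1) * (\<epsilon> * b)))"
    by (intro sum.cong) auto
  also have "\<dots> = (\<Sum>D'\<in>H. ennreal (\<epsilon> ^ CARD('n) * b))" by (simp flip: p add: mult.assoc)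
  also have "\<dots> = ennreal (\<epsilon> ^ CARD('n) * real (card H) * b)"
    using assms(1,4) by (simp add: ennreal_of_nat_eq_real_of_nat mult_ac flip: ennreal_mult)
  finally show ?thesis .
qed

text \<open>Every translate contributes the same amount, so the best family is one with the most
  members.\<close>

lemma H_eps_unit_cube_linear:
  assumes e: "\<epsilon> > 0"
  shows "H_eps D unit_cube \<epsilon> (\<lambda>x. x \<bullet> \<tau>) = ennreal (packing_density \<epsilon> unit_cube * linear_osc \<tau>)"
proof -
  have S: "(\<Sum>D'\<in>H. ennreal (\<epsilon> ^ (CARD('n) - 1) * osc D' (\<lambda>x. x \<bullet> \<tau>))) = ennreal (\<epsilon> ^ CARD('n) * real (card H) * linear_osc \<tau>)"
    if "H \<in> finite_families \<epsilon> D unit_cube" for H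
    by (rule sum_osc_family[OF e that]) (use osc_translate_linear[OF e] linear_osc_nonneg in auto)
  obtain H0 where H0: "H0 \<in> finite_families \<epsilon> D unit_cube" "card H0 = packing_number \<epsilon> unit_cube"
    using packing_number_attained[OF e bounded_unit_cube] by metis
  show ?thesis unfolding H_eps_finite_families[OF e]
  proof (rule antisym)
    show "(SUP H\<in>finite_families \<epsilon> D unit_cube. \<Sum>D'\<in>H. ennreal (\<epsilon> ^ (CARD('n) - 1) * osc D' (\<lambda>x. x \<bullet> \<tau>)))
      \<le> ennreal (packing_density \<epsilon> unit_cube * linear_osc \<tau>)"
    proof (rule SUP_least)
      fix H assume H: "H \<in> finite_families \<epsilon> D unit_cube"
      then show "(\<Sum>D'\<in>H. ennreal (\<epsilon> ^ (CARD('n) - 1) * osc D' (\<lambda>x. x \<bullet> \<tau>))) \<le> ennreal (packing_density \<epsilon> unit_cube * linear_osc \<tau>)"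
        unfolding S[OF H] packing_density_def using packing_number_ge[OF e bounded_unit_cube H] e
        by (intro ennreal_leI mult_right_mono mult_left_mono linear_osc_nonneg) auto
    qed
    show "ennreal (packing_density \<epsilon> unit_cube * linear_osc \<tau>) \<le>
      (SUP H\<in>finite_families \<epsilon> D unit_cube. \<Sum>D'\<in>H. ennreal (\<epsilon> ^ (CARD('n) - 1) * osc D' (\<lambda>x. x \<bullet> \<tau>)))"
      by (rule SUP_upper2[OF H0(1)]) (simp only: S[OF H0(1)] H0(2) packing_density_def order_refl)
  qed
qed

text \<open>The values on the unit cube being explicit, the limit in \<open>psi_sphere\<close> is
  computed from the packing density; homogeneity of \<open>linear_osc\<close> then matches the
  extension to all vectors.\<close>

lemma psi_eq: "psi D \<tau> = \<kappa> * linear_osc \<tau>"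
proof -
  have "psi_sphere D \<nu> = \<kappa> * linear_osc \<nu>" for \<nu> :: "real ^ 'n"
  proof -
    have "((\<lambda>\<epsilon>. ennreal (packing_density \<epsilon> unit_cube * linear_osc \<nu>)) \<longlongrightarrow> ennreal (\<kappa> * linear_osc \<nu>)) (at_right 0)"
      by (intro tendsto_ennrealI tendsto_intros tendsto_packing_density_unit_cube)
    then have "((\<lambda>\<epsilon>. H_eps D unit_cube \<epsilon> (\<lambda>x. x \<bullet> \<nu>)) \<longlongrightarrow> ennreal (\<kappa> * linear_osc \<nu>)) (at_right 0)"
      by (rule Lim_transform_eventually)
        (use H_eps_unit_cube_linear in \<open>auto intro!: eventually_mono[OF eventually_at_right_less[of 0]]\<close>)
    then have "Lim (at_right 0) (\<lambda>\<epsilon>. H_eps D unit_cube \<epsilon> (\<lambda>x. x \<bullet> \<nu>)) = ennreal (\<kappa> * linear_osc \<nu>)"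
      by (intro tendsto_Lim) auto
    then show ?thesis using \<kappa>_pos linear_osc_nonneg[of \<nu>] by (simp add: psi_sphere_def)
  qed
  moreover have "linear_osc \<tau> = norm \<tau> * linear_osc (\<tau> /\<^sub>R norm \<tau>)" if "\<tau> \<noteq> 0" using that by (simp add: linear_osc_scale)
  moreover have "linear_osc 0 = 0" using linear_osc_scale[of 0 0] by simp
  ultimately show ?thesis by (simp add: psi_def mult.left_commute)
qed

text \<open>\<open>2 * radius\<close> bounds \<open>linear_osc\<close> on unit vectors, and by
  subadditivity it is a Lipschitz constant of \<open>linear_osc\<close>.\<close>

definition psi_lip :: real where "psi_lip = \<kappa> * (2 * radius)"

lemma psi_lip_pos: "psi_lip > 0" using \<kappa>_pos radius(1) by (simp add: psi_lip_def)

lemma psi_nonneg: "psi D \<tau> \<ge> 0" using \<kappa>_pos linear_osc_nonneg[of \<tau>] by (simp add: psi_eq)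

lemma psi_le: "psi D \<tau> \<le> psi_lip * norm \<tau>"
  using mult_left_mono[OF linear_osc_le[of \<tau>], of \<kappa>] \<kappa>_pos by (simp add: psi_eq psi_lip_def mult.assoc)

lemma psi_diff: "\<bar>psi D \<tau> - psi D \<sigma>\<bar> \<le> psi_lip * norm (\<tau> - \<sigma>)"
  using mult_left_mono[OF linear_osc_diff[of \<tau> \<sigma>], of \<kappa>] \<kappa>_pos
  by (simp add: psi_eq psi_lip_def mult.assoc abs_mult flip: right_diff_distrib)

lemma psi_add_le: "psi D (\<tau> + \<sigma>) \<le> psi D \<tau> + psi D \<sigma>"
  using mult_left_mono[OF linear_osc_add_le[of \<tau> \<sigma>], of \<kappa>] \<kappa>_pos by (simp add: psi_eq distrib_left)

lemma psi_scale: "psi D (c *\<^sub>R \<tau>) = \<bar>c\<bar> * psi D \<tau>"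
  by (simp add: psi_eq linear_osc_scale)

lemma continuous_on_psi: "continuous_on S (psi D)"
proof -
  have "continuous_on S (\<lambda>\<tau>. \<kappa> * linear_osc \<tau>)"
    using continuous_on_linear_osc by (intro continuous_intros) (rule continuous_on_subset, auto)
  then show ?thesis by (simp add: psi_eq[abs_def])
qed

lemma psi_lower: obtains c where "c > 0" "\<And>\<tau>. psi D \<tau> \<ge> c * norm \<tau>"
proof -
  obtain c where "c > 0" "\<And>\<tau>. linear_osc \<tau> \<ge> c * norm \<tau>" using linear_osc_lower by metis
  then show thesis using \<kappa>_pos by (intro that[of "\<kappa> * c"]) (auto simp: psi_eq mult.assoc)
qed

text \<open>On the convex set \<open>S\<close> the difference \<open>r\<close> of \<open>f\<close>
  and the linear function has Lipschitz constant \<open>\<eta>\<close>, so on the translate it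
  varies by at most \<open>\<eta>\<close> times the diameter. Subadditivity of \<open>osc\<close>,
  used in both directions, does the rest.\<close>

lemma osc_gradient_close:
  fixes f :: "real ^ 'n \<Rightarrow> real"
  assumes e: "\<epsilon> > 0" and S: "convex S" "translate x0 \<epsilon> \<subseteq> S"
    and d: "\<And>x. x \<in> S \<Longrightarrow> f differentiable (at x)" and g: "\<And>x. x \<in> S \<Longrightarrow> norm (grad f x - \<tau>) \<le> \<eta>"
  shows "\<bar>osc (translate x0 \<epsilon>) f - \<epsilon> * linear_osc \<tau>\<bar> \<le> \<epsilon> * (2 * radius * \<eta>)"
proof -
  let ?A = "translate x0 \<epsilon>" and ?l = "\<lambda>x. x \<bullet> \<tau>"
  have \<eta>: "\<eta> \<ge> 0"
  proof -
    obtain x where "x \<in> ?A" using translate_facts(2)[OF e] by blast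
    then show ?thesis using g[of x] S(2) norm_ge_zero order_trans by blast
  qed
  have lin: "grad (\<lambda>x. c * (x \<bullet> \<tau>)) x = c *\<^sub>R \<tau>" "(\<lambda>x. c * (x \<bullet> \<tau>)) differentiable (at x)" for c x
  proof -
    have "((\<lambda>x. c * (x \<bullet> \<tau>)) has_derivative (\<lambda>h. (c *\<^sub>R \<tau>) \<bullet> h)) (at x)"
      by (auto intro!: derivative_eq_intros simp: inner_commute)
    then show "grad (\<lambda>x. c * (x \<bullet> \<tau>)) x = c *\<^sub>R \<tau>" "(\<lambda>x. c * (x \<bullet> \<tau>)) differentiable (at x)"
      by (auto intro: grad_eqI simp: differentiable_def)
  qed
  define r where "r x = f x + (- 1) * (x \<bullet> \<tau>)" for x
  have r: "\<bar>r x - r y\<bar> \<le> \<eta> * norm (x - y)" if "x \<in> S" "y \<in> S" for x y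
  proof (rule lipschitz_of_grad_bound[OF S(1) _ _ that])
    fix z assume z: "z \<in> S"
    show "r differentiable at z" unfolding r_def by (intro differentiable_add d[OF z] lin)
    show "norm (grad r z) \<le> \<eta>"
      unfolding r_def using g[OF z] by (subst grad_add) (simp_all only: d[OF z] lin, simp)
  qed
  have A: "open ?A" "bounded ?A" "measure lebesgue ?A > 0" using translate_facts[OF e] by auto
  have il: "set_integrable lebesgue ?A (\<lambda>x. c * (x \<bullet> \<tau>))" for c
  proof -
    obtain B where B: "\<And>x. x \<in> ?A \<Longrightarrow> norm x \<le> B" using A(2) bounded_iff by metis
    show ?thesis
    proof (rule set_integrable_continuous_bounded[OF A(1,2), where B="\<bar>c\<bar> * (B * norm \<tau>)"])
      show "\<bar>c * (x \<bullet> \<tau>)\<bar> \<le> \<bar>c\<bar> * (B * norm \<tau>)" if "x \<in> ?A" for x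
        using Cauchy_Schwarz_ineq2[of x \<tau>] mult_right_mono[OF B[OF that], of "norm \<tau>"]
        unfolding abs_mult by (intro mult_left_mono) auto
    qed (intro continuous_intros)
  qed
  have ir: "set_integrable lebesgue ?A r"
  proof -
    obtain x1 where x1: "x1 \<in> ?A" using translate_facts(2)[OF e] by blast
    show ?thesis
    proof (rule set_integrable_continuous_bounded[OF A(1,2), where B="\<bar>r x1\<bar> + \<eta> * (\<epsilon> * (2 * radius))"])
      have "r differentiable at z" if "z \<in> S" for z unfolding r_def by (intro differentiable_add d[OF that] lin)
      then show "continuous_on ?A r"
        using S(2) by (intro continuous_at_imp_continuous_on ballI differentiable_imp_continuous_within) auto
      show "\<bar>r x\<bar> \<le> \<bar>r x1\<bar> + \<eta> * (\<epsilon> * (2 * radius))" if x: "x \<in> ?A" for x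
        using r[of x x1] x x1 S(2) mult_left_mono[OF translate_facts(6)[OF e x x1] \<eta>] by fastforce
    qed
  qed
  have osc_r: "osc ?A r \<le> \<epsilon> * (2 * radius * \<eta>)"
  proof (rule osc_le_bound[OF A(3) ir])
    fix x y assume xy: "x \<in> ?A" "y \<in> ?A"
    show "\<bar>r x - r y\<bar> \<le> \<epsilon> * (2 * radius * \<eta>)"
      using r[of x y] xy S(2) mult_left_mono[OF translate_facts(6)[OF e xy] \<eta>] by (fastforce simp: mult_ac)
  qed
  have if': "set_integrable lebesgue ?A f"
    using set_integral_add(1)[OF ir il[of 1]] by (simp add: r_def)
  have "osc ?A f \<le> osc ?A r + osc ?A (\<lambda>x. 1 * (x \<bullet> \<tau>))"
    using osc_add_le[OF A(3) ir il[of 1]] by (simp add: r_def)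
  moreover have "osc ?A (\<lambda>x. (- 1) * r x) = osc ?A r" by (subst osc_cmult) simp
  moreover have "osc ?A (\<lambda>x. 1 * (x \<bullet> \<tau>)) \<le> osc ?A f + osc ?A (\<lambda>x. (- 1) * r x)"
    using osc_add_le[OF A(3) if' set_integrable_mult_right[OF ir, of "- 1"]] by (simp add: r_def)
  ultimately show ?thesis using osc_r osc_translate_linear[OF e, of x0 \<tau>] by simp
qed

text \<open>Optimal packings of the disjoint sets \<open>G j\<close> together form one admissible
  family for \<open>A\<close>.\<close>

lemma H_eps_lower:
  assumes e: "\<epsilon> > 0" and J: "finite J" "disjoint_family_on G J" "\<And>j. j \<in> J \<Longrightarrow> G j \<subseteq> A" "\<And>j. j \<in> J \<Longrightarrow> bounded (G j)"
    and b: "\<And>j. j \<in> J \<Longrightarrow> b j \<ge> 0"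
    and w: "\<And>j x0. j \<in> J \<Longrightarrow> translate x0 \<epsilon> \<subseteq> G j \<Longrightarrow> \<epsilon> * b j \<le> osc (translate x0 \<epsilon>) w"
  shows "ennreal (\<Sum>j\<in>J. packing_density \<epsilon> (G j) * b j) \<le> H_eps D A \<epsilon> w"
proof -
  have p: "\<epsilon> ^ (CARD('n) - 1) * \<epsilon> = \<epsilon> ^ CARD('n)"
    by (rule power_card_minus_one_mult)
  have "\<forall>j\<in>J. \<exists>H. H \<in> finite_families \<epsilon> D (G j) \<and> card H = packing_number \<epsilon> (G j)"
    using packing_number_attained e J by metis
  then obtain H where H: "\<And>j. j \<in> J \<Longrightarrow> H j \<in> finite_families \<epsilon> D (G j)" "\<And>j. j \<in> J \<Longrightarrow> card (H j) = packing_number \<epsilon> (G j)"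
    by metis
  note U = disjoint_family_union_families[OF J(1,2) H(1) J(3) e]
  have "ennreal (packing_density \<epsilon> (G j) * b j) \<le> (\<Sum>D'\<in>H j. ennreal (\<epsilon> ^ (CARD('n) - 1) * osc D' w))" if j: "j \<in> J" for j
  proof -
    have "ennreal (packing_density \<epsilon> (G j) * b j) = (\<Sum>D'\<in>H j. ennreal (\<epsilon> ^ (CARD('n) - 1) * (\<epsilon> * b j)))"
      using e b[OF j] H(2)[OF j]
      by (simp add: packing_density_def ennreal_of_nat_eq_real_of_nat mult_ac p[symmetric] flip: ennreal_mult)
    also have "\<dots> \<le> (\<Sum>D'\<in>H j. ennreal (\<epsilon> ^ (CARD('n) - 1) * osc D' w))"
    proof (intro sum_mono ennreal_leI mult_left_mono)
      fix D' assume D': "D' \<in> H j"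
      obtain x0 where "D' = translate x0 \<epsilon>" using finite_families_memD(2)[OF H(1)[OF j] D'] by auto
      then show "\<epsilon> * b j \<le> osc D' w" using w[OF j] finite_families_memD(1)[OF H(1)[OF j] D'] by auto
    qed (use e in auto)
    finally show ?thesis .
  qed
  then have "(\<Sum>j\<in>J. ennreal (packing_density \<epsilon> (G j) * b j)) \<le> (\<Sum>j\<in>J. \<Sum>D'\<in>H j. ennreal (\<epsilon> ^ (CARD('n) - 1) * osc D' w))"
    by (rule sum_mono)
  also have "\<dots> = (\<Sum>D'\<in>(\<Union>j\<in>J. H j). ennreal (\<epsilon> ^ (CARD('n) - 1) * osc D' w))"
    using J(1) H(1) U(2) by (intro sum.UNION_disjoint[symmetric]) (auto simp: finite_families_def disjoint_family_on_def)
  also have "\<dots> \<le> H_eps D A \<epsilon> w" using U(1) by (intro H_eps_ge e) auto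
  also have "(\<Sum>j\<in>J. ennreal (packing_density \<epsilon> (G j) * b j)) = ennreal (\<Sum>j\<in>J. packing_density \<epsilon> (G j) * b j)"
    using b packing_density_nonneg[OF e] by (intro sum_ennreal) auto
  finally show ?thesis .
qed

end

text \<open>The covering lemma, with a gauge taken from the continuity of \<open>F\<close>, yields
  countably many dyadic cubes inside \<open>A\<close> on which \<open>F\<close> varies by at most
  \<open>\<eta>\<close>. Their interiors miss only faces, a null set, and finitely many of them
  already carry more than \<open>c\<close>, because the measure with density \<open>f\<close> is
  continuous from below.\<close>

lemma finite_cubes:
  fixes A :: "(real ^ 'n) set" and F :: "real ^ 'n \<Rightarrow> real ^ 'n"
  assumes A: "open A" and F: "continuous_on A F" and \<eta>: "\<eta> > 0" and m: "m > 0"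
    and f[measurable]: "f \<in> borel_measurable borel"
    and c: "c < (\<integral>\<^sup>+x\<in>A \<inter> cbox (\<chi> i. - m) (\<chi> i. m). f x \<partial>lborel)"
  obtains J where "finite J" "pairwise disjnt J"
    "\<And>G. G \<in> J \<Longrightarrow> \<exists>u v s. G = box u v \<and> s > 0 \<and> (\<forall>i. v $ i - u $ i = s)"
    "\<And>G. G \<in> J \<Longrightarrow> G \<subseteq> A \<inter> cbox (\<chi> i. - m) (\<chi> i. m)"
    "\<And>G x y. G \<in> J \<Longrightarrow> x \<in> G \<Longrightarrow> y \<in> G \<Longrightarrow> norm (F x - F y) \<le> \<eta>"
    "c < (\<integral>\<^sup>+x\<in>\<Union>J. f x \<partial>lborel)"
proof -
  define a b :: "real ^ 'n" where "a = (\<chi> i. - m)" and "b = (\<chi> i. m)"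
  have "\<exists>r>0. ball x r \<subseteq> A \<and> (\<forall>y\<in>ball x r. norm (F y - F x) \<le> \<eta>/2)" if x: "x \<in> A" for x
  proof -
    obtain r1 where r1: "r1 > 0" "ball x r1 \<subseteq> A" using A x open_contains_ball by metis
    obtain r2 where r2: "r2 > 0" "\<And>y. y \<in> A \<Longrightarrow> dist y x < r2 \<Longrightarrow> dist (F y) (F x) < \<eta>/2"
      using F x \<eta> unfolding continuous_on_iff by (metis half_gt_zero)
    show ?thesis
      using r1 r2 by (intro exI[of _ "min r1 r2"]) (auto simp: dist_norm norm_minus_commute subset_iff less_imp_le)
  qed
  then obtain r where r: "\<And>x. x \<in> A \<Longrightarrow> r x > 0" "\<And>x. x \<in> A \<Longrightarrow> ball x (r x) \<subseteq> A"
    "\<And>x y. x \<in> A \<Longrightarrow> y \<in> ball x (r x) \<Longrightarrow> norm (F y - F x) \<le> \<eta>/2" by metis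
  \<comment> \<open>Off \<open>A\<close> the radius is arbitrary: the tags that
    \<open>covering_lemma\<close> provides lie in \<open>A\<close>.\<close>
  define g where "g x = (if x \<in> A then ball x (r x) else ball x 1)" for x
  have g: "gauge g" using r(1) by (auto simp: gauge_def g_def)
  have "0 \<in> box a b" using m by (simp add: a_def b_def mem_box_cart)
  then have ne: "box a b \<noteq> {}" by blast
  obtain \<D> where \<D>: "countable \<D>" "\<Union>\<D> \<subseteq> cbox a b"
    "\<And>K. K \<in> \<D> \<Longrightarrow> interior K \<noteq> {} \<and> (\<exists>c d. K = cbox c d)"
    "pairwise (\<lambda>A B. interior A \<inter> interior B = {}) \<D>"
    "\<And>K. K \<in> \<D> \<Longrightarrow> \<exists>x \<in> (A \<inter> cbox a b) \<inter> K. K \<subseteq> g x"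
    "\<And>u v. cbox u v \<in> \<D> \<Longrightarrow> \<exists>n. \<forall>i \<in> Basis. v \<bullet> i - u \<bullet> i = (b \<bullet> i - a \<bullet> i) / 2^n"
    "A \<inter> cbox a b \<subseteq> \<Union>\<D>"
    using covering_lemma[OF _ ne g, of "A \<inter> cbox a b"] by (metis inf_le2)
  \<comment> \<open>\<open>from_nat_into\<close> enumerates nonempty families; an empty one would
    make the integral 0, contrary to the bound by \<open>c\<close>.\<close>
  have D_ne: "\<D> \<noteq> {}"
  proof
    assume "\<D> = {}"
    then have "A \<inter> cbox a b = {}" using \<D>(7) by simp
    then show False using c by (simp add: a_def b_def)
  qed
  have K: "\<exists>u v s. interior K = box u v \<and> s > 0 \<and> (\<forall>i. v $ i - u $ i = s)" "K \<subseteq> A"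
    "\<And>x y. x \<in> K \<Longrightarrow> y \<in> K \<Longrightarrow> norm (F x - F y) \<le> \<eta>" if K: "K \<in> \<D>" for K
  proof -
    obtain u v where uv: "K = cbox u v" using \<D>(3)[OF K] by blast
    then obtain n where n: "\<And>i. i \<in> Basis \<Longrightarrow> v \<bullet> i - u \<bullet> i = (b \<bullet> i - a \<bullet> i) / 2^n" using \<D>(6) K by blast
    have "v $ i - u $ i = 2 * m / 2 ^ n" for i
      using n[of "axis i 1"] by (simp add: inner_axis a_def b_def)
    then show "\<exists>u v s. interior K = box u v \<and> s > 0 \<and> (\<forall>i. v $ i - u $ i = s)"
      using m by (intro exI[of _ u] exI[of _ v] exI[of _ "2 * m / 2 ^ n"]) (auto simp: uv)
    obtain x where x: "x \<in> A" "K \<subseteq> ball x (r x)" using \<D>(5)[OF K] unfolding g_def by auto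
    then show "K \<subseteq> A" using r(2) by blast
    show "norm (F y - F z) \<le> \<eta>" if "y \<in> K" "z \<in> K" for y z
    proof -
      have "norm (F y - F z) \<le> norm (F y - F x) + norm (F z - F x)"
        using norm_triangle_ineq4[of "F y - F x" "F z - F x"] by simp
      also have "\<dots> \<le> \<eta>/2 + \<eta>/2" using that x by (intro add_mono r(3)) auto
      finally show ?thesis by simp
    qed
  qed
  have meas: "K \<in> sets borel" if "K \<in> \<D>" for K using \<D>(3)[OF that] by auto
  define e where "e = from_nat_into \<D>"
  have e: "range e = \<D>" unfolding e_def by (rule range_from_nat_into[OF D_ne \<D>(1)])
  define I where "I n = interior ` e ` {..<n}" for n :: nat
  define \<nu> where "\<nu> = density lborel f"
  have [simp]: "sets \<nu> = sets borel" by (simp add: \<nu>_def)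
  have em: "emeasure \<nu> S = (\<integral>\<^sup>+x\<in>S. f x \<partial>lborel)" if "S \<in> sets borel" for S
    using that by (simp add: \<nu>_def emeasure_density)
  have null: "(\<Union>K\<in>\<D>. K - interior K) \<in> null_sets \<nu>"
  proof (rule null_sets_UN'[OF \<D>(1)])
    fix K assume K: "K \<in> \<D>"
    obtain u v where uv: "K = cbox u v" using \<D>(3)[OF K] by blast
    have "K - interior K \<in> null_sets lborel"
      unfolding uv using negligible_frontier_interval[of u v]
      by (auto simp: negligible_iff_null_sets null_sets_def)
    then have "AE x in lborel. x \<notin> K - interior K" by (rule AE_not_in)
    moreover have "K - interior K \<in> sets borel" using meas[OF K] by auto
    ultimately show "K - interior K \<in> null_sets \<nu>"
      by (auto simp: \<nu>_def null_sets_density_iff elim!: eventually_mono)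
  qed
  have bUI: "(\<Union>n. \<Union>(I n)) \<in> sets borel" "\<And>n. \<Union>(I n) \<in> sets borel"
    by (auto simp: I_def intro!: borel_open open_Union)
  have sub: "A \<inter> cbox a b \<subseteq> (\<Union>n. \<Union>(I n)) \<union> (\<Union>K\<in>\<D>. K - interior K)"
  proof
    fix x assume "x \<in> A \<inter> cbox a b"
    then obtain K where K: "K \<in> \<D>" "x \<in> K" using \<D>(7) by blast
    then obtain k where k: "K = e k" using e by blast
    show "x \<in> (\<Union>n. \<Union>(I n)) \<union> (\<Union>K\<in>\<D>. K - interior K)"
    proof (cases "x \<in> interior K")
      case True
      then have "x \<in> \<Union>(I (Suc k))" by (auto simp: I_def k)
      then show ?thesis by blast
    qed (use K in auto)
  qed
  have "c < emeasure \<nu> (A \<inter> cbox a b)" using c A by (subst em) (auto simp: a_def b_def)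
  also have "\<dots> \<le> emeasure \<nu> ((\<Union>n. \<Union>(I n)) \<union> (\<Union>K\<in>\<D>. K - interior K))"
    using sub bUI null by (intro emeasure_mono) auto
  also have "\<dots> = emeasure \<nu> (\<Union>n. \<Union>(I n))"
    using bUI null by (intro emeasure_Un_null_set) auto
  also have "\<dots> = (SUP n. emeasure \<nu> (\<Union>(I n)))"
  proof (rule SUP_emeasure_incseq[symmetric])
    show "incseq (\<lambda>n. \<Union>(I n))" unfolding incseq_def I_def by (intro allI impI Union_mono image_mono) auto
  qed (use bUI in auto)
  finally obtain n where n: "c < emeasure \<nu> (\<Union>(I n))" by (auto simp: less_SUP_iff)
  show thesis
  proof (rule that[of "I n"])
    show "finite (I n)" by (simp add: I_def)
    show "pairwise disjnt (I n)"
    proof (rule pairwiseI)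
      fix G H assume "G \<in> I n" "H \<in> I n" "G \<noteq> H"
      then obtain k l where "G = interior (e k)" "H = interior (e l)" by (auto simp: I_def)
      moreover have "e k \<in> \<D>" "e l \<in> \<D>" for k l using e by auto
      ultimately obtain K L where "K \<in> \<D>" "L \<in> \<D>" "G = interior K" "H = interior L" "K \<noteq> L"
        using \<open>G \<noteq> H\<close> by metis
      then show "disjnt G H" using \<D>(4) by (auto simp: pairwise_def disjnt_def)
    qed
    fix G assume "G \<in> I n"
    then obtain L where L: "L \<in> \<D>" "G = interior L" using e by (auto simp: I_def)
    have GL: "G \<subseteq> L" using L interior_subset by auto
    show "\<exists>u v s. G = box u v \<and> s > 0 \<and> (\<forall>i. v $ i - u $ i = s)" using K(1)[OF L(1)] L(2) by simp
    show "G \<subseteq> A \<inter> cbox (\<chi> i. - m) (\<chi> i. m)" using K(2)[OF L(1)] GL \<D>(2) L(1) unfolding a_def b_def by blast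
    show "norm (F x - F y) \<le> \<eta>" if "x \<in> G" "y \<in> G" for x y using K(3)[OF L(1)] GL that by blast
  next
    show "c < (\<integral>\<^sup>+x\<in>\<Union>(I n). f x \<partial>lborel)" using n em[OF bUI(2)] by simp
  qed
qed

lemma nn_integral_Union_boxes:
  fixes J :: "(real ^ 'n) set set"
  assumes J: "finite J" "pairwise disjnt J" "\<And>G. G \<in> J \<Longrightarrow> open G" and [measurable]: "f \<in> borel_measurable borel"
  shows "(\<integral>\<^sup>+x\<in>\<Union>J. f x \<partial>lborel) = (\<Sum>G\<in>J. \<integral>\<^sup>+x\<in>G. f x \<partial>lborel)"
proof -
  have "(\<Sum>G\<in>J. \<integral>\<^sup>+x\<in>G. f x \<partial>lborel) = (\<Sum>G\<in>J. emeasure (density lborel f) G)"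
    using J(3) by (intro sum.cong) (simp_all add: emeasure_density)
  also have "\<dots> = emeasure (density lborel f) (\<Union>G\<in>J. G)"
    using J by (intro sum_emeasure) (auto simp: disjoint_family_on_def pairwise_def disjnt_def)
  also have "\<dots> = (\<integral>\<^sup>+x\<in>\<Union>J. f x \<partial>lborel)"
    using J(3) by (simp add: emeasure_density borel_open open_Union)
  finally show ?thesis by simp
qed

text \<open>Monotone convergence over growing boxes. It leads to a bounded region, where cubes have
  bounded total volume and pointwise errors can be integrated.\<close>

lemma nn_integral_exhaust_cbox:
  fixes A :: "(real ^ 'n) set"
  assumes A[measurable]: "A \<in> sets borel" and f[measurable]: "f \<in> borel_measurable borel"
    and c: "c < (\<integral>\<^sup>+x\<in>A. f x \<partial>lborel)"
  obtains m where "m > 0" "c < (\<integral>\<^sup>+x\<in>A \<inter> cbox (\<chi> i. - m) (\<chi> i. m). f x \<partial>lborel)"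
proof -
  define B where "B n = A \<inter> cbox (\<chi> i. - real (Suc n)) (\<chi> i. real (Suc n))" for n
  have em: "emeasure (density lborel f) S = (\<integral>\<^sup>+x\<in>S. f x \<partial>lborel)" if "S \<in> sets borel" for S
    using that by (simp add: emeasure_density)
  have [measurable]: "B n \<in> sets borel" for n by (simp add: B_def)
  have "A \<subseteq> (\<Union>n. B n)"
  proof
    fix x assume x: "x \<in> A"
    obtain n where n: "norm x \<le> real n" using real_arch_simple by blast
    have "\<bar>x $ i\<bar> \<le> real (Suc n)" for i using component_le_norm_cart[of x i] n by simp
    then have "- real (Suc n) \<le> x $ i \<and> x $ i \<le> real (Suc n)" for i by (metis abs_le_D1 abs_le_D2 minus_le_iff)
    then show "x \<in> (\<Union>n. B n)" using x by (auto simp: B_def mem_box_cart simp del: of_nat_Suc)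
  qed
  then have "A = (\<Union>n. B n)" by (auto simp: B_def)
  moreover have "(SUP n. emeasure (density lborel f) (B n)) = emeasure (density lborel f) (\<Union>n. B n)"
  proof (rule SUP_emeasure_incseq)
    have "cbox (\<chi> i. - real (Suc j)) (\<chi> i. real (Suc j)) \<subseteq> (cbox (\<chi> i. - real (Suc k)) (\<chi> i. real (Suc k)) :: (real ^ 'n) set)"
      if "j \<le> k" for j k
      using that by (intro subset_box_imp) (auto simp: Basis_vec_def inner_axis)
    then show "incseq B" by (auto simp: incseq_def B_def)
  qed auto
  ultimately have "c < (SUP n. emeasure (density lborel f) (B n))" using c em[OF A] by simp
  then obtain n where "c < emeasure (density lborel f) (B n)" by (auto simp: less_SUP_iff)
  then show thesis using em[of "B n"] by (intro that[of "real (Suc n)"]) (auto simp: B_def)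
qed

context profile
begin

lemma cube_facts:
  assumes "\<exists>u v s. G = box u (v :: real ^ 'n) \<and> s > 0 \<and> (\<forall>i. v $ i - u $ i = s)"
  shows "G \<noteq> {}" "open G" "bounded G" "convex G" "G \<in> lmeasurable"
    "((\<lambda>\<epsilon>. packing_density \<epsilon> G) \<longlongrightarrow> \<kappa> * measure lebesgue G) (at_right 0)"
proof -
  obtain u v s where G: "G = box u v" "s > 0" "\<And>i. v $ i - u $ i = s" using assms by auto
  have "(1/2) *\<^sub>R (u + v) \<in> box u v"
    unfolding mem_box_cart using G(2) G(3) by (auto simp: field_simps)
  then show "G \<noteq> {}" "open G" "bounded G" "convex G" "G \<in> lmeasurable" using G by (auto simp: open_box bounded_box convex_box)
  show "((\<lambda>\<epsilon>. packing_density \<epsilon> G) \<longlongrightarrow> \<kappa> * measure lebesgue G) (at_right 0)" unfolding G(1) by (rule tendsto_packing_density_cube[OF G(2,3)])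
qed

text \<open>The argument \<open>W \<epsilon>\<close> moves with \<open>\<epsilon>\<close>, since it
  will be the mollification of \<open>v \<epsilon>\<close>. Uniform closeness of the gradients
  suffices: the cubes and the vectors \<open>\<tau> G\<close> come from \<open>w\<close> alone and
  are chosen before \<open>\<epsilon>\<close>, and on each cube the packing density
  converges.\<close>

lemma H_eps_liminf_C1:
  fixes w :: "real ^ 'n \<Rightarrow> real" and W :: "real \<Rightarrow> real ^ 'n \<Rightarrow> real"
  assumes A: "open A" and w: "continuous_on A (grad w)"
    and W: "\<And>\<epsilon> x. \<epsilon> > 0 \<Longrightarrow> x \<in> A \<Longrightarrow> W \<epsilon> differentiable (at x)"
    and lim: "\<And>\<eta>. \<eta> > 0 \<Longrightarrow> \<forall>\<^sub>F \<epsilon> in at_right 0. \<forall>x\<in>A. norm (grad (W \<epsilon>) x - grad w x) \<le> \<eta>"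
  shows "(\<integral>\<^sup>+x\<in>A. ennreal (psi D (grad w x)) \<partial>lborel) \<le> Liminf (at_right 0) (\<lambda>\<epsilon>. H_eps D A \<epsilon> (W \<epsilon>))"
proof -
  have [measurable]: "A \<in> sets borel" using A by simp
  define f where "f x = ennreal (indicator A x *\<^sub>R psi D (grad w x))" for x
  have "(\<lambda>x. indicator A x *\<^sub>R psi D (grad w x)) \<in> borel_measurable borel"
    by (intro borel_measurable_continuous_on_indicator continuous_on_compose2[OF continuous_on_psi[of UNIV] w]) auto
  then have [measurable]: "f \<in> borel_measurable borel" unfolding f_def by simp
  have "(\<integral>\<^sup>+x\<in>A. ennreal (psi D (grad w x)) \<partial>lborel) = (\<integral>\<^sup>+x\<in>A. f x \<partial>lborel)"
    by (intro nn_integral_cong) (auto simp: f_def indicator_def)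
  also have "\<dots> \<le> Liminf (at_right 0) (\<lambda>\<epsilon>. H_eps D A \<epsilon> (W \<epsilon>))"
  proof (rule dense_le)
    \<comment> \<open>Arguing with every \<open>c\<close> below the integral covers infinite
      integrals too; the second value \<open>c'\<close> leaves the slack \<open>r' - r\<close> for
      the errors.\<close>
    fix c assume "c < (\<integral>\<^sup>+x\<in>A. f x \<partial>lborel)"
    then obtain c' where c': "c < c'" "c' < (\<integral>\<^sup>+x\<in>A. f x \<partial>lborel)" using dense by blast
    have fin: "c < \<infinity>" "c' < \<infinity>" using c' by (auto intro: less_le_trans)
    obtain r where r1: "c = ennreal r" "0 \<le> r" using fin(1) by (cases c) auto
    obtain r' where r2: "c' = ennreal r'" using fin(2) by (cases c') auto
    have r: "c = ennreal r" "c' = ennreal r'" "r < r'" "0 \<le> r"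
      using r1 r2 c'(1) by (auto simp: ennreal_less_iff)
    obtain m where m: "m > 0" "c' < (\<integral>\<^sup>+x\<in>A \<inter> cbox (\<chi> i. - m) (\<chi> i. m). f x \<partial>lborel)"
      using nn_integral_exhaust_cbox[OF _ _ c'(2)] by auto
    define B :: "(real ^ 'n) set" where "B = (cbox (\<chi> i. - m) (\<chi> i. m) :: (real ^ 'n) set)"
    define V where "V = measure lebesgue B"
    \<comment> \<open>There are three errors \<open>psi_lip * \<eta>\<close>: one from replacing
      \<open>grad w x\<close> by \<open>\<tau> G\<close>, two from the term
      \<open>4 * radius * \<eta>\<close> in \<open>b G\<close>, as
      \<open>psi_lip = \<kappa> * (2 * radius)\<close>.\<close>
    define \<eta> where "\<eta> = (r' - r) / (3 * psi_lip * (V + 1))"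
    have V: "V \<ge> 0" by (simp add: V_def)
    have \<eta>: "\<eta> > 0" "3 * psi_lip * \<eta> * V \<le> r' - r"
    proof -
      show "\<eta> > 0" unfolding \<eta>_def using r psi_lip_pos V by simp
      have "3 * psi_lip * \<eta> * V = (r' - r) * (V / (V + 1))" unfolding \<eta>_def using psi_lip_pos V by simp
      also have "\<dots> \<le> (r' - r) * 1" using r V by (intro mult_left_mono) auto
      finally show "3 * psi_lip * \<eta> * V \<le> r' - r" by simp
    qed
    obtain J where J: "finite J" "pairwise disjnt J"
      "\<And>G. G \<in> J \<Longrightarrow> \<exists>u v s. G = box u v \<and> s > 0 \<and> (\<forall>i. v $ i - u $ i = s)"
      "\<And>G. G \<in> J \<Longrightarrow> G \<subseteq> A \<inter> B"
      "\<And>G x y. G \<in> J \<Longrightarrow> x \<in> G \<Longrightarrow> y \<in> G \<Longrightarrow> norm (grad w x - grad w y) \<le> \<eta>"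
      "c' < (\<integral>\<^sup>+x\<in>\<Union>J. f x \<partial>lborel)"
      by (rule finite_cubes[OF A w \<eta>(1) m(1) \<open>f \<in> borel_measurable borel\<close> m(2), folded B_def]) blast
    note Jne = cube_facts(1-5)[OF J(3)] and Jlim = cube_facts(6)[OF J(3)]
    define \<tau> where "\<tau> G = grad w (SOME x. x \<in> G)" for G
    have \<tau>: "norm (grad w x - \<tau> G) \<le> \<eta>" if "G \<in> J" "x \<in> G" for G x
      unfolding \<tau>_def using J(5)[OF that] Jne(1)[OF that(1)] some_in_eq by blast
    \<comment> \<open>The subtracted term is \<open>2 * radius\<close> times
      \<open>2 * \<eta>\<close>, because \<open>grad (W \<epsilon>)\<close> is within
      \<open>2 * \<eta>\<close> of \<open>\<tau> G\<close>. The truncation at 0 costs nothing,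
      \<open>osc\<close> being nonnegative.\<close>
    define b where "b G = max 0 (linear_osc (\<tau> G) - 4 * radius * \<eta>)" for G
    have low: "\<forall>\<^sub>F \<epsilon> in at_right 0. ennreal (\<Sum>G\<in>J. packing_density \<epsilon> G * b G) \<le> H_eps D A \<epsilon> (W \<epsilon>)"
      using lim[OF \<eta>(1)] eventually_at_right_less[of "0::real"]
    proof eventually_elim
      case (elim \<epsilon>)
      show ?case
      proof (rule H_eps_lower)
        show "disjoint_family_on (\<lambda>G. G) J" using J(2) by (auto simp: disjoint_family_on_def pairwise_def disjnt_def)
        fix G x0 assume G: "G \<in> J" "translate x0 \<epsilon> \<subseteq> G"
        have "\<bar>osc (translate x0 \<epsilon>) (W \<epsilon>) - \<epsilon> * linear_osc (\<tau> G)\<bar> \<le> \<epsilon> * (2 * radius * (2 * \<eta>))"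
        proof (rule osc_gradient_close[OF elim(2) Jne(4)[OF G(1)] G(2)])
          fix x assume x: "x \<in> G"
          then have xA: "x \<in> A" using J(4)[OF G(1)] by auto
          then show "W \<epsilon> differentiable at x" using W elim(2) by blast
          have "norm (grad (W \<epsilon>) x - \<tau> G) \<le> norm (grad (W \<epsilon>) x - grad w x) + norm (grad w x - \<tau> G)"
            using norm_triangle_ineq[of "grad (W \<epsilon>) x - grad w x" "grad w x - \<tau> G"] by simp
          also have "\<dots> \<le> 2 * \<eta>" using elim(1) xA \<tau>[OF G(1) x] by fastforce
          finally show "norm (grad (W \<epsilon>) x - \<tau> G) \<le> 2 * \<eta>" .
        qed
        then have "\<epsilon> * (linear_osc (\<tau> G) - 4 * radius * \<eta>) \<le> osc (translate x0 \<epsilon>) (W \<epsilon>)"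
          by (simp add: abs_le_iff algebra_simps)
        then show "\<epsilon> * b G \<le> osc (translate x0 \<epsilon>) (W \<epsilon>)"
          using osc_nonneg[of "translate x0 \<epsilon>" "W \<epsilon>"] by (auto simp: b_def max_def)
      qed (use J Jne elim in \<open>auto simp: b_def\<close>)
    qed
    have "((\<lambda>\<epsilon>. ennreal (\<Sum>G\<in>J. packing_density \<epsilon> G * b G)) \<longlongrightarrow> ennreal (\<Sum>G\<in>J. \<kappa> * measure lebesgue G * b G)) (at_right 0)"
      by (intro tendsto_ennrealI tendsto_intros Jlim)
    then have "Liminf (at_right 0) (\<lambda>\<epsilon>. ennreal (\<Sum>G\<in>J. packing_density \<epsilon> G * b G)) = ennreal (\<Sum>G\<in>J. \<kappa> * measure lebesgue G * b G)"
      by (intro lim_imp_Liminf) auto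
    then have L: "ennreal (\<Sum>G\<in>J. \<kappa> * measure lebesgue G * b G) \<le> Liminf (at_right 0) (\<lambda>\<epsilon>. H_eps D A \<epsilon> (W \<epsilon>))"
      using Liminf_mono[OF low] by simp
    have "ennreal r' \<le> (\<Sum>G\<in>J. \<integral>\<^sup>+x\<in>G. f x \<partial>lborel)"
      using J(6) nn_integral_Union_boxes[OF J(1,2) Jne(2), of f] r(2) by auto
    also have "\<dots> \<le> (\<Sum>G\<in>J. ennreal ((\<kappa> * b G + 3 * psi_lip * \<eta>) * measure lebesgue G))"
    proof (rule sum_mono)
      fix G assume G: "G \<in> J"
      have "f x * indicator G x \<le> ennreal (\<kappa> * b G + 3 * psi_lip * \<eta>) * indicator G x" for x
      proof (cases "x \<in> G")
        case True
        have "psi D (grad w x) \<le> psi D (\<tau> G) + psi_lip * \<eta>"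
          using psi_diff[of "grad w x" "\<tau> G"] mult_left_mono[OF \<tau>[OF G True], of psi_lip] psi_lip_pos by linarith
        also have "psi D (\<tau> G) \<le> \<kappa> * b G + 2 * psi_lip * \<eta>"
        proof -
          have "\<kappa> * linear_osc (\<tau> G) \<le> \<kappa> * (b G + 4 * radius * \<eta>)" using \<kappa>_pos by (intro mult_left_mono) (auto simp: b_def)
          then show ?thesis by (simp add: psi_eq psi_lip_def algebra_simps)
        qed
        finally have "psi D (grad w x) \<le> \<kappa> * b G + 3 * psi_lip * \<eta>" by (simp add: mult.commute mult.left_commute)
        then show ?thesis using True by (auto simp: f_def indicator_def intro!: ennreal_leI)
      qed simp
      then have "(\<integral>\<^sup>+x\<in>G. f x \<partial>lborel) \<le> (\<integral>\<^sup>+x. ennreal (\<kappa> * b G + 3 * psi_lip * \<eta>) * indicator G x \<partial>lborel)"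
        by (intro nn_integral_mono)
      also have "\<dots> = ennreal (\<kappa> * b G + 3 * psi_lip * \<eta>) * emeasure lborel G"
        using Jne(2)[OF G] by (simp add: nn_integral_cmult_indicator)
      also have "emeasure lborel G = ennreal (measure lebesgue G)"
        using Jne(5)[OF G] Jne(2)[OF G] emeasure_eq_measure2[OF Jne(5)[OF G]] by simp
      finally show "(\<integral>\<^sup>+x\<in>G. f x \<partial>lborel) \<le> ennreal ((\<kappa> * b G + 3 * psi_lip * \<eta>) * measure lebesgue G)"
        using \<kappa>_pos psi_lip_pos \<eta>(1) by (subst ennreal_mult) (auto simp: b_def)
    qed
    also have "\<dots> = ennreal (\<Sum>G\<in>J. (\<kappa> * b G + 3 * psi_lip * \<eta>) * measure lebesgue G)"
      using \<kappa>_pos psi_lip_pos \<eta>(1) by (intro sum_ennreal mult_nonneg_nonneg add_nonneg_nonneg) (auto simp: b_def)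
    finally have "r' \<le> (\<Sum>G\<in>J. (\<kappa> * b G + 3 * psi_lip * \<eta>) * measure lebesgue G)"
      using \<kappa>_pos psi_lip_pos \<eta>(1) by (subst (asm) ennreal_le_iff) (auto simp: b_def intro!: sum_nonneg mult_nonneg_nonneg add_nonneg_nonneg)
    also have "\<dots> = (\<Sum>G\<in>J. \<kappa> * measure lebesgue G * b G) + 3 * psi_lip * \<eta> * (\<Sum>G\<in>J. measure lebesgue G)"
      by (simp add: sum_distrib_left sum.distrib[symmetric] algebra_simps)
    also have "(\<Sum>G\<in>J. measure lebesgue G) \<le> V"
    proof -
      have "(\<Sum>G\<in>J. measure lebesgue G) = measure lebesgue (\<Union>J)"
        using J(1,2) Jne(5) by (intro measure_Union'[symmetric]) auto
      also have "\<dots> \<le> V" unfolding V_def using J(4) Jne(2)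
        using open_Union[of J] by (intro measure_mono_fmeasurable) (auto simp: B_def)
      finally show ?thesis .
    qed
    then have "(\<Sum>G\<in>J. \<kappa> * measure lebesgue G * b G) + 3 * psi_lip * \<eta> * (\<Sum>G\<in>J. measure lebesgue G) \<le>
      (\<Sum>G\<in>J. \<kappa> * measure lebesgue G * b G) + 3 * psi_lip * \<eta> * V"
      using psi_lip_pos \<eta>(1) by (intro add_left_mono mult_left_mono) auto
    finally have "r \<le> (\<Sum>G\<in>J. \<kappa> * measure lebesgue G * b G)" using \<eta>(2) by linarith
    then show "c \<le> Liminf (at_right 0) (\<lambda>\<epsilon>. H_eps D A \<epsilon> (W \<epsilon>))"
      unfolding r(1) using L by (meson ennreal_leI order_trans)
  qed
  finally show ?thesis .
qed

end

section \<open>The Poincare inequality\<close>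

definition C1_on :: "(real ^ 'n) set \<Rightarrow> (real ^ 'n \<Rightarrow> real) \<Rightarrow> bool" where
  "C1_on A v \<longleftrightarrow> (\<forall>x\<in>A. v differentiable (at x)) \<and> continuous_on A (grad v)"

lemma C1_on_continuous: "C1_on A v \<Longrightarrow> continuous_on A v"
  unfolding C1_on_def by (auto intro!: continuous_at_imp_continuous_on differentiable_imp_continuous_within)

lemma C1_on_subset: "C1_on A v \<Longrightarrow> B \<subseteq> A \<Longrightarrow> C1_on B v"
  unfolding C1_on_def by (auto intro: continuous_on_subset)

lemma borel_measurable_indicator_continuous:
  fixes v :: "real ^ 'n \<Rightarrow> real"
  assumes "open A" "continuous_on A v" shows "(\<lambda>x. indicator A x * v x) \<in> borel_measurable borel"
  using borel_measurable_continuous_on_indicator[OF borel_open[OF assms(1)] assms(2)] by simp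

definition energy :: "(real ^ 'n) set \<Rightarrow> (real ^ 'n \<Rightarrow> real) \<Rightarrow> ennreal" where
  "energy A v = (\<integral>\<^sup>+x\<in>A. ennreal (norm (grad v x)) \<partial>lborel)"

text \<open>Points are compared with points, not with a mean: such integrals over overlapping sets
  combine by the triangle inequality, and no means have to be matched.\<close>

definition pair_diff :: "(real ^ 'n \<Rightarrow> real) \<Rightarrow> (real ^ 'n) set \<Rightarrow> (real ^ 'n) set \<Rightarrow> ennreal" where
  "pair_diff v X Y = (\<integral>\<^sup>+x. \<integral>\<^sup>+y. indicator X x * (indicator Y y * ennreal \<bar>v x - v y\<bar>) \<partial>lborel \<partial>lborel)"

text \<open>The fundamental theorem of calculus along the segment. The factor
  \<open>indicator D\<close> lets the integrand come from a Borel function on the whole space, as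
  Fubini will require.\<close>

lemma abs_diff_le_segment_integral:
  fixes v :: "real ^ 'n \<Rightarrow> real"
  assumes D: "open D" and v: "C1_on D v" and seg: "closed_segment x y \<subseteq> D" and d: "norm (y - x) \<le> d"
  shows "ennreal \<bar>v x - v y\<bar> \<le>
    (\<integral>\<^sup>+l. indicator {0..1::real} l * (ennreal d * ennreal (indicator D (x + l *\<^sub>R (y - x)) * norm (grad v (x + l *\<^sub>R (y - x))))) \<partial>lborel)"
proof -
  let ?z = "\<lambda>l::real. x + l *\<^sub>R (y - x)"
  let ?f = "\<lambda>l. grad v (?z l) \<bullet> (y - x)"
  have z: "?z l \<in> D" if "0 \<le> l" "l \<le> 1" for l
  proof -
    have "?z l = (1 - l) *\<^sub>R x + l *\<^sub>R y" by (simp add: algebra_simps)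
    then have "?z l \<in> closed_segment x y" using that unfolding closed_segment_def by blast
    then show ?thesis using seg by blast
  qed
  have F: "((\<lambda>l. v (?z l)) has_real_derivative ?f l) (at l)" if "0 \<le> l" "l \<le> 1" for l
  proof -
    have "(v has_derivative (\<lambda>h. grad v (?z l) \<bullet> h)) (at (?z l))"
      using v z[OF that] by (intro has_derivative_grad) (auto simp: C1_on_def)
    moreover have "(?z has_derivative (\<lambda>h. h *\<^sub>R (y - x))) (at l)"
      by (auto intro!: derivative_eq_intros)
    ultimately have "((\<lambda>l. v (?z l)) has_derivative (\<lambda>h. grad v (?z l) \<bullet> (h *\<^sub>R (y - x)))) (at l)"
      using has_derivative_compose by blast
    then show ?thesis unfolding has_field_derivative_def by (simp add: mult.commute[of _ "grad v (?z l) \<bullet> (y - x)"])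
  qed
  have c: "isCont ?f l" if "0 \<le> l" "l \<le> 1" for l
  proof -
    have "isCont (grad v) (?z l)"
      using v z[OF that] D by (auto simp: C1_on_def continuous_on_eq_continuous_at)
    then have "isCont (\<lambda>l. grad v (?z l)) l"
      by (intro isCont_o2[where f="?z" and g="grad v"] continuous_intros)
    then show ?thesis by (intro continuous_intros)
  qed
  have B: "has_bochner_integral lborel (\<lambda>l. ?f l * indicator {0..1} l) (v (?z 1) - v (?z 0))"
    by (rule has_bochner_integral_FTC_Icc_real) (use F c in auto)
  have "ennreal \<bar>v x - v y\<bar> = ennreal (norm (LINT l|lborel. ?f l * indicator {0..1} l))"
    using has_bochner_integral_integral_eq[OF B] by (simp add: abs_minus_commute)
  also have "\<dots> \<le> (\<integral>\<^sup>+l. ennreal (norm (?f l * indicator {0..1} l)) \<partial>lborel)"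
    by (rule integral_norm_bound_ennreal) (use B in \<open>auto simp: has_bochner_integral_iff\<close>)
  also have "\<dots> \<le> (\<integral>\<^sup>+l. indicator {0..1::real} l * (ennreal d * ennreal (indicator D (?z l) * norm (grad v (?z l)))) \<partial>lborel)"
  proof (rule nn_integral_mono)
    fix l :: real
    show "ennreal (norm (?f l * indicator {0..1} l)) \<le>
      indicator {0..1::real} l * (ennreal d * ennreal (indicator D (?z l) * norm (grad v (?z l))))"
    proof (cases "l \<in> {0..1}")
      case True
      have "d \<ge> 0" using d norm_ge_zero order_trans by blast
      have "\<bar>?f l\<bar> \<le> norm (grad v (?z l)) * norm (y - x)" by (rule Cauchy_Schwarz_ineq2)
      also have "\<dots> \<le> norm (grad v (?z l)) * d" by (intro mult_left_mono d) auto
      finally show ?thesis using True z[of l] \<open>d \<ge> 0\<close>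
        by (auto simp: mult.commute simp flip: ennreal_mult intro!: ennreal_leI)
    qed simp
  qed
  finally show ?thesis .
qed

text \<open>The inverse Jacobian is at most \<open>2 ^ CARD('n)\<close>.\<close>

lemma nn_integral_affine_le:
  fixes t :: "real ^ 'n"
  assumes f: "f \<in> borel_measurable borel" and c: "\<bar>c\<bar> \<ge> 1/2"
  shows "(\<integral>\<^sup>+x. f (t + c *\<^sub>R x) \<partial>lborel) \<le> ennreal (2 ^ CARD('n)) * (\<integral>\<^sup>+x. f x \<partial>lborel)"
proof -
  have c0: "c \<noteq> 0" using c by auto
  have "1 \<le> (2 * \<bar>c\<bar>) ^ CARD('n)" using c by (intro one_le_power) auto
  then have "1 \<le> ennreal (2 ^ CARD('n)) * ennreal (\<bar>c\<bar> ^ CARD('n))"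
    by (simp add: power_mult_distrib flip: ennreal_mult)
  from mult_right_mono[OF this, of "\<integral>\<^sup>+x. f (t + c *\<^sub>R x) \<partial>lborel"]
  show ?thesis unfolding nn_integral_lborel_affine[OF f c0, of t] by (simp add: mult.assoc)
qed

text \<open>The classical argument for convex sets. For fixed \<open>l\<close>, the point
  \<open>(1 - l) x + l y\<close> is substituted for \<open>y\<close> if \<open>\<bar>l\<bar>\<close>
  is at least 1/2 and for \<open>x\<close> otherwise, so the Jacobian never degenerates.\<close>

lemma pair_diff_star:
  fixes v :: "real ^ 'n \<Rightarrow> real"
  assumes D: "open D" and v: "C1_on D v" and [measurable]: "U \<in> sets borel" "B \<in> sets borel"
    and seg: "\<And>x y. x \<in> U \<Longrightarrow> y \<in> B \<Longrightarrow> closed_segment x y \<subseteq> D"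
    and d: "\<And>x y. x \<in> U \<Longrightarrow> y \<in> B \<Longrightarrow> norm (y - x) \<le> d"
  shows "pair_diff v U B \<le> ennreal d * ennreal (2 ^ CARD('n)) * (emeasure lborel U + emeasure lborel B) * energy D v"
proof -
  have [measurable]: "D \<in> sets borel" using D by simp
  define g where "g z = ennreal (indicator D z * norm (grad v z))" for z
  have "(\<lambda>z. indicator D z * norm (grad v z)) \<in> borel_measurable borel"
    using v by (intro borel_measurable_indicator_continuous D continuous_intros) (auto simp: C1_on_def)
  then have g[measurable]: "g \<in> borel_measurable borel" unfolding g_def by simp
  have I: "energy D v = (\<integral>\<^sup>+z. g z \<partial>lborel)"
    unfolding energy_def g_def by (intro nn_integral_cong) (auto simp: indicator_def)
  let ?N = "ennreal (2 ^ CARD('n))" and ?I = "\<integral>\<^sup>+z. g z \<partial>lborel"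
  let ?m = "emeasure lborel U" and ?k = "emeasure lborel B"
  define K where "K l = (\<integral>\<^sup>+x. \<integral>\<^sup>+y. indicator U x * (indicator B y * g (x + l *\<^sub>R (y - x))) \<partial>lborel \<partial>lborel)" for l :: real
  have K: "K l \<le> ?N * (?m + ?k) * ?I" for l
  proof (cases "\<bar>l\<bar> \<ge> 1/2")
    case True
    have "K l \<le> (\<integral>\<^sup>+x. indicator U x * (?N * ?I) \<partial>lborel)" unfolding K_def
    proof (rule nn_integral_mono)
      fix x
      have "(\<integral>\<^sup>+y. indicator U x * (indicator B y * g (x + l *\<^sub>R (y - x))) \<partial>lborel) \<le>
        (\<integral>\<^sup>+y. indicator U x * g ((1 - l) *\<^sub>R x + l *\<^sub>R y) \<partial>lborel)"
        by (intro nn_integral_mono mult_left_mono) (auto simp: indicator_def algebra_simps)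
      also have "\<dots> = indicator U x * (\<integral>\<^sup>+y. g ((1 - l) *\<^sub>R x + l *\<^sub>R y) \<partial>lborel)"
        by (rule nn_integral_cmult) simp
      also have "\<dots> \<le> indicator U x * (?N * ?I)"
        by (intro mult_left_mono nn_integral_affine_le g True) auto
      finally show "(\<integral>\<^sup>+y. indicator U x * (indicator B y * g (x + l *\<^sub>R (y - x))) \<partial>lborel) \<le> indicator U x * (?N * ?I)" .
    qed
    also have "\<dots> = ?N * ?m * ?I" by (simp add: nn_integral_multc mult_ac)
    also have "\<dots> \<le> ?N * (?m + ?k) * ?I" by (intro mult_right_mono mult_left_mono) auto
    finally show ?thesis .
  next
    case False
    then have l: "\<bar>1 - l\<bar> \<ge> 1/2" by linarith
    have "K l = (\<integral>\<^sup>+y. \<integral>\<^sup>+x. indicator U x * (indicator B y * g (x + l *\<^sub>R (y - x))) \<partial>lborel \<partial>lborel)"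
      unfolding K_def by (rule lborel_pair.Fubini'[symmetric]) simp
    also have "\<dots> \<le> (\<integral>\<^sup>+y. indicator B y * (?N * ?I) \<partial>lborel)"
    proof (rule nn_integral_mono)
      fix y
      have "(\<integral>\<^sup>+x. indicator U x * (indicator B y * g (x + l *\<^sub>R (y - x))) \<partial>lborel) \<le>
        (\<integral>\<^sup>+x. indicator B y * g (l *\<^sub>R y + (1 - l) *\<^sub>R x) \<partial>lborel)"
        by (intro nn_integral_mono) (auto simp: indicator_def algebra_simps)
      also have "\<dots> = indicator B y * (\<integral>\<^sup>+x. g (l *\<^sub>R y + (1 - l) *\<^sub>R x) \<partial>lborel)"
        by (rule nn_integral_cmult) simp
      also have "\<dots> \<le> indicator B y * (?N * ?I)"
        by (intro mult_left_mono nn_integral_affine_le g l) auto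
      finally show "(\<integral>\<^sup>+x. indicator U x * (indicator B y * g (x + l *\<^sub>R (y - x))) \<partial>lborel) \<le> indicator B y * (?N * ?I)" .
    qed
    also have "\<dots> = ?N * ?k * ?I" by (simp add: nn_integral_multc mult_ac)
    also have "\<dots> \<le> ?N * (?m + ?k) * ?I" by (intro mult_right_mono mult_left_mono) auto
    finally show ?thesis .
  qed
  have "pair_diff v U B \<le> (\<integral>\<^sup>+x. \<integral>\<^sup>+y. \<integral>\<^sup>+l. indicator {0..1::real} l * (ennreal d * (indicator U x * (indicator B y * g (x + l *\<^sub>R (y - x))))) \<partial>lborel \<partial>lborel \<partial>lborel)"
    unfolding pair_diff_def
  proof (intro nn_integral_mono)
    fix x y
    show "indicator U x * (indicator B y * ennreal \<bar>v x - v y\<bar>) \<le>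
      (\<integral>\<^sup>+l. indicator {0..1::real} l * (ennreal d * (indicator U x * (indicator B y * g (x + l *\<^sub>R (y - x))))) \<partial>lborel)"
    proof (cases "x \<in> U \<and> y \<in> B")
      case True
      then show ?thesis using abs_diff_le_segment_integral[OF D v seg d, of x y] by (simp add: g_def)
    qed auto
  qed
  \<comment> \<open>The integral over \<open>l\<close> is moved to the outside, where the bound for
    \<open>K l\<close> applies pointwise.\<close>
  also have "\<dots> = (\<integral>\<^sup>+x. \<integral>\<^sup>+l. \<integral>\<^sup>+y. indicator {0..1::real} l * (ennreal d * (indicator U x * (indicator B y * g (x + l *\<^sub>R (y - x))))) \<partial>lborel \<partial>lborel \<partial>lborel)"
    by (intro nn_integral_cong pair_sigma_finite.Fubini') (simp_all add: pair_sigma_finite_def sigma_finite_lborel)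
  also have "\<dots> = (\<integral>\<^sup>+l. \<integral>\<^sup>+x. \<integral>\<^sup>+y. indicator {0..1::real} l * (ennreal d * (indicator U x * (indicator B y * g (x + l *\<^sub>R (y - x))))) \<partial>lborel \<partial>lborel \<partial>lborel)"
    by (intro pair_sigma_finite.Fubini') (simp_all add: pair_sigma_finite_def sigma_finite_lborel)
  also have "\<dots> = (\<integral>\<^sup>+l. indicator {0..1::real} l * (ennreal d * K l) \<partial>lborel)"
    unfolding K_def by (simp add: nn_integral_cmult)
  also have "\<dots> \<le> (\<integral>\<^sup>+l. indicator {0..1::real} l * (ennreal d * (?N * (?m + ?k) * ?I)) \<partial>lborel)"
    by (intro nn_integral_mono mult_left_mono K) auto
  also have "\<dots> = ennreal d * ?N * (?m + ?k) * ?I"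
    by (simp add: nn_integral_multc mult.assoc)
  finally show ?thesis unfolding I .
qed

section \<open>Double integrals over chains of sets\<close>

lemma pair_diff_mono: "X \<subseteq> X' \<Longrightarrow> Y \<subseteq> Y' \<Longrightarrow> pair_diff v X Y \<le> pair_diff v X' Y'"
  unfolding pair_diff_def by (intro nn_integral_mono mult_mono) (auto simp: indicator_def)

lemma pair_diff_cong: "(\<And>x. x \<in> X \<union> Y \<Longrightarrow> v x = w x) \<Longrightarrow> pair_diff v X Y = pair_diff w X Y"
  unfolding pair_diff_def by (intro nn_integral_cong) (auto simp: indicator_def)

context
  fixes v :: "real ^ 'n \<Rightarrow> real"
  assumes v[measurable]: "v \<in> borel_measurable borel"
begin

lemma pair_diff_sym:
  assumes [measurable]: "X \<in> sets borel" "Y \<in> sets borel"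
  shows "pair_diff v X Y = pair_diff v Y X"
proof -
  have "pair_diff v X Y = (\<integral>\<^sup>+y. \<integral>\<^sup>+x. indicator X x * (indicator Y y * ennreal \<bar>v x - v y\<bar>) \<partial>lborel \<partial>lborel)"
    unfolding pair_diff_def by (rule lborel_pair.Fubini'[symmetric]) simp
  also have "\<dots> = pair_diff v Y X"
    unfolding pair_diff_def by (intro nn_integral_cong) (simp add: mult_ac abs_minus_commute)
  finally show ?thesis .
qed

lemma pair_diff_Un:
  assumes [measurable]: "X \<in> sets borel" "X' \<in> sets borel" "Y \<in> sets borel"
  shows "pair_diff v (X \<union> X') Y \<le> pair_diff v X Y + pair_diff v X' Y"
proof -
  have "pair_diff v (X \<union> X') Y \<le> (\<integral>\<^sup>+x. (\<integral>\<^sup>+y. indicator X x * (indicator Y y * ennreal \<bar>v x - v y\<bar>) \<partial>lborel) +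
    (\<integral>\<^sup>+y. indicator X' x * (indicator Y y * ennreal \<bar>v x - v y\<bar>) \<partial>lborel) \<partial>lborel)"
    unfolding pair_diff_def by (intro nn_integral_mono) (auto simp: indicator_def)
  also have "\<dots> = pair_diff v X Y + pair_diff v X' Y"
    unfolding pair_diff_def by (rule nn_integral_add) simp_all
  finally show ?thesis .
qed

text \<open>Integrate the triangle inequality through \<open>z\<close> over all \<open>z\<close> in
  \<open>E\<close>; each term carries the measure of the set whose variable does not occur in
  it.\<close>

lemma pair_diff_trans:
  assumes [measurable]: "X \<in> sets borel" "Y \<in> sets borel" "E \<in> sets borel"
  shows "emeasure lborel E * pair_diff v X Y \<le>
    emeasure lborel Y * pair_diff v X E + emeasure lborel X * pair_diff v E Y"
proof -
  let ?i = "\<lambda>x y z. indicator X x * (indicator Y y * indicator E z) :: ennreal"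
  have "emeasure lborel E * pair_diff v X Y =
    (\<integral>\<^sup>+x. \<integral>\<^sup>+y. \<integral>\<^sup>+z. ?i x y z * ennreal \<bar>v x - v y\<bar> \<partial>lborel \<partial>lborel \<partial>lborel)"
  proof -
    have "(\<integral>\<^sup>+z. ?i x y z * ennreal \<bar>v x - v y\<bar> \<partial>lborel) =
      emeasure lborel E * (indicator X x * (indicator Y y * ennreal \<bar>v x - v y\<bar>))" for x y
    proof -
      have "(\<integral>\<^sup>+z. ?i x y z * ennreal \<bar>v x - v y\<bar> \<partial>lborel) =
        (\<integral>\<^sup>+z. indicator E z * (indicator X x * (indicator Y y * ennreal \<bar>v x - v y\<bar>)) \<partial>lborel)"
        by (intro nn_integral_cong) (simp add: mult_ac)
      then show ?thesis by (simp add: nn_integral_multc)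
    qed
    then show ?thesis unfolding pair_diff_def by (simp add: nn_integral_cmult)
  qed
  also have "\<dots> \<le> (\<integral>\<^sup>+x. \<integral>\<^sup>+y. \<integral>\<^sup>+z. ?i x y z * ennreal \<bar>v x - v z\<bar> + ?i x y z * ennreal \<bar>v z - v y\<bar> \<partial>lborel \<partial>lborel \<partial>lborel)"
    by (intro nn_integral_mono) (auto simp: indicator_def simp flip: ennreal_plus intro!: ennreal_leI)
  also have "\<dots> = (\<integral>\<^sup>+x. \<integral>\<^sup>+y. \<integral>\<^sup>+z. ?i x y z * ennreal \<bar>v x - v z\<bar> \<partial>lborel \<partial>lborel \<partial>lborel) +
    (\<integral>\<^sup>+x. \<integral>\<^sup>+y. \<integral>\<^sup>+z. ?i x y z * ennreal \<bar>v z - v y\<bar> \<partial>lborel \<partial>lborel \<partial>lborel)"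
    by (simp add: nn_integral_add)
  also have "(\<integral>\<^sup>+x. \<integral>\<^sup>+y. \<integral>\<^sup>+z. ?i x y z * ennreal \<bar>v x - v z\<bar> \<partial>lborel \<partial>lborel \<partial>lborel) =
    emeasure lborel Y * pair_diff v X E"
  proof -
    have "(\<integral>\<^sup>+y. \<integral>\<^sup>+z. ?i x y z * ennreal \<bar>v x - v z\<bar> \<partial>lborel \<partial>lborel) =
      emeasure lborel Y * (\<integral>\<^sup>+z. indicator X x * (indicator E z * ennreal \<bar>v x - v z\<bar>) \<partial>lborel)" for x
    proof -
      have "(\<integral>\<^sup>+y. \<integral>\<^sup>+z. ?i x y z * ennreal \<bar>v x - v z\<bar> \<partial>lborel \<partial>lborel) =
        (\<integral>\<^sup>+y. \<integral>\<^sup>+z. indicator Y y * (indicator X x * (indicator E z * ennreal \<bar>v x - v z\<bar>)) \<partial>lborel \<partial>lborel)"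
        by (intro nn_integral_cong) (simp add: mult_ac)
      then show ?thesis by (simp add: nn_integral_cmult nn_integral_multc)
    qed
    then show ?thesis unfolding pair_diff_def by (simp add: nn_integral_cmult)
  qed
  also have "(\<integral>\<^sup>+x. \<integral>\<^sup>+y. \<integral>\<^sup>+z. ?i x y z * ennreal \<bar>v z - v y\<bar> \<partial>lborel \<partial>lborel \<partial>lborel) =
    emeasure lborel X * pair_diff v E Y"
  proof -
    have "(\<integral>\<^sup>+x. \<integral>\<^sup>+y. \<integral>\<^sup>+z. ?i x y z * ennreal \<bar>v z - v y\<bar> \<partial>lborel \<partial>lborel \<partial>lborel) =
      (\<integral>\<^sup>+x. \<integral>\<^sup>+z. \<integral>\<^sup>+y. ?i x y z * ennreal \<bar>v z - v y\<bar> \<partial>lborel \<partial>lborel \<partial>lborel)"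
      by (intro nn_integral_cong lborel_pair.Fubini') simp
    also have "\<dots> = (\<integral>\<^sup>+x. indicator X x * pair_diff v E Y \<partial>lborel)"
      unfolding pair_diff_def by (simp add: nn_integral_cmult[symmetric] mult_ac)
    also have "\<dots> = emeasure lborel X * pair_diff v E Y" by (simp add: nn_integral_multc)
    finally show ?thesis .
  qed
  finally show ?thesis .
qed

end

text \<open>A Poincare inequality between two sets, whose constant may depend on the sets but not on
  \<open>v\<close>. The goal is \<open>linked D D D\<close>, reached by chaining smaller
  sets.\<close>

definition linked :: "(real ^ 'n) set \<Rightarrow> (real ^ 'n) set \<Rightarrow> (real ^ 'n) set \<Rightarrow> bool" where
  "linked D X Y \<longleftrightarrow> (\<exists>C\<ge>0. \<forall>v. C1_on D v \<longrightarrow> pair_diff v X Y \<le> ennreal C * energy D v)"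

lemma linked_mono: "linked D X' Y' \<Longrightarrow> X \<subseteq> X' \<Longrightarrow> Y \<subseteq> Y' \<Longrightarrow> linked D X Y"
  unfolding linked_def using pair_diff_mono order_trans by meson

text \<open>The rules above ask for a Borel function on the whole space; a function with
  \<open>C1_on D v\<close> is controlled only on \<open>D\<close>, so it is cut off by the
  indicator.\<close>

lemma pair_diff_indicator: "X \<subseteq> D \<Longrightarrow> Y \<subseteq> D \<Longrightarrow> pair_diff (\<lambda>x. indicator D x * v x) X Y = pair_diff v X Y"
  by (rule pair_diff_cong) (auto simp: indicator_def)

lemma emeasure_open_bounded:
  fixes A :: "(real ^ 'n) set"
  assumes "open A" "bounded A"
  shows "emeasure lborel A = ennreal (measure lebesgue A)"
  using emeasure_eq_measure2[of A lebesgue] assms lmeasurable_open[OF assms(2,1)] by simp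

context
  fixes D :: "(real ^ 'n) set"
  assumes D: "open D" "bounded D"
begin

lemma linked_sym:
  assumes "linked D X Y" "open X" "open Y" "X \<subseteq> D" "Y \<subseteq> D"
  shows "linked D Y X"
proof -
  have "pair_diff v Y X = pair_diff v X Y" if "C1_on D v" for v
  proof -
    have "(\<lambda>x. indicator D x * v x) \<in> borel_measurable borel"
      using C1_on_continuous[OF that] D(1) by (rule borel_measurable_indicator_continuous[rotated])
    from pair_diff_sym[OF this, of X Y] show ?thesis using assms by (simp add: pair_diff_indicator)
  qed
  then show ?thesis using assms(1) unfolding linked_def by auto
qed

lemma linked_Un:
  assumes "linked D X Y" "linked D X' Y" "open X" "open X'" "open Y" "X \<subseteq> D" "X' \<subseteq> D" "Y \<subseteq> D"
  shows "linked D (X \<union> X') Y"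
proof -
  obtain C where C: "C \<ge> 0" "\<And>v. C1_on D v \<Longrightarrow> pair_diff v X Y \<le> ennreal C * energy D v"
    using assms(1) unfolding linked_def by auto
  obtain C' where C': "C' \<ge> 0" "\<And>v. C1_on D v \<Longrightarrow> pair_diff v X' Y \<le> ennreal C' * energy D v"
    using assms(2) unfolding linked_def by auto
  have "pair_diff v (X \<union> X') Y \<le> ennreal (C + C') * energy D v" if v: "C1_on D v" for v
  proof -
    have "(\<lambda>x. indicator D x * v x) \<in> borel_measurable borel"
      using C1_on_continuous[OF v] D(1) by (rule borel_measurable_indicator_continuous[rotated])
    from pair_diff_Un[OF this, of X X' Y]
    have "pair_diff v (X \<union> X') Y \<le> pair_diff v X Y + pair_diff v X' Y"
      using assms by (simp add: pair_diff_indicator)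
    also have "\<dots> \<le> ennreal C * energy D v + ennreal C' * energy D v" by (intro add_mono C C' v)
    also have "\<dots> = ennreal (C + C') * energy D v" using C(1) C'(1) by (simp add: distrib_right)
    finally show ?thesis .
  qed
  then show ?thesis unfolding linked_def using C(1) C'(1) by (intro exI[of _ "C + C'"]) auto
qed

text \<open>The nonempty open set \<open>E\<close> has positive measure, so the factor in front of
  \<open>pair_diff v X Y\<close> in \<open>pair_diff_trans\<close> can be divided out.\<close>

lemma linked_trans:
  assumes "linked D X E" "linked D E Y" "open X" "open E" "open Y" "X \<subseteq> D" "E \<subseteq> D" "Y \<subseteq> D" "E \<noteq> {}"
  shows "linked D X Y"
proof -
  obtain C where C: "C \<ge> 0" "\<And>v. C1_on D v \<Longrightarrow> pair_diff v X E \<le> ennreal C * energy D v"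
    using assms(1) unfolding linked_def by auto
  obtain C' where C': "C' \<ge> 0" "\<And>v. C1_on D v \<Longrightarrow> pair_diff v E Y \<le> ennreal C' * energy D v"
    using assms(2) unfolding linked_def by auto
  define e x y where "e = measure lebesgue E" and "x = measure lebesgue X" and "y = measure lebesgue Y"
  have bd: "bounded X" "bounded E" "bounded Y" using assms D bounded_subset by blast+
  have em: "emeasure lborel E = ennreal e" "emeasure lborel X = ennreal x" "emeasure lborel Y = ennreal y"
    unfolding e_def x_def y_def by (simp_all only: emeasure_open_bounded assms bd)
  have "\<not> negligible E" using assms open_not_negligible by blast
  then have e: "e > 0" unfolding e_def using negligible_iff_measure zero_less_measure_iff lmeasurable_open[OF bd(2) assms(4)] by blast
  have xy: "x \<ge> 0" "y \<ge> 0" by (simp_all add: x_def y_def)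
  have "pair_diff v X Y \<le> ennreal ((y * C + x * C') / e) * energy D v" if v: "C1_on D v" for v
  proof -
    have "(\<lambda>x. indicator D x * v x) \<in> borel_measurable borel"
      using C1_on_continuous[OF v] D(1) by (rule borel_measurable_indicator_continuous[rotated])
    from pair_diff_trans[OF this, of X Y E]
    have "ennreal e * pair_diff v X Y \<le> ennreal y * pair_diff v X E + ennreal x * pair_diff v E Y"
      using assms by (simp add: pair_diff_indicator em)
    also have "\<dots> \<le> ennreal y * (ennreal C * energy D v) + ennreal x * (ennreal C' * energy D v)"
      by (intro add_mono mult_left_mono C C' v) auto
    also have "\<dots> = ennreal (y * C + x * C') * energy D v"
      using C(1) C'(1) xy by (simp add: distrib_right ennreal_mult mult.assoc)
    finally have "ennreal (1 / e) * (ennreal e * pair_diff v X Y) \<le> ennreal (1 / e) * (ennreal (y * C + x * C') * energy D v)"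
      by (rule mult_left_mono) simp
    moreover have "ennreal (1 / e) * (ennreal e * pair_diff v X Y) = pair_diff v X Y"
      using e by (simp add: mult.assoc[symmetric] flip: ennreal_mult)
    moreover have "ennreal (1 / e) * (ennreal (y * C + x * C') * energy D v) = ennreal ((y * C + x * C') / e) * energy D v"
      using e C(1) C'(1) xy by (simp add: mult.assoc[symmetric] del: ennreal_plus flip: ennreal_mult)
    ultimately show ?thesis by simp
  qed
  then show ?thesis unfolding linked_def using e C(1) C'(1) xy
    by (intro exI[of _ "(y * C + x * C') / e"]) auto
qed

lemma linked_star:
  assumes "open U" "open B" "U \<subseteq> D" "B \<subseteq> D" "\<And>x y. x \<in> U \<Longrightarrow> y \<in> B \<Longrightarrow> closed_segment x y \<subseteq> D"
  shows "linked D U B"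
proof -
  obtain d where d: "\<And>x y. x \<in> D \<Longrightarrow> y \<in> D \<Longrightarrow> norm (y - x) \<le> d"
    using D(2) by (metis bounded_two_points dist_norm norm_minus_commute)
  define C where "C = max 0 d * 2 ^ CARD('n) * (measure lebesgue U + measure lebesgue B)"
  have bd: "bounded U" "bounded B" using assms D bounded_subset by blast+
  have C: "C \<ge> 0" by (simp add: C_def)
  have "pair_diff v U B \<le> ennreal C * energy D v" if v: "C1_on D v" for v
  proof -
    have "pair_diff v U B \<le> ennreal (max 0 d) * ennreal (2 ^ CARD('n)) * (emeasure lborel U + emeasure lborel B) * energy D v"
    proof (rule pair_diff_star[OF D(1) v])
      fix x y assume "x \<in> U" "y \<in> B"
      then show "norm (y - x) \<le> max 0 d" using d[of x y] assms by (auto simp: le_max_iff_disj)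
    qed (use assms in auto)
    also have "emeasure lborel U + emeasure lborel B = ennreal (measure lebesgue U + measure lebesgue B)"
      using assms bd by (simp add: emeasure_open_bounded)
    finally show ?thesis unfolding C_def by (simp add: ennreal_mult)
  qed
  then show ?thesis unfolding linked_def using C by blast
qed

text \<open>A maximal linked union of members of the cover is disjoint from all other members.\<close>

lemma linked_connected_cover:
  assumes fin: "finite \<U>" and cov: "\<Union>\<U> = D" and op: "\<And>U. U \<in> \<U> \<Longrightarrow> open U" "\<And>U. U \<in> \<U> \<Longrightarrow> U \<noteq> {}"
    and lk: "\<And>U. U \<in> \<U> \<Longrightarrow> linked D U U" and con: "connected D" "D \<noteq> {}"
  shows "linked D D D"
proof -
  let ?S = "{\<V>. \<V> \<subseteq> \<U> \<and> \<V> \<noteq> {} \<and> linked D (\<Union>\<V>) (\<Union>\<V>)}"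
  obtain U0 where U0: "U0 \<in> \<U>" using cov con(2) by auto
  have "{U0} \<in> ?S" using U0 lk by simp
  moreover have "finite ?S" by (rule finite_subset[of _ "Pow \<U>"]) (blast, simp add: fin)
  ultimately have "Max (card ` ?S) \<in> card ` ?S"
    using Max_in[of "card ` ?S"] by blast
  then obtain \<V> where \<V>0: "\<V> \<in> ?S" "Max (card ` ?S) = card \<V>" by (rule imageE)
  have "card \<W> \<le> card \<V>" if "\<W> \<in> ?S" for \<W>
    using Max_ge[OF finite_imageI[OF \<open>finite ?S\<close>] imageI[OF that, of card]] unfolding \<V>0(2) .
  note \<V> = \<V>0(1) this
  have disj: "U \<inter> \<Union>\<V> = {}" if U: "U \<in> \<U> - \<V>" for U
  proof (rule ccontr)
    assume ne: "U \<inter> \<Union>\<V> \<noteq> {}"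
    have o: "open U" "open (\<Union>\<V>)" "U \<subseteq> D" "\<Union>\<V> \<subseteq> D" using U \<V>(1) op cov by (auto intro!: open_Union)
    have l1: "linked D U U" "linked D (\<Union>\<V>) (\<Union>\<V>)" using U lk \<V>(1) by auto
    \<comment> \<open>Two sets, each linked with itself, are linked to each other through their
      intersection, which here is open and nonempty.\<close>
    have l2: "linked D U (\<Union>\<V>)"
    proof (rule linked_trans[where E="U \<inter> \<Union>\<V>"])
      show "linked D U (U \<inter> \<Union>\<V>)" by (rule linked_mono[OF l1(1)]) auto
      show "linked D (U \<inter> \<Union>\<V>) (\<Union>\<V>)" by (rule linked_mono[OF l1(2)]) auto
      show "U \<inter> \<Union>\<V> \<subseteq> D" using o(3) by blast
    qed (use o ne in \<open>simp_all only: open_Int not_False_eq_True\<close>)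
    have l3: "linked D (\<Union>\<V>) U" by (rule linked_sym[OF l2]) (fact o)+
    have l4: "linked D (U \<union> \<Union>\<V>) U" by (rule linked_Un[OF l1(1) l3]) (fact o)+
    have l5: "linked D (U \<union> \<Union>\<V>) (\<Union>\<V>)" by (rule linked_Un[OF l2 l1(2)]) (fact o)+
    have o': "open (U \<union> \<Union>\<V>)" "U \<union> \<Union>\<V> \<subseteq> D" using o by (auto intro: open_Un)
    have "linked D U (U \<union> \<Union>\<V>)" by (rule linked_sym[OF l4]) (fact o o')+
    moreover have "linked D (\<Union>\<V>) (U \<union> \<Union>\<V>)" by (rule linked_sym[OF l5]) (fact o o')+
    ultimately have "linked D (U \<union> \<Union>\<V>) (U \<union> \<Union>\<V>)" by (rule linked_Un) (fact o o')+
    then have "insert U \<V> \<in> ?S" using U \<V>(1) by auto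
    then have "card (insert U \<V>) \<le> card \<V>" by (rule \<V>(2))
    moreover have "finite \<V>" using \<V>(1) fin finite_subset by blast
    ultimately show False using U by simp
  qed
  \<comment> \<open>Otherwise the two unions would separate the connected set
    \<open>D\<close>.\<close>
  have "\<Union>(\<U> - \<V>) = {}"
  proof (rule ccontr)
    assume "\<Union>(\<U> - \<V>) \<noteq> {}"
    moreover have "open (\<Union>(\<U> - \<V>))" "open (\<Union>\<V>)" using op \<V>(1) by (auto intro!: open_Union)
    moreover have "\<Union>\<V> \<noteq> {}" using \<V>(1) op(2) by auto
    moreover have "D \<subseteq> \<Union>(\<U> - \<V>) \<union> \<Union>\<V>" "\<Union>\<V> \<subseteq> D" "\<Union>(\<U> - \<V>) \<subseteq> D" using cov \<V>(1) by auto
    moreover have "\<Union>(\<U> - \<V>) \<inter> \<Union>\<V> = {}" using disj by auto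
    ultimately show False using connectedD[OF con(1), of "\<Union>(\<U> - \<V>)" "\<Union>\<V>"]
      by (simp add: Int_absorb2) blast
  qed
  then have "\<Union>\<V> = D" using cov \<V>(1) by blast
  then show ?thesis using \<V>(1) by auto
qed

end

text \<open>At a boundary point \<open>p\<close> take for \<open>B\<close> a small ball around \<open>p - t *\<^sub>R e\<close>: segments from points
  near \<open>p\<close> to \<open>B\<close> descend more steeply than the Lipschitz constant of the graph.\<close>

lemma lipschitz_star_shaped:
  fixes D :: "(real ^ 'n) set"
  assumes D: "open D" "lipschitz_boundary D" and p: "p \<in> closure D"
  obtains s B where "s > 0" "open B" "B \<noteq> {}" "B \<subseteq> D" "\<And>x y. x \<in> D \<inter> ball p s \<Longrightarrow> y \<in> B \<Longrightarrow> closed_segment x y \<subseteq> D"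
proof (cases "p \<in> D")
  case True
  then obtain s where s: "s > 0" "ball p s \<subseteq> D" using D open_contains_ball by metis
  show thesis
  proof (rule that[of s "ball p s"])
    fix x y assume "x \<in> D \<inter> ball p s" "y \<in> ball p s"
    then have "closed_segment x y \<subseteq> ball p s" by (intro closed_segment_subset) auto
    then show "closed_segment x y \<subseteq> D" using s by auto
  qed (use s in auto)
next
  case False
  then have "p \<in> frontier D" using p D(1) by (simp add: frontier_def interior_open)
  with D(2) have "\<exists>r>0. \<exists>e. norm e = 1 \<and> (\<exists>g :: real ^ 'n \<Rightarrow> real. \<exists>L.
        L-lipschitz_on {y. y \<bullet> e = 0} g \<and> D \<inter> ball p r = {x \<in> ball p r. x \<bullet> e < g (x - (x \<bullet> e) *\<^sub>R e)})"
    unfolding lipschitz_boundary_def by blast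
  then obtain r e g L where r: "r > 0" and e: "norm e = 1" and g: "L-lipschitz_on {y. y \<bullet> e = 0} (g :: real ^ 'n \<Rightarrow> real)"
    and Dr: "D \<inter> ball p r = {x \<in> ball p r. x \<bullet> e < g (x - (x \<bullet> e) *\<^sub>R e)}"
    by (elim exE conjE) (rule that)
  have L: "L \<ge> 0" using g lipschitz_on_nonneg by blast
  have ee: "e \<bullet> e = 1" using e by (simp add: dot_square_norm)
  \<comment> \<open>The choice of \<open>t\<close> keeps \<open>B\<close> inside
    \<open>ball p r\<close>. Moving each end point by less than \<open>s\<close> costs at most
    \<open>2 * s\<close> in height and \<open>2 * s * L\<close> in the graph, together no more than
    the descent \<open>t\<close>.\<close>
  define t where "t = r / 2"
  define s where "s = t / (2 * (L + 1))"
  have t: "t > 0" using r by (simp add: t_def)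
  have s: "s > 0" "2 * s * (L + 1) \<le> t" using t L by (auto simp: s_def field_simps)
  have "s * 1 \<le> s * (L + 1)" using s(1) L by (intro mult_left_mono) auto
  then have st: "2 * s \<le> t" using s(2) by linarith
  define B where "B = ball (p - t *\<^sub>R e) s"
  have seg: "closed_segment x y \<subseteq> D" if x: "x \<in> D \<inter> ball p s" and y: "y \<in> B" for x y
  proof
    fix z assume "z \<in> closed_segment x y"
    then obtain l where l: "0 \<le> l" "l \<le> 1" "z = (1 - l) *\<^sub>R x + l *\<^sub>R y" by (auto simp: closed_segment_def)
    have xr: "x \<in> ball p r" using x st t s(1) unfolding t_def by auto
    have "dist p y \<le> dist p (p - t *\<^sub>R e) + dist (p - t *\<^sub>R e) y" by (rule dist_triangle)
    moreover have "dist p (p - t *\<^sub>R e) = t" using e t by (simp add: dist_norm)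
    moreover have "dist (p - t *\<^sub>R e) y < s" using y by (simp add: B_def)
    ultimately have "dist p y < t + t" using st s(1) by linarith
    then have yr: "y \<in> ball p r" by (simp add: t_def)
    have "z \<in> closed_segment x y" using l by (auto simp: closed_segment_def)
    then have zr: "z \<in> ball p r" using closed_segment_subset[OF xr yr convex_ball] by auto
    \<comment> \<open>The deviation of \<open>y - x\<close> from \<open>- t *\<^sub>R e\<close>, so
      that points of the segment are \<open>x + l *\<^sub>R (k - t *\<^sub>R e)\<close> with
      \<open>norm k < 2 * s\<close>.\<close>
    define k where "k = (y - (p - t *\<^sub>R e)) + (p - x)"
    have "norm k \<le> norm (y - (p - t *\<^sub>R e)) + norm (p - x)" unfolding k_def by (rule norm_triangle_ineq)
    moreover have "norm (y - (p - t *\<^sub>R e)) < s" using y by (simp add: B_def dist_norm norm_minus_commute)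
    moreover have "norm (p - x) < s" using x by (simp add: dist_norm)
    ultimately have k: "norm k < 2 * s" by linarith
    have zk: "z = x + l *\<^sub>R (k - t *\<^sub>R e)" unfolding l(3) k_def by (simp add: algebra_simps)
    have ke: "\<bar>k \<bullet> e\<bar> \<le> norm k" using Cauchy_Schwarz_ineq2[of k e] e by simp
    let ?P = "\<lambda>x. x - (x \<bullet> e) *\<^sub>R e"
    have P0: "?P a \<in> {y. y \<bullet> e = 0}" for a by (simp add: inner_diff_left ee)
    have nP: "norm (?P k) \<le> norm k"
    proof -
      have "(norm (?P k))\<^sup>2 = (norm k)\<^sup>2 - (k \<bullet> e)\<^sup>2"
        unfolding power2_norm_eq_inner by (simp add: inner_diff_left inner_diff_right ee inner_commute power2_eq_square)
      also have "\<dots> \<le> (norm k)\<^sup>2" by simp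
      finally show ?thesis by (rule power2_le_imp_le) simp
    qed
    have Pz: "?P z - ?P x = l *\<^sub>R ?P k" unfolding zk by (simp add: inner_add_left inner_diff_left ee algebra_simps)
    have "\<bar>g (?P z) - g (?P x)\<bar> \<le> L * norm (?P z - ?P x)"
      using lipschitz_onD[OF g P0 P0, of z x] by (simp add: dist_norm)
    also have "\<dots> \<le> L * (l * (2 * s))"
      unfolding Pz using nP k l L by (intro mult_left_mono) (auto intro!: mult_left_mono)
    finally have gz: "g (?P x) - L * (l * (2 * s)) \<le> g (?P z)" by (simp add: abs_le_iff)
    have "x \<in> D \<inter> ball p r" using x xr by simp
    then have xg: "x \<bullet> e < g (?P x)" unfolding Dr by simp
    have "z \<bullet> e = x \<bullet> e + l * (k \<bullet> e - t)" unfolding zk by (simp add: inner_add_left inner_diff_left ee)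
    also have "\<dots> \<le> x \<bullet> e + l * (2 * s - t)" using ke k l by (intro add_left_mono mult_left_mono) auto
    also have "\<dots> < g (?P x) + l * (2 * s - t)" using xg by simp
    also have "\<dots> \<le> g (?P x) - L * (l * (2 * s))"
    proof -
      have "l * (2 * s * (L + 1)) \<le> l * t" using s(2) l by (intro mult_left_mono) auto
      then show ?thesis by (simp add: algebra_simps)
    qed
    finally have "z \<bullet> e < g (?P z)" using gz by simp
    then have "z \<in> D \<inter> ball p r" unfolding Dr using zr by simp
    then show "z \<in> D" by simp
  qed
  show thesis
  proof (rule that[OF s(1), of B])
    show "open B" "B \<noteq> {}" using s(1) by (auto simp: B_def)
    \<comment> \<open>There is a point of \<open>D\<close> near \<open>p\<close> because
      \<open>p\<close> is in the closure, and every \<open>y\<close> in \<open>B\<close> ends a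
      segment in \<open>D\<close> that starts there.\<close>
    obtain x where "x \<in> D" "dist x p < s" using p s(1) unfolding closure_approachable by blast
    then have "x \<in> D \<inter> ball p s" by (simp add: dist_commute)
    then show "B \<subseteq> D" using seg by (metis ends_in_segment(2) subsetD subsetI)
  qed (use seg in auto)
qed

text \<open>By compactness of the closure, finitely many patches
  \<open>D \<inter> ball p (s p)\<close> cover \<open>D\<close>. Each is linked with itself by way
  of the set \<open>B p\<close>, to which all its points are joined by segments inside
  \<open>D\<close>.\<close>

lemma linked_lipschitz:
  fixes D :: "(real ^ 'n) set"
  assumes D: "open D" "bounded D" "D \<noteq> {}" "connected D" "lipschitz_boundary D"
  shows "linked D D D"
proof -
  have "\<exists>s B. s > 0 \<and> open B \<and> B \<noteq> {} \<and> B \<subseteq> D \<and> (\<forall>x y. x \<in> D \<inter> ball p s \<longrightarrow> y \<in> B \<longrightarrow> closed_segment x y \<subseteq> D)"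
    if "p \<in> closure D" for p
    using lipschitz_star_shaped[OF D(1,5) that] by metis
  then obtain s B where s: "\<And>p. p \<in> closure D \<Longrightarrow> s p > 0"
    and B: "\<And>p. p \<in> closure D \<Longrightarrow> open (B p) \<and> B p \<noteq> {} \<and> B p \<subseteq> D"
    and sB: "\<And>p x y. p \<in> closure D \<Longrightarrow> x \<in> D \<inter> ball p (s p) \<Longrightarrow> y \<in> B p \<Longrightarrow> closed_segment x y \<subseteq> D"
    by metis
  have "compact (closure D)" using D(2) by (simp add: compact_closure)
  moreover have "closure D \<subseteq> (\<Union>p\<in>closure D. ball p (s p))" using s by force
  ultimately obtain C where C: "C \<subseteq> closure D" "finite C" "closure D \<subseteq> (\<Union>p\<in>C. ball p (s p))"
    using compactE_image[of "closure D" "closure D" "\<lambda>p. ball p (s p)"] by (metis open_ball)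
  define \<U> where "\<U> = (\<lambda>p. D \<inter> ball p (s p)) ` C"
  show ?thesis
  proof (rule linked_connected_cover[OF D(1,2), of \<U>])
    show "finite \<U>" using C(2) by (simp add: \<U>_def)
    show "\<Union>\<U> = D" using C(3) closure_subset[of D] by (fastforce simp: \<U>_def)
    fix U assume "U \<in> \<U>"
    then obtain p where p: "p \<in> closure D" "U = D \<inter> ball p (s p)" using C(1) by (auto simp: \<U>_def)
    show oU: "open U" unfolding p(2) by (intro open_Int D open_ball)
    obtain x where "x \<in> D" "dist x p < s p" using p(1) s[OF p(1)] unfolding closure_approachable by blast
    then have "x \<in> U" by (simp add: p(2) dist_commute)
    then show "U \<noteq> {}" by blast
    have "linked D U (B p)"
      by (rule linked_star[OF D(1,2) oU]) (use B[OF p(1)] sB[OF p(1)] p in auto)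
    then show "linked D U U"
      using B[OF p(1)] oU p(2) linked_sym[OF D(1,2), of U "B p"] by (intro linked_trans[OF D(1,2), of U "B p" U]) auto
  qed (use D in auto)
qed

text \<open>The distance of \<open>v x\<close> to the average is at most the average over
  \<open>y\<close> of \<open>\<bar>v x - v y\<bar>\<close>; the two averages account for the square
  of the measure.\<close>

lemma osc_le_pair_diff:
  fixes A :: "(real ^ 'n) set"
  assumes A: "open A" "bounded A" "A \<noteq> {}" and c: "continuous_on A v" and i: "set_integrable lebesgue A v"
  shows "ennreal ((measure lebesgue A)\<^sup>2 * osc A v) \<le> pair_diff v A A"
proof -
  have [measurable]: "A \<in> sets borel" using A by simp
  define V where "V = measure lebesgue A"
  have "\<not> negligible A" using A open_not_negligible by blast
  then have V: "V > 0" unfolding V_def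
    using negligible_iff_measure zero_less_measure_iff lmeasurable_open[OF A(2,1)] by blast
  define w where "w x = indicator A x * v x" for x
  have w[measurable]: "w \<in> borel_measurable borel" unfolding w_def
    by (rule borel_measurable_indicator_continuous[OF A(1) c])
  have iw: "integrable lborel w" using i w unfolding set_integrable_def w_def by (simp add: integrable_completion)
  have iA: "integrable lborel (indicator A :: real ^ 'n \<Rightarrow> real)" using A by (intro integrable_indicator_bounded) auto
  have intA: "(LINT x|lborel. indicator A x) = V" by (simp add: V_def)
  have av: "avg A v = (LINT y|lborel. w y) / V"
    unfolding V_def w_def by (subst avg_borel) (use w in \<open>auto simp: w_def[abs_def]\<close>)
  have pt: "ennreal (V * \<bar>w x - avg A v\<bar>) \<le> (\<integral>\<^sup>+y. indicator A y * ennreal \<bar>w x - w y\<bar> \<partial>lborel)" for x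
  proof -
    have eq: "indicator A y * (w x - w y) = w x * indicator A y - w y" for y by (auto simp: w_def indicator_def)
    have "V * (w x - avg A v) = w x * V - (LINT y|lborel. w y)" using V by (simp add: av field_simps)
    also have "\<dots> = (LINT y|lborel. indicator A y * (w x - w y))"
      unfolding eq using iw iA intA by simp
    finally have "ennreal (V * \<bar>w x - avg A v\<bar>) = ennreal (norm (LINT y|lborel. indicator A y * (w x - w y)))"
      using V by (metis abs_mult abs_of_pos real_norm_def)
    also have "\<dots> \<le> (\<integral>\<^sup>+y. ennreal (norm (indicator A y * (w x - w y))) \<partial>lborel)"
      using iw iA by (intro integral_norm_bound_ennreal) (simp add: eq)
    also have "\<dots> = (\<integral>\<^sup>+y. indicator A y * ennreal \<bar>w x - w y\<bar> \<partial>lborel)"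
      by (intro nn_integral_cong) (auto simp: indicator_def)
    finally show ?thesis .
  qed
  have o: "osc A v = (LINT x|lborel. indicator A x * \<bar>w x - avg A v\<bar>) / V"
  proof -
    have "avg A (\<lambda>x. \<bar>v x - avg A v\<bar>) = avg A (\<lambda>x. \<bar>w x - avg A v\<bar>)" by (rule avg_cong) (simp add: w_def)
    then show ?thesis unfolding osc_def V_def by (simp add: avg_borel)
  qed
  have "set_integrable lebesgue A (\<lambda>x. \<bar>w x - avg A v\<bar>)"
  proof -
    have "set_integrable lebesgue A w" using i by (simp add: w_def cong: set_integrable_cong)
    then show ?thesis using V unfolding V_def by (rule set_integrable_abs_diff_const[rotated])
  qed
  then have int: "integrable lborel (\<lambda>x. indicator A x * \<bar>w x - avg A v\<bar>)"
    unfolding set_integrable_def by (simp add: integrable_completion)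
  have "ennreal (V\<^sup>2 * osc A v) = ennreal V * ennreal (LINT x|lborel. indicator A x * \<bar>w x - avg A v\<bar>)"
    using V by (simp add: o power2_eq_square flip: ennreal_mult')
  also have "ennreal (LINT x|lborel. indicator A x * \<bar>w x - avg A v\<bar>) = (\<integral>\<^sup>+x. ennreal (indicator A x * \<bar>w x - avg A v\<bar>) \<partial>lborel)"
    by (rule nn_integral_eq_integral[OF int, symmetric]) simp
  also have "ennreal V * \<dots> = (\<integral>\<^sup>+x. indicator A x * ennreal (V * \<bar>w x - avg A v\<bar>) \<partial>lborel)"
    using V by (subst nn_integral_cmult[symmetric]) (auto intro!: nn_integral_cong simp: indicator_def ennreal_mult)
  also have "\<dots> \<le> (\<integral>\<^sup>+x. indicator A x * (\<integral>\<^sup>+y. indicator A y * ennreal \<bar>w x - w y\<bar> \<partial>lborel) \<partial>lborel)"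
    by (intro nn_integral_mono mult_left_mono pt) auto
  also have "\<dots> = pair_diff w A A" unfolding pair_diff_def by (simp add: nn_integral_cmult)
  also have "\<dots> = pair_diff v A A" by (rule pair_diff_cong) (simp add: w_def)
  finally show ?thesis by (simp add: V_def)
qed

locale lipschitz_profile = profile D for D :: "(real ^ 'n) set" +
  assumes connected_D: "connected D" and lipschitz_D: "lipschitz_boundary D"
begin

text \<open>Under rescaling to \<open>D\<close> the oscillation is unchanged, while the gradient
  gains a factor \<open>\<epsilon>\<close> and the volume a factor
  \<open>\<epsilon> ^ CARD('n)\<close>. The power of \<open>\<epsilon>\<close> on the left is the
  one that makes the constant independent of \<open>\<epsilon>\<close> and
  \<open>x0\<close>.\<close>

lemma poincare:
  obtains C where "C > 0" "\<And>v x0 \<epsilon>. \<epsilon> > 0 \<Longrightarrow> C1_on (translate x0 \<epsilon>) v \<Longrightarrow> set_integrable lebesgue (translate x0 \<epsilon>) v \<Longrightarrow>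
    ennreal (\<epsilon> ^ (CARD('n) - 1) * osc (translate x0 \<epsilon>) v) \<le> ennreal C * energy (translate x0 \<epsilon>) v"
proof -
  obtain C0 where C0: "C0 \<ge> 0" "\<And>v. C1_on D v \<Longrightarrow> pair_diff v D D \<le> ennreal C0 * energy D v"
    using linked_lipschitz[OF open_D bounded_D D_ne connected_D lipschitz_D] unfolding linked_def by auto
  define V where "V = measure lebesgue D"
  have V: "V > 0" using measure_D_pos by (simp add: V_def)
  \<comment> \<open>Adding 1 makes the constant positive even if \<open>C0 = 0\<close>.\<close>
  define C where "C = (C0 + 1) / V\<^sup>2"
  have C: "C > 0" using C0 V by (simp add: C_def)
  show thesis
  proof (rule that[OF C])
    fix v and x0 :: "real ^ 'n" and \<epsilon> :: real
    assume e: "\<epsilon> > 0" and v: "C1_on (translate x0 \<epsilon>) v" and i: "set_integrable lebesgue (translate x0 \<epsilon>) v"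
    let ?T = "\<lambda>y. x0 + \<epsilon> *\<^sub>R y" and ?A = "translate x0 \<epsilon>"
    have oA: "open ?A" using translate_facts[OF e] by auto
    then have [measurable]: "?A \<in> sets borel" "D \<in> sets borel" using open_D by auto
    define w where "w y = v (?T y)" for y
    have w: "(w has_derivative (\<lambda>h. (\<epsilon> *\<^sub>R grad v (?T y)) \<bullet> h)) (at y)" if "y \<in> D" for y
    proof -
      have "(v has_derivative (\<lambda>h. grad v (?T y) \<bullet> h)) (at (?T y))"
        using v that unfolding C1_on_def by (intro has_derivative_grad) blast
      moreover have "(?T has_derivative (\<lambda>h. \<epsilon> *\<^sub>R h)) (at y)" by (auto intro!: derivative_eq_intros)
      ultimately have "((\<lambda>y. v (?T y)) has_derivative (\<lambda>h. grad v (?T y) \<bullet> (\<epsilon> *\<^sub>R h))) (at y)"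
        using has_derivative_compose by blast
      then show ?thesis unfolding w_def by simp
    qed
    have gw: "grad w y = \<epsilon> *\<^sub>R grad v (?T y)" if "y \<in> D" for y by (rule grad_eqI[OF w[OF that]])
    have C1w: "C1_on D w" unfolding C1_on_def
    proof
      show "\<forall>x\<in>D. w differentiable at x" using w by (auto simp: differentiable_def)
      have "continuous_on D (\<lambda>y. \<epsilon> *\<^sub>R grad v (?T y))"
        using v unfolding C1_on_def by (intro continuous_on_scaleR continuous_on_const continuous_on_compose2[of ?A "grad v" D ?T] continuous_on_add continuous_on_id) auto
      then show "continuous_on D (grad w)" using gw by (simp cong: continuous_on_cong)
    qed
    have mv: "(\<lambda>x. indicator ?A x * v x) \<in> borel_measurable borel"
      by (rule borel_measurable_indicator_continuous[OF oA C1_on_continuous[OF v]])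
    have iv: "integrable lborel (\<lambda>x. indicator ?A x * v x)"
      using i mv unfolding set_integrable_def by (simp add: integrable_completion)
    have "integrable lborel (\<lambda>y. indicator ?A (?T y) * v (?T y))"
      using integrable_lborel_affine[OF iv, of \<epsilon> x0] e by simp
    then have "integrable lborel (\<lambda>y. indicator D y *\<^sub>R w y)"
      using e by (simp add: indicator_affine_image w_def)
    then have iw: "set_integrable lebesgue D w" unfolding set_integrable_def
      by (subst integrable_completion) auto
    have osc: "osc ?A v = osc D w" unfolding w_def by (rule osc_affine[OF open_D e mv])
    have E: "energy D w = ennreal \<epsilon> * (\<integral>\<^sup>+y. ennreal (indicator ?A (?T y) * norm (grad v (?T y))) \<partial>lborel)"
    proof -
      have m: "(\<lambda>y. ennreal (indicator ?A y * norm (grad v y))) \<in> borel_measurable borel"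
        using borel_measurable_indicator_continuous[OF oA, of "\<lambda>x. norm (grad v x)"] v
        by (auto simp: C1_on_def intro!: measurable_compose[OF _ measurable_ennreal] continuous_intros)
      have m2: "(\<lambda>y. ennreal (indicator ?A (?T y) * norm (grad v (?T y)))) \<in> borel_measurable borel"
        by (rule measurable_compose[OF _ m]) simp
      have "energy D w = (\<integral>\<^sup>+y. ennreal \<epsilon> * ennreal (indicator ?A (?T y) * norm (grad v (?T y))) \<partial>lborel)"
        unfolding energy_def using e
        by (intro nn_integral_cong) (auto simp: indicator_affine_image gw indicator_def simp flip: ennreal_mult)
      then show ?thesis using m2 by (simp add: nn_integral_cmult)
    qed
    have E2: "energy ?A v = ennreal (\<epsilon> ^ CARD('n)) * (\<integral>\<^sup>+y. ennreal (indicator ?A (?T y) * norm (grad v (?T y))) \<partial>lborel)"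
    proof -
      have m: "(\<lambda>y. ennreal (indicator ?A y * norm (grad v y))) \<in> borel_measurable borel"
        using borel_measurable_indicator_continuous[OF oA, of "\<lambda>x. norm (grad v x)"] v
        by (auto simp: C1_on_def intro!: measurable_compose[OF _ measurable_ennreal] continuous_intros)
      have "energy ?A v = (\<integral>\<^sup>+y. ennreal (indicator ?A y * norm (grad v y)) \<partial>lborel)"
        unfolding energy_def by (intro nn_integral_cong) (auto simp: indicator_def)
      also have "\<dots> = ennreal (\<bar>\<epsilon>\<bar> ^ CARD('n)) * (\<integral>\<^sup>+y. ennreal (indicator ?A (?T y) * norm (grad v (?T y))) \<partial>lborel)"
        using e by (intro nn_integral_lborel_affine m) auto
      finally show ?thesis using e by simp
    qed
    have p: "\<epsilon> ^ (CARD('n) - 1) * \<epsilon> = \<epsilon> ^ CARD('n)"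
      by (rule power_card_minus_one_mult)
    then have EE: "ennreal (\<epsilon> ^ (CARD('n) - 1)) * energy D w = energy ?A v"
      unfolding E E2 using e by (simp add: mult.assoc[symmetric] flip: ennreal_mult)
    have "ennreal (V\<^sup>2 * osc D w) \<le> ennreal C0 * energy D w"
      unfolding V_def using osc_le_pair_diff[OF open_D bounded_D D_ne C1_on_continuous[OF C1w] iw] C0(2)[OF C1w] by simp
    also have "\<dots> \<le> ennreal (C0 + 1) * energy D w" by (intro mult_right_mono ennreal_leI) auto
    finally have "ennreal (\<epsilon> ^ (CARD('n) - 1) / V\<^sup>2) * ennreal (V\<^sup>2 * osc D w) \<le>
      ennreal (\<epsilon> ^ (CARD('n) - 1) / V\<^sup>2) * (ennreal (C0 + 1) * energy D w)" by (rule mult_left_mono) simp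
    moreover have "ennreal (\<epsilon> ^ (CARD('n) - 1) / V\<^sup>2) * ennreal (V\<^sup>2 * osc D w) = ennreal (\<epsilon> ^ (CARD('n) - 1) * osc ?A v)"
      using V e osc_nonneg[of D w] by (simp add: osc flip: ennreal_mult)
    moreover have "ennreal (\<epsilon> ^ (CARD('n) - 1) / V\<^sup>2) * (ennreal (C0 + 1) * energy D w) = ennreal C * energy ?A v"
    proof -
      have "ennreal (\<epsilon> ^ (CARD('n) - 1) / V\<^sup>2) * ennreal (C0 + 1) = ennreal C * ennreal (\<epsilon> ^ (CARD('n) - 1))"
        using V e C0(1) C by (simp add: C_def mult.commute del: ennreal_plus flip: ennreal_mult)
      then show ?thesis unfolding EE[symmetric] by (simp add: mult.assoc[symmetric])
    qed
    ultimately show "ennreal (\<epsilon> ^ (CARD('n) - 1) * osc ?A v) \<le> ennreal C * energy ?A v" by simp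
  qed
qed

end

section \<open>Upper bound for functions of class \<open>C\<^sup>1\<close>\<close>

text \<open>The induction uses the identity with the intersection, which avoids a subtraction in
  \<open>ennreal\<close>.\<close>

lemma sum_UN_le_sum:
  fixes q :: "'a \<Rightarrow> ennreal"
  assumes "finite J" "\<And>G. G \<in> J \<Longrightarrow> finite (H G)"
  shows "sum q (\<Union>G\<in>J. H G) \<le> (\<Sum>G\<in>J. sum q (H G))"
  using assms
proof (induction J)
  case (insert G J)
  let ?U = "\<Union>G\<in>J. H G"
  have "sum q (H G \<union> ?U) \<le> sum q (H G \<union> ?U) + sum q (H G \<inter> ?U)" by simp
  also have "\<dots> = sum q (H G) + sum q ?U" using insert by (intro sum.union_inter) auto
  finally have "sum q (\<Union>G\<in>insert G J. H G) \<le> sum q (H G) + sum q ?U" by simp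
  also have "\<dots> \<le> sum q (H G) + (\<Sum>G\<in>J. sum q (H G))" using insert by (intro add_left_mono) auto
  finally show ?case using insert by simp
qed simp

context lipschitz_profile
begin

lemma measurable_indicator_grad:
  assumes "open A" "C1_on A v"
  shows "(\<lambda>x. ennreal (indicator A x * norm (grad v x))) \<in> borel_measurable borel"
    and "(\<lambda>x. ennreal (indicator A x * psi D (grad v x))) \<in> borel_measurable borel"
proof -
  have g: "continuous_on A (grad v)" using assms(2) by (simp add: C1_on_def)
  show "(\<lambda>x. ennreal (indicator A x * norm (grad v x))) \<in> borel_measurable borel"
    using borel_measurable_indicator_continuous[OF assms(1) continuous_on_norm[OF g]] by simp
  show "(\<lambda>x. ennreal (indicator A x * psi D (grad v x))) \<in> borel_measurable borel"
    using borel_measurable_indicator_continuous[OF assms(1) continuous_on_compose2[OF continuous_on_psi[of UNIV] g]] by simp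
qed

text \<open>Finite energy sits, up to \<open>\<eta>0\<close>, on finitely many cubes with almost
  constant gradient, and even on a compact subset \<open>K\<close> of their union. Compactness is
  wanted because it provides a Lebesgue number for the cover of \<open>K\<close> by the
  cubes.\<close>

lemma concentrate_on_cubes:
  fixes v :: "real ^ 'n \<Rightarrow> real"
  assumes A: "open A" and v: "C1_on A v" and fin: "energy A v < \<infinity>" and \<eta>0: "\<eta>0 > 0"
  obtains J K \<eta> where "finite J" "pairwise disjnt J"
    "\<And>G. G \<in> J \<Longrightarrow> \<exists>u v s. G = box u v \<and> s > 0 \<and> (\<forall>i. v $ i - u $ i = s)"
    "\<And>G. G \<in> J \<Longrightarrow> G \<subseteq> A" "\<eta> > 0"
    "\<And>G x y. G \<in> J \<Longrightarrow> x \<in> G \<Longrightarrow> y \<in> G \<Longrightarrow> norm (grad v x - grad v y) \<le> \<eta>"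
    "\<eta> * (\<Sum>G\<in>J. measure lebesgue G) \<le> \<eta>0"
    "compact K" "K \<subseteq> \<Union>J" "energy (A - K) v \<le> ennreal \<eta>0"
proof (cases "energy A v \<le> ennreal \<eta>0")
  \<comment> \<open>If the total energy is at most \<open>\<eta>0\<close>, the empty family works;
    otherwise \<open>E - \<eta>0\<close> is positive, so \<open>ennreal\<close> does not truncate
    it.\<close>
  case True
  show thesis by (rule that[of "{}" 1 "{}"]) (use True \<eta>0 in auto)
next
  case False
  define f where "f x = ennreal (indicator A x * norm (grad v x))" for x
  have f[measurable]: "f \<in> borel_measurable borel" unfolding f_def by (rule measurable_indicator_grad[OF A v])
  have [measurable]: "A \<in> sets borel" using A by simp
  have ef: "energy S v = (\<integral>\<^sup>+x\<in>S. f x \<partial>lborel)" if "S \<subseteq> A" for S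
    unfolding energy_def f_def using that by (intro nn_integral_cong) (auto simp: indicator_def)
  obtain E where E: "energy A v = ennreal E" "E \<ge> 0" using fin by (cases "energy A v") auto
  have E0: "E > \<eta>0" using False E \<eta>0 by (simp add: not_le ennreal_less_iff)
  have "ennreal (E - \<eta>0) < energy A v" using E E0 \<eta>0 by (simp add: ennreal_less_iff)
  then have c: "ennreal (E - \<eta>0) < (\<integral>\<^sup>+x\<in>A. f x \<partial>lborel)" using ef by simp
  obtain m where m: "m > 0" "ennreal (E - \<eta>0) < (\<integral>\<^sup>+x\<in>A \<inter> cbox (\<chi> i. - m) (\<chi> i. m). f x \<partial>lborel)"
    using nn_integral_exhaust_cbox[OF _ f c] by auto
  define B :: "(real ^ 'n) set" where "B = cbox (\<chi> i. - m) (\<chi> i. m)"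
  define V where "V = measure lebesgue B"
  define \<eta> where "\<eta> = \<eta>0 / (V + 1)"
  have V: "V \<ge> 0" by (simp add: V_def)
  have \<eta>: "\<eta> > 0" "\<eta> * V \<le> \<eta>0" using V \<eta>0 by (auto simp: \<eta>_def field_simps)
  have g: "continuous_on A (grad v)" using v by (simp add: C1_on_def)
  obtain J where J: "finite J" "pairwise disjnt J"
      "\<And>G. G \<in> J \<Longrightarrow> \<exists>u v s. G = box u v \<and> s > 0 \<and> (\<forall>i. v $ i - u $ i = s)"
      "\<And>G. G \<in> J \<Longrightarrow> G \<subseteq> A \<inter> B"
      "\<And>G x y. G \<in> J \<Longrightarrow> x \<in> G \<Longrightarrow> y \<in> G \<Longrightarrow> norm (grad v x - grad v y) \<le> \<eta>"
      "ennreal (E - \<eta>0) < (\<integral>\<^sup>+x\<in>\<Union>J. f x \<partial>lborel)"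
    by (rule finite_cubes[OF A g \<eta>(1) m(1) f m(2), folded B_def]) blast
  note Jc = cube_facts[OF J(3)]
  have oJ: "open (\<Union>J)" using Jc(2) by (intro open_Union) auto
  obtain C where C: "\<And>n. compact (C n)" "\<And>n. C n \<subseteq> \<Union>J" "\<And>n. C n \<subseteq> interior (C (Suc n))" "\<Union>(range C) = \<Union>J"
    using open_Union_compact_subsets[OF oJ] by metis
  have [measurable]: "C n \<in> sets borel" for n using C(1) by (simp add: borel_compact)
  have em: "emeasure (density lborel f) S = (\<integral>\<^sup>+x\<in>S. f x \<partial>lborel)" if "S \<in> sets borel" for S
    using that by (simp add: emeasure_density)
  have "incseq C" using C(3) interior_subset by (intro incseq_SucI) blast
  then have "(SUP n. emeasure (density lborel f) (C n)) = emeasure (density lborel f) (\<Union>J)"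
    unfolding C(4)[symmetric] by (intro SUP_emeasure_incseq) auto
  then have "ennreal (E - \<eta>0) < (SUP n. emeasure (density lborel f) (C n))"
    using J(6) em[of "\<Union>J"] oJ by simp
  then obtain n where n: "ennreal (E - \<eta>0) < (\<integral>\<^sup>+x\<in>C n. f x \<partial>lborel)" by (auto simp: less_SUP_iff em)
  have CA: "C n \<subseteq> A" using C(2)[of n] J(4) by blast
  show thesis
  proof (rule that[OF J(1-3) _ \<eta>(1) J(5) _ C(1)[of n] C(2)[of n]])
    have "(\<Sum>G\<in>J. measure lebesgue G) = measure lebesgue (\<Union>J)"
      using J(1,2) Jc(5) by (intro measure_Union'[symmetric]) auto
    also have "\<dots> \<le> V" unfolding V_def using J(4) oJ
      by (intro measure_mono_fmeasurable) (auto simp: B_def)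
    finally show "\<eta> * (\<Sum>G\<in>J. measure lebesgue G) \<le> \<eta>0"
      using \<eta> by (meson mult_left_mono less_imp_le order_trans)
    \<comment> \<open>The subtraction is carried out in the reals: the energies on
      \<open>C n\<close> and on \<open>A - C n\<close> become \<open>q\<close> and \<open>r\<close>
      with \<open>E = q + r\<close>.\<close>
    have "ennreal E = emeasure (density lborel f) (C n \<union> (A - C n))"
      using E ef[of A] em[of A] CA by (simp add: Un_absorb1)
    also have "\<dots> = emeasure (density lborel f) (C n) + emeasure (density lborel f) (A - C n)"
      by (intro plus_emeasure[symmetric]) auto
    also have "emeasure (density lborel f) (A - C n) = energy (A - C n) v" by (subst em) (auto simp: ef)
    finally have eq: "ennreal E = emeasure (density lborel f) (C n) + energy (A - C n) v" .
    then have "energy (A - C n) v \<le> ennreal E" by simp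
    then obtain r where r: "energy (A - C n) v = ennreal r" "r \<ge> 0" by (cases "energy (A - C n) v") (auto simp: top_unique)
    have "emeasure (density lborel f) (C n) \<le> ennreal E" unfolding eq by simp
    then obtain q where q: "emeasure (density lborel f) (C n) = ennreal q" "q \<ge> 0"
      by (cases "emeasure (density lborel f) (C n)") (auto simp: top_unique)
    have "E = q + r" using eq q r E(2) by (simp flip: ennreal_plus)
    moreover have "ennreal (E - \<eta>0) < ennreal q" unfolding q(1)[symmetric] using n em[of "C n"] by simp
    then have "E - \<eta>0 < q" using E0 by (simp add: ennreal_less_iff)
    ultimately show "energy (A - C n) v \<le> ennreal \<eta>0" unfolding r(1) by (intro ennreal_leI) simp
  qed (use J(4) in auto)
qed

text \<open>Once its diameter is below a Lebesgue number, a translate that meets \<open>K\<close>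
  lies in one cube; there it counts towards the packing number, and its oscillation is nearly that
  of a linear function. The others are disjoint subsets of \<open>A - K\<close>, and by the Poincare
  inequality they contribute at most \<open>CP * \<eta>0\<close> altogether.\<close>

lemma H_eps_limsup_C1:
  fixes v :: "real ^ 'n \<Rightarrow> real"
  assumes A: "open A" and v: "C1_on A v" and i: "set_integrable lebesgue A v" and fin: "energy A v < \<infinity>"
  shows "Limsup (at_right 0) (\<lambda>\<epsilon>. H_eps D A \<epsilon> v) \<le> (\<integral>\<^sup>+x\<in>A. ennreal (psi D (grad v x)) \<partial>lborel)"
proof (rule ennreal_le_epsilon)
  fix e :: real assume e: "e > 0"
  obtain CP where CP: "CP > 0" "\<And>v x0 \<epsilon>. \<epsilon> > 0 \<Longrightarrow> C1_on (translate x0 \<epsilon>) v \<Longrightarrow> set_integrable lebesgue (translate x0 \<epsilon>) v \<Longrightarrow>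
    ennreal (\<epsilon> ^ (CARD('n) - 1) * osc (translate x0 \<epsilon>) v) \<le> ennreal CP * energy (translate x0 \<epsilon>) v"
    using poincare by blast
  \<comment> \<open>\<open>CP * \<eta>0\<close> pays for the translates off \<open>K\<close>, and
    \<open>2 * psi_lip * \<eta>0\<close> for the variation of the gradient on the cubes.\<close>
  define \<eta>0 where "\<eta>0 = e / (CP + 2 * psi_lip)"
  have "CP + 2 * psi_lip > 0" using CP(1) psi_lip_pos by simp
  then have "\<eta>0 > 0" "(CP + 2 * psi_lip) * \<eta>0 = e" using e by (simp_all add: \<eta>0_def)
  then have \<eta>0: "\<eta>0 > 0" "CP * \<eta>0 + 2 * psi_lip * \<eta>0 = e" by (simp_all add: distrib_right)
  obtain J K \<eta> where J: "finite J" "pairwise disjnt J"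
    "\<And>G. G \<in> J \<Longrightarrow> \<exists>u v s. G = box u v \<and> s > 0 \<and> (\<forall>i. v $ i - u $ i = s)"
    "\<And>G. G \<in> J \<Longrightarrow> G \<subseteq> A" and \<eta>: "\<eta> > 0"
    and osc_J: "\<And>G x y. G \<in> J \<Longrightarrow> x \<in> G \<Longrightarrow> y \<in> G \<Longrightarrow> norm (grad v x - grad v y) \<le> \<eta>"
    and mJ: "\<eta> * (\<Sum>G\<in>J. measure lebesgue G) \<le> \<eta>0"
    and K: "compact K" "K \<subseteq> \<Union>J" "energy (A - K) v \<le> ennreal \<eta>0"
    by (rule concentrate_on_cubes[OF A v fin \<eta>0(1)]) blast
  note Jc = cube_facts[OF J(3)]
  obtain \<delta> where \<delta>: "\<delta> > 0" "\<And>x. x \<in> K \<Longrightarrow> \<exists>G\<in>J. ball x \<delta> \<subseteq> G"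
    using Heine_Borel_lemma[OF K(1,2)] Jc(2) by metis
  define f where "f x = ennreal (indicator A x * norm (grad v x))" for x
  have f[measurable]: "f \<in> borel_measurable borel" unfolding f_def by (rule measurable_indicator_grad[OF A v])
  have ef: "energy S v = (\<integral>\<^sup>+x\<in>S. f x \<partial>lborel)" if "S \<subseteq> A" for S
    unfolding energy_def f_def using that by (intro nn_integral_cong) (auto simp: indicator_def)
  define \<tau> where "\<tau> G = grad v (SOME x. x \<in> G)" for G
  have \<tau>: "norm (grad v x - \<tau> G) \<le> \<eta>" if "G \<in> J" "x \<in> G" for G x
    unfolding \<tau>_def using osc_J[OF that] Jc(1)[OF that(1)] some_in_eq by blast
  define b where "b G = linear_osc (\<tau> G) + 2 * radius * \<eta>" for G
  have b: "b G \<ge> 0" for G using linear_osc_nonneg radius(1) \<eta> by (simp add: b_def)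
  have p: "\<epsilon> ^ (CARD('n) - 1) * \<epsilon> = \<epsilon> ^ CARD('n)" for \<epsilon> :: real
    by (rule power_card_minus_one_mult)
  have up: "\<forall>\<^sub>F \<epsilon> in at_right 0. H_eps D A \<epsilon> v \<le> ennreal ((\<Sum>G\<in>J. packing_density \<epsilon> G * b G) + CP * \<eta>0)"
  proof -
    have "\<delta> / (2 * radius) > 0" using \<delta> radius(1) by simp
    then have "\<forall>\<^sub>F \<epsilon> in at_right 0. \<epsilon> < \<delta> / (2 * radius)"
      by (auto simp: eventually_at_right_field)
    then show ?thesis using eventually_at_right_less[of "0::real"]
    proof eventually_elim
      case (elim \<epsilon>)
      have e0: "\<epsilon> > 0" and e1: "\<epsilon> * (2 * radius) < \<delta>" using elim radius(1) by (auto simp: field_simps)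
      show ?case unfolding H_eps_finite_families[OF e0]
      proof (rule SUP_least)
        fix H assume H: "H \<in> finite_families \<epsilon> D A"
        let ?q = "\<lambda>D'. ennreal (\<epsilon> ^ (CARD('n) - 1) * osc D' v)"
        have fH: "finite H" "pairwise disjnt H" using H by (auto simp: finite_families_def translate_families_def)
        define HG where "HG G = {D'\<in>H. D' \<subseteq> G}" for G
        define H0 where "H0 = {D'\<in>H. D' \<inter> K = {}}"
        have cov: "H \<subseteq> (\<Union>G\<in>J. HG G) \<union> H0"
        proof
          fix D' assume D': "D' \<in> H"
          show "D' \<in> (\<Union>G\<in>J. HG G) \<union> H0"
          proof (cases "D' \<inter> K = {}")
            case False
            then obtain x where x: "x \<in> D'" "x \<in> K" by auto
            obtain x0 where x0: "D' = translate x0 \<epsilon>" using finite_families_memD(2)[OF H D'] by auto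
            obtain G where G: "G \<in> J" "ball x \<delta> \<subseteq> G" using \<delta>(2)[OF x(2)] by auto
            have "D' \<subseteq> ball x \<delta>"
            proof
              fix y assume "y \<in> D'"
              then show "y \<in> ball x \<delta>" using translate_facts(6)[OF e0, of x x0 y] x(1) e1 unfolding x0 by (simp add: dist_norm)
            qed
            then show ?thesis using D' G by (auto simp: HG_def)
          qed (use D' in \<open>auto simp: H0_def\<close>)
        qed
        have part1: "(\<Sum>D'\<in>HG G. ?q D') \<le> ennreal (packing_density \<epsilon> G * b G)" if G: "G \<in> J" for G
        proof -
          have HGf: "HG G \<in> finite_families \<epsilon> D G"
            using H by (auto simp: HG_def finite_families_def translate_families_def pairwise_def)
          have "(\<Sum>D'\<in>HG G. ?q D') \<le> (\<Sum>D'\<in>HG G. ennreal (\<epsilon> ^ CARD('n) * b G))"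
          proof (rule sum_mono, rule ennreal_leI)
            fix D' assume D': "D' \<in> HG G"
            obtain x0 where x0: "D' = translate x0 \<epsilon>" using finite_families_memD(2)[OF HGf D'] by auto
            have "\<bar>osc (translate x0 \<epsilon>) v - \<epsilon> * linear_osc (\<tau> G)\<bar> \<le> \<epsilon> * (2 * radius * \<eta>)"
            proof (rule osc_gradient_close[OF e0 Jc(4)[OF G]])
              show "translate x0 \<epsilon> \<subseteq> G" using D' x0 by (auto simp: HG_def)
              show "v differentiable at x" if "x \<in> G" for x using v J(4)[OF G] that by (auto simp: C1_on_def)
            qed (rule \<tau>[OF G])
            then have "osc D' v \<le> \<epsilon> * b G" unfolding x0 b_def by (simp add: abs_le_iff algebra_simps)
            then have "\<epsilon> ^ (CARD('n) - 1) * osc D' v \<le> \<epsilon> ^ (CARD('n) - 1) * (\<epsilon> * b G)"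
              using e0 by (intro mult_left_mono) auto
            then show "\<epsilon> ^ (CARD('n) - 1) * osc D' v \<le> \<epsilon> ^ CARD('n) * b G"
              by (simp only: p[symmetric] mult.assoc)
          qed
          also have "\<dots> = ennreal (real (card (HG G)) * (\<epsilon> ^ CARD('n) * b G))"
            using e0 b by (simp add: ennreal_of_nat_eq_real_of_nat flip: ennreal_mult)
          also have "\<dots> \<le> ennreal (real (packing_number \<epsilon> G) * (\<epsilon> ^ CARD('n) * b G))"
            using packing_number_ge[OF e0 Jc(3)[OF G] HGf] e0 b by (intro ennreal_leI mult_right_mono) auto
          finally show ?thesis by (simp add: packing_density_def mult_ac)
        qed
        have part2: "(\<Sum>D'\<in>H0. ?q D') \<le> ennreal (CP * \<eta>0)"
        proof -
          have o: "open D'" "D' \<subseteq> A" if "D' \<in> H0" for D'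
            using finite_families_memD[OF H, of D'] that translate_facts(1)[OF e0] by (auto simp: H0_def)
          have "(\<Sum>D'\<in>H0. ?q D') \<le> (\<Sum>D'\<in>H0. ennreal CP * (\<integral>\<^sup>+x\<in>D'. f x \<partial>lborel))"
          proof (rule sum_mono)
            fix D' assume D': "D' \<in> H0"
            then obtain x0 where x0: "D' = translate x0 \<epsilon>" using finite_families_memD(2)[OF H, of D'] by (auto simp: H0_def)
            have "C1_on D' v" using v o[OF D'] C1_on_subset by blast
            moreover have "set_integrable lebesgue D' v" using o[OF D'] by (intro set_integrable_subset[OF i]) auto
            ultimately have "?q D' \<le> ennreal CP * energy D' v" unfolding x0 by (rule CP(2)[OF e0])
            then show "?q D' \<le> ennreal CP * (\<integral>\<^sup>+x\<in>D'. f x \<partial>lborel)" using ef[OF o(2)[OF D']] by simp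
          qed
          also have "\<dots> = ennreal CP * (\<integral>\<^sup>+x\<in>\<Union>H0. f x \<partial>lborel)"
            unfolding sum_distrib_left[symmetric] using fH o(1)
            by (subst nn_integral_Union_boxes) (auto simp: H0_def pairwise_def)
          also have "(\<integral>\<^sup>+x\<in>\<Union>H0. f x \<partial>lborel) \<le> (\<integral>\<^sup>+x\<in>A - K. f x \<partial>lborel)"
            using o(2) by (intro nn_integral_mono) (auto simp: indicator_def H0_def)
          also have "\<dots> = energy (A - K) v" by (simp add: ef)
          also have "\<dots> \<le> ennreal \<eta>0" by (rule K)
          finally show ?thesis using CP(1) \<eta>0(1) by (simp add: ennreal_mult mult_left_mono)
        qed
        have "(\<Sum>D'\<in>H. ?q D') \<le> (\<Sum>D'\<in>(\<Union>G\<in>J. HG G) \<union> H0. ?q D')"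
          using fH J(1) cov by (intro sum_mono2) (auto simp: HG_def H0_def)
        also have "\<dots> \<le> (\<Sum>D'\<in>(\<Union>G\<in>J. HG G). ?q D') + (\<Sum>D'\<in>H0. ?q D')"
          using fH J(1) by (subst sum.union_inter[symmetric]) (auto simp: HG_def H0_def)
        also have "(\<Sum>D'\<in>(\<Union>G\<in>J. HG G). ?q D') \<le> (\<Sum>G\<in>J. \<Sum>D'\<in>HG G. ?q D')"
          using J(1) fH by (intro sum_UN_le_sum) (auto simp: HG_def)
        also have "\<dots> \<le> (\<Sum>G\<in>J. ennreal (packing_density \<epsilon> G * b G))" by (intro sum_mono part1)
        also have "\<dots> = ennreal (\<Sum>G\<in>J. packing_density \<epsilon> G * b G)" using b packing_density_nonneg[OF e0] by (intro sum_ennreal) auto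
        finally have "(\<Sum>D'\<in>H. ?q D') \<le> ennreal (\<Sum>G\<in>J. packing_density \<epsilon> G * b G) + (\<Sum>D'\<in>H0. ?q D')"
          by (simp add: add_right_mono)
        also have "\<dots> \<le> ennreal (\<Sum>G\<in>J. packing_density \<epsilon> G * b G) + ennreal (CP * \<eta>0)" by (intro add_left_mono part2)
        also have "\<dots> = ennreal ((\<Sum>G\<in>J. packing_density \<epsilon> G * b G) + CP * \<eta>0)"
          using b packing_density_nonneg[OF e0] CP(1) \<eta>0(1) by (intro ennreal_plus[symmetric] sum_nonneg) auto
        finally show "(\<Sum>D'\<in>H. ?q D') \<le> ennreal ((\<Sum>G\<in>J. packing_density \<epsilon> G * b G) + CP * \<eta>0)" .
      qed
    qed
  qed
  have "((\<lambda>\<epsilon>. ennreal ((\<Sum>G\<in>J. packing_density \<epsilon> G * b G) + CP * \<eta>0)) \<longlongrightarrow> ennreal ((\<Sum>G\<in>J. \<kappa> * measure lebesgue G * b G) + CP * \<eta>0)) (at_right 0)"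
    by (intro tendsto_ennrealI tendsto_intros Jc)
  then have "Limsup (at_right 0) (\<lambda>\<epsilon>. ennreal ((\<Sum>G\<in>J. packing_density \<epsilon> G * b G) + CP * \<eta>0)) = ennreal ((\<Sum>G\<in>J. \<kappa> * measure lebesgue G * b G) + CP * \<eta>0)"
    by (intro lim_imp_Limsup) auto
  then have L: "Limsup (at_right 0) (\<lambda>\<epsilon>. H_eps D A \<epsilon> v) \<le> ennreal ((\<Sum>G\<in>J. \<kappa> * measure lebesgue G * b G) + CP * \<eta>0)"
    using Limsup_mono[OF up] by simp
  define F where "F x = ennreal (indicator A x * psi D (grad v x))" for x
  have [measurable]: "F \<in> borel_measurable borel" unfolding F_def by (rule measurable_indicator_grad[OF A v])
  \<comment> \<open>\<open>\<kappa> * b G\<close> exceeds \<open>psi D (grad v x)\<close> by at most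
    \<open>2 * psi_lip * \<eta>\<close>: one half comes from the definition of \<open>b\<close>, the
    other from replacing \<open>\<tau> G\<close> by the gradient.\<close>
  have low: "ennreal (\<kappa> * measure lebesgue G * b G) \<le> (\<integral>\<^sup>+x\<in>G. F x \<partial>lborel) + ennreal (2 * psi_lip * \<eta> * measure lebesgue G)"
    if G: "G \<in> J" for G
  proof -
    have [measurable]: "G \<in> sets borel" using Jc(2)[OF G] by simp
    have eG: "emeasure lborel G = ennreal (measure lebesgue G)"
      using Jc(2,3)[OF G] by (rule emeasure_open_bounded)
    have "ennreal (\<kappa> * measure lebesgue G * b G) = ennreal (\<kappa> * b G) * emeasure lborel G"
      using \<kappa>_pos b unfolding eG by (simp add: mult_ac flip: ennreal_mult)
    also have "\<dots> = (\<integral>\<^sup>+x. ennreal (\<kappa> * b G) * indicator G x \<partial>lborel)" by (simp add: nn_integral_cmult_indicator)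
    also have "\<dots> \<le> (\<integral>\<^sup>+x. F x * indicator G x + ennreal (2 * psi_lip * \<eta>) * indicator G x \<partial>lborel)"
    proof (rule nn_integral_mono)
      fix x show "ennreal (\<kappa> * b G) * indicator G x \<le> F x * indicator G x + ennreal (2 * psi_lip * \<eta>) * indicator G x"
      proof (cases "x \<in> G")
        case True
        have "psi D (\<tau> G) \<le> psi D (grad v x) + psi_lip * \<eta>"
          using psi_diff[of "grad v x" "\<tau> G"] mult_left_mono[OF \<tau>[OF G True], of psi_lip] psi_lip_pos by linarith
        moreover have "\<kappa> * b G = psi D (\<tau> G) + psi_lip * \<eta>" by (simp add: b_def psi_eq psi_lip_def algebra_simps)
        ultimately have "\<kappa> * b G \<le> psi D (grad v x) + 2 * psi_lip * \<eta>" by linarith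
        then show ?thesis using True J(4)[OF G] psi_nonneg[of "grad v x"] psi_lip_pos \<eta>
          by (auto simp: F_def indicator_def subset_iff simp flip: ennreal_plus intro!: ennreal_leI)
      qed simp
    qed
    also have "\<dots> = (\<integral>\<^sup>+x\<in>G. F x \<partial>lborel) + ennreal (2 * psi_lip * \<eta>) * emeasure lborel G"
      by (simp add: nn_integral_add nn_integral_cmult_indicator)
    also have "ennreal (2 * psi_lip * \<eta>) * emeasure lborel G = ennreal (2 * psi_lip * \<eta> * measure lebesgue G)"
      using psi_lip_pos \<eta> unfolding eG by (simp add: ennreal_mult)
    finally show ?thesis .
  qed
  have "ennreal ((\<Sum>G\<in>J. \<kappa> * measure lebesgue G * b G) + CP * \<eta>0) = (\<Sum>G\<in>J. ennreal (\<kappa> * measure lebesgue G * b G)) + ennreal (CP * \<eta>0)"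
    using \<kappa>_pos b CP(1) \<eta>0(1) by (subst ennreal_plus) (auto intro!: sum_nonneg simp: sum_ennreal)
  also have "\<dots> \<le> (\<Sum>G\<in>J. (\<integral>\<^sup>+x\<in>G. F x \<partial>lborel) + ennreal (2 * psi_lip * \<eta> * measure lebesgue G)) + ennreal (CP * \<eta>0)"
    by (intro add_right_mono sum_mono low)
  also have "\<dots> = (\<integral>\<^sup>+x\<in>\<Union>J. F x \<partial>lborel) + ennreal (\<Sum>G\<in>J. 2 * psi_lip * \<eta> * measure lebesgue G) + ennreal (CP * \<eta>0)"
    using psi_lip_pos \<eta> by (subst nn_integral_Union_boxes[OF J(1,2) Jc(2)]) (auto simp: sum.distrib sum_ennreal)
  also have "\<dots> \<le> (\<integral>\<^sup>+x\<in>A. F x \<partial>lborel) + ennreal (2 * psi_lip * \<eta>0) + ennreal (CP * \<eta>0)"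
  proof (intro add_right_mono add_mono ennreal_leI)
    show "(\<integral>\<^sup>+x\<in>\<Union>J. F x \<partial>lborel) \<le> (\<integral>\<^sup>+x\<in>A. F x \<partial>lborel)"
      using J(4) by (intro nn_integral_mono) (auto simp: indicator_def)
    have "(\<Sum>G\<in>J. 2 * psi_lip * \<eta> * measure lebesgue G) = 2 * psi_lip * (\<eta> * (\<Sum>G\<in>J. measure lebesgue G))"
      by (simp add: sum_distrib_left mult_ac)
    also have "\<dots> \<le> 2 * psi_lip * \<eta>0" using mJ psi_lip_pos by (intro mult_left_mono) auto
    finally show "(\<Sum>G\<in>J. 2 * psi_lip * \<eta> * measure lebesgue G) \<le> 2 * psi_lip * \<eta>0" .
  qed
  also have "\<dots> = (\<integral>\<^sup>+x\<in>A. F x \<partial>lborel) + ennreal e"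
    using \<eta>0 psi_lip_pos CP(1) by (simp add: add.assoc add.commute flip: ennreal_plus)
  also have "(\<integral>\<^sup>+x\<in>A. F x \<partial>lborel) = (\<integral>\<^sup>+x\<in>A. ennreal (psi D (grad v x)) \<partial>lborel)"
    by (intro nn_integral_cong) (auto simp: F_def indicator_def)
  finally show "Limsup (at_right 0) (\<lambda>\<epsilon>. H_eps D A \<epsilon> v) \<le> (\<integral>\<^sup>+x\<in>A. ennreal (psi D (grad v x)) \<partial>lborel) + ennreal e"
    using L by (rule order_trans[rotated])
qed

end

section \<open>Interior estimate and Meyers-Serrin approximation\<close>

lemma osc_shift:
  fixes A :: "(real ^ 'n) set"
  assumes A: "open A" and u: "u \<in> borel_measurable borel"
  shows "osc ((\<lambda>z. z - y) ` A) u = osc A (\<lambda>x. u (x - y))"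
proof -
  have im: "(\<lambda>z. z - y) ` A = (\<lambda>z. - y + 1 *\<^sub>R z) ` A" by (intro image_cong) auto
  have "open ((\<lambda>z. - y + 1 *\<^sub>R z) ` A)" using A by (intro open_affine_image) auto
  then have [measurable]: "(\<lambda>z. - y + 1 *\<^sub>R z) ` A \<in> sets borel" by simp
  note [measurable] = u
  have "(\<lambda>x. indicator ((\<lambda>z. - y + 1 *\<^sub>R z) ` A) x * u x) \<in> borel_measurable borel" by measurable
  then have "osc ((\<lambda>z. - y + 1 *\<^sub>R z) ` A) u = osc A (\<lambda>x. u (- y + 1 *\<^sub>R x))"
    by (rule osc_affine[OF A zero_less_one])
  then show ?thesis unfolding im by (simp add: algebra_simps)
qed

text \<open>Jensen's inequality for the convex functional \<open>osc A\<close>.\<close>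

lemma osc_conv_le:
  fixes A :: "(real ^ 'n) set" and u :: "real ^ 'n \<Rightarrow> real"
  assumes A: "open A" "bounded A" "A \<noteq> {}" and u: "integrable lborel u" and m: "mollifier \<delta> \<rho>"
  shows "ennreal (osc A (conv \<rho> u)) \<le> (\<integral>\<^sup>+y. ennreal (\<rho> y) * ennreal (osc A (\<lambda>x. u (x - y))) \<partial>lborel)"
    and "(\<lambda>y. osc A (\<lambda>x. u (x - y))) \<in> borel_measurable borel"
proof -
  have [measurable]: "A \<in> sets borel" "u \<in> borel_measurable borel" "\<rho> \<in> borel_measurable borel"
    using A u mollifierD(7)[OF m] by auto
  define V where "V = measure lborel A"
  have "\<not> negligible A" using A open_not_negligible by blast
  then have "measure lebesgue A > 0"
    using negligible_iff_measure zero_less_measure_iff lmeasurable_open[OF A(2,1)] by blast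
  then have V: "V > 0" by (simp add: V_def)
  have iA: "integrable lborel (indicator A :: real ^ 'n \<Rightarrow> real)" using A by (intro integrable_indicator_bounded) auto
  have intA: "(LINT x|lborel. indicator A x) = V" by (simp add: V_def)
  \<comment> \<open>The average over \<open>A\<close> of \<open>u\<close> translated by
    \<open>y\<close>; by Fubini the average of the mollification is the integral of \<open>M\<close>
    against \<open>\<rho>\<close>.\<close>
  define M where "M y = (LINT x|lborel. indicator A x * u (x - y)) / V" for y
  have M: "avg A (\<lambda>x. u (x - y)) = M y" for y by (simp add: M_def V_def avg_borel)
  have [measurable]: "M \<in> borel_measurable borel" unfolding M_def by measurable
  have ou: "osc A (\<lambda>x. u (x - y)) = (LINT x|lborel. indicator A x * \<bar>u (x - y) - M y\<bar>) / V" for y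
    unfolding osc_def M by (simp add: V_def avg_borel)
  show meas: "(\<lambda>y. osc A (\<lambda>x. u (x - y))) \<in> borel_measurable borel" unfolding ou by measurable
  have iu: "integrable lborel (\<lambda>x. u (x - y))" for y
    using integrable_lborel_affine[OF u, of 1 "-y"] by (simp add: algebra_simps)
  have iAu: "integrable lborel (\<lambda>x. indicator A x * u (x - y))" for y
    using integrable_mult_indicator[of A lborel "\<lambda>x. u (x - y)"] iu by simp
  define w where "w = conv \<rho> u"
  have w: "w x = (LINT y|lborel. \<rho> y * u (x - y))" for x by (simp add: w_def conv_eq_swap)
  obtain B where B: "\<And>x. \<bar>\<rho> x\<bar> \<le> B" using mollifier_bounded[OF m] by auto
  have "continuous_on UNIV w" unfolding w_def by (rule continuous_on_conv[OF u mollifierD(6)[OF m] B])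
  then have [measurable]: "w \<in> borel_measurable borel" by (rule borel_measurable_continuous_onI)
  have int2: "integrable (lborel \<Otimes>\<^sub>M lborel) (\<lambda>(x, y). indicator A x * (\<rho> y * u (x - y)))"
  proof -
    have "(\<integral>\<^sup>+z. ennreal (norm (case z of (x, y) \<Rightarrow> indicator A x * (\<rho> y * u (x - y)))) \<partial>(lborel \<Otimes>\<^sub>M lborel)) =
      (\<integral>\<^sup>+y. \<integral>\<^sup>+x. ennreal (norm (indicator A x * (\<rho> y * u (x - y)))) \<partial>lborel \<partial>lborel)"
      by (subst lborel_pair.nn_integral_snd[symmetric]) auto
    also have "\<dots> \<le> (\<integral>\<^sup>+y. \<integral>\<^sup>+x. ennreal (\<rho> y) * ennreal \<bar>u (x - y)\<bar> \<partial>lborel \<partial>lborel)"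
      using mollifierD(2)[OF m] by (intro nn_integral_mono) (auto simp: indicator_def abs_mult simp flip: ennreal_mult)
    also have "\<dots> = (\<integral>\<^sup>+y. ennreal (\<rho> y) * (\<integral>\<^sup>+x. ennreal \<bar>u x\<bar> \<partial>lborel) \<partial>lborel)"
      using nn_integral_lborel_shift(1)[of "\<lambda>x. ennreal \<bar>u x\<bar>"] by (simp add: nn_integral_cmult)
    also have "\<dots> = (\<integral>\<^sup>+x. ennreal \<bar>u x\<bar> \<partial>lborel)" by (simp add: nn_integral_multc mollifierD(8)[OF m])
    also have "\<dots> < \<infinity>" using u unfolding integrable_iff_bounded by simp
    finally show ?thesis unfolding integrable_iff_bounded by simp
  qed
  have avw: "avg A w = (LINT y|lborel. \<rho> y * M y)"
  proof -
    have "(LINT x|lborel. indicator A x * w x) = (LINT x|lborel. LINT y|lborel. indicator A x * (\<rho> y * u (x - y)))"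
      by (simp add: w)
    also have "\<dots> = (LINT y|lborel. LINT x|lborel. indicator A x * (\<rho> y * u (x - y)))"
      by (rule lborel_pair.Fubini_integral[OF int2, symmetric])
    also have "\<dots> = (LINT y|lborel. V * (\<rho> y * M y))"
      using V by (intro Bochner_Integration.integral_cong) (auto simp: M_def mult.left_commute[of "indicator A _"])
    finally show ?thesis using V by (simp add: avg_borel flip: V_def)
  qed
  have iM: "integrable lborel (\<lambda>y. \<rho> y * M y)"
  proof -
    have "integrable lborel (\<lambda>y. LINT x|lborel. indicator A x * (\<rho> y * u (x - y)))"
      by (rule lborel_pair.integrable_snd[OF int2])
    then have "integrable lborel (\<lambda>y. V * (\<rho> y * M y))"
      using V by (simp add: M_def mult.left_commute[of "indicator A _"])
    then show ?thesis using V by simp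
  qed
  have pt: "ennreal \<bar>w x - avg A w\<bar> \<le> (\<integral>\<^sup>+y. ennreal (\<rho> y) * ennreal \<bar>u (x - y) - M y\<bar> \<partial>lborel)" for x
  proof -
    have i: "integrable lborel (\<lambda>y. \<rho> y * u (x - y))" by (rule integrable_conv_swap[OF u m])
    have "ennreal \<bar>w x - avg A w\<bar> = ennreal (norm (LINT y|lborel. \<rho> y * u (x - y) - \<rho> y * M y))"
      using i iM by (simp add: w avw)
    also have "\<dots> \<le> (\<integral>\<^sup>+y. ennreal (norm (\<rho> y * u (x - y) - \<rho> y * M y)) \<partial>lborel)"
      using i iM by (intro integral_norm_bound_ennreal) auto
    also have "\<dots> = (\<integral>\<^sup>+y. ennreal (\<rho> y) * ennreal \<bar>u (x - y) - M y\<bar> \<partial>lborel)"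
      using mollifierD(2)[OF m] by (intro nn_integral_cong) (simp add: abs_mult flip: ennreal_mult right_diff_distrib)
    finally show ?thesis .
  qed
  have "ennreal V * ennreal (osc A w) = ennreal (LINT x|lborel. indicator A x * \<bar>w x - avg A w\<bar>)"
    using V by (simp add: osc_def avg_borel[of A "\<lambda>x. \<bar>w x - avg A w\<bar>"] flip: V_def ennreal_mult')
  \<comment> \<open>If the integrand is not integrable, the left side is 0 by default, so the
    inequality holds in both cases.\<close>
  also have "\<dots> \<le> (\<integral>\<^sup>+x. ennreal (indicator A x * \<bar>w x - avg A w\<bar>) \<partial>lborel)"
  proof (cases "integrable lborel (\<lambda>x. indicator A x * \<bar>w x - avg A w\<bar>)")
    case True
    then show ?thesis by (subst nn_integral_eq_integral) auto
  next
    case False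
    then show ?thesis by (simp add: not_integrable_integral_eq)
  qed
  also have "\<dots> \<le> (\<integral>\<^sup>+x. \<integral>\<^sup>+y. indicator A x * (ennreal (\<rho> y) * ennreal \<bar>u (x - y) - M y\<bar>) \<partial>lborel \<partial>lborel)"
  proof (rule nn_integral_mono)
    fix x
    have "ennreal (indicator A x * \<bar>w x - avg A w\<bar>) = indicator A x * ennreal \<bar>w x - avg A w\<bar>" by (auto simp: indicator_def)
    also have "\<dots> \<le> indicator A x * (\<integral>\<^sup>+y. ennreal (\<rho> y) * ennreal \<bar>u (x - y) - M y\<bar> \<partial>lborel)"
      by (intro mult_left_mono pt) auto
    also have "\<dots> = (\<integral>\<^sup>+y. indicator A x * (ennreal (\<rho> y) * ennreal \<bar>u (x - y) - M y\<bar>) \<partial>lborel)"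
      by (rule nn_integral_cmult[symmetric]) simp
    finally show "ennreal (indicator A x * \<bar>w x - avg A w\<bar>) \<le> (\<integral>\<^sup>+y. indicator A x * (ennreal (\<rho> y) * ennreal \<bar>u (x - y) - M y\<bar>) \<partial>lborel)" .
  qed
  also have "\<dots> = (\<integral>\<^sup>+y. \<integral>\<^sup>+x. indicator A x * (ennreal (\<rho> y) * ennreal \<bar>u (x - y) - M y\<bar>) \<partial>lborel \<partial>lborel)"
    by (rule lborel_pair.Fubini'[symmetric]) simp
  also have "\<dots> = (\<integral>\<^sup>+y. ennreal V * (ennreal (\<rho> y) * ennreal (osc A (\<lambda>x. u (x - y)))) \<partial>lborel)"
  proof (rule nn_integral_cong)
    fix y
    have "integrable lborel (\<lambda>x. indicator A x * u (x - y) - M y * indicator A x)"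
      using iAu iA by auto
    then have "integrable lborel (\<lambda>x. \<bar>indicator A x * u (x - y) - M y * indicator A x\<bar>)" by (rule integrable_abs)
    moreover have "\<bar>indicator A x * u (x - y) - M y * indicator A x\<bar> = indicator A x * \<bar>u (x - y) - M y\<bar>" for x
      by (auto simp: indicator_def)
    ultimately have i: "integrable lborel (\<lambda>x. indicator A x * \<bar>u (x - y) - M y\<bar>)" by simp
    have "(\<integral>\<^sup>+x. indicator A x * (ennreal (\<rho> y) * ennreal \<bar>u (x - y) - M y\<bar>) \<partial>lborel) =
      (\<integral>\<^sup>+x. ennreal (\<rho> y) * ennreal (indicator A x * \<bar>u (x - y) - M y\<bar>) \<partial>lborel)"
      by (intro nn_integral_cong) (auto simp: indicator_def)
    also have "\<dots> = ennreal (\<rho> y) * ennreal (LINT x|lborel. indicator A x * \<bar>u (x - y) - M y\<bar>)"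
      by (subst nn_integral_cmult, simp, subst nn_integral_eq_integral[OF i]) auto
    also have "ennreal (LINT x|lborel. indicator A x * \<bar>u (x - y) - M y\<bar>) = ennreal V * ennreal (osc A (\<lambda>x. u (x - y)))"
      using V by (simp add: ou flip: ennreal_mult')
    finally show "(\<integral>\<^sup>+x. indicator A x * (ennreal (\<rho> y) * ennreal \<bar>u (x - y) - M y\<bar>) \<partial>lborel) =
      ennreal V * (ennreal (\<rho> y) * ennreal (osc A (\<lambda>x. u (x - y))))" by (simp add: mult_ac)
  qed
  also have "\<dots> = ennreal V * (\<integral>\<^sup>+y. ennreal (\<rho> y) * ennreal (osc A (\<lambda>x. u (x - y))) \<partial>lborel)"
    using meas by (intro nn_integral_cmult) simp
  finally have "ennreal (1 / V) * (ennreal V * ennreal (osc A w)) \<le>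
    ennreal (1 / V) * (ennreal V * (\<integral>\<^sup>+y. ennreal (\<rho> y) * ennreal (osc A (\<lambda>x. u (x - y))) \<partial>lborel))"
    by (rule mult_left_mono) simp
  moreover have "ennreal (1 / V) * (ennreal V * z) = z" for z
    using V by (simp add: mult.assoc[symmetric] flip: ennreal_mult)
  ultimately show "ennreal (osc A (conv \<rho> u)) \<le> (\<integral>\<^sup>+y. ennreal (\<rho> y) * ennreal (osc A (\<lambda>x. u (x - y))) \<partial>lborel)"
    by (simp add: w_def)
qed

context profile
begin

text \<open>For every \<open>y\<close> with \<open>norm y \<le> \<delta>\<close> the family shifted
  by \<open>- y\<close> is admissible for \<open>\<Omega>\<close>, hence bounded by the same
  supremum; averaging over \<open>y\<close> changes nothing because \<open>\<rho>\<close> has total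
  mass 1.\<close>

lemma H_eps_conv_le:
  fixes u :: "real ^ 'n \<Rightarrow> real"
  assumes e: "\<epsilon> > 0" and u: "integrable lborel u" and m: "mollifier \<delta> \<rho>"
    and G: "\<And>x. x \<in> G \<Longrightarrow> cball x \<delta> \<subseteq> \<Omega>"
  shows "H_eps D G \<epsilon> (conv \<rho> u) \<le> H_eps D \<Omega> \<epsilon> u"
proof -
  note [measurable] = mollifierD(7)[OF m]
  have bu: "u \<in> borel_measurable borel" using u by auto
  let ?e = "\<epsilon> ^ (CARD('n) - 1)"
  show ?thesis
  unfolding H_eps_finite_families[OF e, where G=G]
  proof (rule SUP_least)
    fix H assume H: "H \<in> finite_families \<epsilon> D G"
    have D': "open D'" "bounded D'" "D' \<noteq> {}" if D'H: "D' \<in> H" for D'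
    proof -
      obtain x0 where "D' = translate x0 \<epsilon>" using finite_families_memD(2)[OF H D'H] by auto
      then show "open D'" "bounded D'" "D' \<noteq> {}" using translate_facts[OF e, of x0] by auto
    qed
    have S: "(\<Sum>D'\<in>H. ennreal (?e * osc D' (\<lambda>x. u (x - y)))) \<le> H_eps D \<Omega> \<epsilon> u" if y: "norm y \<le> \<delta>" for y
    proof -
      let ?s = "\<lambda>z. z - y"
      have inj: "inj_on ((`) ?s) H" by (auto intro!: inj_onI simp: inj_image_eq_iff)
      have "(`) ?s ` H \<in> finite_families \<epsilon> D \<Omega>"
        unfolding finite_families_def translate_families_def
      proof (intro CollectI conjI ballI)
        show "finite ((`) ?s ` H)" using H by (simp add: finite_families_def)
        have "pairwise disjnt H" using H by (simp add: finite_families_def translate_families_def)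
        then show "pairwise disjnt ((`) ?s ` H)"
          unfolding pairwise_image by (rule pairwise_mono) (auto simp: disjnt_def)
        fix E assume "E \<in> (`) ?s ` H"
        then obtain D' where D'2: "D' \<in> H" "E = ?s ` D'" by auto
        obtain x0 where x0: "D' = translate x0 \<epsilon>" using finite_families_memD(2)[OF H D'2(1)] by auto
        show "E \<subseteq> \<Omega>"
        proof
          fix z assume "z \<in> E"
          then obtain x where x: "x \<in> D'" "z = x - y" using D'2 by auto
          have "z \<in> cball x \<delta>" using y x by (simp add: dist_norm)
          then show "z \<in> \<Omega>" using G x finite_families_memD(1)[OF H D'2(1)] by blast
        qed
        show "\<exists>x0. E = (\<lambda>y. x0 + \<epsilon> *\<^sub>R y) ` D"
          by (rule exI[of _ "x0 - y"]) (simp add: D'2 x0 image_image algebra_simps)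
      qed
      then have "(\<Sum>E\<in>(`) ?s ` H. ennreal (?e * osc E u)) \<le> H_eps D \<Omega> \<epsilon> u" by (rule H_eps_ge[OF e])
      then show ?thesis using D' by (simp add: sum.reindex[OF inj] osc_shift[OF _ bu] cong: sum.cong)
    qed
    have "(\<Sum>D'\<in>H. ennreal (?e * osc D' (conv \<rho> u))) \<le>
      (\<Sum>D'\<in>H. \<integral>\<^sup>+y. ennreal (\<rho> y) * ennreal (?e * osc D' (\<lambda>x. u (x - y))) \<partial>lborel)"
    proof (rule sum_mono)
      fix D' assume D'H: "D' \<in> H"
      note o = osc_conv_le[OF D'[OF D'H] u m]
      note [measurable] = o(2)
      have "ennreal (?e * osc D' (conv \<rho> u)) = ennreal ?e * ennreal (osc D' (conv \<rho> u))"
        using e by (intro ennreal_mult osc_nonneg) auto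
      also have "\<dots> \<le> ennreal ?e * (\<integral>\<^sup>+y. ennreal (\<rho> y) * ennreal (osc D' (\<lambda>x. u (x - y))) \<partial>lborel)"
        by (intro mult_left_mono o) auto
      also have "\<dots> = (\<integral>\<^sup>+y. ennreal ?e * (ennreal (\<rho> y) * ennreal (osc D' (\<lambda>x. u (x - y)))) \<partial>lborel)"
        by (rule nn_integral_cmult[symmetric]) simp
      also have "\<dots> = (\<integral>\<^sup>+y. ennreal (\<rho> y) * ennreal (?e * osc D' (\<lambda>x. u (x - y))) \<partial>lborel)"
        using e by (intro nn_integral_cong) (simp add: ennreal_mult[OF _ osc_nonneg] mult.left_commute)
      finally show "ennreal (?e * osc D' (conv \<rho> u)) \<le> (\<integral>\<^sup>+y. ennreal (\<rho> y) * ennreal (?e * osc D' (\<lambda>x. u (x - y))) \<partial>lborel)" .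
    qed
    also have "\<dots> = (\<integral>\<^sup>+y. (\<Sum>D'\<in>H. ennreal (\<rho> y) * ennreal (?e * osc D' (\<lambda>x. u (x - y)))) \<partial>lborel)"
      using osc_conv_le(2)[OF D' u m] by (intro nn_integral_sum[symmetric]) auto
    also have "\<dots> \<le> (\<integral>\<^sup>+y. ennreal (\<rho> y) * H_eps D \<Omega> \<epsilon> u \<partial>lborel)"
    proof (rule nn_integral_mono)
      fix y
      show "(\<Sum>D'\<in>H. ennreal (\<rho> y) * ennreal (?e * osc D' (\<lambda>x. u (x - y)))) \<le> ennreal (\<rho> y) * H_eps D \<Omega> \<epsilon> u"
      proof (cases "norm y \<le> \<delta>")
        case True
        then show ?thesis unfolding sum_distrib_left[symmetric] by (intro mult_left_mono S) auto
      qed (use mollifierD(3)[OF m] in auto)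
    qed
    also have "\<dots> = H_eps D \<Omega> \<epsilon> u" by (simp add: nn_integral_multc mollifierD(8)[OF m])
    finally show "(\<Sum>D'\<in>H. ennreal (?e * osc D' (conv \<rho> u))) \<le> H_eps D \<Omega> \<epsilon> u" .
  qed
qed

end

lemma grad_sum:
  assumes "finite I" "\<And>i. i \<in> I \<Longrightarrow> f i differentiable (at x)"
  shows "grad (\<lambda>x. \<Sum>i\<in>I. f i x) x = (\<Sum>i\<in>I. grad (f i) x)"
  using assms
proof (induction I)
  case empty
  then show ?case by (simp add: grad_def vec_eq_iff)
next
  case (insert i I)
  have "(\<lambda>x. \<Sum>i\<in>I. f i x) differentiable at x" using insert by (intro differentiable_sum) auto
  then show ?case using insert by (simp add: grad_add)
qed

lemma grad_cong:
  assumes "open A" "x \<in> A" "\<And>y. y \<in> A \<Longrightarrow> f y = g y"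
  shows "grad f x = grad g x"
  by (simp add: grad_def vec_eq_iff partial_deriv_cong[OF assms])

text \<open>Fatou's lemma for a counting measure.\<close>

lemma sum_liminf_le:
  fixes A :: "nat \<Rightarrow> nat \<Rightarrow> ennreal"
  shows "(\<Sum>i\<le>N. liminf (\<lambda>k. A i k)) \<le> liminf (\<lambda>k. \<Sum>i\<le>N. A i k)"
proof -
  have "(\<integral>\<^sup>+i. liminf (\<lambda>k. A i k) \<partial>count_space {..N}) \<le> liminf (\<lambda>k. \<integral>\<^sup>+i. A i k \<partial>count_space {..N})"
    by (rule nn_integral_liminf) simp
  then show ?thesis by (simp add: nn_integral_count_space_finite)
qed

lemma suminf_half_powers: "\<eta> \<ge> 0 \<Longrightarrow> (\<Sum>i. ennreal (\<eta> * (1/2) ^ Suc i)) = ennreal \<eta>"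
  using sums_mult[OF power_half_series, of \<eta>] by (intro suminf_ennreal_eq) auto

lemma norm_integral_le_L1:
  fixes g :: "real ^ 'n \<Rightarrow> real ^ 'n"
  assumes f: "integrable lborel f" and [measurable]: "g \<in> borel_measurable borel" and B: "\<And>z. norm (g z) \<le> B"
  shows "norm (LINT z|lborel. f z *\<^sub>R g z) \<le> B * (LINT z|lborel. \<bar>f z\<bar>)"
proof -
  have "norm (LINT z|lborel. f z *\<^sub>R g z) \<le> (LINT z|lborel. norm (f z *\<^sub>R g z))"
    by (rule integral_norm_bound)
  also have "\<dots> \<le> (LINT z|lborel. B * \<bar>f z\<bar>)"
  proof (rule integral_mono)
    show "integrable lborel (\<lambda>z. norm (f z *\<^sub>R g z))"
      by (intro integrable_norm integrable_mult_bounded[OF f _ B]) simp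
    show "integrable lborel (\<lambda>z. B * \<bar>f z\<bar>)" using f by simp
    show "norm (f z *\<^sub>R g z) \<le> B * \<bar>f z\<bar>" for z
      using mult_right_mono[OF B[of z], of "\<bar>f z\<bar>"] by (simp add: mult.commute)
  qed
  finally show ?thesis by simp
qed

section \<open>Interior estimate and gluing\<close>

context profile
begin

text \<open>For a fixed mollifier the gradients of \<open>conv \<rho> (v \<epsilon>)\<close>
  converge uniformly, the error being at most a bound of \<open>grad \<rho>\<close> times the
  distance in the mean. So \<open>H_eps_liminf_C1\<close> applies, and \<open>H_eps_conv_le\<close>
  removes the mollification on the right.\<close>

lemma interior_estimate:
  fixes u :: "real ^ 'n \<Rightarrow> real"
  assumes u: "integrable lborel u" and v: "\<And>\<epsilon>. \<epsilon> > 0 \<Longrightarrow> integrable lborel (v \<epsilon>)"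
    and lim: "((\<lambda>\<epsilon>. LINT x|lborel. \<bar>v \<epsilon> x - u x\<bar>) \<longlongrightarrow> 0) (at_right 0)"
    and m: "mollifier \<delta> \<rho>" and G: "open G" "\<And>x. x \<in> G \<Longrightarrow> cball x \<delta> \<subseteq> \<Omega>"
  shows "(\<integral>\<^sup>+x\<in>G. ennreal (psi D (grad (conv \<rho> u) x)) \<partial>lborel) \<le> Liminf (at_right 0) (\<lambda>\<epsilon>. H_eps D \<Omega> \<epsilon> (v \<epsilon>))"
proof -
  note \<rho> = mollifierD(1,3)[OF m]
  have c: "continuous_on UNIV (grad \<rho>)" by (rule smooth_on_grad_continuous[OF \<rho>(1)])
  then have [measurable]: "grad \<rho> \<in> borel_measurable borel" by (rule borel_measurable_continuous_onI)
  obtain B where B: "B \<ge> 0" "\<And>x. norm (grad \<rho> x) \<le> B"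
    using bounded_of_compact_support[OF c, of \<delta>] grad_zero_outside[of \<delta> \<rho>, OF \<rho>(2)] by metis
  have "(\<integral>\<^sup>+x\<in>G. ennreal (psi D (grad (conv \<rho> u) x)) \<partial>lborel) \<le> Liminf (at_right 0) (\<lambda>\<epsilon>. H_eps D G \<epsilon> (conv \<rho> (v \<epsilon>)))"
  proof (rule H_eps_liminf_C1[OF G(1)])
    show "continuous_on G (grad (conv \<rho> u))"
      using smooth_on_grad_continuous[OF conv_smooth[OF u \<rho>]] continuous_on_subset by blast
    show "conv \<rho> (v \<epsilon>) differentiable at x" if "\<epsilon> > 0" for \<epsilon> x by (rule grad_conv(1)[OF v[OF that] \<rho>])
    fix \<eta> :: real assume \<eta>: "\<eta> > 0"
    have "((\<lambda>\<epsilon>. B * (LINT x|lborel. \<bar>v \<epsilon> x - u x\<bar>)) \<longlongrightarrow> B * 0) (at_right 0)" by (intro tendsto_intros lim)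
    then have "\<forall>\<^sub>F \<epsilon> in at_right 0. B * (LINT x|lborel. \<bar>v \<epsilon> x - u x\<bar>) < \<eta>"
      using \<eta> by (intro order_tendstoD) auto
    then show "\<forall>\<^sub>F \<epsilon> in at_right 0. \<forall>x\<in>G. norm (grad (conv \<rho> (v \<epsilon>)) x - grad (conv \<rho> u) x) \<le> \<eta>"
      using eventually_at_right_less[of "0::real"]
    proof eventually_elim
      case (elim \<epsilon>)
      show ?case
      proof
        fix x
        have i: "integrable lborel (\<lambda>z. v \<epsilon> z *\<^sub>R grad \<rho> (x - z))" "integrable lborel (\<lambda>z. u z *\<^sub>R grad \<rho> (x - z))"
          using u v[OF elim(2)] by (auto intro!: integrable_mult_bounded[OF _ _ B(2)])
        have g1: "grad (conv \<rho> (v \<epsilon>)) x = (LINT z|lborel. v \<epsilon> z *\<^sub>R grad \<rho> (x - z))"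
          by (rule grad_conv(2)[OF v[OF elim(2)] \<rho>])
        have g2: "grad (conv \<rho> u) x = (LINT z|lborel. u z *\<^sub>R grad \<rho> (x - z))"
          by (rule grad_conv(2)[OF u \<rho>])
        have "grad (conv \<rho> (v \<epsilon>)) x - grad (conv \<rho> u) x = (LINT z|lborel. (v \<epsilon> z - u z) *\<^sub>R grad \<rho> (x - z))"
          unfolding g1 g2 using i by (simp add: scaleR_diff_left)
        also have "norm \<dots> \<le> B * (LINT x|lborel. \<bar>v \<epsilon> x - u x\<bar>)"
          using u v[OF elim(2)] B(2) by (intro norm_integral_le_L1) auto
        finally show "norm (grad (conv \<rho> (v \<epsilon>)) x - grad (conv \<rho> u) x) \<le> \<eta>" using elim(1) by linarith
      qed
    qed
  qed
  also have "\<dots> \<le> Liminf (at_right 0) (\<lambda>\<epsilon>. H_eps D \<Omega> \<epsilon> (v \<epsilon>))"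
    using v H_eps_conv_le[OF _ _ m G(2)]
    by (intro Liminf_mono) (auto intro!: eventually_mono[OF eventually_at_right_less[of 0]])
  finally show ?thesis .
qed

text \<open>The Meyers--Serrin construction: with a partition of unity \<open>\<zeta> i\<close>, glue mollifications
  \<open>u\<^sub>k\<close> with \<open>k = k i\<close> chosen such that the integral of \<open>\<zeta> i * psi (grad u\<^sub>k)\<close> is close to its
  lower limit in \<open>k\<close>; these lower limits add up to at most \<open>M\<close>.\<close>

lemma meyers_serrin:
  fixes u :: "real ^ 'n \<Rightarrow> real"
  assumes \<Omega>: "open \<Omega>" and u: "integrable lborel u" and M: "M < \<infinity>"
    and est: "\<And>\<delta> \<rho> G. mollifier \<delta> \<rho> \<Longrightarrow> open G \<Longrightarrow> (\<And>x. x \<in> G \<Longrightarrow> cball x \<delta> \<subseteq> \<Omega>) \<Longrightarrow>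
      (\<integral>\<^sup>+x\<in>G. ennreal (psi D (grad (conv \<rho> u) x)) \<partial>lborel) \<le> M"
    and \<eta>: "\<eta> > 0"
  obtains w where "smooth_on \<Omega> w" "w \<in> L1 \<Omega>" "(\<integral>\<^sup>+x\<in>\<Omega>. ennreal \<bar>w x - u x\<bar> \<partial>lborel) \<le> ennreal \<eta>"
    "(\<integral>\<^sup>+x\<in>\<Omega>. ennreal (psi D (grad w x)) \<partial>lborel) \<le> M + ennreal \<eta>"
proof -
  have [measurable]: "\<Omega> \<in> sets borel" "u \<in> borel_measurable borel" using \<Omega> u by auto
  obtain C where C: "\<And>n. compact (C n)" "\<And>n. C n \<subseteq> \<Omega>" "\<And>n. C n \<subseteq> interior (C (Suc n))" "\<Union>(range C) = \<Omega>"
    using open_Union_compact_subsets[OF \<Omega>] by metis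
  have "C n \<subseteq> C (Suc n)" for n using C(3) interior_subset by blast
  then have Cmono: "C n \<subseteq> C n'" if "n \<le> n'" for n n' using that by (rule lift_Suc_mono_le)
  have "\<forall>n. \<exists>\<chi>0. smooth_on UNIV \<chi>0 \<and> (\<forall>x. 0 \<le> \<chi>0 x) \<and> (\<forall>x. \<chi>0 x \<le> 1) \<and> (\<forall>x\<in>C n. \<chi>0 x = 1) \<and>
    (\<forall>x. x \<notin> interior (C (Suc n)) \<longrightarrow> \<chi>0 x = (0::real))"
  proof
    fix n
    obtain \<chi>0 S where "smooth_on UNIV \<chi>0" "\<And>x. 0 \<le> \<chi>0 x" "\<And>x. \<chi>0 x \<le> 1" "\<And>x. x \<in> C n \<Longrightarrow> \<chi>0 x = 1"
      "compact S" "S \<subseteq> interior (C (Suc n))" "\<And>x. x \<notin> S \<Longrightarrow> \<chi>0 x = (0::real)"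
      by (rule smooth_cutoff[OF C(1) open_interior C(3)]) blast
    then show "\<exists>\<chi>0. smooth_on UNIV \<chi>0 \<and> (\<forall>x. 0 \<le> \<chi>0 x) \<and> (\<forall>x. \<chi>0 x \<le> 1) \<and> (\<forall>x\<in>C n. \<chi>0 x = 1) \<and>
      (\<forall>x. x \<notin> interior (C (Suc n)) \<longrightarrow> \<chi>0 x = (0::real))" by (intro exI[of _ \<chi>0]) blast
  qed
  then obtain X where Xs: "\<And>n. smooth_on UNIV (X n)" and X01: "\<And>n x. 0 \<le> X n x" "\<And>n x. X n x \<le> (1::real)"
    and X1: "\<And>n x. x \<in> C n \<Longrightarrow> X n x = 1" and X0: "\<And>n x. x \<notin> interior (C (Suc n)) \<Longrightarrow> X n x = 0"
    by (metis (no_types, lifting))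
  \<comment> \<open>Differences of successive cutoffs: the partial sums telescope to
    \<open>X N\<close>, and on \<open>C N\<close> only the indices up to \<open>N\<close> survive.
    The factor \<open>- 1\<close> fits \<open>Ck_on_mult\<close>.\<close>
  define \<zeta> where "\<zeta> n x = X n x + (- 1) * (if n = 0 then 0 else X (n - 1) x)" for n x
  have \<zeta>s: "smooth_on UNIV (\<zeta> n)" for n
  proof -
    have "Ck_on k UNIV (\<lambda>x. X n x + (- 1) * (if n = 0 then 0 else X (n - 1) x))" for k
    proof (rule Ck_on_add[OF open_UNIV smooth_onD[OF Xs] Ck_on_mult[OF open_UNIV Ck_on_const]])
      show "Ck_on k UNIV (\<lambda>x. if n = 0 then 0 else X (n - 1) x)"
        by (cases "n = 0") (simp_all add: Ck_on_const smooth_onD[OF Xs])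
    qed
    then show ?thesis unfolding smooth_on_def \<zeta>_def[abs_def] by blast
  qed
  have \<zeta>0: "0 \<le> \<zeta> n x" for n x
  proof (cases n)
    case (Suc j)
    show ?thesis
    proof (cases "x \<in> C (Suc j)")
      case True then show ?thesis using X1[OF True] X01(2)[of j x] by (simp add: \<zeta>_def Suc)
    next
      case False
      then have "X j x = 0" using X0[of x j] interior_subset by blast
      then show ?thesis using X01(1) by (simp add: \<zeta>_def Suc)
    qed
  qed (simp add: \<zeta>_def X01)
  have \<zeta>_sum: "(\<Sum>i\<le>N. \<zeta> i x) = X N x" for N x
    by (induction N) (auto simp: \<zeta>_def)
  have \<zeta>_vanish: "\<zeta> i x = 0" if xN: "x \<in> C N" "N < i" for i N x
  proof -
    obtain j where j: "i = Suc j" "N \<le> j" using xN(2) by (cases i) auto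
    have "x \<in> C j" "x \<in> C i" using Cmono[OF j(2)] Cmono[of N i] xN by auto
    then show ?thesis using X1[of x j] X1[of x i] by (simp add: \<zeta>_def j(1))
  qed
  have \<zeta>1: "\<zeta> i x \<le> 1" for i x
    using X01(2)[of i x] X01(1)[of "i - 1" x] by (cases "i = 0") (simp_all add: \<zeta>_def)
  have \<zeta>_supp: "\<zeta> i x = 0" if "x \<notin> C (Suc i)" for i x
  proof -
    have "x \<notin> interior (C (Suc i))" using that interior_subset by blast
    moreover have "x \<notin> interior (C i)"
      using that Cmono[OF le_SucI[OF order_refl], of i] interior_subset[of "C i"] by blast
    ultimately show ?thesis using X0[of x i] X0[of x "i - 1"] by (cases i) (auto simp: \<zeta>_def)
  qed
  have "\<exists>B. B \<ge> 0 \<and> (\<forall>x. norm (grad (\<zeta> i) x) \<le> B)" for i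
  proof -
    obtain R' where R': "\<And>x. x \<in> C (Suc i) \<Longrightarrow> norm x \<le> R'"
      using compact_imp_bounded[OF C(1)] bounded_iff by metis
    then have "\<zeta> i y = 0" if "R' < norm y" for y using that \<zeta>_supp[of y i] by fastforce
    then show ?thesis
      using bounded_of_compact_support[OF smooth_on_grad_continuous[OF \<zeta>s[of i]], of R'] grad_zero_outside[of R' "\<zeta> i"] by metis
  qed
  then obtain B where B: "\<And>i. B i \<ge> 0" "\<And>i x. norm (grad (\<zeta> i) x) \<le> B i" by metis
  have "\<exists>\<rho> :: real ^ 'n \<Rightarrow> real. mollifier (1 / real (Suc k)) \<rho>" for k
    using mollifier_exists[of "1 / real (Suc k)"] by auto
  then obtain \<rho> :: "nat \<Rightarrow> real ^ 'n \<Rightarrow> real" where \<rho>: "\<And>k. mollifier (1 / real (Suc k)) (\<rho> k)" by metis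
  define U where "U k = conv (\<rho> k) u" for k
  have Us: "smooth_on UNIV (U k)" for k
    unfolding U_def by (rule conv_smooth[OF u mollifierD(1)[OF \<rho>] mollifierD(3)[OF \<rho>]])
  have Ud: "U k differentiable (at x)" for k x by (rule smooth_on_differentiable[OF Us UNIV_I])
  have \<zeta>d: "\<zeta> i differentiable (at x)" for i x by (rule smooth_on_differentiable[OF \<zeta>s UNIV_I])
  have [measurable]: "U k \<in> borel_measurable borel" for k
    by (rule borel_measurable_continuous_onI[OF smooth_on_continuous[OF Us]])
  have [measurable]: "\<zeta> i \<in> borel_measurable borel" for i
    by (rule borel_measurable_continuous_onI[OF smooth_on_continuous[OF \<zeta>s]])
  have [measurable]: "(\<lambda>x. psi D (grad (U k) x)) \<in> borel_measurable borel" for k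
    by (intro borel_measurable_continuous_onI continuous_on_compose2[OF continuous_on_psi[of UNIV]] smooth_on_grad_continuous Us) auto
  define A where "A i k = (\<integral>\<^sup>+x. ennreal (\<zeta> i x * psi D (grad (U k) x)) \<partial>lborel)" for i k
  \<comment> \<open>For fixed \<open>N\<close> these terms are together bounded by one integral over
    \<open>interior (C (Suc N))\<close>, where mollification at radius \<open>1 / Suc k\<close>
    stays inside \<open>\<Omega>\<close> for large \<open>k\<close>. Thus \<open>est\<close> bounds
    the whole sum by \<open>M\<close>, not merely each term.\<close>
  have A_sum: "\<forall>\<^sub>F k in sequentially. (\<Sum>i\<le>N. A i k) \<le> M" for N
  proof -
    obtain d where d: "d > 0" "(\<Union>x\<in>C (Suc N). ball x d) \<subseteq> \<Omega>"
      using compact_subset_open_imp_ball_epsilon_subset[OF C(1) \<Omega> C(2)] by metis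
    obtain k0 where k0: "1 / real (Suc k0) < d" using nat_approx_posE[OF d(1)] by blast
    have "(\<Sum>i\<le>N. A i k) \<le> M" if k: "k \<ge> k0" for k
    proof -
      have "1 / real (Suc k) \<le> 1 / real (Suc k0)" using k by (simp add: divide_simps)
      then have kd: "1 / real (Suc k) < d" using k0 by linarith
      have "(\<Sum>i\<le>N. A i k) = (\<integral>\<^sup>+x. (\<Sum>i\<le>N. ennreal (\<zeta> i x * psi D (grad (U k) x))) \<partial>lborel)"
        unfolding A_def by (intro nn_integral_sum[symmetric]) simp
      also have "\<dots> = (\<integral>\<^sup>+x. ennreal (X N x * psi D (grad (U k) x)) \<partial>lborel)"
        using \<zeta>0 psi_nonneg by (intro nn_integral_cong) (simp add: sum_ennreal \<zeta>_sum flip: sum_distrib_right)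
      also have "\<dots> \<le> (\<integral>\<^sup>+x\<in>interior (C (Suc N)). ennreal (psi D (grad (U k) x)) \<partial>lborel)"
      proof (rule nn_integral_mono)
        fix x show "ennreal (X N x * psi D (grad (U k) x)) \<le> ennreal (psi D (grad (U k) x)) * indicator (interior (C (Suc N))) x"
        proof (cases "x \<in> interior (C (Suc N))")
          case True
          then show ?thesis using X01(2)[of N x] psi_nonneg[of "grad (U k) x"] by (auto intro!: ennreal_leI mult_left_le_one_le X01)
        qed (simp add: X0)
      qed
      also have "\<dots> \<le> M" unfolding U_def
      proof (rule est[OF \<rho> open_interior])
        fix x assume "x \<in> interior (C (Suc N))"
        then have "x \<in> C (Suc N)" using interior_subset by blast
        then have "ball x d \<subseteq> \<Omega>" using d(2) by blast
        then show "cball x (1 / real (Suc k)) \<subseteq> \<Omega>" using kd by (auto simp: subset_iff)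
      qed
      finally show ?thesis .
    qed
    then show ?thesis unfolding eventually_sequentially by blast
  qed
  define m where "m i = liminf (A i)" for i
  have m_sum: "(\<Sum>i\<le>N. m i) \<le> M" for N
  proof -
    have "(\<Sum>i\<le>N. m i) \<le> liminf (\<lambda>k. \<Sum>i\<le>N. A i k)" unfolding m_def by (rule sum_liminf_le)
    also have "\<dots> \<le> limsup (\<lambda>k. \<Sum>i\<le>N. A i k)" by (rule Liminf_le_Limsup) simp
    also have "\<dots> \<le> M" by (rule Limsup_bounded[OF A_sum])
    finally show ?thesis .
  qed
  have m_suminf: "(\<Sum>i. m i) \<le> M"
    unfolding suminf_eq_SUP using m_sum
    by (intro SUP_least) (metis lessThan_Suc_atMost not0_implies_Suc sum.empty lessThan_0 zero_le)
  have m_fin: "m i < \<infinity>" for i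
  proof -
    have "m i \<le> (\<Sum>j\<le>i. m j)" by (intro member_le_sum) auto
    then show ?thesis using m_sum[of i] M by (meson le_less_trans)
  qed
  \<comment> \<open>Based on \<open>\<eta>/2\<close> because each \<open>\<theta> i\<close> is spent
    twice: on the choice of \<open>k i\<close> and on the gradients of the cutoffs.\<close>
  define \<theta> where "\<theta> i = \<eta>/2 * (1/2) ^ Suc i" for i :: nat
  have \<theta>: "\<theta> i > 0" for i using \<eta> by (simp add: \<theta>_def)
  have \<theta>_sum: "(\<Sum>i. ennreal (\<theta> i)) = ennreal (\<eta>/2)" unfolding \<theta>_def using \<eta> by (intro suminf_half_powers) auto
  \<comment> \<open>The first condition holds for infinitely many \<open>k\<close> by the definition
    of the lower limit, the second for all large \<open>k\<close> by convergence in the mean, so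
    some \<open>k\<close> meets both. The factor \<open>1 + psi_lip * B i\<close> makes the second
    condition control the distance itself as well as the term with
    \<open>grad (\<zeta> i)\<close>.\<close>
  have "\<exists>k. A i k \<le> m i + ennreal (\<theta> i) \<and>
    ennreal (1 + psi_lip * B i) * (\<integral>\<^sup>+x. ennreal \<bar>U k x - u x\<bar> \<partial>lborel) \<le> ennreal (\<theta> i)" for i
  proof -
    have c1: "1 + psi_lip * B i \<ge> 1" using psi_lip_pos B(1)[of i] by simp
    then have "\<theta> i / (1 + psi_lip * B i) > 0" using \<theta>[of i] by (intro divide_pos_pos) auto
    then obtain d where d: "d > 0" "\<And>\<delta> \<rho>. mollifier \<delta> \<rho> \<Longrightarrow> \<delta> < d \<Longrightarrow>
      (\<integral>\<^sup>+x. ennreal \<bar>conv \<rho> u x - u x\<bar> \<partial>lborel) \<le> ennreal (\<theta> i / (1 + psi_lip * B i))"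
      using conv_mollifier_L1[OF u] by metis
    obtain k0 where k0: "1 / real (Suc k0) < d" using nat_approx_posE[OF d(1)] by blast
    have ev: "\<forall>\<^sub>F k in sequentially. ennreal (1 + psi_lip * B i) * (\<integral>\<^sup>+x. ennreal \<bar>U k x - u x\<bar> \<partial>lborel) \<le> ennreal (\<theta> i)"
      unfolding eventually_sequentially
    proof (intro exI[of _ k0] allI impI)
      fix k assume "k0 \<le> k"
      then have "1 / real (Suc k) \<le> 1 / real (Suc k0)" by (simp add: divide_simps)
      then have "1 / real (Suc k) < d" using k0 by linarith
      then have "ennreal (1 + psi_lip * B i) * (\<integral>\<^sup>+x. ennreal \<bar>U k x - u x\<bar> \<partial>lborel) \<le> ennreal (1 + psi_lip * B i) * ennreal (\<theta> i / (1 + psi_lip * B i))"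
        unfolding U_def by (intro mult_left_mono d(2)[OF \<rho>]) auto
      also have "\<dots> = ennreal (\<theta> i)" using c1 \<theta>[of i] by (subst ennreal_mult[symmetric]) auto
      finally show "ennreal (1 + psi_lip * B i) * (\<integral>\<^sup>+x. ennreal \<bar>U k x - u x\<bar> \<partial>lborel) \<le> ennreal (\<theta> i)" .
    qed
    have fr: "\<exists>\<^sub>F k in sequentially. A i k < m i + ennreal (\<theta> i)"
    proof (rule ccontr)
      assume "\<not> ?thesis"
      then have "\<forall>\<^sub>F k in sequentially. m i + ennreal (\<theta> i) \<le> A i k" by (simp add: not_frequently not_less)
      then have "m i + ennreal (\<theta> i) \<le> m i" unfolding m_def by (rule Liminf_bounded)
      moreover have "m i < m i + ennreal (\<theta> i)"
        using m_fin[of i] \<theta>[of i] by (metis add.right_neutral ennreal_add_left_cancel_less ennreal_less_zero_iff infinity_ennreal_def less_irrefl)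
      ultimately show False by simp
    qed
    have "\<exists>\<^sub>F k in sequentially. A i k < m i + ennreal (\<theta> i) \<and>
        ennreal (1 + psi_lip * B i) * (\<integral>\<^sup>+x. ennreal \<bar>U k x - u x\<bar> \<partial>lborel) \<le> ennreal (\<theta> i)"
      by (rule frequently_rev_mp[OF fr]) (use ev in \<open>auto elim: eventually_mono\<close>)
    then show ?thesis using frequently_ex less_imp_le by (metis (no_types, lifting))
  qed
  then obtain k where k: "\<And>i. A i (k i) \<le> m i + ennreal (\<theta> i)"
    "\<And>i. ennreal (1 + psi_lip * B i) * (\<integral>\<^sup>+x. ennreal \<bar>U (k i) x - u x\<bar> \<partial>lborel) \<le> ennreal (\<theta> i)" by metis
  define V where "V i = U (k i)" for i
  have Vs: "smooth_on UNIV (V i)" and [measurable]: "V i \<in> borel_measurable borel" for i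
    using Us by (auto simp: V_def)
  have Vd: "V i differentiable (at x)" for i x
    unfolding V_def by (rule Ud)
  have V1: "(\<integral>\<^sup>+x. ennreal \<bar>V i x - u x\<bar> \<partial>lborel) \<le> ennreal (\<theta> i)"
    and V2: "(\<integral>\<^sup>+x. ennreal (psi_lip * B i * \<bar>V i x - u x\<bar>) \<partial>lborel) \<le> ennreal (\<theta> i)" for i
  proof -
    have c0: "0 \<le> psi_lip * B i" using psi_lip_pos B(1)[of i] by simp
    have "1 * (\<integral>\<^sup>+x. ennreal \<bar>V i x - u x\<bar> \<partial>lborel) \<le> ennreal (1 + psi_lip * B i) * (\<integral>\<^sup>+x. ennreal \<bar>V i x - u x\<bar> \<partial>lborel)"
      using c0 by (intro mult_right_mono) (auto simp: ennreal_1[symmetric] simp del: ennreal_1 ennreal_plus intro!: ennreal_leI)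
    then show "(\<integral>\<^sup>+x. ennreal \<bar>V i x - u x\<bar> \<partial>lborel) \<le> ennreal (\<theta> i)" using k(2)[of i] by (simp add: V_def)
    have "(\<integral>\<^sup>+x. ennreal (psi_lip * B i * \<bar>V i x - u x\<bar>) \<partial>lborel) = ennreal (psi_lip * B i) * (\<integral>\<^sup>+x. ennreal \<bar>V i x - u x\<bar> \<partial>lborel)"
      using c0 by (subst nn_integral_cmult[symmetric]) (auto simp: ennreal_mult intro!: nn_integral_cong)
    also have "\<dots> \<le> ennreal (1 + psi_lip * B i) * (\<integral>\<^sup>+x. ennreal \<bar>V i x - u x\<bar> \<partial>lborel)"
      using c0 by (intro mult_right_mono ennreal_leI) auto
    finally show "(\<integral>\<^sup>+x. ennreal (psi_lip * B i * \<bar>V i x - u x\<bar>) \<partial>lborel) \<le> ennreal (\<theta> i)" using k(2)[of i] by (simp add: V_def)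
  qed
  define w where "w x = (\<Sum>i. \<zeta> i x * V i x)" for x
  have w_fin: "w x = (\<Sum>i\<le>N. \<zeta> i x * V i x)" if "x \<in> C N" for x N
    unfolding w_def using \<zeta>_vanish[OF that] by (intro suminf_finite) auto
  have int_C: "\<exists>N. x \<in> interior (C N)" if x: "x \<in> \<Omega>" for x
  proof -
    obtain N where "x \<in> C N" using x C(4) by blast
    then show ?thesis using C(3)[of N] by blast
  qed
  have pd: "(\<lambda>x. \<zeta> i x * V i x) differentiable (at x)" for i x
    by (intro differentiable_mult \<zeta>d Vd)
  have w_smooth: "smooth_on \<Omega> w"
    unfolding smooth_on_def
  proof (intro allI Ck_on_locally)
    fix l x assume "x \<in> \<Omega>"
    then obtain N where N: "x \<in> interior (C N)" using int_C by blast
    have "Ck_on l UNIV (\<lambda>x. \<Sum>i\<le>N. \<zeta> i x * V i x)"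
      using \<zeta>s Vs by (intro Ck_on_sum Ck_on_mult) (auto simp: smooth_on_def)
    then have "Ck_on l (interior (C N)) (\<lambda>x. \<Sum>i\<le>N. \<zeta> i x * V i x)" by (rule Ck_on_subset) simp
    moreover have "Ck_on l (interior (C N)) w \<longleftrightarrow> Ck_on l (interior (C N)) (\<lambda>x. \<Sum>i\<le>N. \<zeta> i x * V i x)"
      by (rule Ck_on_cong[OF open_interior]) (rule w_fin[OF subsetD[OF interior_subset]])
    ultimately have "Ck_on l (interior (C N)) w" by simp
    then show "\<exists>U. open U \<and> x \<in> U \<and> Ck_on l U w" using N open_interior by blast
  qed
  have w_grad: "psi D (grad w x) \<le> (\<Sum>i\<le>N. \<zeta> i x * psi D (grad (V i) x) + psi_lip * B i * \<bar>V i x - u x\<bar>)"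
    if x: "x \<in> interior (C N)" for x N
  proof -
    have w: "w y = (\<Sum>i\<le>N. \<zeta> i y * V i y)" if "y \<in> interior (C N)" for y
      by (rule w_fin[OF subsetD[OF interior_subset that]])
    have "grad w x = grad (\<lambda>y. \<Sum>i\<le>N. \<zeta> i y * V i y) x"
      by (rule grad_cong[OF open_interior x]) (rule w)
    also have "\<dots> = (\<Sum>i\<le>N. grad (\<lambda>y. \<zeta> i y * V i y) x)" by (rule grad_sum) (simp_all add: pd)
    also have "\<dots> = (\<Sum>i\<le>N. \<zeta> i x *\<^sub>R grad (V i) x + V i x *\<^sub>R grad (\<zeta> i) x)"
      by (simp add: grad_mult[OF \<zeta>d Vd])
    \<comment> \<open>The gradients of the \<open>\<zeta> i\<close> sum to 0 near \<open>x\<close>,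
      so the number \<open>u x\<close> may be subtracted from every \<open>V i x\<close>; only small
      differences meet the possibly large \<open>grad (\<zeta> i)\<close>, and \<open>u\<close> is
      never differentiated.\<close>
    also have "\<dots> = (\<Sum>i\<le>N. \<zeta> i x *\<^sub>R grad (V i) x + (V i x - u x) *\<^sub>R grad (\<zeta> i) x)"
    proof -
      have "(\<Sum>i\<le>N. grad (\<zeta> i) x) = grad (\<lambda>y. \<Sum>i\<le>N. \<zeta> i y) x" by (rule grad_sum[symmetric]) (simp_all add: \<zeta>d)
      also have "\<dots> = grad (\<lambda>y. 1) x"
        by (rule grad_cong[OF open_interior x]) (use X1 interior_subset in \<open>fastforce simp: \<zeta>_sum\<close>)
      also have "\<dots> = 0" by (simp add: grad_def vec_eq_iff)
      finally have "(\<Sum>i\<le>N. u x *\<^sub>R grad (\<zeta> i) x) = 0" by (simp flip: scaleR_sum_right)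
      then show ?thesis by (simp add: scaleR_diff_left sum.distrib sum_subtractf)
    qed
    finally have g: "grad w x = (\<Sum>i\<le>N. \<zeta> i x *\<^sub>R grad (V i) x + (V i x - u x) *\<^sub>R grad (\<zeta> i) x)" .
    have sub: "psi D (\<Sum>i\<in>I. h i) \<le> (\<Sum>i\<in>I. psi D (h i))" if "finite I" for I :: "nat set" and h
      using that
    proof (induction I)
      case empty then show ?case using psi_scale[of 0 0] by simp
    next
      case (insert i I) then show ?case using psi_add_le[of "h i" "sum h I"] by simp
    qed
    have "psi D (grad w x) \<le> (\<Sum>i\<le>N. psi D (\<zeta> i x *\<^sub>R grad (V i) x + (V i x - u x) *\<^sub>R grad (\<zeta> i) x))"
      unfolding g by (rule sub) simp
    also have "\<dots> \<le> (\<Sum>i\<le>N. \<zeta> i x * psi D (grad (V i) x) + psi_lip * B i * \<bar>V i x - u x\<bar>)"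
    proof (rule sum_mono)
      fix i
      have "psi D ((V i x - u x) *\<^sub>R grad (\<zeta> i) x) \<le> \<bar>V i x - u x\<bar> * (psi_lip * B i)"
        unfolding psi_scale using psi_lip_pos
        by (intro mult_left_mono order_trans[OF psi_le] B) auto
      then show "psi D (\<zeta> i x *\<^sub>R grad (V i) x + (V i x - u x) *\<^sub>R grad (\<zeta> i) x) \<le>
        \<zeta> i x * psi D (grad (V i) x) + psi_lip * B i * \<bar>V i x - u x\<bar>"
        using psi_add_le[of "\<zeta> i x *\<^sub>R grad (V i) x" "(V i x - u x) *\<^sub>R grad (\<zeta> i) x"] \<zeta>0[of i x]
        by (simp add: psi_scale mult.commute)
    qed
    finally show ?thesis .
  qed
  have w_diff: "\<bar>w x - u x\<bar> \<le> (\<Sum>i\<le>N. \<bar>V i x - u x\<bar>)" if x: "x \<in> C N" for x N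
  proof -
    have "w x - u x = (\<Sum>i\<le>N. \<zeta> i x * V i x) - (\<Sum>i\<le>N. \<zeta> i x) * u x"
      unfolding w_fin[OF x] using X1[OF x] by (simp add: \<zeta>_sum)
    also have "\<dots> = (\<Sum>i\<le>N. \<zeta> i x * (V i x - u x))"
      by (simp add: sum_distrib_right right_diff_distrib sum_subtractf)
    finally have "\<bar>w x - u x\<bar> \<le> (\<Sum>i\<le>N. \<bar>\<zeta> i x * (V i x - u x)\<bar>)" by (metis sum_abs)
    also have "\<dots> \<le> (\<Sum>i\<le>N. \<bar>V i x - u x\<bar>)"
      unfolding abs_mult using \<zeta>0 \<zeta>1 by (intro sum_mono mult_left_le_one_le) auto
    finally show ?thesis .
  qed
  have L1_bound: "(\<integral>\<^sup>+x\<in>\<Omega>. ennreal \<bar>w x - u x\<bar> \<partial>lborel) \<le> ennreal (\<eta>/2)"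
  proof -
    have "(\<integral>\<^sup>+x\<in>\<Omega>. ennreal \<bar>w x - u x\<bar> \<partial>lborel) \<le> (\<integral>\<^sup>+x. (\<Sum>i. ennreal \<bar>V i x - u x\<bar>) \<partial>lborel)"
    proof (rule nn_integral_mono)
      fix x show "ennreal \<bar>w x - u x\<bar> * indicator \<Omega> x \<le> (\<Sum>i. ennreal \<bar>V i x - u x\<bar>)"
      proof (cases "x \<in> \<Omega>")
        case True
        then obtain N where N: "x \<in> C N" using C(4) by blast
        have "ennreal \<bar>w x - u x\<bar> \<le> ennreal (\<Sum>i\<le>N. \<bar>V i x - u x\<bar>)" by (rule ennreal_leI[OF w_diff[OF N]])
        also have "\<dots> = (\<Sum>i\<le>N. ennreal \<bar>V i x - u x\<bar>)" by (rule sum_ennreal[symmetric]) simp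
        also have "\<dots> \<le> (\<Sum>i. ennreal \<bar>V i x - u x\<bar>)" by (rule sum_le_suminf) auto
        finally show ?thesis using True by simp
      qed simp
    qed
    also have "\<dots> = (\<Sum>i. \<integral>\<^sup>+x. ennreal \<bar>V i x - u x\<bar> \<partial>lborel)" by (rule nn_integral_suminf) simp
    also have "\<dots> \<le> (\<Sum>i. ennreal (\<theta> i))" by (intro suminf_le V1) auto
    finally show ?thesis unfolding \<theta>_sum .
  qed
  have psi_bound: "(\<integral>\<^sup>+x\<in>\<Omega>. ennreal (psi D (grad w x)) \<partial>lborel) \<le> M + ennreal \<eta>"
  proof -
    have [measurable]: "(\<lambda>x. psi D (grad (V i) x)) \<in> borel_measurable borel" for i unfolding V_def by simp
    have "(\<integral>\<^sup>+x\<in>\<Omega>. ennreal (psi D (grad w x)) \<partial>lborel) \<le>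
      (\<integral>\<^sup>+x. (\<Sum>i. ennreal (\<zeta> i x * psi D (grad (V i) x)) + ennreal (psi_lip * B i * \<bar>V i x - u x\<bar>)) \<partial>lborel)"
    proof (rule nn_integral_mono)
      fix x
      show "ennreal (psi D (grad w x)) * indicator \<Omega> x \<le>
        (\<Sum>i. ennreal (\<zeta> i x * psi D (grad (V i) x)) + ennreal (psi_lip * B i * \<bar>V i x - u x\<bar>))"
      proof (cases "x \<in> \<Omega>")
        case True
        then obtain N where N: "x \<in> interior (C N)" using int_C by blast
        have nn: "0 \<le> \<zeta> i x * psi D (grad (V i) x)" "0 \<le> psi_lip * B i * \<bar>V i x - u x\<bar>" for i
          using \<zeta>0 psi_nonneg psi_lip_pos B(1) by auto
        have "ennreal (psi D (grad w x)) \<le> ennreal (\<Sum>i\<le>N. \<zeta> i x * psi D (grad (V i) x) + psi_lip * B i * \<bar>V i x - u x\<bar>)"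
          by (rule ennreal_leI[OF w_grad[OF N]])
        also have "\<dots> = (\<Sum>i\<le>N. ennreal (\<zeta> i x * psi D (grad (V i) x)) + ennreal (psi_lip * B i * \<bar>V i x - u x\<bar>))"
          using nn by (subst sum_ennreal[symmetric]) auto
        also have "\<dots> \<le> (\<Sum>i. ennreal (\<zeta> i x * psi D (grad (V i) x)) + ennreal (psi_lip * B i * \<bar>V i x - u x\<bar>))"
          by (rule sum_le_suminf) auto
        finally show ?thesis using True by simp
      qed simp
    qed
    also have "\<dots> = (\<Sum>i. \<integral>\<^sup>+x. ennreal (\<zeta> i x * psi D (grad (V i) x)) + ennreal (psi_lip * B i * \<bar>V i x - u x\<bar>) \<partial>lborel)"
      by (rule nn_integral_suminf) simp
    also have "\<dots> = (\<Sum>i. A i (k i) + (\<integral>\<^sup>+x. ennreal (psi_lip * B i * \<bar>V i x - u x\<bar>) \<partial>lborel))"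
      by (simp add: nn_integral_add A_def V_def)
    also have "\<dots> \<le> (\<Sum>i. (m i + ennreal (\<theta> i)) + ennreal (\<theta> i))"
      by (intro suminf_le add_mono k(1) V2) auto
    also have "\<dots> = (\<Sum>i. m i) + (\<Sum>i. ennreal (\<theta> i)) + (\<Sum>i. ennreal (\<theta> i))"
      by (simp add: suminf_add[symmetric])
    also have "\<dots> \<le> M + ennreal (\<eta>/2) + ennreal (\<eta>/2)" unfolding \<theta>_sum by (intro add_right_mono m_suminf)
    also have "\<dots> = M + ennreal \<eta>" using \<eta> by (simp add: add.assoc flip: ennreal_plus)
    finally show ?thesis .
  qed
  have "w \<in> L1 \<Omega>"
  proof -
    have mw[measurable]: "(\<lambda>x. indicator \<Omega> x * w x) \<in> borel_measurable borel"
      by (rule borel_measurable_indicator_continuous[OF \<Omega> smooth_on_continuous[OF w_smooth]])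
    have "(\<integral>\<^sup>+x. ennreal (norm (indicator \<Omega> x * w x)) \<partial>lborel) \<le> (\<integral>\<^sup>+x. ennreal \<bar>indicator \<Omega> x * w x - indicator \<Omega> x * u x\<bar> + ennreal \<bar>u x\<bar> \<partial>lborel)"
      by (intro nn_integral_mono) (auto simp: indicator_def simp flip: ennreal_plus intro!: ennreal_leI)
    also have "\<dots> = (\<integral>\<^sup>+x. ennreal \<bar>indicator \<Omega> x * w x - indicator \<Omega> x * u x\<bar> \<partial>lborel) + (\<integral>\<^sup>+x. ennreal \<bar>u x\<bar> \<partial>lborel)"
      by (rule nn_integral_add) simp_all
    also have "(\<integral>\<^sup>+x. ennreal \<bar>indicator \<Omega> x * w x - indicator \<Omega> x * u x\<bar> \<partial>lborel) = (\<integral>\<^sup>+x\<in>\<Omega>. ennreal \<bar>w x - u x\<bar> \<partial>lborel)"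
      by (intro nn_integral_cong) (auto simp: indicator_def)
    also have "\<dots> + (\<integral>\<^sup>+x. ennreal \<bar>u x\<bar> \<partial>lborel) < \<infinity>"
      using L1_bound u unfolding integrable_iff_bounded by (auto simp: less_top[symmetric] top_unique)
    finally have "integrable lborel (\<lambda>x. indicator \<Omega> x * w x)" unfolding integrable_iff_bounded using mw by simp
    then show ?thesis unfolding L1_def set_integrable_def using mw by (simp add: integrable_completion)
  qed
  then show thesis
    using w_smooth psi_bound L1_bound \<eta> by (intro that[of w]) (auto intro: order_trans ennreal_leI)
qed

end

section \<open>Gamma-convergence\<close>

text \<open>The convolution of \<open>F\<close> with the indicator of a large ball is constant near
  0, because the ball contains the whole reflected and shifted support. Its gradient at 0, computed
  under the integral, is the integral of \<open>grad F\<close> after a reflection.\<close>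

lemma integral_grad_compact_support:
  fixes F :: "real ^ 'n \<Rightarrow> real"
  assumes d: "\<And>x. F differentiable (at x)" and c: "continuous_on UNIV (grad F)" and R: "\<And>x. R < norm x \<Longrightarrow> F x = 0"
  shows "integrable lborel (grad F)" "(LINT x|lborel. grad F x) = 0"
proof -
  have [measurable]: "grad F \<in> borel_measurable borel" using c by (rule borel_measurable_continuous_onI)
  have g0: "grad F x = 0" if "R < norm x" for x by (rule grad_zero_outside[OF R that])
  obtain B where B: "\<And>x. norm (grad F x) \<le> B" using bounded_of_compact_support[OF c g0] by metis
  have "continuous_on UNIV F" using d by (simp add: continuous_on_eq_continuous_at differentiable_imp_continuous_within)
  then obtain B0 where B0: "\<And>x. norm (F x) \<le> B0" using bounded_of_compact_support[of F R] R by metis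
  \<comment> \<open>For \<open>x\<close> in the unit ball, \<open>F (x - z)\<close> vanishes unless
    \<open>norm z < R + 1\<close>, so multiplication by this indicator loses nothing.\<close>
  define u :: "real ^ 'n \<Rightarrow> real" where "u = indicator (ball 0 (R + 2))"
  have iu: "integrable lborel u" unfolding u_def by (intro integrable_indicator_bounded) auto
  have "integrable lborel (\<lambda>x. u x *\<^sub>R grad F x)" by (rule integrable_mult_bounded[OF iu _ B]) simp
  moreover have u1: "u x *\<^sub>R grad F x = grad F x" for x using g0[of x] by (auto simp: u_def indicator_def)
  ultimately show i: "integrable lborel (grad F)" by simp
  have D: "(conv F u has_derivative (\<lambda>h. (LINT z|lborel. u z *\<^sub>R grad F (0 - z)) \<bullet> h)) (at 0)"
    by (rule conv_has_derivative[OF iu d c B]) (use B0 in simp)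
  have const: "conv F u x = (LINT z|lborel. F (0 - z))" if "x \<in> ball 0 1" for x
  proof -
    have [measurable]: "F \<in> borel_measurable borel"
      by (rule borel_measurable_continuous_onI) fact
    have "u z * F (x - z) = F (x - z)" for z
    proof (cases "R < norm (x - z)")
      case False
      have "norm z \<le> norm (x - z) + norm x" using norm_triangle_ineq4[of x "x - z"] by simp
      then have "z \<in> ball 0 (R + 2)" using False that by simp
      then show ?thesis by (simp add: u_def)
    qed (simp add: R)
    then have "conv F u x = (LINT z|lborel. F (x - z))" by (simp only: conv_def)
    then show ?thesis by (simp only: integral_lborel_reflect[OF \<open>F \<in> borel_measurable borel\<close>])
  qed
  have "grad (conv F u) 0 = grad (\<lambda>x. LINT z|lborel. F (0 - z)) 0"
    by (rule grad_cong[of "ball 0 1"]) (use const in auto)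
  also have "\<dots> = 0" by (simp add: grad_def vec_eq_iff)
  finally have "(LINT z|lborel. u z *\<^sub>R grad F (0 - z)) = 0" using grad_eqI[OF D] by simp
  moreover have "u z *\<^sub>R grad F (0 - z) = grad F (0 - z)" for z using g0[of "0 - z"] by (auto simp: u_def indicator_def)
  ultimately show "(LINT x|lborel. grad F x) = 0"
    using integral_lborel_reflect[of "grad F" 0] by simp
qed

lemma test_fieldsD:
  assumes "\<phi> \<in> test_fields \<Omega>"
  shows "\<And>i x. (\<lambda>x. \<phi> x $ i) differentiable (at x)" "\<And>i. continuous_on UNIV (grad (\<lambda>x. \<phi> x $ i))"
    "compact (closure {x. \<phi> x \<noteq> 0})" "closure {x. \<phi> x \<noteq> 0} \<subseteq> \<Omega>" "\<And>x. norm (\<phi> x) \<le> 1"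
proof -
  have C: "Ck_on 1 UNIV (\<lambda>x. \<phi> x $ i)" for i using assms by (simp add: test_fields_def)
  show "(\<lambda>x. \<phi> x $ i) differentiable (at x)" for i x using C[of i] by (simp del: Ck_on.simps(1))
  show "continuous_on UNIV (grad (\<lambda>x. \<phi> x $ i))" for i
    using Ck_on_grad_continuous[of 0 UNIV "\<lambda>x. \<phi> x $ i"] C[of i] by (simp del: Ck_on.simps)
  show "compact (closure {x. \<phi> x \<noteq> 0})" "closure {x. \<phi> x \<noteq> 0} \<subseteq> \<Omega>" "\<And>x. norm (\<phi> x) \<le> 1"
    using assms by (auto simp: test_fields_def)
qed

lemma divergence_bounded:
  fixes \<phi> :: "real ^ 'n \<Rightarrow> real ^ 'n"
  assumes "\<phi> \<in> test_fields \<Omega>"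
  obtains B where "B \<ge> 0" "\<And>x. \<bar>divergence \<phi> x\<bar> \<le> B" "continuous_on UNIV (divergence \<phi>)"
proof -
  note T = test_fieldsD[OF assms]
  obtain R where R: "\<And>x. x \<in> closure {x. \<phi> x \<noteq> 0} \<Longrightarrow> norm x \<le> R"
    using compact_imp_bounded[OF T(3)] bounded_iff by metis
  have \<phi>0: "\<phi> x $ i = 0" if "R < norm x" for x i
  proof -
    have "x \<notin> closure {x. \<phi> x \<noteq> 0}" using R[of x] that by auto
    then have "\<phi> x = 0" using closure_subset[of "{x. \<phi> x \<noteq> 0}"] by blast
    then show ?thesis by simp
  qed
  have dv: "divergence \<phi> = (\<lambda>x. \<Sum>i\<in>UNIV. grad (\<lambda>y. \<phi> y $ i) x $ i)"
    by (simp add: divergence_def grad_nth fun_eq_iff)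
  have c: "continuous_on UNIV (divergence \<phi>)"
    unfolding dv by (intro continuous_on_sum continuous_on_component T(2))
  have "divergence \<phi> x = 0" if "R < norm x" for x
    unfolding dv using grad_zero_outside[of R "\<lambda>y. \<phi> y $ i" x for i, OF \<phi>0 that] by simp
  then obtain B where "B \<ge> 0" "\<And>x. norm (divergence \<phi> x) \<le> B" using bounded_of_compact_support[OF c] by metis
  then show thesis using c by (intro that[of B]) auto
qed

text \<open>The products \<open>v x * \<phi> x $ i\<close>, extended by 0, are of class
  \<open>C^1\<close> on the whole space, so the integrals of their derivatives vanish. What remains
  is the integral of \<open>- (\<phi> x \<bullet> grad v x)\<close>, bounded by the energy as
  \<open>norm (\<phi> x) \<le> 1\<close>.\<close>

lemma integration_by_parts:
  fixes v :: "real ^ 'n \<Rightarrow> real"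
  assumes \<Omega>: "open \<Omega>" and v: "C1_on \<Omega> v" and e: "energy \<Omega> v \<le> ennreal K" and K: "K \<ge> 0" and \<phi>: "\<phi> \<in> test_fields \<Omega>"
  shows "(LINT x:\<Omega>|lebesgue. v x * divergence \<phi> x) \<le> K"
proof -
  note T = test_fieldsD[OF \<phi>]
  have [measurable]: "\<Omega> \<in> sets borel" using \<Omega> by simp
  define S where "S = closure {x. \<phi> x \<noteq> 0}"
  have S: "compact S" "S \<subseteq> \<Omega>" "closed S" using T by (auto simp: S_def)
  have \<phi>0: "\<phi> x = 0" if "x \<notin> S" for x
    using that closure_subset[of "{x. \<phi> x \<noteq> 0}"] unfolding S_def by blast
  define F where "F i x = indicator \<Omega> x * (v x * \<phi> x $ i)" for i x
  have vd: "v differentiable (at x)" if "x \<in> \<Omega>" for x using v that by (simp add: C1_on_def)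
  have pd: "(\<lambda>x. v x * \<phi> x $ i) differentiable (at x)" if "x \<in> \<Omega>" for i x
    by (intro differentiable_mult vd[OF that] T(1))
  have F1: "F i differentiable (at x)" "grad (F i) x = v x *\<^sub>R grad (\<lambda>x. \<phi> x $ i) x + \<phi> x $ i *\<^sub>R grad v x" if x: "x \<in> \<Omega>" for i x
  proof -
    have eq: "F i y = v y * \<phi> y $ i" if "y \<in> \<Omega>" for y using that by (simp add: F_def)
    have "F i differentiable (at x) \<longleftrightarrow> (\<lambda>x. v x * \<phi> x $ i) differentiable (at x)"
      by (rule differentiable_cong_open[OF \<Omega> x]) (rule eq)
    then show "F i differentiable (at x)" using pd[OF x] by simp
    have "grad (F i) x = grad (\<lambda>x. v x * \<phi> x $ i) x" by (rule grad_cong[OF \<Omega> x]) (rule eq)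
    then show "grad (F i) x = v x *\<^sub>R grad (\<lambda>x. \<phi> x $ i) x + \<phi> x $ i *\<^sub>R grad v x"
      using grad_mult[OF vd[OF x] T(1)] by simp
  qed
  have F0: "F i differentiable (at x)" "grad (F i) x = 0" if x: "x \<in> - S" for i x
  proof -
    have o: "open (- S)" using S(3) by auto
    have eq: "F i y = 0" if "y \<in> - S" for y using that \<phi>0[of y] by (simp add: F_def)
    have "F i differentiable (at x) \<longleftrightarrow> (\<lambda>x. 0 :: real) differentiable (at x)"
      by (rule differentiable_cong_open[OF o x]) (rule eq)
    then show "F i differentiable (at x)" by simp
    have "grad (F i) x = grad (\<lambda>x. 0) x" by (rule grad_cong[OF o x]) (rule eq)
    then show "grad (F i) x = 0" by (simp add: grad_def vec_eq_iff)
  qed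
  \<comment> \<open>Both sets are open, and \<open>F i\<close> is of class \<open>C^1\<close> on
    each of them.\<close>
  have cov: "\<Omega> \<union> - S = UNIV" using S(2) by auto
  have Fd: "F i differentiable (at x)" for i x using F1(1)[of x i] F0(1)[of x i] cov by blast
  have Fc: "continuous_on UNIV (grad (F i))" for i
  proof -
    have "continuous_on \<Omega> (\<lambda>x. v x *\<^sub>R grad (\<lambda>x. \<phi> x $ i) x + \<phi> x $ i *\<^sub>R grad v x)"
      using v T(1)[of i] continuous_on_subset[OF T(2)[of i]] C1_on_continuous[OF v] unfolding C1_on_def
      by (intro continuous_on_add continuous_on_scaleR)
        (auto intro!: continuous_at_imp_continuous_on differentiable_imp_continuous_within)
    then have "continuous_on \<Omega> (grad (F i))" by (simp add: F1(2) cong: continuous_on_cong)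
    moreover have "continuous_on (- S) (grad (F i))"
      by (rule continuous_on_eq[OF continuous_on_const[of _ 0]]) (rule F0(2)[symmetric])
    ultimately have "continuous_on (\<Omega> \<union> - S) (grad (F i))" using \<Omega> S(3) by (intro continuous_on_open_Un) auto
    then show ?thesis unfolding cov .
  qed
  obtain R where R: "\<And>x. x \<in> S \<Longrightarrow> norm x \<le> R" using compact_imp_bounded[OF S(1)] bounded_iff by metis
  have FR: "F i x = 0" if "R < norm x" for i x
  proof -
    have "x \<notin> S" using R[of x] that by auto
    then show ?thesis by (simp add: F_def \<phi>0)
  qed
  note G = integral_grad_compact_support[OF Fd Fc FR]
  define P where "P x = (\<Sum>i\<in>UNIV. grad (F i) x \<bullet> axis i 1)" for x
  have iP: "integrable lborel P" unfolding P_def by (intro Bochner_Integration.integrable_sum integrable_inner_left G(1))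
  have P0: "(LINT x|lborel. P x) = 0"
    unfolding P_def using G by (subst Bochner_Integration.integral_sum) (auto simp: G(2))
  define Q where "Q x = indicator \<Omega> x * (\<phi> x \<bullet> grad v x)" for x
  have PQ: "P x - Q x = indicator \<Omega> x * (v x * divergence \<phi> x)" for x
  proof (cases "x \<in> \<Omega>")
    case True
    then have "P x = (\<Sum>i\<in>UNIV. v x * grad (\<lambda>x. \<phi> x $ i) x $ i + \<phi> x $ i * grad v x $ i)"
      by (simp add: P_def F1(2) inner_axis)
    moreover have "Q x = (\<Sum>i\<in>UNIV. \<phi> x $ i * grad v x $ i)" using True by (simp add: Q_def inner_vec_def)
    ultimately show ?thesis using True
      by (simp add: divergence_def grad_nth[symmetric] sum.distrib sum_distrib_left)
  next
    case False
    then have "x \<in> - S" using S(2) by auto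
    then show ?thesis using False by (simp add: P_def Q_def F0(2))
  qed
  have [measurable]: "Q \<in> borel_measurable borel" unfolding Q_def
  proof (rule borel_measurable_indicator_continuous[OF \<Omega>])
    have "continuous_on \<Omega> (\<lambda>x. \<phi> x $ i)" for i
      using T(1) by (intro continuous_at_imp_continuous_on ballI differentiable_imp_continuous_within) auto
    then have "continuous_on \<Omega> (\<lambda>x. \<chi> i. \<phi> x $ i)" by (rule continuous_on_vec_lambda)
    then have "continuous_on \<Omega> \<phi>" by simp
    then show "continuous_on \<Omega> (\<lambda>x. \<phi> x \<bullet> grad v x)" using v by (intro continuous_on_inner) (auto simp: C1_on_def)
  qed
  have bQ: "(\<integral>\<^sup>+x. ennreal (norm (Q x)) \<partial>lborel) \<le> ennreal K"
  proof -
    have "(\<integral>\<^sup>+x. ennreal (norm (Q x)) \<partial>lborel) \<le> energy \<Omega> v" unfolding energy_def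
    proof (rule nn_integral_mono)
      fix x
      have "\<bar>\<phi> x \<bullet> grad v x\<bar> \<le> 1 * norm (grad v x)"
        by (rule order_trans[OF Cauchy_Schwarz_ineq2]) (intro mult_right_mono T(5) norm_ge_zero)
      then show "ennreal (norm (Q x)) \<le> ennreal (norm (grad v x)) * indicator \<Omega> x"
        by (auto simp: Q_def indicator_def intro!: ennreal_leI)
    qed
    then show ?thesis using e by simp
  qed
  have iQ: "integrable lborel Q" unfolding integrable_iff_bounded
    using bQ by (auto intro: le_less_trans)
  have "integrable lborel (\<lambda>x. indicator \<Omega> x * (v x * divergence \<phi> x))"
    unfolding PQ[symmetric] using iP iQ by simp
  then have "(LINT x:\<Omega>|lebesgue. v x * divergence \<phi> x) = (LINT x|lborel. indicator \<Omega> x * (v x * divergence \<phi> x))"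
    unfolding set_lebesgue_integral_def by (simp add: integral_completion)
  also have "\<dots> = - (LINT x|lborel. Q x)" unfolding PQ[symmetric] using iP iQ P0 by simp
  also have "\<dots> \<le> norm (LINT x|lborel. Q x)" by simp
  also have "\<dots> \<le> K"
    using integral_norm_bound_ennreal[OF iQ] bQ K by (metis ennreal_le_iff order_trans)
  finally show ?thesis .
qed

lemma L1_mult_bounded:
  assumes "u \<in> L1 \<Omega>" "continuous_on UNIV g" "\<And>x. \<bar>g x\<bar> \<le> B"
  shows "set_integrable lebesgue \<Omega> (\<lambda>x. u x * g x)"
proof -
  have "g \<in> borel_measurable borel" using assms(2) by (rule borel_measurable_continuous_onI)
  then have [measurable]: "g \<in> borel_measurable lebesgue" by (simp add: measurable_completion)
  have "integrable lebesgue (\<lambda>x. (indicator \<Omega> x *\<^sub>R u x) *\<^sub>R g x)"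
    using assms(1,3) by (intro integrable_mult_bounded[where B=B and u="\<lambda>x. indicator \<Omega> x *\<^sub>R u x"]) (auto simp: L1_def set_integrable_def)
  then show ?thesis by (simp add: set_integrable_def mult.assoc)
qed

lemma L1_abs_diff:
  assumes "u \<in> L1 \<Omega>" "v \<in> L1 \<Omega>"
  shows "set_integrable lebesgue \<Omega> (\<lambda>x. \<bar>u x - v x\<bar>)"
  using assms unfolding L1_def by (intro set_integrable_abs set_integral_diff) auto

lemma L1_dist_nn_integral:
  assumes "u \<in> L1 \<Omega>" "v \<in> L1 \<Omega>"
  shows "ennreal (LINT x:\<Omega>|lebesgue. \<bar>u x - v x\<bar>) = (\<integral>\<^sup>+x\<in>\<Omega>. ennreal \<bar>u x - v x\<bar> \<partial>lebesgue)"
proof -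
  have "ennreal (LINT x:\<Omega>|lebesgue. \<bar>u x - v x\<bar>) = (\<integral>\<^sup>+x. ennreal (indicator \<Omega> x *\<^sub>R \<bar>u x - v x\<bar>) \<partial>lebesgue)"
    unfolding set_lebesgue_integral_def
    using L1_abs_diff[OF assms] by (intro nn_integral_eq_integral[symmetric]) (auto simp: set_integrable_def)
  also have "\<dots> = (\<integral>\<^sup>+x\<in>\<Omega>. ennreal \<bar>u x - v x\<bar> \<partial>lebesgue)"
    by (intro nn_integral_cong) (auto simp: indicator_def)
  finally show ?thesis .
qed

text \<open>Lower semicontinuity of the total variation: since \<open>divergence \<phi>\<close> is
  bounded, each test field gives a functional that is continuous in the mean.\<close>

lemma BV_of_C1_approximation:
  fixes u :: "real ^ 'n \<Rightarrow> real" and w :: "nat \<Rightarrow> real ^ 'n \<Rightarrow> real"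
  assumes \<Omega>: "open \<Omega>" and u: "u \<in> L1 \<Omega>" and w: "\<And>h. w h \<in> L1 \<Omega>" "\<And>h. C1_on \<Omega> (w h)"
    and e: "\<And>h. energy \<Omega> (w h) \<le> ennreal K" and K: "K \<ge> 0" and lim: "tendsto_L1 \<Omega> w u sequentially"
  shows "u \<in> BV \<Omega>"
proof -
  have "ereal (LINT x:\<Omega>|lebesgue. u x * divergence \<phi> x) \<le> ereal K" if \<phi>: "\<phi> \<in> test_fields \<Omega>" for \<phi>
  proof -
    obtain B where B: "B \<ge> 0" "\<And>x. \<bar>divergence \<phi> x\<bar> \<le> B" "continuous_on UNIV (divergence \<phi>)"
      using divergence_bounded[OF \<phi>] by metis
    have "(LINT x:\<Omega>|lebesgue. u x * divergence \<phi> x) \<le> K + B * (LINT x:\<Omega>|lebesgue. \<bar>w h x - u x\<bar>)" for h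
    proof -
      have i: "set_integrable lebesgue \<Omega> (\<lambda>x. u x * divergence \<phi> x)" "set_integrable lebesgue \<Omega> (\<lambda>x. w h x * divergence \<phi> x)"
        by (rule L1_mult_bounded[OF u B(3,2)], rule L1_mult_bounded[OF w(1) B(3,2)])
      have iB: "set_integrable lebesgue \<Omega> (\<lambda>x. B * \<bar>w h x - u x\<bar>)"
        using L1_abs_diff[OF w(1) u] by simp
      have "(LINT x:\<Omega>|lebesgue. u x * divergence \<phi> x) \<le> (LINT x:\<Omega>|lebesgue. w h x * divergence \<phi> x + B * \<bar>w h x - u x\<bar>)"
      proof (rule set_integral_mono[OF i(1) set_integral_add(1)[OF i(2) iB]])
        fix x
        have "(u x - w h x) * divergence \<phi> x \<le> \<bar>u x - w h x\<bar> * B"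
          by (rule order_trans[OF abs_ge_self]) (auto simp: abs_mult intro!: mult_left_mono B)
        moreover have "\<bar>u x - w h x\<bar> * B = B * \<bar>w h x - u x\<bar>" by (simp add: abs_minus_commute mult.commute)
        ultimately show "u x * divergence \<phi> x \<le> w h x * divergence \<phi> x + B * \<bar>w h x - u x\<bar>"
          by (simp only: left_diff_distrib)
      qed
      also have "\<dots> = (LINT x:\<Omega>|lebesgue. w h x * divergence \<phi> x) + (LINT x:\<Omega>|lebesgue. B * \<bar>w h x - u x\<bar>)"
        by (rule set_integral_add(2)[OF i(2) iB])
      also have "\<dots> \<le> K + B * (LINT x:\<Omega>|lebesgue. \<bar>w h x - u x\<bar>)"
        using integration_by_parts[OF \<Omega> w(2) e K \<phi>] by simp
      finally show ?thesis .
    qed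
    moreover have "(\<lambda>h. K + B * (LINT x:\<Omega>|lebesgue. \<bar>w h x - u x\<bar>)) \<longlonglongrightarrow> K + B * 0"
      using lim unfolding tendsto_L1_def by (intro tendsto_intros)
    ultimately have "(LINT x:\<Omega>|lebesgue. u x * divergence \<phi> x) \<le> K + B * 0"
      by (intro LIMSEQ_le_const) auto
    then show ?thesis by simp
  qed
  then have "total_variation \<Omega> u \<le> ereal K" unfolding total_variation_def by (rule SUP_least)
  then show ?thesis using u unfolding BV_def by auto
qed

section \<open>Borel representatives and selection of indices\<close>

text \<open>Mollification is set up for integrable Borel functions on the whole space; by
  \<open>H_eps_cong_AE\<close> the functionals do not notice the exchange.\<close>

lemma L1_borel_representative:
  fixes u :: "real ^ 'n \<Rightarrow> real"
  assumes \<Omega>: "open \<Omega>" and u: "u \<in> L1 \<Omega>"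
  obtains u' where "integrable lborel u'" "u' \<in> L1 \<Omega>" "AE x in lebesgue. x \<in> \<Omega> \<longrightarrow> u x = u' x" "\<And>x. x \<notin> \<Omega> \<Longrightarrow> u' x = 0"
proof -
  have i: "integrable lebesgue (\<lambda>x. indicator \<Omega> x *\<^sub>R u x)" using u by (simp add: L1_def set_integrable_def)
  then obtain g where g: "g \<in> borel_measurable lborel" "AE x in lborel. indicator \<Omega> x *\<^sub>R u x = g x"
    using completion_ex_borel_measurable_real[of "\<lambda>x. indicator \<Omega> x *\<^sub>R u x" lborel] by auto
  define u' where "u' x = indicator \<Omega> x * g x" for x
  have [measurable]: "\<Omega> \<in> sets borel" "g \<in> borel_measurable borel" using \<Omega> g(1) by auto
  have mu: "u' \<in> borel_measurable borel" unfolding u'_def by measurable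
  have "AE x in lborel. indicator \<Omega> x *\<^sub>R u x = u' x"
    using g(2) by eventually_elim (auto simp: u'_def indicator_def)
  then have ae: "AE x in lebesgue. indicator \<Omega> x *\<^sub>R u x = u' x" by (rule AE_completion)
  have "integrable lebesgue u'"
    by (rule integrable_cong_AE_imp[OF i]) (use mu ae in \<open>auto simp: measurable_completion elim: eventually_mono\<close>)
  then have iu: "integrable lborel u'" using mu by (simp add: integrable_completion)
  have "(\<lambda>x. indicator \<Omega> x *\<^sub>R u' x) = u'" by (auto simp: u'_def indicator_def)
  then have "u' \<in> L1 \<Omega>" using \<open>integrable lebesgue u'\<close> by (simp add: L1_def set_integrable_def)
  moreover have "AE x in lebesgue. x \<in> \<Omega> \<longrightarrow> u x = u' x" using ae by eventually_elim auto
  ultimately show thesis using iu by (intro that[of u']) (auto simp: u'_def)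
qed

lemma avg_cong_AE:
  assumes "set_integrable lebesgue A u" "set_integrable lebesgue A v" "AE x in lebesgue. x \<in> A \<longrightarrow> u x = v x"
  shows "avg A u = avg A v"
proof -
  have "(LINT x:A|lebesgue. u x) = (LINT x:A|lebesgue. v x)" unfolding set_lebesgue_integral_def
    using assms by (intro integral_cong_AE) (auto simp: set_integrable_def indicator_def elim!: eventually_mono)
  then show ?thesis by (simp add: avg_def)
qed

lemma osc_cong_AE:
  fixes u :: "real ^ 'n \<Rightarrow> real"
  assumes "measure lebesgue A > 0" "set_integrable lebesgue A u" "set_integrable lebesgue A v"
    "AE x in lebesgue. x \<in> A \<longrightarrow> u x = v x"
  shows "osc A u = osc A v"
  unfolding osc_def avg_cong_AE[OF assms(2-4)]
  using assms by (intro avg_cong_AE set_integrable_abs_diff_const) (auto elim!: eventually_mono)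

text \<open>\<open>s \<epsilon>\<close> is the largest index in \<open>S \<epsilon>\<close>. The
  bound \<open>real m \<le> 1 / \<epsilon>\<close> makes this set finite, and since it grows without
  limit it does not keep \<open>s\<close> from tending to infinity.\<close>

lemma diagonal_selection:
  fixes P :: "nat \<Rightarrow> real \<Rightarrow> bool"
  assumes "\<And>m. \<forall>\<^sub>F \<epsilon> in at_right 0. P m \<epsilon>"
  obtains s :: "real \<Rightarrow> nat" where "\<And>N. \<forall>\<^sub>F \<epsilon> in at_right 0. N \<le> s \<epsilon>" "\<forall>\<^sub>F \<epsilon> in at_right 0. P (s \<epsilon>) \<epsilon>"
proof -
  have "\<exists>e>0. \<forall>\<epsilon>. 0 < \<epsilon> \<and> \<epsilon> < e \<longrightarrow> P m \<epsilon>" for m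
    using assms[of m] by (auto simp: eventually_at_right_field)
  then obtain e where e: "\<And>m. e m > (0::real)" "\<And>m \<epsilon>. 0 < \<epsilon> \<Longrightarrow> \<epsilon> < e m \<Longrightarrow> P m \<epsilon>" by metis
  define S where "S \<epsilon> = {m. real m \<le> 1 / \<epsilon> \<and> \<epsilon> < e m}" for \<epsilon>
  have fin: "finite (S \<epsilon>)" for \<epsilon>
  proof (rule finite_subset)
    show "S \<epsilon> \<subseteq> {..nat \<lceil>1 / \<epsilon>\<rceil>}" by (auto simp: S_def) linarith
  qed simp
  define s where "s \<epsilon> = Max (S \<epsilon>)" for \<epsilon>
  have ev: "\<forall>\<^sub>F \<epsilon> in at_right 0. N \<in> S \<epsilon>" for N
  proof -
    have pos: "0 < min (e N) (1 / (real N + 1))" using e(1)[of N] by simp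
    have "N \<in> S \<epsilon>" if "0 < \<epsilon>" "\<epsilon> < min (e N) (1 / (real N + 1))" for \<epsilon>
    proof -
      have "real N * \<epsilon> \<le> (real N + 1) * \<epsilon>" using that by simp
      also have "\<dots> \<le> 1" using that by (simp add: field_simps)
      finally show ?thesis using that by (simp add: S_def field_simps)
    qed
    then show ?thesis using pos unfolding eventually_at_right_field by blast
  qed
  show thesis
  proof (rule that[of s])
    show "\<forall>\<^sub>F \<epsilon> in at_right 0. N \<le> s \<epsilon>" for N
      using ev[of N] by eventually_elim (simp add: s_def fin)
    show "\<forall>\<^sub>F \<epsilon> in at_right 0. P (s \<epsilon>) \<epsilon>"
      using ev[of 0] eventually_at_right_less[of "0::real"]
    proof eventually_elim
      case (elim \<epsilon>)
      then have "s \<epsilon> \<in> S \<epsilon>" unfolding s_def by (intro Max_in fin) auto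
      then show ?case using elim e(2) by (simp add: S_def)
    qed
  qed
qed

lemma smooth_on_C1: "smooth_on A v \<Longrightarrow> C1_on A v"
  unfolding C1_on_def using smooth_on_differentiable smooth_on_grad_continuous by blast

section \<open>The liminf inequality\<close>

context profile
begin

lemma H_eps_cong_AE:
  assumes \<Omega>: "open \<Omega>" and e: "\<epsilon> > 0" and uv: "u \<in> L1 \<Omega>" "v \<in> L1 \<Omega>" "AE x in lebesgue. x \<in> \<Omega> \<longrightarrow> u x = v x"
  shows "H_eps D \<Omega> \<epsilon> u = H_eps D \<Omega> \<epsilon> v"
proof -
  have "osc D' u = osc D' v" if H: "H \<in> finite_families \<epsilon> D \<Omega>" "D' \<in> H" for H D'
  proof -
    obtain x0 where x0: "D' = translate x0 \<epsilon>" using finite_families_memD(2)[OF H] by auto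
    have D': "open D'" "measure lebesgue D' > 0" "D' \<subseteq> \<Omega>"
      using translate_facts[OF e, of x0] finite_families_memD(1)[OF H] unfolding x0 by auto
    have "set_integrable lebesgue D' u" "set_integrable lebesgue D' v"
      using uv D' by (auto simp: L1_def intro!: set_integrable_subset[of lebesgue \<Omega> _ D'])
    moreover have "AE x in lebesgue. x \<in> D' \<longrightarrow> u x = v x" using uv(3) by eventually_elim (use D'(3) in auto)
    ultimately show ?thesis using D'(2) by (intro osc_cong_AE)
  qed
  then show ?thesis unfolding H_eps_finite_families[OF e] by (intro SUP_cong sum.cong) auto
qed

lemma energy_le_psi:
  assumes "c > 0" "\<And>\<tau>. psi D \<tau> \<ge> c * norm \<tau>" "(\<integral>\<^sup>+x\<in>A. ennreal (psi D (grad v x)) \<partial>lborel) \<le> ennreal K" "K \<ge> 0"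
  and A: "open A" "C1_on A v"
  shows "energy A v \<le> ennreal (K / c)"
proof -
  have m: "(\<lambda>x. ennreal (indicator A x * norm (grad v x))) \<in> borel_measurable borel"
    using A borel_measurable_indicator_continuous[OF A(1) continuous_on_norm, of "grad v"] by (simp add: C1_on_def)
  have eq: "energy A v = (\<integral>\<^sup>+x. ennreal (indicator A x * norm (grad v x)) \<partial>lborel)"
    unfolding energy_def by (intro nn_integral_cong) (auto simp: indicator_def)
  have "ennreal c * energy A v = (\<integral>\<^sup>+x. ennreal c * ennreal (indicator A x * norm (grad v x)) \<partial>lborel)"
    unfolding eq using m by (intro nn_integral_cmult[symmetric]) simp
  also have "\<dots> \<le> (\<integral>\<^sup>+x\<in>A. ennreal (psi D (grad v x)) \<partial>lborel)"
    using assms(1,2) by (intro nn_integral_mono) (auto simp: indicator_def intro!: ennreal_leI simp flip: ennreal_mult)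
  also have "\<dots> \<le> ennreal K" by fact
  finally have "ennreal (1/c) * (ennreal c * energy A v) \<le> ennreal (1/c) * ennreal K" by (rule mult_left_mono) simp
  moreover have "ennreal (1/c) * (ennreal c * energy A v) = energy A v"
    using assms(1) by (simp add: mult.assoc[symmetric] flip: ennreal_mult)
  moreover have "ennreal (1/c) * ennreal K = ennreal (K / c)" using assms(1,4) by (simp flip: ennreal_mult)
  ultimately show ?thesis by simp
qed

text \<open>With \<open>M\<close> the lower limit, \<open>interior_estimate\<close> provides the
  hypothesis of \<open>meyers_serrin\<close> for all interior sets and radii. The smooth functions
  obtained with errors \<open>1 / Suc h\<close> put \<open>u\<close> into \<open>BV\<close> and
  compete in the infimum that defines the limit functional.\<close>

lemma Gamma_liminf:
  assumes \<Omega>: "open \<Omega>" and u: "u \<in> L1 \<Omega>" and v: "\<And>\<epsilon>. \<epsilon> > 0 \<Longrightarrow> v \<epsilon> \<in> L1 \<Omega>"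
    and lim: "tendsto_L1 \<Omega> v u (at_right 0)"
  shows "H_limit D \<Omega> u \<le> Liminf (at_right 0) (\<lambda>\<epsilon>. H_eps D \<Omega> \<epsilon> (v \<epsilon>))"
proof (cases "Liminf (at_right 0) (\<lambda>\<epsilon>. H_eps D \<Omega> \<epsilon> (v \<epsilon>)) < \<infinity>")
  case False
  then have "Liminf (at_right 0) (\<lambda>\<epsilon>. H_eps D \<Omega> \<epsilon> (v \<epsilon>)) = \<infinity>" by (simp add: less_top[symmetric])
  then show ?thesis by simp
next
  case True
  define M where "M = Liminf (at_right 0) (\<lambda>\<epsilon>. H_eps D \<Omega> \<epsilon> (v \<epsilon>))"
  obtain u' where u': "integrable lborel u'" "u' \<in> L1 \<Omega>" "AE x in lebesgue. x \<in> \<Omega> \<longrightarrow> u x = u' x" "\<And>x. x \<notin> \<Omega> \<Longrightarrow> u' x = 0"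
    by (rule L1_borel_representative[OF \<Omega> u]) blast
  \<comment> \<open>Membership of \<open>v \<epsilon>\<close> in \<open>L1 \<Omega>\<close> is
    assumed for positive \<open>\<epsilon>\<close>, so the choice is made under this
    condition.\<close>
  have "\<exists>w. \<epsilon> > 0 \<longrightarrow> integrable lborel w \<and> w \<in> L1 \<Omega> \<and> (AE x in lebesgue. x \<in> \<Omega> \<longrightarrow> v \<epsilon> x = w x) \<and> (\<forall>x. x \<notin> \<Omega> \<longrightarrow> w x = 0)" for \<epsilon>
  proof (cases "\<epsilon> > 0")
    case True
    obtain w where "integrable lborel w" "w \<in> L1 \<Omega>" "AE x in lebesgue. x \<in> \<Omega> \<longrightarrow> v \<epsilon> x = w x" "\<And>x. x \<notin> \<Omega> \<Longrightarrow> w x = 0"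
      by (rule L1_borel_representative[OF \<Omega> v[OF True]]) blast
    then show ?thesis by blast
  qed simp
  from choice[OF allI[OF this]] obtain v' where v'0: "\<forall>\<epsilon>. \<epsilon> > 0 \<longrightarrow> integrable lborel (v' \<epsilon>) \<and> v' \<epsilon> \<in> L1 \<Omega> \<and>
    (AE x in lebesgue. x \<in> \<Omega> \<longrightarrow> v \<epsilon> x = v' \<epsilon> x) \<and> (\<forall>x. x \<notin> \<Omega> \<longrightarrow> v' \<epsilon> x = 0)" by (rule exE)
  have v': "integrable lborel (v' \<epsilon>)" "v' \<epsilon> \<in> L1 \<Omega>" "AE x in lebesgue. x \<in> \<Omega> \<longrightarrow> v \<epsilon> x = v' \<epsilon> x"
    "\<And>x. x \<notin> \<Omega> \<Longrightarrow> v' \<epsilon> x = 0" if "\<epsilon> > 0" for \<epsilon>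
    using v'0[rule_format, OF that] by simp_all
  have dist: "(LINT x|lborel. \<bar>v' \<epsilon> x - u' x\<bar>) = (LINT x:\<Omega>|lebesgue. \<bar>v \<epsilon> x - u x\<bar>)" if e: "\<epsilon> > 0" for \<epsilon>
  proof -
    have "(LINT x|lborel. \<bar>v' \<epsilon> x - u' x\<bar>) = (LINT x|lebesgue. \<bar>v' \<epsilon> x - u' x\<bar>)"
      using v'(1)[OF e] u'(1) by (intro integral_completion[symmetric]) auto
    also have "\<dots> = (LINT x:\<Omega>|lebesgue. \<bar>v \<epsilon> x - u x\<bar>)"
      unfolding set_lebesgue_integral_def
    proof (rule integral_cong_AE)
      have "v' \<epsilon> \<in> borel_measurable borel" "u' \<in> borel_measurable borel" using v'(1)[OF e] u'(1) by auto
      then show "(\<lambda>x. \<bar>v' \<epsilon> x - u' x\<bar>) \<in> borel_measurable lebesgue" by (intro measurable_completion) simp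
      show "(\<lambda>x. indicator \<Omega> x *\<^sub>R \<bar>v \<epsilon> x - u x\<bar>) \<in> borel_measurable lebesgue"
        using L1_abs_diff[OF v[OF e] u] unfolding set_integrable_def by (rule borel_measurable_integrable)
      show "AE x in lebesgue. \<bar>v' \<epsilon> x - u' x\<bar> = indicator \<Omega> x *\<^sub>R \<bar>v \<epsilon> x - u x\<bar>"
        using v'(3)[OF e] u'(3) by eventually_elim (use v'(4)[OF e] u'(4) in \<open>auto simp: indicator_def\<close>)
    qed
    finally show ?thesis .
  qed
  have lim': "((\<lambda>\<epsilon>. LINT x|lborel. \<bar>v' \<epsilon> x - u' x\<bar>) \<longlongrightarrow> 0) (at_right 0)"
    using lim unfolding tendsto_L1_def
    by (rule Lim_transform_eventually) (use dist in \<open>auto intro!: eventually_mono[OF eventually_at_right_less[of 0]]\<close>)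
  have M': "Liminf (at_right 0) (\<lambda>\<epsilon>. H_eps D \<Omega> \<epsilon> (v' \<epsilon>)) = M" unfolding M_def
    using H_eps_cong_AE[OF \<Omega> _ v v'(2,3)]
    by (intro Liminf_eq) (auto intro!: eventually_mono[OF eventually_at_right_less[of 0]])
  have est: "(\<integral>\<^sup>+x\<in>G. ennreal (psi D (grad (conv \<rho> u') x)) \<partial>lborel) \<le> M"
    if "mollifier \<delta> \<rho>" "open G" "\<And>x. x \<in> G \<Longrightarrow> cball x \<delta> \<subseteq> \<Omega>" for \<delta> \<rho> G
    using interior_estimate[OF u'(1) v'(1) lim' that] unfolding M' .
  obtain Mr where Mr: "M = ennreal Mr" "Mr \<ge> 0" using True unfolding M_def[symmetric] by (cases M) auto
  have "\<exists>w. smooth_on \<Omega> w \<and> w \<in> L1 \<Omega> \<and> (\<integral>\<^sup>+x\<in>\<Omega>. ennreal \<bar>w x - u' x\<bar> \<partial>lborel) \<le> ennreal (1 / real (Suc h)) \<and>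
    (\<integral>\<^sup>+x\<in>\<Omega>. ennreal (psi D (grad w x)) \<partial>lborel) \<le> M + ennreal (1 / real (Suc h))" for h
  proof (rule meyers_serrin[OF \<Omega> u'(1) True[folded M_def], where \<eta>="1 / real (Suc h)"])
    show "(\<integral>\<^sup>+x\<in>G. ennreal (psi D (grad (conv \<rho> u') x)) \<partial>lborel) \<le> M"
      if "mollifier \<delta> \<rho>" "open G" "\<And>x. x \<in> G \<Longrightarrow> cball x \<delta> \<subseteq> \<Omega>" for \<delta> \<rho> G
      by (rule est[OF that])
  qed (simp, blast)
  from choice[OF allI[OF this]] obtain w where w0: "\<forall>h. smooth_on \<Omega> (w h) \<and> w h \<in> L1 \<Omega> \<and>
    (\<integral>\<^sup>+x\<in>\<Omega>. ennreal \<bar>w h x - u' x\<bar> \<partial>lborel) \<le> ennreal (1 / real (Suc h)) \<and>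
    (\<integral>\<^sup>+x\<in>\<Omega>. ennreal (psi D (grad (w h) x)) \<partial>lborel) \<le> M + ennreal (1 / real (Suc h))" by (rule exE)
  have w: "smooth_on \<Omega> (w h)" "w h \<in> L1 \<Omega>"
    "(\<integral>\<^sup>+x\<in>\<Omega>. ennreal \<bar>w h x - u' x\<bar> \<partial>lborel) \<le> ennreal (1 / real (Suc h))"
    "(\<integral>\<^sup>+x\<in>\<Omega>. ennreal (psi D (grad (w h) x)) \<partial>lborel) \<le> M + ennreal (1 / real (Suc h))" for h
    using w0[rule_format, of h] by simp_all
  have wu: "(LINT x:\<Omega>|lebesgue. \<bar>w h x - u x\<bar>) \<le> 1 / real (Suc h)" for h
  proof -
    have "ennreal (LINT x:\<Omega>|lebesgue. \<bar>w h x - u x\<bar>) = (\<integral>\<^sup>+x\<in>\<Omega>. ennreal \<bar>w h x - u x\<bar> \<partial>lebesgue)"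
      by (rule L1_dist_nn_integral[OF w(2) u])
    also have "\<dots> = (\<integral>\<^sup>+x\<in>\<Omega>. ennreal \<bar>w h x - u' x\<bar> \<partial>lebesgue)"
      using u'(3) by (intro nn_integral_cong_AE) (auto simp: indicator_def elim!: eventually_mono)
    also have "\<dots> \<le> ennreal (1 / real (Suc h))" using w(3)[of h] by (simp add: nn_integral_completion)
    finally show ?thesis by simp
  qed
  have conv_w: "tendsto_L1 \<Omega> w u sequentially" unfolding tendsto_L1_def
  proof (rule tendsto_sandwich[OF _ _ tendsto_const])
    show "(\<lambda>h. 1 / real (Suc h)) \<longlonglongrightarrow> 0" by (rule LIMSEQ_Suc[OF lim_1_over_n])
    show "\<forall>\<^sub>F h in sequentially. 0 \<le> (LINT x:\<Omega>|lebesgue. \<bar>w h x - u x\<bar>)"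
      unfolding set_lebesgue_integral_def by (intro always_eventually allI Bochner_Integration.integral_nonneg) simp
    show "\<forall>\<^sub>F h in sequentially. (LINT x:\<Omega>|lebesgue. \<bar>w h x - u x\<bar>) \<le> 1 / real (Suc h)"
      using wu by simp
  qed
  \<comment> \<open>This excludes the infinite branch of \<open>H_limit\<close>; the bound of
    \<open>psi\<close> from below turns the anisotropic bounds into energy bounds.\<close>
  have "u \<in> BV \<Omega>"
  proof -
    obtain c where c: "c > 0" "\<And>\<tau>. psi D \<tau> \<ge> c * norm \<tau>" using psi_lower by metis
    have e: "energy \<Omega> (w h) \<le> ennreal ((Mr + 1) / c)" for h
    proof (rule energy_le_psi[OF c _ _ \<Omega> smooth_on_C1[OF w(1)]])
      have "M + ennreal (1 / real (Suc h)) \<le> ennreal (Mr + 1)"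
        unfolding Mr(1) using Mr(2) by (auto simp flip: ennreal_plus intro!: ennreal_leI)
      then show "(\<integral>\<^sup>+x\<in>\<Omega>. ennreal (psi D (grad (w h) x)) \<partial>lborel) \<le> ennreal (Mr + 1)"
        using w(4)[of h] by (rule order_trans[rotated])
    qed (use Mr(2) in simp)
    show ?thesis
      by (rule BV_of_C1_approximation[OF \<Omega> u w(2) smooth_on_C1[OF w(1)] e _ conv_w]) (use Mr(2) c(1) in simp)
  qed
  then have "H_limit D \<Omega> u = anisotropic_variation (psi D) \<Omega> u" by (simp add: H_limit_def)
  also have "\<dots> \<le> liminf (\<lambda>h. \<integral>\<^sup>+x\<in>\<Omega>. ennreal (psi D (grad (w h) x)) \<partial>lebesgue)"
    unfolding anisotropic_variation_def by (rule INF_lower) (use w conv_w in simp)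
  also have "\<dots> \<le> liminf (\<lambda>h. M + ennreal (1 / real (Suc h)))"
    using w(4) by (intro Liminf_mono) (simp add: nn_integral_completion)
  also have "\<dots> = M"
  proof (rule lim_imp_Liminf)
    have "(\<lambda>h. ennreal (Mr + 1 / real (Suc h))) \<longlonglongrightarrow> ennreal (Mr + 0)"
      by (intro tendsto_ennrealI tendsto_intros LIMSEQ_Suc[OF lim_1_over_n])
    then show "(\<lambda>h. M + ennreal (1 / real (Suc h))) \<longlonglongrightarrow> M" using Mr by simp
  qed simp
  finally show ?thesis unfolding M_def .
qed

end

section \<open>The limsup inequality\<close>

context lipschitz_profile
begin

text \<open>A nearly optimal smooth competitor for the infimum, taken at an index \<open>h\<close>
  where it is also close to \<open>u\<close>: one condition holds frequently, the other eventually.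
  This function, kept fixed while \<open>\<epsilon>\<close> tends to 0, is good enough by
  \<open>H_eps_limsup_C1\<close>.\<close>

lemma recovery_approximant:
  assumes \<Omega>: "open \<Omega>" and u: "u \<in> L1 \<Omega>" and L: "anisotropic_variation (psi D) \<Omega> u = ennreal L" "L \<ge> 0" and \<eta>: "\<eta> > 0"
  obtains w where "w \<in> L1 \<Omega>" "(LINT x:\<Omega>|lebesgue. \<bar>w x - u x\<bar>) < \<eta>"
    "\<forall>\<^sub>F \<epsilon> in at_right 0. H_eps D \<Omega> \<epsilon> w < ennreal (L + \<eta>)"
proof -
  have "anisotropic_variation (psi D) \<Omega> u < ennreal (L + \<eta>)" using L \<eta> by (simp add: ennreal_less_iff)
  then obtain w where w: "\<And>h. smooth_on \<Omega> (w h)" "\<And>h. w h \<in> L1 \<Omega>" "tendsto_L1 \<Omega> w u sequentially"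
    and li: "liminf (\<lambda>h. \<integral>\<^sup>+x\<in>\<Omega>. ennreal (psi D (grad (w h) x)) \<partial>lebesgue) < ennreal (L + \<eta>)"
    unfolding anisotropic_variation_def INF_less_iff by auto
  have fr: "\<exists>\<^sub>F h in sequentially. (\<integral>\<^sup>+x\<in>\<Omega>. ennreal (psi D (grad (w h) x)) \<partial>lebesgue) < ennreal (L + \<eta>)"
  proof (rule ccontr)
    assume "\<not> ?thesis"
    then have "\<forall>\<^sub>F h in sequentially. ennreal (L + \<eta>) \<le> (\<integral>\<^sup>+x\<in>\<Omega>. ennreal (psi D (grad (w h) x)) \<partial>lebesgue)"
      by (simp add: not_frequently not_less)
    then have "ennreal (L + \<eta>) \<le> liminf (\<lambda>h. \<integral>\<^sup>+x\<in>\<Omega>. ennreal (psi D (grad (w h) x)) \<partial>lebesgue)" by (rule Liminf_bounded)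
    then show False using li by simp
  qed
  have ev: "\<forall>\<^sub>F h in sequentially. (LINT x:\<Omega>|lebesgue. \<bar>w h x - u x\<bar>) < \<eta>"
    using w(3) \<eta> unfolding tendsto_L1_def by (rule order_tendstoD)
  have "\<exists>\<^sub>F h in sequentially. (\<integral>\<^sup>+x\<in>\<Omega>. ennreal (psi D (grad (w h) x)) \<partial>lebesgue) < ennreal (L + \<eta>) \<and>
      (LINT x:\<Omega>|lebesgue. \<bar>w h x - u x\<bar>) < \<eta>"
    by (rule frequently_rev_mp[OF fr]) (use ev in \<open>auto elim: eventually_mono\<close>)
  then obtain h where h: "(\<integral>\<^sup>+x\<in>\<Omega>. ennreal (psi D (grad (w h) x)) \<partial>lebesgue) < ennreal (L + \<eta>)"
    "(LINT x:\<Omega>|lebesgue. \<bar>w h x - u x\<bar>) < \<eta>" using frequently_ex by blast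
  have psi: "(\<integral>\<^sup>+x\<in>\<Omega>. ennreal (psi D (grad (w h) x)) \<partial>lborel) < ennreal (L + \<eta>)"
    using h(1) by (simp add: nn_integral_completion)
  \<comment> \<open>\<open>H_eps_limsup_C1\<close> asks for finite energy, which the lower bound on
    \<open>psi\<close> supplies.\<close>
  obtain c where c: "c > 0" "\<And>\<tau>. psi D \<tau> \<ge> c * norm \<tau>" using psi_lower by metis
  have "energy \<Omega> (w h) \<le> ennreal ((L + \<eta>) / c)"
    by (rule energy_le_psi[OF c less_imp_le[OF psi] _ \<Omega> smooth_on_C1[OF w(1)]]) (use L \<eta> in simp)
  then have "energy \<Omega> (w h) < \<infinity>" by (auto intro: le_less_trans)
  then have "Limsup (at_right 0) (\<lambda>\<epsilon>. H_eps D \<Omega> \<epsilon> (w h)) \<le> (\<integral>\<^sup>+x\<in>\<Omega>. ennreal (psi D (grad (w h) x)) \<partial>lborel)"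
    using w(2)[of h] by (intro H_eps_limsup_C1[OF \<Omega> smooth_on_C1[OF w(1)]]) (simp_all add: L1_def)
  also note psi
  finally have "\<forall>\<^sub>F \<epsilon> in at_right 0. H_eps D \<Omega> \<epsilon> (w h) < ennreal (L + \<eta>)" by (rule Limsup_lessD)
  then show thesis using w(2) h(2) by (intro that)
qed

text \<open>A diagonal argument: the approximant with index \<open>m\<close> has error
  \<open>1 / Suc m\<close>, and \<open>s \<epsilon>\<close> grows slowly enough for its bound on the
  functional to hold at scale \<open>\<epsilon>\<close>.\<close>

lemma Gamma_limsup:
  assumes \<Omega>: "open \<Omega>" and u: "u \<in> L1 \<Omega>"
  obtains v where "\<And>\<epsilon>. v \<epsilon> \<in> L1 \<Omega>" "tendsto_L1 \<Omega> v u (at_right 0)"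
    "Limsup (at_right 0) (\<lambda>\<epsilon>. H_eps D \<Omega> \<epsilon> (v \<epsilon>)) \<le> H_limit D \<Omega> u"
proof (cases "H_limit D \<Omega> u < \<infinity>")
  case False
  \<comment> \<open>With an infinite right-hand side the constant family will do.\<close>
  then have "H_limit D \<Omega> u = \<infinity>" by (simp add: less_top[symmetric])
  then show thesis using u by (intro that[of "\<lambda>_. u"]) (simp_all add: tendsto_L1_def)
next
  case True
  then have HL: "H_limit D \<Omega> u = anisotropic_variation (psi D) \<Omega> u" by (auto simp: H_limit_def split: if_splits)
  then obtain L where L: "anisotropic_variation (psi D) \<Omega> u = ennreal L" "L \<ge> 0"
    using True by (cases "anisotropic_variation (psi D) \<Omega> u") auto
  have "\<exists>w. w \<in> L1 \<Omega> \<and> (LINT x:\<Omega>|lebesgue. \<bar>w x - u x\<bar>) < 1 / real (Suc m) \<and>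
      (\<forall>\<^sub>F \<epsilon> in at_right 0. H_eps D \<Omega> \<epsilon> w < ennreal (L + 1 / real (Suc m)))" for m
  proof -
    have "0 < 1 / real (Suc m)" by simp
    then obtain w where "w \<in> L1 \<Omega>" "(LINT x:\<Omega>|lebesgue. \<bar>w x - u x\<bar>) < 1 / real (Suc m)"
      "\<forall>\<^sub>F \<epsilon> in at_right 0. H_eps D \<Omega> \<epsilon> w < ennreal (L + 1 / real (Suc m))"
      by (rule recovery_approximant[OF \<Omega> u L])
    then show ?thesis by blast
  qed
  from choice[OF allI[OF this]] obtain w where w0: "\<forall>m. w m \<in> L1 \<Omega> \<and>
    (LINT x:\<Omega>|lebesgue. \<bar>w m x - u x\<bar>) < 1 / real (Suc m) \<and>
    (\<forall>\<^sub>F \<epsilon> in at_right 0. H_eps D \<Omega> \<epsilon> (w m) < ennreal (L + 1 / real (Suc m)))" by (rule exE)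
  have w: "w m \<in> L1 \<Omega>" "(LINT x:\<Omega>|lebesgue. \<bar>w m x - u x\<bar>) < 1 / real (Suc m)"
    "\<forall>\<^sub>F \<epsilon> in at_right 0. H_eps D \<Omega> \<epsilon> (w m) < ennreal (L + 1 / real (Suc m))" for m
    using w0[rule_format, of m] by simp_all
  obtain s :: "real \<Rightarrow> nat" where s: "\<And>N. \<forall>\<^sub>F \<epsilon> in at_right 0. N \<le> s \<epsilon>"
    "\<forall>\<^sub>F \<epsilon> in at_right 0. H_eps D \<Omega> \<epsilon> (w (s \<epsilon>)) < ennreal (L + 1 / real (Suc (s \<epsilon>)))"
    by (rule diagonal_selection[where P="\<lambda>m \<epsilon>. H_eps D \<Omega> \<epsilon> (w m) < ennreal (L + 1 / real (Suc m))", OF w(3)]) blast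
  have s_top: "filterlim s sequentially (at_right 0)" using s(1) by (simp add: filterlim_at_top)
  have s0: "((\<lambda>\<epsilon>. 1 / real (Suc (s \<epsilon>))) \<longlongrightarrow> 0) (at_right 0)"
    by (rule filterlim_compose[OF LIMSEQ_Suc[OF lim_1_over_n] s_top])
  show thesis
  proof (rule that[of "\<lambda>\<epsilon>. w (s \<epsilon>)"])
    show "tendsto_L1 \<Omega> (\<lambda>\<epsilon>. w (s \<epsilon>)) u (at_right 0)" unfolding tendsto_L1_def
    proof (rule tendsto_sandwich[OF _ _ tendsto_const s0])
      show "\<forall>\<^sub>F \<epsilon> in at_right 0. 0 \<le> (LINT x:\<Omega>|lebesgue. \<bar>w (s \<epsilon>) x - u x\<bar>)"
        unfolding set_lebesgue_integral_def by (intro always_eventually allI Bochner_Integration.integral_nonneg) simp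
      show "\<forall>\<^sub>F \<epsilon> in at_right 0. (LINT x:\<Omega>|lebesgue. \<bar>w (s \<epsilon>) x - u x\<bar>) \<le> 1 / real (Suc (s \<epsilon>))"
        using w(2) by (intro always_eventually allI less_imp_le)
    qed
    have "Limsup (at_right 0) (\<lambda>\<epsilon>. H_eps D \<Omega> \<epsilon> (w (s \<epsilon>))) \<le> Limsup (at_right 0) (\<lambda>\<epsilon>. ennreal (L + 1 / real (Suc (s \<epsilon>))))"
      using s(2) by (intro Limsup_mono) (auto elim!: eventually_mono)
    also have "\<dots> = ennreal (L + 0)"
      by (intro lim_imp_Limsup tendsto_ennrealI tendsto_intros s0) simp
    finally show "Limsup (at_right 0) (\<lambda>\<epsilon>. H_eps D \<Omega> \<epsilon> (w (s \<epsilon>))) \<le> H_limit D \<Omega> u" by (simp add: HL L)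
  qed (rule w(1))
qed

end

theorem theorem1p1:
  fixes \<Omega> D :: "(real ^ 'n) set"
  assumes "open \<Omega>"
    and "open D" and "D \<noteq> {}" and "bounded D" and "connected D" and "lipschitz_boundary D"
  shows "Gamma_converges_L1 \<Omega> (H_eps D \<Omega>) (H_limit D \<Omega>)"
proof -
  interpret lipschitz_profile D
    by unfold_locales (use assms in auto)
  show ?thesis unfolding Gamma_converges_L1_def
  proof (intro conjI ballI allI impI)
    fix u and v :: "real \<Rightarrow> real ^ 'n \<Rightarrow> real"
    assume "u \<in> L1 \<Omega>" "\<forall>\<epsilon>>0. v \<epsilon> \<in> L1 \<Omega>" "tendsto_L1 \<Omega> v u (at_right 0)"
    then show "H_limit D \<Omega> u \<le> Liminf (at_right 0) (\<lambda>\<epsilon>. H_eps D \<Omega> \<epsilon> (v \<epsilon>))"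
      using assms(1) by (intro Gamma_liminf) auto
  next
    fix u assume "u \<in> L1 \<Omega>"
    then show "\<exists>v. (\<forall>\<epsilon>>0. v \<epsilon> \<in> L1 \<Omega>) \<and> tendsto_L1 \<Omega> v u (at_right 0) \<and>
      Limsup (at_right 0) (\<lambda>\<epsilon>. H_eps D \<Omega> \<epsilon> (v \<epsilon>)) \<le> H_limit D \<Omega> u"
      using Gamma_limsup[OF assms(1)] by metis
  qed
qed

end
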